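(* Let $E\to M$ be an exact Courant algebroid, $d=\dim M\ge2$, with (semi-Riemannian) generalised metric $\mathcal G$ and divergence operator $\mathrm{div}=\mathrm{div}^{\mathcal G}-\langle e,\cdot\rangle$, $e\in\Gamma(E)$, and let $D=D^{\mathcal G,\mathrm{div}}$ be the canonical generalised Levi-Civita connection. The pure-type part of the full generalised Ricci curvature $\overline{\mathcal{R}c}^D$ is given, on $E_\pm\times E_\pm$, by \begin{align*} \overline{\mathcal{R}c}^D\big|_{E_\pm\times E_\pm}={}&\mathrm{Rc}-\frac1{12}H^2\pm\frac{\mathrm{div}_g(e_\pm)}{d-1}\,g\pm\frac{d-2}{d-1}[g\nabla e_\pm]^{\mathrm{sym}}\\ &+\frac{3-2d}{2(d-1)^2}|e_\pm|^2_{\mathcal G}\,g+\frac{d-2}{2(d-1)^2}\,g\pi e_\pm\otimes g\pi e_\pm , \end{align*} where the tensors on $M$ on the right-hand side are evaluated on sections of $E_\pm$ via $\pi$.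
   Context: **Setting.** $(E,\pi,\langle\cdot,\cdot\rangle,[\cdot,\cdot])$ is an exact Courant algebroid over $M$: the bracket is the Dorfman bracket and $0\to T^*M\to E\xrightarrow{\pi}TM\to0$ is exact. A (semi-Riemannian) generalised metric is a nondegenerate symmetric bilinear form $\mathcal G$ on $E$ such that the endomorphism $\mathcal G^{\mathrm{End}}$ defined by $\langle\mathcal G^{\mathrm{End}}u,v\rangle=\mathcal G(u,v)$ is an involution and $\mathcal G|_{T^*M}$ is nondegenerate. $E_\pm$ are the $\pm1$-eigenbundles of $\mathcal G^{\mathrm{End}}$, so $E=E_+\oplus E_-$ orthogonally and $\mathcal G=\pm\langle\cdot,\cdot\rangle$ on $E_\pm$. The maps $\pi_\pm=\pi|_{E_\pm}:E_\pm\to TM$ are isomorphisms, and $g$ is the semi-Riemannian metric on $M$ with $(\pi_\pm)^*g=\mathcal G|_{E_\pm\times E_\pm}$. $\nabla$ is the Levi-Civita connection of $g$. The map $\phi:E\to\mathbb TM=TM\oplus T^*M$, $\phi|_{E_\pm}=(1\pm g)\circ\pi_\pm$, is an isomorphism of Courant algebroids onto $\mathbb TM$ with anchor the projection to $TM$, scalar product $\langle X+\xi,Y+\zeta\rangle=\frac12(\xi(Y)+\zeta(X))$ and bracket $[X+\xi,Y+\zeta]_H=\mathcal L_XY+\mathcal L_X\zeta-\iota_Yd\xi+H(X,Y,\cdot)$, where $H$ is a closed three-form on $M$ determined in this way. **Generalised connections.** A generalised connection is an $\mathbb R$-bilinear map $D:\Gamma(E)\times\Gamma(E)\to\Gamma(E)$,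 $(u,v)\mapsto D_uv$, $C^\infty(M)$-linear in $u$, with $D_u(fv)=(\pi(u)f)v+fD_uv$ and $\pi(u)\langle v,w\rangle=\langle D_uv,w\rangle+\langle v,D_uw\rangle$. Its torsion is $T(u,v,w)=\langle D_uv-D_vu-[u,v],w\rangle+\langle D_wu,v\rangle$. It is metric if $D\mathcal G=0$ (equivalently $D$ preserves $E_\pm$); a generalised Levi-Civita connection is a torsion-free metric generalised connection. A divergence operator is an $\mathbb R$-linear map $\mathrm{div}:\Gamma(E)\to C^\infty(M)$ with $\mathrm{div}(fv)=\pi(v)f+f\,\mathrm{div}(v)$; $D$ has divergence $\mathrm{div}^D(v)=\mathrm{tr}(u\mapsto D_uv)$. The metric divergence is $\mathrm{div}^{\mathcal G}=\mathrm{div}^g\circ\pi$, with $\mathrm{div}^g=\mathrm{div}_g$ the divergence of $g$ on vector fields. **Canonical generalised Levi-Civita connection.** Let $\widetilde D$ be the generalised connection with $\widetilde D_u=\pi_\pm^{-1}\circ\nabla_{\pi(u)}\circ\pi_\pm$ on $\Gamma(E_\pm)$ for $u\in\Gamma(E_\pm)$, and $\widetilde D_u=[u,\cdot]_\mp$ on $\Gamma(E_\mp)$ for $u\in\Gamma(E_\pm)$ (subscripts on brackets denote projection to $E_\mp$). Its torsion $\widetilde T$ is totally skew; $D^0$ is defined by $\langle D^0_uv,w\rangle=\langle\widetilde D_uv,w\rangle-\frac13\widetilde T(u,v,w)$; it is a generalised Levi-Civita connection with divergence $\mathrm{div}^{\mathcal G}$. Let $\mathfrak{so}(E)_{\mathcal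 G}^{\langle1\rangle}$ be the bundle of $S\in E^*\otimes\mathfrak{so}(E)$, $S_u$ preserving $E_\pm$, with $\sum_{\mathrm{cycl}}\langle S_uv,w\rangle=0$; put $\mathrm{tr}(S)(v)=\mathrm{tr}(u\mapsto S_uv)$. $D^{\mathcal G,\mathrm{div}}$ is the unique generalised Levi-Civita connection with divergence $\mathrm{div}$ such that $D^{\mathcal G,\mathrm{div}}-D^0$ is pointwise orthogonal, with respect to the scalar product induced by $\langle\cdot,\cdot\rangle$, to $\ker(\mathrm{tr}:\mathfrak{so}(E)_{\mathcal G}^{\langle1\rangle}\to E^* )$. (Explicitly, $D^{\mathcal G,\mathrm{div}}-D^0=\frac1{d-1}(\chi_+^{e_+}+\chi_-^{e_-})$ with $\chi_\pm^{e_\pm}(a,b)=\langle a,b\rangle e_\pm-\langle e_\pm,b\rangle a$ for $a,b\in E_\pm$, extended by zero.) **Curvature.** With $D^2_{v,w}=D_vD_w-D_{D_vw}$ the generalised Riemann tensor is the section of $\mathrm{Sym}^2\Lambda^2E^*$ $$\mathcal{R}m^D(a,b,v,w)=\tfrac12\Big\{\langle(D^2_{v,w}-D^2_{w,v})b,a\rangle+\langle(D^2_{b,a}-D^2_{a,b})v,w\rangle-\mathrm{tr}_E(\langle Dv,w\rangle\langle Db,a\rangle)\Big\},$$ where $\mathrm{tr}_E$ is the trace with respect to $\langle\cdot,\cdot\rangle$ in the dotted slots: $\mathrm{tr}_E\,B=\sum_IB(e_I,e^I)$ for a local frame $(e_I)$ of $E$ and the frame $(e^I)$ with $\langle e^I,e_J\rangle=\delta^I_J$.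 The full generalised Ricci tensor is $\overline{\mathcal{R}c}^D(a,b)=\mathrm{tr}_E\,\mathcal{R}m^D(\cdot,a,\cdot,b)$ for $a,b\in\Gamma(E)$. **Notation.** $e_\pm$ are the projections of $e$ to $E_\pm$; $|e_\pm|^2_{\mathcal G}=\mathcal G(e_\pm,e_\pm)$; $\mathrm{div}_g(e_\pm)=\mathrm{div}_g(\pi e_\pm)$; $[g\nabla e_\pm]^{\mathrm{sym}}(A,B)=\frac12\big(g(\nabla_A\pi e_\pm,B)+g(\nabla_B\pi e_\pm,A)\big)$; $g\pi e_\pm=g(\pi e_\pm,\cdot)$. $\mathrm{Rc}$ is the Ricci tensor of $g$. $H^2(A,B)=\sum_{i,j}H(\epsilon_i,A,\epsilon_j)H(\epsilon^i,B,\epsilon^j)$ for a local frame $(\epsilon_i)$ of $TM$ with $g$-dual frame $(\epsilon^i)$. *)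

theory Defs
  imports "HOL-Analysis.Analysis" "HOL-Library.Function_Algebras"
begin

text \<open>Sections, functions and tangent vectors are functions and are added, multiplied and
  scaled pointwise.\<close>

instantiation "fun" :: (type, real_vector) real_vector
begin

definition scaleR_fun :: "real \<Rightarrow> ('a \<Rightarrow> 'b) \<Rightarrow> 'a \<Rightarrow> 'b" where
  "scaleR_fun c f = (\<lambda>x. c *\<^sub>R f x)"

instance
  by standard (simp_all add: scaleR_fun_def fun_eq_iff scaleR_add_right scaleR_add_left)

end

lemma scaleR_fun_apply [simp]: "(c *\<^sub>R f) x = c *\<^sub>R f x"
  by (simp add: scaleR_fun_def)


section \<open>Fibrewise linear algebra\<close>

definition lin_on :: "'a::real_vector set \<Rightarrow> ('a \<Rightarrow> 'b::real_vector) \<Rightarrow> bool" where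
  "lin_on V f \<longleftrightarrow> (\<forall>x\<in>V. \<forall>y\<in>V. f (x + y) = f x + f y) \<and> (\<forall>c. \<forall>x\<in>V. f (c *\<^sub>R x) = c *\<^sub>R f x)"

definition bilin_on :: "'a::real_vector set \<Rightarrow> ('a \<Rightarrow> 'a \<Rightarrow> 'b::real_vector) \<Rightarrow> bool" where
  "bilin_on V \<beta> \<longleftrightarrow> (\<forall>x\<in>V. lin_on V (\<beta> x)) \<and> (\<forall>y\<in>V. lin_on V (\<lambda>x. \<beta> x y))"

definition sym_on :: "'a set \<Rightarrow> ('a \<Rightarrow> 'a \<Rightarrow> real) \<Rightarrow> bool" where
  "sym_on V \<beta> \<longleftrightarrow> (\<forall>x\<in>V. \<forall>y\<in>V. \<beta> x y = \<beta> y x)"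

definition nondeg_on :: "'a::zero set \<Rightarrow> ('a \<Rightarrow> 'a \<Rightarrow> real) \<Rightarrow> bool" where
  "nondeg_on V \<beta> \<longleftrightarrow> (\<forall>x\<in>V. (\<forall>y\<in>V. \<beta> x y = 0) \<longrightarrow> x = 0)"

definition is_basis_family :: "'a::real_vector set \<Rightarrow> nat \<Rightarrow> (nat \<Rightarrow> 'a) \<Rightarrow> bool" where
  "is_basis_family V n b \<longleftrightarrow>
     inj_on b {..<n} \<and> independent (b ` {..<n}) \<and> span (b ` {..<n}) = V"


section \<open>Smooth manifolds\<close>

text \<open>Infinite differentiability on an open set, through iterated directional derivatives.\<close>

primrec ck_on :: "nat \<Rightarrow> 'e::euclidean_space set \<Rightarrow> ('e \<Rightarrow> 'b::real_normed_vector) \<Rightarrow> bool" where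
  "ck_on 0 S f \<longleftrightarrow> continuous_on S f"
| "ck_on (Suc k) S f \<longleftrightarrow>
     (\<forall>x\<in>S. f differentiable (at x)) \<and> (\<forall>v. ck_on k S (\<lambda>x. frechet_derivative f (at x) v))"

definition smooth_map_on :: "'e::euclidean_space set \<Rightarrow> ('e \<Rightarrow> 'b::real_normed_vector) \<Rightarrow> bool" where
  "smooth_map_on S f \<longleftrightarrow> (\<forall>k. ck_on k S f)"

type_synonym ('m, 'e) atlas = "('m set \<times> ('m \<Rightarrow> 'e)) set"

text \<open>The manifold is the whole type \<open>'m\<close>, of dimension \<open>DIM('e)\<close>; its Hausdorff and second
  countable topology is given by the type class.\<close>

definition smooth_manifold ::
  "('m::{t2_space,second_countable_topology}, 'e::euclidean_space) atlas \<Rightarrow> bool" where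
  "smooth_manifold A \<longleftrightarrow>
     (\<forall>(U, \<phi>)\<in>A. open U \<and> open (\<phi> ` U) \<and> homeomorphism U (\<phi> ` U) \<phi> (inv_into U \<phi>)) \<and>
     (\<Union>(U, \<phi>)\<in>A. U) = UNIV \<and>
     (\<forall>(U, \<phi>)\<in>A. \<forall>(V, \<psi>)\<in>A. smooth_map_on (\<phi> ` (U \<inter> V)) (\<psi> \<circ> inv_into U \<phi>))"

definition smooth_fun_on :: "('m, 'e::euclidean_space) atlas \<Rightarrow> 'm set \<Rightarrow> ('m \<Rightarrow> real) \<Rightarrow> bool" where
  "smooth_fun_on A W f \<longleftrightarrow> (\<forall>(U, \<phi>)\<in>A. smooth_map_on (\<phi> ` (U \<inter> W)) (f \<circ> inv_into U \<phi>))"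

definition Cinf :: "('m, 'e::euclidean_space) atlas \<Rightarrow> ('m \<Rightarrow> real) set" where
  "Cinf A = {f. smooth_fun_on A UNIV f}"

type_synonym 'm tvec = "('m \<Rightarrow> real) \<Rightarrow> real"
type_synonym 'm vfield = "'m \<Rightarrow> 'm tvec"

text \<open>Tangent vectors at \<open>p\<close> are the derivations at \<open>p\<close> of the algebra of smooth functions,
  extended by zero to all functions so that equality of tangent vectors is equality in HOL.\<close>

definition tangent_space :: "('m, 'e::euclidean_space) atlas \<Rightarrow> 'm \<Rightarrow> 'm tvec set" where
  "tangent_space A p =
     {v. (\<forall>f. f \<notin> Cinf A \<longrightarrow> v f = 0) \<and> lin_on (Cinf A) v \<and>
         (\<forall>f\<in>Cinf A. \<forall>h\<in>Cinf A. v (f * h) = f p * v h + h p * v f)}"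

definition vf_apply :: "'m vfield \<Rightarrow> ('m \<Rightarrow> real) \<Rightarrow> 'm \<Rightarrow> real" where
  "vf_apply X f = (\<lambda>p. X p f)"

definition vfields :: "('m, 'e::euclidean_space) atlas \<Rightarrow> 'm vfield set" where
  "vfields A = {X. (\<forall>p. X p \<in> tangent_space A p) \<and> (\<forall>f\<in>Cinf A. vf_apply X f \<in> Cinf A)}"

definition lie_bracket :: "'m vfield \<Rightarrow> 'm vfield \<Rightarrow> 'm vfield" where
  "lie_bracket X Y = (\<lambda>p f. X p (vf_apply Y f) - Y p (vf_apply X f))"

text \<open>Multiplication of a section by a function, and evaluation of tensors on sections.\<close>

definition fmul :: "('m \<Rightarrow> real) \<Rightarrow> ('m \<Rightarrow> 'v::real_vector) \<Rightarrow> 'm \<Rightarrow> 'v" where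
  "fmul f u = (\<lambda>p. f p *\<^sub>R u p)"

definition ev2 :: "('m \<Rightarrow> 'v \<Rightarrow> 'v \<Rightarrow> real) \<Rightarrow> ('m \<Rightarrow> 'v) \<Rightarrow> ('m \<Rightarrow> 'v) \<Rightarrow> 'm \<Rightarrow> real" where
  "ev2 \<beta> u v = (\<lambda>p. \<beta> p (u p) (v p))"

definition ev3 ::
  "('m \<Rightarrow> 'v \<Rightarrow> 'v \<Rightarrow> 'v \<Rightarrow> real) \<Rightarrow> ('m \<Rightarrow> 'v) \<Rightarrow> ('m \<Rightarrow> 'v) \<Rightarrow> ('m \<Rightarrow> 'v) \<Rightarrow> 'm \<Rightarrow> real" where
  "ev3 \<beta> u v w = (\<lambda>p. \<beta> p (u p) (v p) (w p))"


section \<open>Metric traces\<close>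

text \<open>\<open>F\<close> gives the fibres of a vector bundle, \<open>S\<close> its smooth sections and \<open>\<beta>\<close> a nondegenerate
  symmetric form on the fibres. The sections \<open>e i\<close> form a frame at \<open>p\<close> and the \<open>e' i\<close> the
  \<open>\<beta>\<close>-dual frame at \<open>p\<close>.\<close>

definition dual_frames ::
  "('m \<Rightarrow> 'v::real_vector set) \<Rightarrow> ('m \<Rightarrow> 'v) set \<Rightarrow> ('m \<Rightarrow> 'v \<Rightarrow> 'v \<Rightarrow> real) \<Rightarrow> 'm \<Rightarrow>
   (nat \<Rightarrow> 'm \<Rightarrow> 'v) \<Rightarrow> (nat \<Rightarrow> 'm \<Rightarrow> 'v) \<Rightarrow> bool" where
  "dual_frames F S \<beta> p e e' \<longleftrightarrow>
     (\<forall>i<dim (F p). e i \<in> S \<and> e' i \<in> S) \<and>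
     is_basis_family (F p) (dim (F p)) (\<lambda>i. e i p) \<and>
     (\<forall>i<dim (F p). \<forall>j<dim (F p). \<beta> p (e' i p) (e j p) = (if i = j then 1 else 0))"

text \<open>Trace at \<open>p\<close> with respect to \<open>\<beta>\<close>. The argument \<open>T u v\<close> is the value at \<open>p\<close> of a tensor on
  the sections \<open>u\<close>, \<open>v\<close>; it depends only on \<open>u p\<close> and \<open>v p\<close>, so duality of the frames is needed
  at \<open>p\<close> only and the choice of frames does not matter. The trace of an endomorphism \<open>B\<close> is the
  trace of \<open>\<lambda>u v. \<beta> (B u) v\<close>, because the \<open>\<beta> (\<cdot>) (e' i)\<close> are the coframe dual to \<open>e\<close>.\<close>

definition metric_trace ::
  "('m \<Rightarrow> 'v::real_vector set) \<Rightarrow> ('m \<Rightarrow> 'v) set \<Rightarrow> ('m \<Rightarrow> 'v \<Rightarrow> 'v \<Rightarrow> real) \<Rightarrow> 'm \<Rightarrow>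
   (('m \<Rightarrow> 'v) \<Rightarrow> ('m \<Rightarrow> 'v) \<Rightarrow> real) \<Rightarrow> real" where
  "metric_trace F S \<beta> p T =
     (let (e, e') = (SOME (e, e'). dual_frames F S \<beta> p e e') in \<Sum>i<dim (F p). T (e i) (e' i))"


section \<open>Semi-Riemannian geometry\<close>

definition semi_riemannian ::
  "('m, 'e::euclidean_space) atlas \<Rightarrow> ('m \<Rightarrow> 'm tvec \<Rightarrow> 'm tvec \<Rightarrow> real) \<Rightarrow> bool" where
  "semi_riemannian A g \<longleftrightarrow>
     (\<forall>p. bilin_on (tangent_space A p) (g p) \<and> sym_on (tangent_space A p) (g p) \<and>
          nondeg_on (tangent_space A p) (g p)) \<and>
     (\<forall>X\<in>vfields A. \<forall>Y\<in>vfields A. ev2 g X Y \<in> Cinf A)"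

definition levi_civita ::
  "('m, 'e::euclidean_space) atlas \<Rightarrow> ('m \<Rightarrow> 'm tvec \<Rightarrow> 'm tvec \<Rightarrow> real) \<Rightarrow>
   ('m vfield \<Rightarrow> 'm vfield \<Rightarrow> 'm vfield) \<Rightarrow> bool" where
  "levi_civita A g nabla \<longleftrightarrow>
     (\<forall>X\<in>vfields A. \<forall>Y\<in>vfields A. nabla X Y \<in> vfields A) \<and>
     (\<forall>X\<in>vfields A. \<forall>Y\<in>vfields A. \<forall>Z\<in>vfields A.
        nabla (X + Y) Z = nabla X Z + nabla Y Z \<and> nabla X (Y + Z) = nabla X Y + nabla X Z) \<and>
     (\<forall>X\<in>vfields A. \<forall>Y\<in>vfields A. \<forall>f\<in>Cinf A.
        nabla (fmul f X) Y = fmul f (nabla X Y) \<and>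
        nabla X (fmul f Y) = fmul (vf_apply X f) Y + fmul f (nabla X Y)) \<and>
     (\<forall>X\<in>vfields A. \<forall>Y\<in>vfields A. nabla X Y - nabla Y X = lie_bracket X Y) \<and>
     (\<forall>X\<in>vfields A. \<forall>Y\<in>vfields A. \<forall>Z\<in>vfields A.
        vf_apply X (ev2 g Y Z) = ev2 g (nabla X Y) Z + ev2 g Y (nabla X Z))"

abbreviation trace_TM ::
  "('m, 'e::euclidean_space) atlas \<Rightarrow> ('m \<Rightarrow> 'm tvec \<Rightarrow> 'm tvec \<Rightarrow> real) \<Rightarrow> 'm \<Rightarrow>
   ('m vfield \<Rightarrow> 'm vfield \<Rightarrow> real) \<Rightarrow> real" where
  "trace_TM A \<equiv> metric_trace (tangent_space A) (vfields A)"

definition div_g ::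
  "('m, 'e::euclidean_space) atlas \<Rightarrow> ('m \<Rightarrow> 'm tvec \<Rightarrow> 'm tvec \<Rightarrow> real) \<Rightarrow>
   ('m vfield \<Rightarrow> 'm vfield \<Rightarrow> 'm vfield) \<Rightarrow> 'm vfield \<Rightarrow> 'm \<Rightarrow> real" where
  "div_g A g nabla X = (\<lambda>p. trace_TM A g p (\<lambda>Y Y'. ev2 g (nabla Y X) Y' p))"

definition riemann ::
  "('m vfield \<Rightarrow> 'm vfield \<Rightarrow> 'm vfield) \<Rightarrow> 'm vfield \<Rightarrow> 'm vfield \<Rightarrow> 'm vfield \<Rightarrow> 'm vfield" where
  "riemann nabla X Y Z =
     nabla X (nabla Y Z) - nabla Y (nabla X Z) - nabla (lie_bracket X Y) Z"

text \<open>\<open>Rc(X, Y) = tr (Z \<mapsto> R(Z, X) Y)\<close>.\<close>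

definition ricci ::
  "('m, 'e::euclidean_space) atlas \<Rightarrow> ('m \<Rightarrow> 'm tvec \<Rightarrow> 'm tvec \<Rightarrow> real) \<Rightarrow>
   ('m vfield \<Rightarrow> 'm vfield \<Rightarrow> 'm vfield) \<Rightarrow> 'm vfield \<Rightarrow> 'm vfield \<Rightarrow> 'm \<Rightarrow> real" where
  "ricci A g nabla X Y = (\<lambda>p. trace_TM A g p (\<lambda>Z Z'. ev2 g (riemann nabla Z X Y) Z' p))"

definition three_form ::
  "('m, 'e::euclidean_space) atlas \<Rightarrow> ('m \<Rightarrow> 'm tvec \<Rightarrow> 'm tvec \<Rightarrow> 'm tvec \<Rightarrow> real) \<Rightarrow> bool" where
  "three_form A H \<longleftrightarrow>
     (\<forall>p. \<forall>x\<in>tangent_space A p. bilin_on (tangent_space A p) (H p x)) \<and>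
     (\<forall>p. \<forall>x\<in>tangent_space A p. \<forall>y\<in>tangent_space A p. \<forall>z\<in>tangent_space A p.
        H p x y z = - H p y x z \<and> H p x y z = - H p x z y) \<and>
     (\<forall>X\<in>vfields A. \<forall>Y\<in>vfields A. \<forall>Z\<in>vfields A. ev3 H X Y Z \<in> Cinf A)"

definition closed_three_form ::
  "('m, 'e::euclidean_space) atlas \<Rightarrow> ('m \<Rightarrow> 'm tvec \<Rightarrow> 'm tvec \<Rightarrow> 'm tvec \<Rightarrow> real) \<Rightarrow> bool" where
  "closed_three_form A H \<longleftrightarrow> three_form A H \<and>
     (\<forall>X\<in>vfields A. \<forall>Y\<in>vfields A. \<forall>Z\<in>vfields A. \<forall>W\<in>vfields A.
        vf_apply X (ev3 H Y Z W) - vf_apply Y (ev3 H X Z W)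
        + vf_apply Z (ev3 H X Y W) - vf_apply W (ev3 H X Y Z)
        - ev3 H (lie_bracket X Y) Z W + ev3 H (lie_bracket X Z) Y W
        - ev3 H (lie_bracket X W) Y Z - ev3 H (lie_bracket Y Z) X W
        + ev3 H (lie_bracket Y W) X Z - ev3 H (lie_bracket Z W) X Y = 0)"

definition H_square ::
  "('m, 'e::euclidean_space) atlas \<Rightarrow> ('m \<Rightarrow> 'm tvec \<Rightarrow> 'm tvec \<Rightarrow> real) \<Rightarrow>
   ('m \<Rightarrow> 'm tvec \<Rightarrow> 'm tvec \<Rightarrow> 'm tvec \<Rightarrow> real) \<Rightarrow> 'm vfield \<Rightarrow> 'm vfield \<Rightarrow> 'm \<Rightarrow> real" where
  "H_square A g H X Y = (\<lambda>p. trace_TM A g p (\<lambda>Z Z'. trace_TM A g p (\<lambda>W W'.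
      ev3 H Z X W p * ev3 H Z' Y W' p)))"

text \<open>One-forms enter through their values on vector fields.\<close>

type_synonym 'm oneform = "'m vfield \<Rightarrow> 'm \<Rightarrow> real"

definition lie_form :: "'m vfield \<Rightarrow> 'm oneform \<Rightarrow> 'm oneform" where
  "lie_form X \<zeta> = (\<lambda>Z. vf_apply X (\<zeta> Z) - \<zeta> (lie_bracket X Z))"

definition d_form :: "'m oneform \<Rightarrow> 'm vfield \<Rightarrow> 'm vfield \<Rightarrow> 'm \<Rightarrow> real" where
  "d_form \<xi> Y Z = vf_apply Y (\<xi> Z) - vf_apply Z (\<xi> Y) - \<xi> (lie_bracket Y Z)"

definition H_bracket ::
  "('m \<Rightarrow> 'm tvec \<Rightarrow> 'm tvec \<Rightarrow> 'm tvec \<Rightarrow> real) \<Rightarrow>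
   'm vfield \<times> 'm oneform \<Rightarrow> 'm vfield \<times> 'm oneform \<Rightarrow> 'm vfield \<times> 'm oneform" where
  "H_bracket H = (\<lambda>(X, \<xi>) (Y, \<zeta>).
     (lie_bracket X Y, \<lambda>Z. lie_form X \<zeta> Z - d_form \<xi> Y Z + ev3 H X Y Z))"


section \<open>Exact Courant algebroids\<close>

text \<open>The fibres of the vector bundle \<open>E\<close> are subspaces of a vector space \<open>'v\<close>. This is no
  restriction, since \<open>'v\<close> is arbitrary (take the direct sum of all fibres), and only the linear
  structure of each fibre is used. The smooth structure is given by local frames \<open>(U, e)\<close> over open
  sets covering \<open>M\<close>, with smooth transition functions.\<close>

record ('m, 'e, 'v) courant =
  atlas :: "('m, 'e) atlas"
  fibre :: "'m \<Rightarrow> 'v set"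
  rnk :: nat
  frames :: "('m set \<times> (nat \<Rightarrow> 'm \<Rightarrow> 'v)) set"
  anchor :: "'m \<Rightarrow> 'v \<Rightarrow> 'm tvec"
  pairing :: "'m \<Rightarrow> 'v \<Rightarrow> 'v \<Rightarrow> real"
  dorfman :: "('m \<Rightarrow> 'v) \<Rightarrow> ('m \<Rightarrow> 'v) \<Rightarrow> 'm \<Rightarrow> 'v"

definition smooth_vector_bundle ::
  "('m::topological_space, 'e::euclidean_space, 'v::real_vector) courant \<Rightarrow> bool" where
  "smooth_vector_bundle C \<longleftrightarrow>
     (\<Union>(U, e)\<in>frames C. U) = UNIV \<and>
     (\<forall>(U, e)\<in>frames C. open U \<and>
        (\<forall>p\<in>U. is_basis_family (fibre C p) (rnk C) (\<lambda>i. e i p))) \<and>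
     (\<forall>(U, e)\<in>frames C. \<forall>(V, f)\<in>frames C.
        \<exists>a. (\<forall>i<rnk C. \<forall>j<rnk C. smooth_fun_on (atlas C) (U \<inter> V) (a i j)) \<and>
            (\<forall>j<rnk C. \<forall>p\<in>U \<inter> V. f j p = (\<Sum>i<rnk C. a i j p *\<^sub>R e i p)))"

definition sections ::
  "('m, 'e::euclidean_space, 'v::real_vector) courant \<Rightarrow> ('m \<Rightarrow> 'v) set" where
  "sections C = {u. (\<forall>p. u p \<in> fibre C p) \<and>
     (\<forall>(U, e)\<in>frames C. \<exists>a. (\<forall>i<rnk C. smooth_fun_on (atlas C) U (a i)) \<and>
        (\<forall>p\<in>U. u p = (\<Sum>i<rnk C. a i p *\<^sub>R e i p)))}"

definition anch :: "('m, 'e, 'v) courant \<Rightarrow> ('m \<Rightarrow> 'v) \<Rightarrow> 'm vfield" where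
  "anch C u = (\<lambda>p. anchor C p (u p))"

abbreviation pair :: "('m, 'e, 'v) courant \<Rightarrow> ('m \<Rightarrow> 'v) \<Rightarrow> ('m \<Rightarrow> 'v) \<Rightarrow> 'm \<Rightarrow> real" where
  "pair C \<equiv> ev2 (pairing C)"

text \<open>In the last clause the factor 1 in \<open>\<langle>[u,v] + [v,u], w\<rangle> = \<pi>(w)\<langle>u,v\<rangle>\<close> is the one belonging to the
  scalar product \<open>\<langle>X + \<xi>, Y + \<zeta>\<rangle> = (\<xi>(Y) + \<zeta>(X)) / 2\<close> of the generalised tangent bundle.\<close>

definition courant_algebroid ::
  "('m::{t2_space,second_countable_topology}, 'e::euclidean_space, 'v::real_vector) courant \<Rightarrow> bool" where
  "courant_algebroid C \<longleftrightarrow>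
     smooth_manifold (atlas C) \<and> smooth_vector_bundle C \<and>
     (\<forall>p. lin_on (fibre C p) (anchor C p) \<and> anchor C p ` fibre C p \<subseteq> tangent_space (atlas C) p) \<and>
     (\<forall>u\<in>sections C. anch C u \<in> vfields (atlas C)) \<and>
     (\<forall>p. bilin_on (fibre C p) (pairing C p) \<and> sym_on (fibre C p) (pairing C p) \<and>
          nondeg_on (fibre C p) (pairing C p)) \<and>
     (\<forall>u\<in>sections C. \<forall>v\<in>sections C. pair C u v \<in> Cinf (atlas C)) \<and>
     (\<forall>u\<in>sections C. \<forall>v\<in>sections C. dorfman C u v \<in> sections C) \<and>
     bilin_on (sections C) (dorfman C) \<and>
     (\<forall>u\<in>sections C. \<forall>v\<in>sections C. \<forall>w\<in>sections C.
        dorfman C u (dorfman C v w) = dorfman C (dorfman C u v) w + dorfman C v (dorfman C u w)) \<and>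
     (\<forall>u\<in>sections C. \<forall>v\<in>sections C.
        anch C (dorfman C u v) = lie_bracket (anch C u) (anch C v)) \<and>
     (\<forall>u\<in>sections C. \<forall>v\<in>sections C. \<forall>f\<in>Cinf (atlas C).
        dorfman C u (fmul f v) = fmul (vf_apply (anch C u) f) v + fmul f (dorfman C u v)) \<and>
     (\<forall>u\<in>sections C. \<forall>v\<in>sections C. \<forall>w\<in>sections C.
        vf_apply (anch C u) (pair C v w) = pair C (dorfman C u v) w + pair C v (dorfman C u w)) \<and>
     (\<forall>u\<in>sections C. \<forall>v\<in>sections C. \<forall>w\<in>sections C.
        pair C (dorfman C u v + dorfman C v u) w = vf_apply (anch C w) (pair C u v))"

text \<open>The covector \<open>\<xi>\<close> corresponds to the \<open>v \<in> E\<close> with \<open>\<langle>v, w\<rangle> = \<xi>(\<pi> w) / 2\<close> for all \<open>w\<close>.\<close>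

definition cotangent_in_E ::
  "('m, 'e::euclidean_space, 'v::real_vector) courant \<Rightarrow> 'm \<Rightarrow> 'v set" where
  "cotangent_in_E C p = {v \<in> fibre C p. \<exists>\<xi>. lin_on (tangent_space (atlas C) p) \<xi> \<and>
     (\<forall>w\<in>fibre C p. pairing C p v w = \<xi> (anchor C p w) / 2)}"

text \<open>Exactness of \<open>0 \<rightarrow> T\<^sup>*M \<rightarrow> E \<rightarrow> TM \<rightarrow> 0\<close>. The first map is dual to the anchor, so its
  injectivity is the surjectivity of the anchor.\<close>

definition exact_courant_algebroid ::
  "('m::{t2_space,second_countable_topology}, 'e::euclidean_space, 'v::real_vector) courant \<Rightarrow> bool" where
  "exact_courant_algebroid C \<longleftrightarrow> courant_algebroid C \<and>
     (\<forall>p. anchor C p ` fibre C p = tangent_space (atlas C) p \<and>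
          {v \<in> fibre C p. anchor C p v = 0} = cotangent_in_E C p)"

abbreviation trace_E ::
  "('m, 'e::euclidean_space, 'v::real_vector) courant \<Rightarrow> 'm \<Rightarrow>
   (('m \<Rightarrow> 'v) \<Rightarrow> ('m \<Rightarrow> 'v) \<Rightarrow> real) \<Rightarrow> real" where
  "trace_E C \<equiv> metric_trace (fibre C) (sections C) (pairing C)"


section \<open>Generalised metrics\<close>

definition G_End ::
  "('m, 'e, 'v) courant \<Rightarrow> ('m \<Rightarrow> 'v \<Rightarrow> 'v \<Rightarrow> real) \<Rightarrow> 'm \<Rightarrow> 'v \<Rightarrow> 'v" where
  "G_End C G p u = (THE w. w \<in> fibre C p \<and> (\<forall>v\<in>fibre C p. pairing C p w v = G p u v))"

definition generalised_metric ::
  "('m, 'e::euclidean_space, 'v::real_vector) courant \<Rightarrow> ('m \<Rightarrow> 'v \<Rightarrow> 'v \<Rightarrow> real) \<Rightarrow> bool" where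
  "generalised_metric C G \<longleftrightarrow>
     (\<forall>p. bilin_on (fibre C p) (G p) \<and> sym_on (fibre C p) (G p) \<and> nondeg_on (fibre C p) (G p)) \<and>
     (\<forall>u\<in>sections C. \<forall>v\<in>sections C. ev2 G u v \<in> Cinf (atlas C)) \<and>
     (\<forall>p. \<forall>u\<in>fibre C p. G_End C G p (G_End C G p u) = u) \<and>
     (\<forall>p. nondeg_on (cotangent_in_E C p) (G p))"

text \<open>The sign \<open>s = \<plusminus>1\<close> selects \<open>E\<^sub>\<plusminus>\<close>.\<close>

definition eigen_fibre ::
  "('m, 'e, 'v::real_vector) courant \<Rightarrow> ('m \<Rightarrow> 'v \<Rightarrow> 'v \<Rightarrow> real) \<Rightarrow> real \<Rightarrow> 'm \<Rightarrow> 'v set" where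
  "eigen_fibre C G s p = {u \<in> fibre C p. G_End C G p u = s *\<^sub>R u}"

definition eigen_sections ::
  "('m, 'e::euclidean_space, 'v::real_vector) courant \<Rightarrow> ('m \<Rightarrow> 'v \<Rightarrow> 'v \<Rightarrow> real) \<Rightarrow> real \<Rightarrow>
   ('m \<Rightarrow> 'v) set" where
  "eigen_sections C G s = {u \<in> sections C. \<forall>p. u p \<in> eigen_fibre C G s p}"

definition proj ::
  "('m, 'e, 'v::real_vector) courant \<Rightarrow> ('m \<Rightarrow> 'v \<Rightarrow> 'v \<Rightarrow> real) \<Rightarrow> real \<Rightarrow> ('m \<Rightarrow> 'v) \<Rightarrow> 'm \<Rightarrow> 'v" where
  "proj C G s u = (\<lambda>p. (1 / 2) *\<^sub>R (u p + s *\<^sub>R G_End C G p (u p)))"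

text \<open>The inverse of \<open>\<pi>\<^sub>\<plusminus>\<close>, on vector fields.\<close>

definition lift ::
  "('m, 'e, 'v::real_vector) courant \<Rightarrow> ('m \<Rightarrow> 'v \<Rightarrow> 'v \<Rightarrow> real) \<Rightarrow> real \<Rightarrow> 'm vfield \<Rightarrow> 'm \<Rightarrow> 'v" where
  "lift C G s X = (\<lambda>p. THE v. v \<in> eigen_fibre C G s p \<and> anchor C p v = X p)"

definition induced_metric ::
  "('m, 'e::euclidean_space, 'v::real_vector) courant \<Rightarrow> ('m \<Rightarrow> 'v \<Rightarrow> 'v \<Rightarrow> real) \<Rightarrow>
   ('m \<Rightarrow> 'm tvec \<Rightarrow> 'm tvec \<Rightarrow> real) \<Rightarrow> bool" where
  "induced_metric C G g \<longleftrightarrow> semi_riemannian (atlas C) g \<and>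
     (\<forall>s\<in>{1, -1}. \<forall>p. \<forall>u\<in>eigen_fibre C G s p. \<forall>v\<in>eigen_fibre C G s p.
        g p (anchor C p u) (anchor C p v) = G p u v)"

text \<open>The map \<open>\<phi> = (1 \<plusminus> g) \<circ> \<pi>\<^sub>\<plusminus>\<close> on \<open>E\<^sub>\<plusminus>\<close>.\<close>

definition phi ::
  "('m, 'e, 'v::real_vector) courant \<Rightarrow> ('m \<Rightarrow> 'v \<Rightarrow> 'v \<Rightarrow> real) \<Rightarrow>
   ('m \<Rightarrow> 'm tvec \<Rightarrow> 'm tvec \<Rightarrow> real) \<Rightarrow> ('m \<Rightarrow> 'v) \<Rightarrow> 'm vfield \<times> 'm oneform" where
  "phi C G g u =
     (anch C u, \<lambda>Z. ev2 g (anch C (proj C G 1 u)) Z - ev2 g (anch C (proj C G (-1) u)) Z)"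

text \<open>The form \<open>H\<close> for which \<open>\<phi>\<close> intertwines the brackets. Bijectivity of \<open>\<phi>\<close> and its
  compatibility with anchors and scalar products hold for every generalised metric and do not
  involve \<open>H\<close>.\<close>

definition induced_three_form ::
  "('m, 'e::euclidean_space, 'v::real_vector) courant \<Rightarrow> ('m \<Rightarrow> 'v \<Rightarrow> 'v \<Rightarrow> real) \<Rightarrow>
   ('m \<Rightarrow> 'm tvec \<Rightarrow> 'm tvec \<Rightarrow> real) \<Rightarrow>
   ('m \<Rightarrow> 'm tvec \<Rightarrow> 'm tvec \<Rightarrow> 'm tvec \<Rightarrow> real) \<Rightarrow> bool" where
  "induced_three_form C G g H \<longleftrightarrow> closed_three_form (atlas C) H \<and>
     (\<forall>u\<in>sections C. \<forall>v\<in>sections C.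
        fst (phi C G g (dorfman C u v)) = fst (H_bracket H (phi C G g u) (phi C G g v)) \<and>
        (\<forall>Z\<in>vfields (atlas C).
           snd (phi C G g (dorfman C u v)) Z = snd (H_bracket H (phi C G g u) (phi C G g v)) Z))"


section \<open>Generalised connections\<close>

type_synonym ('m, 'v) gconn = "('m \<Rightarrow> 'v) \<Rightarrow> ('m \<Rightarrow> 'v) \<Rightarrow> 'm \<Rightarrow> 'v"

definition generalised_connection ::
  "('m, 'e::euclidean_space, 'v::real_vector) courant \<Rightarrow> ('m, 'v) gconn \<Rightarrow> bool" where
  "generalised_connection C D \<longleftrightarrow>
     (\<forall>u\<in>sections C. \<forall>v\<in>sections C. D u v \<in> sections C) \<and>
     bilin_on (sections C) D \<and>
     (\<forall>u\<in>sections C. \<forall>v\<in>sections C. \<forall>f\<in>Cinf (atlas C).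
        D (fmul f u) v = fmul f (D u v) \<and>
        D u (fmul f v) = fmul (vf_apply (anch C u) f) v + fmul f (D u v)) \<and>
     (\<forall>u\<in>sections C. \<forall>v\<in>sections C. \<forall>w\<in>sections C.
        vf_apply (anch C u) (pair C v w) = pair C (D u v) w + pair C v (D u w))"

definition torsion ::
  "('m, 'e, 'v::real_vector) courant \<Rightarrow> ('m, 'v) gconn \<Rightarrow>
   ('m \<Rightarrow> 'v) \<Rightarrow> ('m \<Rightarrow> 'v) \<Rightarrow> ('m \<Rightarrow> 'v) \<Rightarrow> 'm \<Rightarrow> real" where
  "torsion C D u v w = pair C (D u v - D v u - dorfman C u v) w + pair C (D w u) v"

definition generalised_levi_civita ::
  "('m, 'e::euclidean_space, 'v::real_vector) courant \<Rightarrow> ('m \<Rightarrow> 'v \<Rightarrow> 'v \<Rightarrow> real) \<Rightarrow>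
   ('m, 'v) gconn \<Rightarrow> bool" where
  "generalised_levi_civita C G D \<longleftrightarrow> generalised_connection C D \<and>
     (\<forall>u\<in>sections C. \<forall>v\<in>sections C. \<forall>w\<in>sections C.
        vf_apply (anch C u) (ev2 G v w) = ev2 G (D u v) w + ev2 G v (D u w)) \<and>
     (\<forall>u\<in>sections C. \<forall>v\<in>sections C. \<forall>w\<in>sections C. torsion C D u v w = 0)"

definition divergence_operator ::
  "('m, 'e::euclidean_space, 'v::real_vector) courant \<Rightarrow> (('m \<Rightarrow> 'v) \<Rightarrow> 'm \<Rightarrow> real) \<Rightarrow> bool" where
  "divergence_operator C dv \<longleftrightarrow>
     (\<forall>v\<in>sections C. dv v \<in> Cinf (atlas C)) \<and> lin_on (sections C) dv \<and>
     (\<forall>v\<in>sections C. \<forall>f\<in>Cinf (atlas C). dv (fmul f v) = vf_apply (anch C v) f + f * dv v)"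

definition div_conn ::
  "('m, 'e::euclidean_space, 'v::real_vector) courant \<Rightarrow> ('m, 'v) gconn \<Rightarrow> ('m \<Rightarrow> 'v) \<Rightarrow> 'm \<Rightarrow> real" where
  "div_conn C D v = (\<lambda>p. trace_E C p (\<lambda>u u'. pair C (D u v) u' p))"

definition div_G ::
  "('m, 'e::euclidean_space, 'v::real_vector) courant \<Rightarrow> ('m \<Rightarrow> 'm tvec \<Rightarrow> 'm tvec \<Rightarrow> real) \<Rightarrow>
   ('m vfield \<Rightarrow> 'm vfield \<Rightarrow> 'm vfield) \<Rightarrow> ('m \<Rightarrow> 'v) \<Rightarrow> 'm \<Rightarrow> real" where
  "div_G C g nabla v = div_g (atlas C) g nabla (anch C v)"


section \<open>The canonical generalised Levi-Civita connection\<close>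

definition D_tilde ::
  "('m, 'e, 'v::real_vector) courant \<Rightarrow> ('m \<Rightarrow> 'v \<Rightarrow> 'v \<Rightarrow> real) \<Rightarrow>
   ('m vfield \<Rightarrow> 'm vfield \<Rightarrow> 'm vfield) \<Rightarrow> ('m, 'v) gconn" where
  "D_tilde C G nabla u v = (\<Sum>s\<in>{1, -1}.
      lift C G s (nabla (anch C (proj C G s u)) (anch C (proj C G s v)))
      + proj C G (- s) (dorfman C (proj C G s u) (proj C G (- s) v)))"

definition D_zero ::
  "('m, 'e::euclidean_space, 'v::real_vector) courant \<Rightarrow> ('m \<Rightarrow> 'v \<Rightarrow> 'v \<Rightarrow> real) \<Rightarrow>
   ('m vfield \<Rightarrow> 'm vfield \<Rightarrow> 'm vfield) \<Rightarrow> ('m, 'v) gconn" where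
  "D_zero C G nabla u v = (THE x. x \<in> sections C \<and>
     (\<forall>w\<in>sections C. pair C x w =
        pair C (D_tilde C G nabla u v) w - (1 / 3) *\<^sub>R torsion C (D_tilde C G nabla) u v w))"

text \<open>The fibre at \<open>p\<close> of the first prolongation of \<open>so(E)\<^sub>G\<close>.\<close>

definition so_prolongation ::
  "('m, 'e, 'v::real_vector) courant \<Rightarrow> ('m \<Rightarrow> 'v \<Rightarrow> 'v \<Rightarrow> real) \<Rightarrow> 'm \<Rightarrow> ('v \<Rightarrow> 'v \<Rightarrow> 'v) set" where
  "so_prolongation C G p = {K. bilin_on (fibre C p) K \<and>
     (\<forall>u\<in>fibre C p. \<forall>v\<in>fibre C p. K u v \<in> fibre C p) \<and>
     (\<forall>u\<in>fibre C p. \<forall>v\<in>fibre C p. \<forall>w\<in>fibre C p.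
        pairing C p (K u v) w = - pairing C p v (K u w)) \<and>
     (\<forall>s\<in>{1, -1}. \<forall>u\<in>fibre C p. \<forall>v\<in>eigen_fibre C G s p. K u v \<in> eigen_fibre C G s p) \<and>
     (\<forall>u\<in>fibre C p. \<forall>v\<in>fibre C p. \<forall>w\<in>fibre C p.
        pairing C p (K u v) w + pairing C p (K v w) u + pairing C p (K w u) v = 0)}"

definition prolongation_kernel ::
  "('m, 'e::euclidean_space, 'v::real_vector) courant \<Rightarrow> ('m \<Rightarrow> 'v \<Rightarrow> 'v \<Rightarrow> real) \<Rightarrow> 'm \<Rightarrow>
   ('v \<Rightarrow> 'v \<Rightarrow> 'v) set" where
  "prolongation_kernel C G p = {K \<in> so_prolongation C G p.
     \<forall>v\<in>fibre C p. trace_E C p (\<lambda>u u'. pairing C p (K (u p) v) (u' p)) = 0}"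

text \<open>The scalar product induced on \<open>E\<^sup>* \<otimes> so(E)\<close> is
  \<open>\<langle>S, K\<rangle> = \<Sum> \<langle>S\<^bsub>e\<^sub>I\<^esub> e\<^sub>J, K\<^bsub>e\<^sup>I\<^esub> e\<^sup>J\<rangle>\<close>, up to a constant factor depending on conventions.\<close>

definition canonical_connection ::
  "('m, 'e::euclidean_space, 'v::real_vector) courant \<Rightarrow> ('m \<Rightarrow> 'v \<Rightarrow> 'v \<Rightarrow> real) \<Rightarrow>
   ('m vfield \<Rightarrow> 'm vfield \<Rightarrow> 'm vfield) \<Rightarrow> (('m \<Rightarrow> 'v) \<Rightarrow> 'm \<Rightarrow> real) \<Rightarrow> ('m, 'v) gconn \<Rightarrow> bool" where
  "canonical_connection C G nabla dv D \<longleftrightarrow>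
     generalised_levi_civita C G D \<and> (\<forall>v\<in>sections C. div_conn C D v = dv v) \<and>
     (\<forall>p. \<forall>K\<in>prolongation_kernel C G p.
        trace_E C p (\<lambda>u u'. trace_E C p (\<lambda>v v'.
          pairing C p ((D u v - D_zero C G nabla u v) p) (K (u' p) (v' p)))) = 0)"


section \<open>Generalised curvature\<close>

definition D_second :: "('m, 'v::real_vector) gconn \<Rightarrow>
  ('m \<Rightarrow> 'v) \<Rightarrow> ('m \<Rightarrow> 'v) \<Rightarrow> ('m \<Rightarrow> 'v) \<Rightarrow> 'm \<Rightarrow> 'v" where
  "D_second D v w a = D v (D w a) - D (D v w) a"

definition gen_riemann ::
  "('m, 'e::euclidean_space, 'v::real_vector) courant \<Rightarrow> ('m, 'v) gconn \<Rightarrow>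
   ('m \<Rightarrow> 'v) \<Rightarrow> ('m \<Rightarrow> 'v) \<Rightarrow> ('m \<Rightarrow> 'v) \<Rightarrow> ('m \<Rightarrow> 'v) \<Rightarrow> 'm \<Rightarrow> real" where
  "gen_riemann C D a b v w = (\<lambda>p. (1 / 2) *
     (pair C (D_second D v w b - D_second D w v b) a p
      + pair C (D_second D b a v - D_second D a b v) w p
      - trace_E C p (\<lambda>u u'. pair C (D u v) w p * pair C (D u' b) a p)))"

definition gen_ricci ::
  "('m, 'e::euclidean_space, 'v::real_vector) courant \<Rightarrow> ('m, 'v) gconn \<Rightarrow>
   ('m \<Rightarrow> 'v) \<Rightarrow> ('m \<Rightarrow> 'v) \<Rightarrow> 'm \<Rightarrow> real" where
  "gen_ricci C D a b = (\<lambda>p. trace_E C p (\<lambda>u u'. gen_riemann C D u a u' b p))"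

text \<open>The symmetric part of \<open>(A, B) \<mapsto> g(\<nabla>\<^sub>A X, B)\<close>.\<close>

definition sym_nabla ::
  "('m \<Rightarrow> 'm tvec \<Rightarrow> 'm tvec \<Rightarrow> real) \<Rightarrow> ('m vfield \<Rightarrow> 'm vfield \<Rightarrow> 'm vfield) \<Rightarrow>
   'm vfield \<Rightarrow> 'm vfield \<Rightarrow> 'm vfield \<Rightarrow> 'm \<Rightarrow> real" where
  "sym_nabla g nabla X A B = (\<lambda>p. (1 / 2) * (ev2 g (nabla A X) B p + ev2 g (nabla B X) A p))"

end

theory Submission
  imports Defs "Jordan_Normal_Form.Determinant"
begin

text \<open>Write \<open>s = \<plusminus>1\<close>, \<open>k = s / (d - 1)\<close> and \<open>E = \<pi> e\<^sub>s\<close>. Transported to \<open>TM\<close> by the lifts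
  \<open>\<pi>\<^sub>\<plusminus>\<inverse>\<close>, the derivative of a section of \<open>E\<^sub>s\<close> along \<open>X\<close> is \<open>\<nabla>\<^sub>X + (s / 2) H(X, \<cdot>)\<close> in
  directions of \<open>E\<^sub>-\<^sub>s\<close> and \<open>\<nabla>\<^sub>X + P\<^sub>X\<close> with
  \<open>P\<^sub>X Y = (s / 6) H(X, Y) + k (g(X, Y) E - g(E, Y) X)\<close> in directions of \<open>E\<^sub>s\<close>; the second summand
  of \<open>P\<close> is found by testing \<open>D - D\<^sup>0\<close> against explicit elements of the kernel of the trace. Only
  frame vectors of type \<open>s\<close> contribute to the Ricci curvature on \<open>E\<^sub>s\<close>. In the expansion of the
  curvature the trace over \<open>E\<close> cancels the terms that are not tensorial, the derivatives of \<open>H\<close>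
  vanish by skew-symmetry after contraction, and the terms quadratic in \<open>P\<close> give \<open>H\<^sup>2\<close>, \<open>|e\<^sub>s|\<^sup>2\<close> and
  \<open>g E \<otimes> g E\<close>.\<close>

text \<open>Two obstacles shape the proof. First, tangent vectors are derivations of globally
  defined functions, and a trace is a sum over a frame picked by \<open>SOME\<close>. So bump
  functions are needed to localise, Hadamard's lemma to find the dimension of the tangent space, and
  every traced expression must be shown tensorial before it can be evaluated in a convenient frame.
  For the generalised curvature this fails term by term and rests on vanishing torsion. Second, the
  scalar product is g on E_+ and -g on E_-. A section u is therefore handled as the pair of vector
  fields \<open>pj 1 u\<close>, \<open>pj (-1) u\<close>; brackets, connections and curvature become
  formulas on M in a sign s with s^2 = 1. Vanishing torsion is also the reason for the cancellation
  of the nabla terms in the curvature: it identifies the torsion of the induced derivative along E_s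
  with the difference of the two derivatives that the trace over E compares
  (\<open>Dl_om\<close>).\<close>

no_notation Matrix.scalar_prod (infix \<open>\<bullet>\<close> 70)

section \<open>Smooth functions on open sets\<close>

lemma frechet_derivative_eqI:
  "(f has_derivative f') (at x) \<Longrightarrow> frechet_derivative f (at x) = f'"
  by (rule frechet_derivative_at[symmetric])

text \<open>Openness of S makes the derivatives of f and g agree on S as well, so the induction
  passes to the directional derivatives.\<close>

lemma ck_on_cong:
  assumes "open S" "\<And>x. x \<in> S \<Longrightarrow> f x = g x" "ck_on k S f"
  shows "ck_on k S g"
  using assms(2,3)
proof (induction k arbitrary: f g)
  case 0
  then show ?case using continuous_on_eq[of S f g] by simp
next
  case (Suc k)
  have d: "(g has_derivative frechet_derivative f (at x)) (at x)" if "x \<in> S" for x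
    by (rule has_derivative_transform_within_open[OF _ assms(1) that, of f])
       (use Suc.prems that in \<open>simp_all add: frechet_derivative_works\<close>)
  have "ck_on k S (\<lambda>x. frechet_derivative g (at x) v)" for v
    by (rule Suc.IH[where f="\<lambda>x. frechet_derivative f (at x) v"])
      (use Suc.prems(2) in \<open>simp_all add: frechet_derivative_eqI[OF d]\<close>)
  then show ?case
    using d by (auto simp: differentiable_def)
qed

text \<open>Admits any explicitly known derivative in place of the one selected by
  \<open>frechet_derivative\<close>; the closure rules below all enter their induction step through
  it.\<close>

lemma ck_on_SucI:
  assumes "open S" "\<And>x. x \<in> S \<Longrightarrow> (f has_derivative f' x) (at x)"
    "\<And>v. ck_on k S (\<lambda>x. f' x v)"
  shows "ck_on (Suc k) S f"
proof -
  have "ck_on k S (\<lambda>x. frechet_derivative f (at x) v)" for v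
    by (rule ck_on_cong[OF assms(1) _ assms(3)[of v]]) (simp add: frechet_derivative_eqI[OF assms(2)])
  then show ?thesis
    using assms(2) by (auto simp: differentiable_def)
qed

lemma ck_on_Suc_derivative:
  assumes "ck_on (Suc k) S f" "x \<in> S"
  shows "(f has_derivative frechet_derivative f (at x)) (at x)"
  using assms by (auto simp: frechet_derivative_works)

lemma ck_on_Suc_ck_on_derivative:
  "ck_on (Suc k) S f \<Longrightarrow> ck_on k S (\<lambda>x. frechet_derivative f (at x) v)"
  by simp

lemma ck_on_SucD: "ck_on (Suc k) S f \<Longrightarrow> ck_on k S f"
proof (induction k arbitrary: f)
  case 0
  then show ?case
    by (auto intro!: continuous_at_imp_continuous_on differentiable_imp_continuous_within)
next
  case (Suc k)
  then show ?case by simp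
qed

lemma ck_on_subset: "ck_on k S f \<Longrightarrow> T \<subseteq> S \<Longrightarrow> ck_on k T f"
  by (induction k arbitrary: f) (auto intro: continuous_on_subset)

lemma ck_on_local:
  assumes "\<And>x. x \<in> S \<Longrightarrow> \<exists>T. open T \<and> x \<in> T \<and> ck_on k T f"
  shows "ck_on k S f"
  using assms
proof (induction k arbitrary: f)
  case 0
  have "isCont f x" if x: "x \<in> S" for x
  proof -
    obtain T where "open T" "x \<in> T" "continuous_on T f" using "0.prems"[OF x] by auto
    then show ?thesis using continuous_on_eq_continuous_at by blast
  qed
  then show ?case by (simp add: continuous_at_imp_continuous_on)
next
  case (Suc k)
  have "f differentiable (at x)" if "x \<in> S" for x
    using Suc.prems[OF that] by auto
  moreover have "ck_on k S (\<lambda>x. frechet_derivative f (at x) v)" for v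
    using Suc.prems by (intro Suc.IH) fastforce
  ultimately show ?case by simp
qed

declare ck_on.simps(2) [simp del]

lemma ck_on_const [simp]: "open S \<Longrightarrow> ck_on k S (\<lambda>x. c)"
proof (induction k arbitrary: c)
  case (Suc k)
  show ?case
    by (rule ck_on_SucI[where f'="\<lambda>x v. 0"]) (use Suc in auto)
qed simp

lemma ck_on_bounded_linear:
  assumes "open S" "bounded_linear L"
  shows "ck_on k S L"
proof (cases k)
  case 0
  then show ?thesis
    by (simp add: assms bounded_linear.continuous_on[OF assms(2) continuous_on_id])
next
  case (Suc j)
  show ?thesis unfolding Suc
    by (rule ck_on_SucI[where f'="\<lambda>x v. L v"])
       (auto simp: assms bounded_linear.has_derivative[OF assms(2) has_derivative_ident])
qed

lemma ck_on_linear_compose: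
  assumes "open S" "bounded_linear L" "ck_on k S f"
  shows "ck_on k S (\<lambda>x. L (f x))"
  using assms(3)
proof (induction k arbitrary: f)
  case 0
  then show ?case
    by (auto intro: bounded_linear.continuous_on[OF assms(2)])
next
  case (Suc k)
  show ?case
    by (rule ck_on_SucI[OF assms(1), where f'="\<lambda>x v. L (frechet_derivative f (at x) v)"])
       (use Suc in \<open>auto intro: bounded_linear.has_derivative[OF assms(2)] ck_on_Suc_derivative
          ck_on_Suc_ck_on_derivative\<close>)
qed

lemma ck_on_add:
  assumes "open S" "ck_on k S f" "ck_on k S g"
  shows "ck_on k S (\<lambda>x. f x + g x)"
  using assms(2,3)
proof (induction k arbitrary: f g)
  case 0
  then show ?case by (auto intro: continuous_intros)
next
  case (Suc k)
  show ?case
    by (rule ck_on_SucI[OF assms(1), where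
          f'="\<lambda>x v. frechet_derivative f (at x) v + frechet_derivative g (at x) v"])
       (use Suc in \<open>auto intro!: has_derivative_add ck_on_Suc_derivative ck_on_Suc_ck_on_derivative\<close>)
qed

lemma ck_on_scaleR:
  fixes f :: "'a::euclidean_space \<Rightarrow> real"
  assumes "open S" "ck_on k S f" "ck_on k S g"
  shows "ck_on k S (\<lambda>x. f x *\<^sub>R g x)"
  using assms(2,3)
proof (induction k arbitrary: f g)
  case 0
  then show ?case by (auto intro: continuous_intros)
next
  case (Suc k)
  have "ck_on k S (\<lambda>x. f x *\<^sub>R frechet_derivative g (at x) v + frechet_derivative f (at x) v *\<^sub>R g x)" for v
    by (intro ck_on_add Suc.IH) (use Suc.prems in \<open>auto simp: assms(1) dest: ck_on_SucD intro: ck_on_Suc_ck_on_derivative\<close>)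
  then show ?case
    by (intro ck_on_SucI[OF assms(1), where
          f'="\<lambda>x v. f x *\<^sub>R frechet_derivative g (at x) v + frechet_derivative f (at x) v *\<^sub>R g x"])
       (use Suc.prems in \<open>auto intro!: has_derivative_scaleR ck_on_Suc_derivative\<close>)
qed

lemma ck_on_sum:
  assumes "open S" "\<And>i. i \<in> I \<Longrightarrow> ck_on k S (f i)"
  shows "ck_on k S (\<lambda>x. \<Sum>i\<in>I. f i x)"
  using assms(2)
  by (induction I rule: infinite_finite_induct) (auto intro!: ck_on_add assms(1) ck_on_const)

text \<open>The derivative of 1/f is a product of 1/f, 1/f and -Df, so the induction hypothesis for
  the same f suffices.\<close>

lemma ck_on_inverse:
  fixes f :: "'a::euclidean_space \<Rightarrow> real"
  assumes "open S" "ck_on k S f" "\<And>x. x \<in> S \<Longrightarrow> f x \<noteq> 0"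
  shows "ck_on k S (\<lambda>x. inverse (f x))"
  using assms(2)
proof (induction k)
  case 0
  then show ?case using assms(3) by (auto intro: continuous_intros)
next
  case (Suc k)
  have i: "ck_on k S (\<lambda>x. inverse (f x))" by (rule Suc.IH) (use Suc.prems in \<open>rule ck_on_SucD\<close>)
  have "ck_on k S (\<lambda>x. (inverse (f x) *\<^sub>R (inverse (f x))) *\<^sub>R (- frechet_derivative f (at x) v))" for v
    by (intro ck_on_scaleR ck_on_linear_compose[where L="uminus"] i assms(1))
       (use Suc.prems in \<open>auto intro: bounded_linear_minus bounded_linear_ident ck_on_Suc_ck_on_derivative\<close>)
  moreover have "((\<lambda>x. inverse (f x)) has_derivative
      (\<lambda>v. (inverse (f x) *\<^sub>R (inverse (f x))) *\<^sub>R (- frechet_derivative f (at x) v))) (at x)" if "x \<in> S" for x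
    using Deriv.has_derivative_inverse[OF assms(3)[OF that] ck_on_Suc_derivative[OF Suc.prems that]]
    by (simp add: algebra_simps)
  ultimately show ?case
    by (rule ck_on_SucI[OF assms(1), rotated])
qed

lemma ck_on_compose:
  fixes g :: "'a::euclidean_space \<Rightarrow> 'b::euclidean_space"
  assumes "open S" "open T" "ck_on k T f" "ck_on k S g" "\<And>x. x \<in> S \<Longrightarrow> g x \<in> T"
  shows "ck_on k S (\<lambda>x. f (g x))"
  using assms(3,4)
proof (induction k arbitrary: f)
  case 0
  then show ?case
    using assms(5) by (auto intro: continuous_on_compose2)
next
  case (Suc k)
  \<comment> \<open>The chain rule differentiates f in a direction that depends on x, whereas
    \<open>ck_on\<close> speaks of fixed directions; expanding in the basis separates the
    two.\<close>
  let ?D = "\<lambda>x v. \<Sum>b\<in>Basis. (frechet_derivative g (at x) v \<bullet> b) *\<^sub>R frechet_derivative f (at (g x)) b"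
  have "((\<lambda>x. f (g x)) has_derivative ?D x) (at x)" if "x \<in> S" for x
  proof -
    have df: "(f has_derivative frechet_derivative f (at (g x))) (at (g x))"
      using ck_on_Suc_derivative[OF Suc.prems(1) assms(5)[OF that]] .
    then interpret f: bounded_linear "frechet_derivative f (at (g x))"
      by (rule has_derivative_bounded_linear)
    have 1: "((\<lambda>x. f (g x)) has_derivative (\<lambda>v. frechet_derivative f (at (g x)) (frechet_derivative g (at x) v))) (at x)"
      using has_derivative_compose[OF ck_on_Suc_derivative[OF Suc.prems(2) that] df] .
    have 2: "frechet_derivative f (at (g x)) w =
        (\<Sum>b\<in>Basis. (w \<bullet> b) *\<^sub>R frechet_derivative f (at (g x)) b)" for w
      using f.sum[of "\<lambda>b. (w \<bullet> b) *\<^sub>R b" Basis] by (simp add: euclidean_representation f.scaleR)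
    show ?thesis
      using 1 by (simp only: 2[of "frechet_derivative g (at x) v" for v])
  qed
  moreover have "ck_on k S (\<lambda>x. ?D x v)" for v
  proof (intro ck_on_sum ck_on_scaleR assms(1))
    fix b :: 'b assume "b \<in> Basis"
    show "ck_on k S (\<lambda>x. frechet_derivative g (at x) v \<bullet> b)"
      by (rule ck_on_linear_compose[OF assms(1) bounded_linear_inner_left])
        (rule ck_on_Suc_ck_on_derivative[OF Suc.prems(2)])
    show "ck_on k S (\<lambda>x. frechet_derivative f (at (g x)) b)"
      by (rule Suc.IH[OF ck_on_Suc_ck_on_derivative[OF Suc.prems(1)] ck_on_SucD[OF Suc.prems(2)]])
  qed
  ultimately show ?case
    by (rule ck_on_SucI[OF assms(1)])
qed

section \<open>Closure properties of smooth maps\<close>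

lemma smooth_map_on_cong:
  "open S \<Longrightarrow> (\<And>x. x \<in> S \<Longrightarrow> f x = g x) \<Longrightarrow> smooth_map_on S f \<Longrightarrow> smooth_map_on S g"
  unfolding smooth_map_on_def using ck_on_cong[of S f g] by blast

lemma smooth_map_on_subset: "smooth_map_on S f \<Longrightarrow> T \<subseteq> S \<Longrightarrow> smooth_map_on T f"
  unfolding smooth_map_on_def using ck_on_subset[of _ S f T] by blast

lemma smooth_map_on_local:
  assumes "\<And>x. x \<in> S \<Longrightarrow> \<exists>T. open T \<and> x \<in> T \<and> smooth_map_on T f"
  shows "smooth_map_on S f"
  unfolding smooth_map_on_def
proof
  show "ck_on k S f" for k
    by (rule ck_on_local) (meson assms smooth_map_on_def)
qed

lemma smooth_map_on_const: "open S \<Longrightarrow> smooth_map_on S (\<lambda>x. c)"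
  unfolding smooth_map_on_def by simp

lemma smooth_map_on_add:
  "open S \<Longrightarrow> smooth_map_on S f \<Longrightarrow> smooth_map_on S g \<Longrightarrow> smooth_map_on S (\<lambda>x. f x + g x)"
  unfolding smooth_map_on_def by (simp add: ck_on_add)

lemma smooth_map_on_scaleR:
  fixes f :: "'a::euclidean_space \<Rightarrow> real"
  shows "open S \<Longrightarrow> smooth_map_on S f \<Longrightarrow> smooth_map_on S g \<Longrightarrow> smooth_map_on S (\<lambda>x. f x *\<^sub>R g x)"
  unfolding smooth_map_on_def by (simp add: ck_on_scaleR)

lemma smooth_map_on_mult:
  fixes f :: "'a::euclidean_space \<Rightarrow> real"
  shows "open S \<Longrightarrow> smooth_map_on S f \<Longrightarrow> smooth_map_on S g \<Longrightarrow> smooth_map_on S (\<lambda>x. f x * g x)"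
  using smooth_map_on_scaleR[of S f g] by simp

lemma smooth_map_on_inverse:
  fixes f :: "'a::euclidean_space \<Rightarrow> real"
  shows "open S \<Longrightarrow> smooth_map_on S f \<Longrightarrow> (\<And>x. x \<in> S \<Longrightarrow> f x \<noteq> 0) \<Longrightarrow> smooth_map_on S (\<lambda>x. inverse (f x))"
  unfolding smooth_map_on_def by (simp add: ck_on_inverse)

lemma smooth_map_on_compose:
  fixes g :: "'a::euclidean_space \<Rightarrow> 'b::euclidean_space"
  shows "open S \<Longrightarrow> open T \<Longrightarrow> smooth_map_on T f \<Longrightarrow> smooth_map_on S g \<Longrightarrow> (\<And>x. x \<in> S \<Longrightarrow> g x \<in> T)
    \<Longrightarrow> smooth_map_on S (\<lambda>x. f (g x))"
  by (simp add: smooth_map_on_def ck_on_compose[where T=T])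

lemma smooth_map_on_linear: "open S \<Longrightarrow> bounded_linear L \<Longrightarrow> smooth_map_on S L"
  unfolding smooth_map_on_def by (simp add: ck_on_bounded_linear)

lemma smooth_map_on_has_derivative:
  "smooth_map_on S f \<Longrightarrow> x \<in> S \<Longrightarrow> (f has_derivative frechet_derivative f (at x)) (at x)"
  unfolding smooth_map_on_def using ck_on_Suc_derivative[of 0 S f x] by blast

subsection \<open>Bump functions\<close>

text \<open>For P = 1 the classical flat function exp (-1/t). The polynomial in 1/t makes the family
  closed under differentiation.\<close>

definition exp_cutoff :: "real poly \<Rightarrow> real \<Rightarrow> real" where
  "exp_cutoff P t = (if t > 0 then poly P (1 / t) * exp (- (1 / t)) else 0)"

lemma poly_times_exp_tendsto_0: "((\<lambda>y. poly P y * exp (- y)) \<longlongrightarrow> (0::real)) at_top"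
proof -
  have "((\<lambda>y. \<Sum>i\<le>degree P. coeff P i * (y ^ i / exp y)) \<longlongrightarrow> (\<Sum>i\<le>degree P. coeff P i * 0)) at_top"
    by (intro tendsto_sum tendsto_mult tendsto_const tendsto_power_div_exp_0)
  then show ?thesis
    by (simp add: poly_altdef sum_distrib_right exp_minus divide_inverse mult.assoc)
qed

lemma exp_cutoff_tendsto_0: "(exp_cutoff P \<longlongrightarrow> 0) (at 0)"
proof (rule filterlim_split_at)
  have "\<forall>\<^sub>F t in at_left 0. exp_cutoff P t = 0"
    by (rule eventually_at_leftI[of "-1"]) (auto simp: exp_cutoff_def)
  then show "(exp_cutoff P \<longlongrightarrow> 0) (at_left 0)"
    by (simp add: tendsto_eventually)
  have "((\<lambda>t. poly P (inverse t) * exp (- inverse t)) \<longlongrightarrow> 0) (at_right 0)"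
    by (rule filterlim_compose[OF poly_times_exp_tendsto_0 filterlim_inverse_at_top_right])
  moreover have "\<forall>\<^sub>F t in at_right 0. exp_cutoff P t = poly P (inverse t) * exp (- inverse t)"
    by (rule eventually_at_rightI[of 0 1]) (auto simp: exp_cutoff_def divide_inverse)
  ultimately show "(exp_cutoff P \<longlongrightarrow> 0) (at_right 0)"
    by (simp add: tendsto_cong)
qed

text \<open>With y = 1/t, differentiating P(y) exp(-y) in t gives y^2 (P - P')(y) exp(-y). At t = 0
  the difference quotient is itself a cutoff, with polynomial y P(y), and tends to 0.\<close>

lemma exp_cutoff_has_derivative:
  "(exp_cutoff P has_field_derivative exp_cutoff (monom 1 2 * (P - pderiv P)) t) (at t)"
proof -
  let ?Q = "monom 1 2 * (P - pderiv P)"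
  consider "t < 0" | "t > 0" | "t = 0" by linarith
  then show ?thesis
  proof cases
    case 1
    have "((\<lambda>t. 0) has_field_derivative 0) (at t)" by simp
    then show ?thesis
      by (rule has_field_derivative_transform_within_open[where S="{..<0}", THEN DERIV_cong])
        (use 1 in \<open>auto simp: exp_cutoff_def\<close>)
  next
    case 2
    have "((\<lambda>t. poly P (1 / t) * exp (- (1 / t))) has_field_derivative exp_cutoff ?Q t) (at t)"
      using 2 by (auto intro!: derivative_eq_intros poly_DERIV[THEN DERIV_chain2] simp: exp_cutoff_def)
        (simp add: poly_monom field_simps power2_eq_square)
    then show ?thesis
      by (rule has_field_derivative_transform_within_open[where S="{0<..}"])
        (use 2 in \<open>auto simp: exp_cutoff_def\<close>)
  next
    case 3
    have "((\<lambda>h. (exp_cutoff P (0 + h) - exp_cutoff P 0) / h) \<longlongrightarrow> 0) (at 0)"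
    proof (rule Lim_transform_eventually[OF exp_cutoff_tendsto_0[of "monom 1 1 * P"]])
      show "\<forall>\<^sub>F h in at 0. exp_cutoff (monom 1 1 * P) h = (exp_cutoff P (0 + h) - exp_cutoff P 0) / h"
        by (auto simp: exp_cutoff_def poly_monom field_simps intro!: always_eventually)
    qed
    then show ?thesis
      unfolding 3 DERIV_def by (simp add: exp_cutoff_def)
  qed
qed

lemma smooth_map_on_exp_cutoff: "smooth_map_on UNIV (exp_cutoff P)"
proof -
  have "ck_on k UNIV (exp_cutoff P)" for k
  proof (induction k arbitrary: P)
    case 0
    show ?case
      using exp_cutoff_has_derivative[of P, THEN DERIV_isCont]
      by (simp add: continuous_at_imp_continuous_on)
  next
    case (Suc k)
    show ?case
    proof (rule ck_on_SucI[OF open_UNIV, where f'="\<lambda>t v. exp_cutoff (monom 1 2 * (P - pderiv P)) t * v"])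
      show "(exp_cutoff P has_derivative (*) (exp_cutoff (monom 1 2 * (P - pderiv P)) t)) (at t)" for t
        using exp_cutoff_has_derivative by (simp add: has_field_derivative_def)
      show "ck_on k UNIV (\<lambda>t. exp_cutoff (monom 1 2 * (P - pderiv P)) t * v)" for v
        using ck_on_scaleR[OF open_UNIV Suc.IH, of "\<lambda>_. v"] by simp
    qed
  qed
  then show ?thesis by (simp add: smooth_map_on_def)
qed

lemma smooth_bump_exists:
  fixes a :: "'a::euclidean_space"
  assumes "r > 0"
  obtains \<psi> :: "'a \<Rightarrow> real" where "smooth_map_on UNIV \<psi>"
    "\<And>x. x \<in> ball a (r / 2) \<Longrightarrow> \<psi> x = 1" "\<And>x. x \<notin> ball a r \<Longrightarrow> \<psi> x = 0"
proof -
  define h where "h = exp_cutoff [:1:]"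
  have h: "h t = (if t > 0 then exp (- (1 / t)) else 0)" for t
    by (simp add: h_def exp_cutoff_def)
  have hs: "smooth_map_on UNIV h"
    unfolding h_def by (rule smooth_map_on_exp_cutoff)
  \<comment> \<open>The squared distance, which unlike the distance is smooth at a.\<close>
  define q where "q = (\<lambda>x::'a. (x - a) \<bullet> (x - a))"
  have q: "q x = (dist a x)\<^sup>2" for x
    by (simp add: q_def dist_norm norm_minus_commute[of a] flip: power2_norm_eq_inner)
  have inner: "smooth_map_on UNIV (\<lambda>x::'a. (x - a) \<bullet> b)" for b
    using smooth_map_on_add[OF open_UNIV smooth_map_on_linear[OF open_UNIV bounded_linear_inner_left]
        smooth_map_on_const[OF open_UNIV], of b "- (a \<bullet> b)"]
    by (simp add: inner_diff_left)
  have qs: "smooth_map_on UNIV q"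
  proof -
    have "q = (\<lambda>x. \<Sum>b\<in>Basis. ((x - a) \<bullet> b) *\<^sub>R ((x - a) \<bullet> b))"
      unfolding q_def by (rule ext, subst euclidean_inner) simp
    then show ?thesis
      using inner unfolding smooth_map_on_def by (simp add: ck_on_sum ck_on_scaleR del: real_scaleR_def)
  qed
  have lin: "smooth_map_on UNIV (\<lambda>x. h (c * q x + d))" for c d
    using smooth_map_on_compose[OF open_UNIV open_UNIV hs
        smooth_map_on_add[OF open_UNIV smooth_map_on_mult[OF open_UNIV
          smooth_map_on_const[OF open_UNIV] qs] smooth_map_on_const[OF open_UNIV]]] by auto
  \<comment> \<open>\<open>u\<close> is positive exactly on the open ball of radius r, and
    \<open>w\<close> vanishes exactly on the closed ball of radius r/2. Hence u + w has no zero and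
    u / (u + w) is the required bump.\<close>
  define u where "u = (\<lambda>x. h (-1 * q x + r\<^sup>2))"
  define w where "w = (\<lambda>x. h (1 * q x + - (r / 2)\<^sup>2))"
  have us: "smooth_map_on UNIV u" "smooth_map_on UNIV w"
    unfolding u_def w_def by (rule lin)+
  have u0: "u x = 0" if "x \<notin> ball a r" for x
  proof -
    have "r\<^sup>2 \<le> q x" unfolding q by (intro power_mono) (use that assms in auto)
    then show ?thesis by (simp add: u_def h)
  qed
  have w0: "w x = 0" if "x \<in> ball a (r / 2)" for x
  proof -
    have "q x \<le> (r/2)\<^sup>2" unfolding q by (intro power_mono) (use that assms in auto)
    then show ?thesis by (simp add: w_def h)
  qed
  have nn: "u x \<ge> 0" "w x \<ge> 0" for x by (auto simp: u_def w_def h)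
  have upos: "u x > 0" if "x \<in> ball a r" for x
  proof -
    have "q x < r\<^sup>2" unfolding q by (intro power_strict_mono) (use that in auto)
    then show ?thesis by (simp add: u_def h)
  qed
  have wpos: "w x > 0" if "x \<notin> ball a r" for x
  proof -
    have "(r/2)\<^sup>2 < q x" unfolding q by (intro power_strict_mono) (use that assms in auto)
    then show ?thesis by (simp add: w_def h)
  qed
  have pos: "u x + w x \<noteq> 0" for x
    using upos[of x] wpos[of x] nn[of x] by (cases "x \<in> ball a r") (auto simp: add_nonneg_eq_0_iff)
  show ?thesis
  proof (rule that[of "\<lambda>x. u x * inverse (u x + w x)"])
    show "smooth_map_on UNIV (\<lambda>x. u x * inverse (u x + w x))"
      by (intro smooth_map_on_mult smooth_map_on_inverse smooth_map_on_add us pos open_UNIV)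
    show "u x * inverse (u x + w x) = 1" if "x \<in> ball a (r / 2)" for x
      using w0[OF that] pos[of x] by simp
    show "u x * inverse (u x + w x) = 0" if "x \<notin> ball a r" for x
      using u0[OF that] by simp
  qed
qed

subsection \<open>Hadamard's lemma\<close>

text \<open>Each differentiation under the integral sign produces a factor t; the weight t^j is
  there to make the statement inductive.\<close>

lemma ck_on_segment_integral:
  fixes F :: "'a::euclidean_space \<Rightarrow> real"
  assumes S: "open S" "convex S" "a \<in> S" and F: "ck_on k S F"
  shows "ck_on k S (\<lambda>x. integral {0..1} (\<lambda>t. t ^ j * F (a + t *\<^sub>R (x - a))))"
proof -
  have seg: "a + t *\<^sub>R (x - a) \<in> S" if "x \<in> S" "t \<in> {0..1}" for x and t :: real
    using that convexD_alt[OF S(2) S(3) that(1), of t] by (simp add: algebra_simps)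
  have cont: "continuous_on (S \<times> {0..1}) (\<lambda>(x, t). t ^ j * F (a + t *\<^sub>R (x - a)))"
    if "continuous_on S F" for F :: "'a \<Rightarrow> real" and j
    unfolding split_beta
    by (intro continuous_intros continuous_on_compose2[OF that]) (auto intro: seg)
  show ?thesis
    using F
  proof (induction k arbitrary: F j)
    case 0
    then show ?case
      using integral_continuous_on_param[of S 0 1 "\<lambda>x t. t ^ j * F (a + t *\<^sub>R (x - a))"] cont
      by (simp add: split_beta)
  next
    case (Suc k)
    let ?D = "\<lambda>x t v. t ^ Suc j * frechet_derivative F (at (a + t *\<^sub>R (x - a))) v"
    have bl: "bounded_linear (?D x t)" if "x \<in> S" "t \<in> {0..1}" for x t
      using has_derivative_bounded_linear[OF ck_on_Suc_derivative[OF Suc.prems seg[OF that]]]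
      by (intro bounded_linear_const_mult)
    \<comment> \<open>Differentiation under the integral is available for derivatives that depend
      continuously on both variables as bounded linear maps.\<close>
    define B where "B = (\<lambda>x t. Blinfun (?D x t))"
    have B: "blinfun_apply (B x t) = ?D x t" if "x \<in> S" "t \<in> {0..1}" for x t
      unfolding B_def by (rule bounded_linear_Blinfun_apply[OF bl[OF that]])
    have d: "((\<lambda>x. t ^ j * F (a + t *\<^sub>R (x - a))) has_derivative blinfun_apply (B x t)) (at x within S)"
      if xt: "x \<in> S" "t \<in> cbox 0 1" for x t
    proof -
      have t: "t \<in> {0..1}" using xt by simp
      have dF: "(F has_derivative frechet_derivative F (at (a + t *\<^sub>R (x - a)))) (at (a + t *\<^sub>R (x - a)))"
        by (rule ck_on_Suc_derivative[OF Suc.prems seg[OF xt(1) t]])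
      interpret l: bounded_linear "frechet_derivative F (at (a + t *\<^sub>R (x - a)))"
        using dF by (rule has_derivative_bounded_linear)
      have "((\<lambda>x. a + t *\<^sub>R (x - a)) has_derivative (\<lambda>v. t *\<^sub>R v)) (at x within S)"
        by (auto intro!: derivative_eq_intros)
      from has_derivative_compose[OF this dF]
      have "((\<lambda>x. F (a + t *\<^sub>R (x - a))) has_derivative
          (\<lambda>v. frechet_derivative F (at (a + t *\<^sub>R (x - a))) (t *\<^sub>R v))) (at x within S)" .
      then have "((\<lambda>x. t ^ j * F (a + t *\<^sub>R (x - a))) has_derivative
          (\<lambda>v. t ^ j * frechet_derivative F (at (a + t *\<^sub>R (x - a))) (t *\<^sub>R v))) (at x within S)"
        by (rule has_derivative_mult_right)
      then show ?thesis
        unfolding B[OF xt(1) t] by (simp add: l.scaleR mult_ac)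
    qed
    have cB: "continuous_on (S \<times> cbox 0 1) (\<lambda>(x, t). B x t)"
      unfolding split_beta
    proof (rule continuous_on_blinfun_componentwise)
      fix i :: 'a
      have "continuous_on S (\<lambda>x. frechet_derivative F (at x) i)"
      proof -
        have "ck_on k S (\<lambda>x. frechet_derivative F (at x) i)"
          by (rule ck_on_Suc_ck_on_derivative[OF Suc.prems])
        then have "ck_on 0 S (\<lambda>x. frechet_derivative F (at x) i)"
          by (induction k) (auto dest: ck_on_SucD)
        then show ?thesis by simp
      qed
      from cont[OF this, of "Suc j"]
      have "continuous_on (S \<times> cbox 0 1)
          (\<lambda>(x, t). t ^ Suc j * frechet_derivative F (at (a + t *\<^sub>R (x - a))) i)"
        by (simp only: cbox_interval)
      then show "continuous_on (S \<times> cbox 0 1) (\<lambda>x. blinfun_apply (B (fst x) (snd x)) i)"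
        by (rule continuous_on_eq) (auto simp: B simp del: power_Suc)
    qed
    have cF: "continuous_on S F"
      using Suc.prems by (auto simp: ck_on.simps(2) intro!: continuous_at_imp_continuous_on differentiable_imp_continuous_within)
    have der': "((\<lambda>x. integral (cbox 0 1) (\<lambda>t. t ^ j * F (a + t *\<^sub>R (x - a)))) has_derivative
        integral (cbox 0 1) (B x)) (at x within S)" if "x \<in> S" for x
    proof (rule leibniz_rule[OF d _ cB that S(2)])
      fix y assume y: "y \<in> S"
      have "continuous_on (cbox 0 1) (\<lambda>t. t ^ j * F (a + t *\<^sub>R (y - a)))"
        by (intro continuous_intros continuous_on_compose2[OF cF]) (auto intro: seg[OF y])
      then show "(\<lambda>t. t ^ j * F (a + t *\<^sub>R (y - a))) integrable_on cbox 0 1"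
        by (rule integrable_continuous)
    qed
    have der: "((\<lambda>x. integral {0..1} (\<lambda>t. t ^ j * F (a + t *\<^sub>R (x - a)))) has_derivative
        integral {0..1} (B x)) (at x)" if "x \<in> S" for x
      using der'[OF that] by (simp only: at_within_open[OF that S(1)] cbox_interval)
    have Bi: "blinfun_apply (integral {0..1} (B x)) v = integral {0..1} (\<lambda>t. ?D x t v)" if "x \<in> S" for x v
    proof -
      have "continuous_on (cbox 0 1) (B x)"
        using continuous_on_compose2[OF cB continuous_on_Pair[OF continuous_on_const[of _ x] continuous_on_id[of "cbox 0 1"]]]
          that by auto
      then have "B x integrable_on cbox 0 1" by (rule integrable_continuous)
      from integral_linear[OF this, where h="\<lambda>L. blinfun_apply L v"]
      have "blinfun_apply (integral {0..1} (B x)) v = integral {0..1} (\<lambda>t. blinfun_apply (B x t) v)"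
        by (simp add: o_def bounded_linear_intros)
      also have "\<dots> = integral {0..1} (\<lambda>t. ?D x t v)"
        by (intro integral_cong) (simp add: B that)
      finally show ?thesis .
    qed
    show ?case
    proof (rule ck_on_SucI[OF S(1) der])
      fix v
      have "ck_on k S (\<lambda>x. integral {0..1} (\<lambda>t. ?D x t v))"
        by (rule Suc.IH) (rule ck_on_Suc_ck_on_derivative[OF Suc.prems])
      then show "ck_on k S (\<lambda>x. blinfun_apply (integral {0..1} (B x)) v)"
        by (rule ck_on_cong[OF S(1), rotated]) (simp add: Bi)
    qed
  qed
qed

text \<open>Integrate the derivative of t -> F(a + t (x - a)) over [0,1] and expand x - a in the
  basis; G b is the averaged partial derivative along the segment.\<close>

lemma Hadamard:
  fixes F :: "'a::euclidean_space \<Rightarrow> real"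
  assumes S: "open S" "convex S" "a \<in> S" and F: "smooth_map_on S F"
  obtains G where "\<And>b. smooth_map_on S (G b)"
    "\<And>b. G b a = frechet_derivative F (at a) b"
    "\<And>x. x \<in> S \<Longrightarrow> F x = F a + (\<Sum>b\<in>Basis. ((x - a) \<bullet> b) * G b x)"
proof -
  have seg: "a + t *\<^sub>R (x - a) \<in> S" if "x \<in> S" "t \<in> {0..1}" for x and t :: real
    using that convexD_alt[OF S(2) S(3) that(1), of t] by (simp add: algebra_simps)
  \<comment> \<open>The factor t^0 is kept so that \<open>ck_on_segment_integral\<close> applies
    with j = 0.\<close>
  define G where "G = (\<lambda>b x. integral {0..1} (\<lambda>t::real. t ^ 0 * frechet_derivative F (at (a + t *\<^sub>R (x - a))) b))"
  have cD: "continuous_on S (\<lambda>x. frechet_derivative F (at x) b)" for b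
    using F ck_on_Suc_ck_on_derivative[of 0 S F b] unfolding smooth_map_on_def by auto
  show ?thesis
  proof (rule that[of G])
    show "smooth_map_on S (G b)" for b
      unfolding smooth_map_on_def G_def
      using F by (intro allI ck_on_segment_integral S ck_on_Suc_ck_on_derivative) (simp add: smooth_map_on_def)
    show "G b a = frechet_derivative F (at a) b" for b
      by (simp add: G_def)
    fix x assume x: "x \<in> S"
    have "((\<lambda>t. F (a + t *\<^sub>R (x - a))) has_vector_derivative
        frechet_derivative F (at (a + t *\<^sub>R (x - a))) (x - a)) (at t within {0..1})" if "t \<in> {0..1}" for t
    proof -
      have dF: "(F has_derivative frechet_derivative F (at (a + t *\<^sub>R (x - a)))) (at (a + t *\<^sub>R (x - a)))"
        by (rule smooth_map_on_has_derivative[OF F seg[OF x that]])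
      interpret l: bounded_linear "frechet_derivative F (at (a + t *\<^sub>R (x - a)))"
        using dF by (rule has_derivative_bounded_linear)
      have "((\<lambda>t. a + t *\<^sub>R (x - a)) has_derivative (\<lambda>s. s *\<^sub>R (x - a))) (at t within {0..1})"
        by (auto intro!: derivative_eq_intros)
      from has_derivative_compose[OF this dF]
      show ?thesis by (simp add: has_vector_derivative_def l.scaleR)
    qed
    then have "((\<lambda>t. frechet_derivative F (at (a + t *\<^sub>R (x - a))) (x - a)) has_integral
        F (a + 1 *\<^sub>R (x - a)) - F (a + 0 *\<^sub>R (x - a))) {0..1}"
      by (intro fundamental_theorem_of_calculus) auto
    then have 1: "F x - F a = integral {0..1} (\<lambda>t. frechet_derivative F (at (a + t *\<^sub>R (x - a))) (x - a))"
      by (simp add: integral_unique)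
    have ex: "frechet_derivative F (at y) (x - a) = (\<Sum>b\<in>Basis. ((x - a) \<bullet> b) * frechet_derivative F (at y) b)"
      if "y \<in> S" for y
    proof -
      interpret l: bounded_linear "frechet_derivative F (at y)"
        using smooth_map_on_has_derivative[OF F that] by (rule has_derivative_bounded_linear)
      show ?thesis
        using l.sum[of "\<lambda>b. ((x - a) \<bullet> b) *\<^sub>R b" Basis] by (simp add: euclidean_representation l.scaleR)
    qed
    have int: "(\<lambda>t. frechet_derivative F (at (a + t *\<^sub>R (x - a))) b) integrable_on {0..1}" for b
    proof -
      have "continuous_on (cbox 0 1) (\<lambda>t. frechet_derivative F (at (a + t *\<^sub>R (x - a))) b)"
        using seg[OF x] by (intro continuous_on_compose2[OF cD] continuous_on_add continuous_on_scaleR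
            continuous_on_const continuous_on_id) auto
      then show ?thesis using integrable_continuous by fastforce
    qed
    have "F x - F a = integral {0..1} (\<lambda>t. \<Sum>b\<in>Basis. ((x - a) \<bullet> b) * frechet_derivative F (at (a + t *\<^sub>R (x - a))) b)"
      unfolding 1 by (intro integral_cong ex seg x)
    also have "\<dots> = (\<Sum>b\<in>Basis. ((x - a) \<bullet> b) * G b x)"
      using int by (subst integral_sum) (auto simp: G_def intro: integrable_on_mult_right)
    finally show "F x = F a + (\<Sum>b\<in>Basis. ((x - a) \<bullet> b) * G b x)" by simp
  qed
qed

section \<open>Smooth functions on a manifold\<close>

lemma sum_fun_apply: "(\<Sum>i\<in>I. f i) x = (\<Sum>i\<in>I. f i x)"
  by (induction I rule: infinite_finite_induct) simp_all

locale manifold =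
  fixes A :: "('m::{t2_space,second_countable_topology}, 'e::euclidean_space) atlas"
  assumes smooth_manifold: "smooth_manifold A"
begin

lemma chart_homeomorphism:
  assumes "(U, \<phi>) \<in> A"
  shows "open U" "open (\<phi> ` U)" "homeomorphism U (\<phi> ` U) \<phi> (inv_into U \<phi>)" "inj_on \<phi> U"
    "continuous_on U \<phi>" "continuous_on (\<phi> ` U) (inv_into U \<phi>)"
proof -
  show "open U" "open (\<phi> ` U)" and h: "homeomorphism U (\<phi> ` U) \<phi> (inv_into U \<phi>)"
    using smooth_manifold assms unfolding smooth_manifold_def by blast+
  show "inj_on \<phi> U"
    using homeomorphism_apply1[OF h] by (metis inj_onI)
  show "continuous_on U \<phi>" "continuous_on (\<phi> ` U) (inv_into U \<phi>)"
    using h by (auto simp: homeomorphism_def)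
qed

lemma chart_at:
  obtains U \<phi> where "(U, \<phi>) \<in> A" "p \<in> U"
proof -
  have "p \<in> (\<Union>(U, \<phi>)\<in>A. U)"
    using smooth_manifold unfolding smooth_manifold_def by simp
  then show ?thesis using that by blast
qed

lemma open_chart_image:
  assumes "(U, \<phi>) \<in> A" "open W"
  shows "open (\<phi> ` (U \<inter> W))"
proof -
  have "openin (top_of_set U) (U \<inter> W)"
    using assms(2) by (rule openin_open_Int)
  then have "openin (top_of_set (\<phi> ` U)) (\<phi> ` (U \<inter> W))"
    by (rule homeomorphism_imp_open_map[OF chart_homeomorphism(3)[OF assms(1)]])
  then show ?thesis
    using chart_homeomorphism(2)[OF assms(1)] by (rule openin_open_trans)
qed

lemma smooth_fun_on_cong:
  assumes "open W" "\<And>p. p \<in> W \<Longrightarrow> f p = h p" "smooth_fun_on A W f"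
  shows "smooth_fun_on A W h"
  unfolding smooth_fun_on_def
proof (clarify)
  fix U \<phi> assume c: "(U, \<phi>) \<in> A"
  show "smooth_map_on (\<phi> ` (U \<inter> W)) (h \<circ> inv_into U \<phi>)"
  proof (rule smooth_map_on_cong[OF open_chart_image[OF c assms(1)]])
    show "smooth_map_on (\<phi> ` (U \<inter> W)) (f \<circ> inv_into U \<phi>)"
      using assms(3) c unfolding smooth_fun_on_def by blast
    show "(f \<circ> inv_into U \<phi>) x = (h \<circ> inv_into U \<phi>) x" if "x \<in> \<phi> ` (U \<inter> W)" for x
      using that assms(2) chart_homeomorphism(4)[OF c] by auto
  qed
qed

lemma smooth_fun_on_subset: "smooth_fun_on A W f \<Longrightarrow> N \<subseteq> W \<Longrightarrow> smooth_fun_on A N f"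
  unfolding smooth_fun_on_def by (fast intro: smooth_map_on_subset)

lemma smooth_fun_on_local:
  assumes "\<And>p. p \<in> W \<Longrightarrow> \<exists>N. open N \<and> p \<in> N \<and> smooth_fun_on A N f"
  shows "smooth_fun_on A W f"
  unfolding smooth_fun_on_def
proof (clarify)
  fix U \<phi> assume c: "(U, \<phi>) \<in> A"
  show "smooth_map_on (\<phi> ` (U \<inter> W)) (f \<circ> inv_into U \<phi>)"
  proof (rule smooth_map_on_local)
    fix x assume "x \<in> \<phi> ` (U \<inter> W)"
    then obtain p where p: "x = \<phi> p" "p \<in> U" "p \<in> W" by blast
    obtain N where N: "open N" "p \<in> N" "smooth_fun_on A N f" using assms[OF p(3)] by blast
    have "smooth_map_on (\<phi> ` (U \<inter> N)) (f \<circ> inv_into U \<phi>)"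
      using N(3) c unfolding smooth_fun_on_def by blast
    then show "\<exists>T. open T \<and> x \<in> T \<and> smooth_map_on T (f \<circ> inv_into U \<phi>)"
      using open_chart_image[OF c N(1)] p N(2) by blast
  qed
qed

lemma smooth_fun_on_const: "open W \<Longrightarrow> smooth_fun_on A W (\<lambda>p. c)"
  unfolding smooth_fun_on_def o_def by (auto intro!: smooth_map_on_const open_chart_image)

lemma smooth_fun_on_add:
  "open W \<Longrightarrow> smooth_fun_on A W f \<Longrightarrow> smooth_fun_on A W h \<Longrightarrow> smooth_fun_on A W (\<lambda>p. f p + h p)"
  unfolding smooth_fun_on_def o_def using smooth_map_on_add[OF open_chart_image] by fast

lemma smooth_fun_on_mult:
  "open W \<Longrightarrow> smooth_fun_on A W f \<Longrightarrow> smooth_fun_on A W h \<Longrightarrow> smooth_fun_on A W (\<lambda>p. f p * h p)"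
  unfolding smooth_fun_on_def o_def using smooth_map_on_mult[OF open_chart_image] by fast

lemma smooth_fun_on_inverse:
  assumes "open W" "smooth_fun_on A W f" "\<And>p. p \<in> W \<Longrightarrow> f p \<noteq> 0"
  shows "smooth_fun_on A W (\<lambda>p. inverse (f p))"
  unfolding smooth_fun_on_def o_def
proof (clarify)
  fix U \<phi> assume c: "(U, \<phi>) \<in> A"
  have "smooth_map_on (\<phi> ` (U \<inter> W)) (\<lambda>x. f (inv_into U \<phi> x))"
    using assms(2) c unfolding smooth_fun_on_def o_def by blast
  then show "smooth_map_on (\<phi> ` (U \<inter> W)) (\<lambda>x. inverse (f (inv_into U \<phi> x)))"
    by (rule smooth_map_on_inverse[OF open_chart_image[OF c assms(1)]])
      (use assms(3) chart_homeomorphism(4)[OF c] in auto)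
qed

lemma smooth_fun_on_sum:
  "open W \<Longrightarrow> (\<And>i. i \<in> I \<Longrightarrow> smooth_fun_on A W (f i)) \<Longrightarrow> smooth_fun_on A W (\<lambda>p. \<Sum>i\<in>I. f i p)"
  by (induction I rule: infinite_finite_induct) (simp_all add: smooth_fun_on_const smooth_fun_on_add)

lemma smooth_fun_on_prod:
  "open W \<Longrightarrow> (\<And>i. i \<in> I \<Longrightarrow> smooth_fun_on A W (f i)) \<Longrightarrow> smooth_fun_on A W (\<lambda>p. \<Prod>i\<in>I. f i p)"
  by (induction I rule: infinite_finite_induct) (simp_all add: smooth_fun_on_const smooth_fun_on_mult)

text \<open>In any other chart the pullback is F after a transition map.\<close>

lemma smooth_fun_on_chart_compose:
  assumes c: "(U, \<phi>) \<in> A" and T: "open T" "smooth_map_on T F"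
  shows "smooth_fun_on A (U \<inter> \<phi> -` T) (\<lambda>p. F (\<phi> p))" "open (U \<inter> \<phi> -` T)"
proof -
  show op: "open (U \<inter> \<phi> -` T)"
    using continuous_open_preimage[OF chart_homeomorphism(5,1)[OF c] T(1)] .
  show "smooth_fun_on A (U \<inter> \<phi> -` T) (\<lambda>p. F (\<phi> p))"
    unfolding smooth_fun_on_def o_def
  proof (clarify)
    fix V \<psi> assume d: "(V, \<psi>) \<in> A"
    let ?S = "\<psi> ` (V \<inter> (U \<inter> \<phi> -` T))"
    have "smooth_map_on (\<psi> ` (V \<inter> U)) (\<phi> \<circ> inv_into V \<psi>)"
      using smooth_manifold c d unfolding smooth_manifold_def by blast
    then have "smooth_map_on ?S (\<lambda>x. \<phi> (inv_into V \<psi> x))"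
      by (auto simp: o_def elim: smooth_map_on_subset)
    then show "smooth_map_on ?S (\<lambda>x. F (\<phi> (inv_into V \<psi> x)))"
      by (rule smooth_map_on_compose[OF open_chart_image[OF d op] T])
        (use chart_homeomorphism(4)[OF d] in auto)
  qed
qed

lemma Cinf_iff: "f \<in> Cinf A \<longleftrightarrow> smooth_fun_on A UNIV f"
  by (simp add: Cinf_def)

lemma Cinf_add [simp, intro]: "f \<in> Cinf A \<Longrightarrow> h \<in> Cinf A \<Longrightarrow> f + h \<in> Cinf A"
  using smooth_fun_on_add[OF open_UNIV] by (simp add: Cinf_iff plus_fun_def)

lemma Cinf_mult [simp, intro]: "f \<in> Cinf A \<Longrightarrow> h \<in> Cinf A \<Longrightarrow> f * h \<in> Cinf A"
  using smooth_fun_on_mult[OF open_UNIV] by (simp add: Cinf_iff times_fun_def)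

lemma Cinf_const [simp, intro]: "(\<lambda>p. c) \<in> Cinf A"
  using smooth_fun_on_const[OF open_UNIV] by (simp add: Cinf_iff)

lemma Cinf_zero [simp, intro]: "0 \<in> Cinf A"
  using Cinf_const[of 0] by (simp add: zero_fun_def)

lemma Cinf_one [simp, intro]: "1 \<in> Cinf A"
  using Cinf_const[of 1] by (simp add: one_fun_def)

lemma Cinf_scaleR [simp, intro]: "f \<in> Cinf A \<Longrightarrow> c *\<^sub>R f \<in> Cinf A"
  using Cinf_mult[OF Cinf_const, of f c] by (simp add: scaleR_fun_def times_fun_def)

lemma Cinf_minus [simp, intro]: "f \<in> Cinf A \<Longrightarrow> - f \<in> Cinf A"
  using Cinf_scaleR[of f "-1"] by (simp add: scaleR_fun_def fun_Compl_def)

lemma Cinf_diff [simp, intro]: "f \<in> Cinf A \<Longrightarrow> h \<in> Cinf A \<Longrightarrow> f - h \<in> Cinf A"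
  using Cinf_add[OF _ Cinf_minus, of f h] by simp

lemma Cinf_sum [intro]: "(\<And>i. i \<in> I \<Longrightarrow> f i \<in> Cinf A) \<Longrightarrow> (\<Sum>i\<in>I. f i) \<in> Cinf A"
  by (induction I rule: infinite_finite_induct) auto

lemma Cinf_localI:
  assumes "\<And>p. \<exists>N. open N \<and> p \<in> N \<and> smooth_fun_on A N f"
  shows "f \<in> Cinf A"
  unfolding Cinf_iff by (rule smooth_fun_on_local) (use assms in blast)

text \<open>The condition that the support lies inside W is expressed by an open Z which together
  with W covers M and on which the bump vanishes. In this form a product with a function that is
  smooth only on W is smooth on both members of an open cover.\<close>

lemma bump:
  assumes "open W" "p \<in> W"
  obtains \<psi> N Z where "\<psi> \<in> Cinf A" "open N" "p \<in> N" "N \<subseteq> W" "\<And>q. q \<in> N \<Longrightarrow> \<psi> q = 1"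
    "open Z" "W \<union> Z = UNIV" "\<And>q. q \<in> Z \<Longrightarrow> \<psi> q = 0"
proof -
  obtain U \<phi> where c: "(U, \<phi>) \<in> A" "p \<in> U" by (rule chart_at)
  note h = chart_homeomorphism[OF c(1)]
  have inv: "inv_into U \<phi> (\<phi> q) = q" if "q \<in> U" for q
    using that h(4) by simp
  have "\<phi> p \<in> \<phi> ` (U \<inter> W)" using c assms by blast
  then obtain r where r: "r > 0" "cball (\<phi> p) r \<subseteq> \<phi> ` (U \<inter> W)"
    using open_chart_image[OF c(1) assms(1)] open_contains_cball by metis
  obtain \<beta> :: "'e \<Rightarrow> real" where \<beta>: "smooth_map_on UNIV \<beta>"
    "\<And>x. x \<in> ball (\<phi> p) (r / 2) \<Longrightarrow> \<beta> x = 1" "\<And>x. x \<notin> ball (\<phi> p) r \<Longrightarrow> \<beta> x = 0"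
    using smooth_bump_exists[OF r(1)] by metis
  \<comment> \<open>K is compact, hence closed because M is Hausdorff. This makes the extension by
    zero smooth outside the chart.\<close>
  define K where "K = inv_into U \<phi> ` cball (\<phi> p) r"
  have "compact K" unfolding K_def
    by (intro compact_continuous_image continuous_on_subset[OF h(6)] compact_cball) (use r in blast)
  then have Kc: "open (- K)" by (simp add: compact_imp_closed open_Compl)
  have KW: "K \<subseteq> U \<inter> W"
  proof
    fix q assume "q \<in> K"
    then obtain x where x: "x \<in> cball (\<phi> p) r" "q = inv_into U \<phi> x" unfolding K_def by blast
    then obtain q' where "q' \<in> U \<inter> W" "x = \<phi> q'" using r(2) by blast
    then show "q \<in> U \<inter> W" using x inv by auto
  qed
  define \<psi> where "\<psi> = (\<lambda>q. if q \<in> U then \<beta> (\<phi> q) else 0)"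
  have zero: "\<psi> q = 0" if "q \<in> - K" for q
  proof (cases "q \<in> U")
    case True
    have "\<phi> q \<notin> ball (\<phi> p) r"
      using that inv[OF True] unfolding K_def by (metis ComplD ball_subset_cball image_eqI subsetD)
    then show ?thesis by (simp add: \<psi>_def \<beta>(3))
  qed (simp add: \<psi>_def)
  have "smooth_fun_on A U (\<lambda>q. \<beta> (\<phi> q))"
    using smooth_fun_on_chart_compose(1)[OF c(1) open_UNIV \<beta>(1)] by simp
  then have sU: "smooth_fun_on A U \<psi>"
    by (rule smooth_fun_on_cong[OF h(1), rotated]) (simp add: \<psi>_def)
  have sK: "smooth_fun_on A (- K) \<psi>"
    using smooth_fun_on_const[OF Kc, of 0]
    by (rule smooth_fun_on_cong[OF Kc, rotated]) (simp add: zero)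
  have "\<psi> \<in> Cinf A"
  proof (rule Cinf_localI)
    fix q show "\<exists>N. open N \<and> q \<in> N \<and> smooth_fun_on A N \<psi>"
      using sU sK h(1) Kc KW by (cases "q \<in> U") blast+
  qed
  moreover have "open (U \<inter> \<phi> -` ball (\<phi> p) (r / 2))"
    using continuous_open_preimage[OF h(5,1) open_ball] .
  moreover have "p \<in> U \<inter> \<phi> -` ball (\<phi> p) (r / 2)" using c(2) r(1) by simp
  moreover have one: "\<psi> q = 1" if "q \<in> U \<inter> \<phi> -` ball (\<phi> p) (r / 2)" for q
    using that \<beta>(2) by (simp add: \<psi>_def)
  moreover have "U \<inter> \<phi> -` ball (\<phi> p) (r / 2) \<subseteq> W"
  proof
    fix q assume "q \<in> U \<inter> \<phi> -` ball (\<phi> p) (r / 2)"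
    then have "q \<notin> - K" using one zero by fastforce
    then show "q \<in> W" using KW by blast
  qed
  moreover have "W \<union> - K = UNIV" using KW by blast
  ultimately show ?thesis using that Kc zero by blast
qed

lemma cutoff_Cinf:
  assumes "\<psi> \<in> Cinf A" "open W" "open Z" "W \<union> Z = UNIV" "\<And>q. q \<in> Z \<Longrightarrow> \<psi> q = 0" "smooth_fun_on A W f"
  shows "\<psi> * f \<in> Cinf A"
proof (rule Cinf_localI)
  have "smooth_fun_on A W (\<psi> * f)"
    unfolding times_fun_def using assms(1)
    by (intro smooth_fun_on_mult assms(2,6)) (auto simp: Cinf_iff dest: smooth_fun_on_subset)
  moreover have "smooth_fun_on A Z (\<psi> * f)"
    using smooth_fun_on_const[OF assms(3), of 0]
    by (rule smooth_fun_on_cong[OF assms(3), rotated]) (simp add: assms(5))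
  ultimately show "\<exists>N. open N \<and> p \<in> N \<and> smooth_fun_on A N (\<psi> * f)" for p
    using assms(2,3,4) by blast
qed

lemma local_extension:
  assumes "open W" "p \<in> W" "smooth_fun_on A W f"
  obtains h N where "h \<in> Cinf A" "open N" "p \<in> N" "N \<subseteq> W" "\<And>q. q \<in> N \<Longrightarrow> h q = f q"
proof -
  obtain \<psi> N Z where b: "\<psi> \<in> Cinf A" "open N" "p \<in> N" "N \<subseteq> W" "\<And>q. q \<in> N \<Longrightarrow> \<psi> q = 1"
    "open Z" "W \<union> Z = UNIV" "\<And>q. q \<in> Z \<Longrightarrow> \<psi> q = 0"
    by (rule bump[OF assms(1,2)]) (rule that)
  show ?thesis
    by (rule that[of "\<psi> * f" N]) (use b cutoff_Cinf[OF b(1) assms(1) b(6,7,8) assms(3)] in auto)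
qed

subsection \<open>Tangent spaces\<close>

lemma tangent_spaceD:
  assumes "v \<in> tangent_space A p"
  shows "f \<notin> Cinf A \<Longrightarrow> v f = 0"
    and "f \<in> Cinf A \<Longrightarrow> h \<in> Cinf A \<Longrightarrow> v (f + h) = v f + v h"
    and "f \<in> Cinf A \<Longrightarrow> v (c *\<^sub>R f) = c * v f"
    and "f \<in> Cinf A \<Longrightarrow> h \<in> Cinf A \<Longrightarrow> v (f * h) = f p * v h + h p * v f"
  using assms unfolding tangent_space_def lin_on_def by auto

lemma tangent_space_subspace: "subspace (tangent_space A p)"
  unfolding subspace_def
proof (intro conjI ballI allI)
  show "0 \<in> tangent_space A p"
    by (simp add: tangent_space_def lin_on_def)
  show "v + w \<in> tangent_space A p" if "v \<in> tangent_space A p" "w \<in> tangent_space A p" for v w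
    using that unfolding tangent_space_def lin_on_def by (simp add: algebra_simps)
  show "c *\<^sub>R v \<in> tangent_space A p" if "v \<in> tangent_space A p" for v c
    using that unfolding tangent_space_def lin_on_def by (simp add: algebra_simps)
qed

lemma tangent_const: "v \<in> tangent_space A p \<Longrightarrow> v (\<lambda>q. c) = 0"
proof -
  assume v: "v \<in> tangent_space A p"
  have "v 1 = 0" using tangent_spaceD(4)[OF v Cinf_one Cinf_one] by simp
  moreover have c: "(\<lambda>q. c) = c *\<^sub>R 1" by (simp add: scaleR_fun_def)
  ultimately show ?thesis unfolding c tangent_spaceD(3)[OF v Cinf_one, of c] by simp
qed

lemma tangent_diff:
  "v \<in> tangent_space A p \<Longrightarrow> f \<in> Cinf A \<Longrightarrow> h \<in> Cinf A \<Longrightarrow> v (f - h) = v f - v h"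
  using tangent_spaceD(2)[of v p "f - h" h] by simp

lemma tangent_sum:
  "v \<in> tangent_space A p \<Longrightarrow> (\<And>i. i \<in> I \<Longrightarrow> f i \<in> Cinf A) \<Longrightarrow> v (\<Sum>i\<in>I. f i) = (\<Sum>i\<in>I. v (f i))"
proof (induction I rule: infinite_finite_induct)
  case (insert x F)
  have "v (f x + sum f F) = v (f x) + v (sum f F)"
    by (rule tangent_spaceD(2)[OF insert.prems(1)]) (use insert.prems in auto)
  moreover have "v (sum f F) = (\<Sum>i\<in>F. v (f i))"
    by (rule insert.IH) (use insert.prems in auto)
  ultimately show ?case
    by (simp only: sum.insert[OF insert.hyps])
qed (use tangent_const[of v p 0] in \<open>simp_all add: zero_fun_def\<close>)

text \<open>f - h equals (1 - \<psi>) (f - h), a product of two functions that vanish at p, so the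
  Leibniz rule gives 0.\<close>

lemma tangent_local:
  assumes v: "v \<in> tangent_space A p" and fh: "f \<in> Cinf A" "h \<in> Cinf A"
    and N: "open N" "p \<in> N" "\<And>q. q \<in> N \<Longrightarrow> f q = h q"
  shows "v f = v h"
proof -
  obtain \<psi> N' Z where b: "\<psi> \<in> Cinf A" "open N'" "p \<in> N'" "N' \<subseteq> N" "\<And>q. q \<in> N' \<Longrightarrow> \<psi> q = 1"
    "open Z" "N \<union> Z = UNIV" "\<And>q. q \<in> Z \<Longrightarrow> \<psi> q = 0"
    by (rule bump[OF N(1,2)]) (rule that)
  have eq: "f - h = (1 - \<psi>) * (f - h)"
  proof
    fix q show "(f - h) q = ((1 - \<psi>) * (f - h)) q"
      using N(3) b(7,8) by (cases "q \<in> N") auto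
  qed
  have "v (f - h) = (1 - \<psi>) p * v (f - h) + (f - h) p * v (1 - \<psi>)"
    by (subst eq, rule tangent_spaceD(4)[OF v]) (use b fh in auto)
  then have "v (f - h) = 0" using b(3,5) N(2,3) by simp
  then show ?thesis using tangent_diff[OF v fh] by simp
qed

text \<open>Near p Hadamard's lemma gives f = f(p) + \<Sum> x_b g_b with centred coordinates x_b. A
  derivation at p sees of this only \<Sum> v(x_b) g_b(p), so the coordinate derivatives span. As
  derivations act on global functions, the x_b and g_b are first extended from the chart to all of
  M.\<close>

lemma tangent_basis:
  "\<exists>B. finite B \<and> independent B \<and> span B = tangent_space A p \<and> card B = DIM('e)"
proof -
  obtain U \<phi> where c: "(U, \<phi>) \<in> A" "p \<in> U" by (rule chart_at)
  note h = chart_homeomorphism[OF c(1)]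
  have inv: "inv_into U \<phi> (\<phi> q) = q" if "q \<in> U" for q
    using that h(4) by simp
  let ?F = "\<lambda>f. f \<circ> inv_into U \<phi>"
  \<comment> \<open>The value 0 off \<open>Cinf A\<close> matches the convention in
    \<open>tangent_space\<close>.\<close>
  define D where "D = (\<lambda>b f. if f \<in> Cinf A then frechet_derivative (?F f) (at (\<phi> p)) b else 0)"
  have sm: "smooth_map_on (\<phi> ` U) (?F f)" if "f \<in> Cinf A" for f
    using that c(1) unfolding Cinf_iff smooth_fun_on_def by fastforce
  have der: "(?F f has_derivative frechet_derivative (?F f) (at (\<phi> p))) (at (\<phi> p))" if "f \<in> Cinf A" for f
    by (rule smooth_map_on_has_derivative[OF sm[OF that]]) (use c in blast)
  have DT: "D b \<in> tangent_space A p" for b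
  proof -
    have "D b (f + k) = D b f + D b k" if "f \<in> Cinf A" "k \<in> Cinf A" for f k
      using frechet_derivative_eqI[OF has_derivative_add[OF der[OF that(1)] der[OF that(2)]]] that
      by (simp add: D_def o_def)
    moreover have "D b (r *\<^sub>R f) = r *\<^sub>R D b f" if "f \<in> Cinf A" for f r
      using frechet_derivative_eqI[OF has_derivative_mult_right[OF der[OF that], of r]] that
      by (simp add: D_def o_def)
    moreover have "D b (f * k) = f p * D b k + k p * D b f" if "f \<in> Cinf A" "k \<in> Cinf A" for f k
      using frechet_derivative_eqI[OF has_derivative_mult[OF der[OF that(1)] der[OF that(2)]]] that
      by (simp add: D_def o_def inv c(2))
    ultimately show ?thesis by (simp add: tangent_space_def lin_on_def) (simp add: D_def)
  qed
  define P where "P b y \<longleftrightarrow> y \<in> Cinf A \<and>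
      (\<exists>N. open N \<and> p \<in> N \<and> N \<subseteq> U \<and> (\<forall>q\<in>N. y q = (\<phi> q - \<phi> p) \<bullet> b))" for b y
  have "\<exists>y. P b y" for b
  proof -
    have "smooth_map_on UNIV (\<lambda>x. x \<bullet> b + - (\<phi> p \<bullet> b))"
      by (intro smooth_map_on_add smooth_map_on_const smooth_map_on_linear bounded_linear_inner_left open_UNIV)
    from smooth_fun_on_chart_compose(1)[OF c(1) open_UNIV this]
    have s: "smooth_fun_on A U (\<lambda>q. (\<phi> q - \<phi> p) \<bullet> b)"
      by (simp add: inner_diff_left)
    obtain y N where "y \<in> Cinf A" "open N" "p \<in> N" "N \<subseteq> U" "\<And>q. q \<in> N \<Longrightarrow> y q = (\<phi> q - \<phi> p) \<bullet> b"
      by (rule local_extension[OF h(1) c(2) s]) (rule that)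
    then show ?thesis unfolding P_def by blast
  qed
  then obtain x where xP: "\<And>b. P b (x b)"
    using choice[of P] by blast
  have x: "x b \<in> Cinf A" for b
    using xP[of b] by (simp add: P_def)
  have xN: "\<exists>N. open N \<and> p \<in> N \<and> N \<subseteq> U \<and> (\<forall>q\<in>N. x b q = (\<phi> q - \<phi> p) \<bullet> b)" for b
    using xP[of b] by (simp add: P_def)
  have xp: "x b p = 0" for b
  proof -
    obtain N where "p \<in> N" "\<forall>q\<in>N. x b q = (\<phi> q - \<phi> p) \<bullet> b" using xN by blast
    then show ?thesis by simp
  qed
  have Dx: "D b (x b') = b \<bullet> b'" for b b'
  proof -
    obtain N where N: "open N" "p \<in> N" "N \<subseteq> U" "\<forall>q\<in>N. x b' q = (\<phi> q - \<phi> p) \<bullet> b'"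
      using xN by blast
    have "((\<lambda>y. (y - \<phi> p) \<bullet> b') has_derivative (\<lambda>v. v \<bullet> b')) (at (\<phi> p))"
      by (auto intro!: derivative_eq_intros)
    then have "(?F (x b') has_derivative (\<lambda>v. v \<bullet> b')) (at (\<phi> p))"
      by (rule has_derivative_transform_within_open[OF _ open_chart_image[OF c(1) N(1)]])
        (use c N inv in auto)
    then show ?thesis using x by (simp add: D_def frechet_derivative_eqI)
  qed
  have rep: "v = (\<Sum>b\<in>Basis. v (x b) *\<^sub>R D b)" if v: "v \<in> tangent_space A p" for v
  proof
    fix f
    show "v f = (\<Sum>b\<in>Basis. v (x b) *\<^sub>R D b) f"
    proof (cases "f \<in> Cinf A")
      case False
      then show ?thesis
        using tangent_spaceD(1)[OF v] by (simp add: sum_fun_apply D_def) 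
    next
      case f: True
      have "\<phi> p \<in> \<phi> ` U" using c by blast
      then obtain r where r: "r > 0" "ball (\<phi> p) r \<subseteq> \<phi> ` U"
        using h(2) open_contains_ball by metis
      let ?S = "ball (\<phi> p) r"
      obtain G where G: "\<And>b. smooth_map_on ?S (G b)"
        "\<And>b. G b (\<phi> p) = frechet_derivative (?F f) (at (\<phi> p)) b"
        "\<And>y. y \<in> ?S \<Longrightarrow> ?F f y = ?F f (\<phi> p) + (\<Sum>b\<in>Basis. ((y - \<phi> p) \<bullet> b) * G b y)"
        using Hadamard[OF open_ball convex_ball _ smooth_map_on_subset[OF sm[OF f] r(2)], of "\<phi> p"] r(1)
        by auto
      let ?W = "U \<inter> \<phi> -` ?S"
      have pW: "p \<in> ?W" using c r by simp
      define Q where "Q b gN \<longleftrightarrow> fst gN \<in> Cinf A \<and> open (snd gN) \<and> p \<in> snd gN \<and>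
          (\<forall>q\<in>snd gN. fst gN q = G b (\<phi> q))" for b and gN :: "('m \<Rightarrow> real) \<times> 'm set"
      have "\<exists>gN. Q b gN" for b
      proof -
        obtain g N where "g \<in> Cinf A" "open N" "p \<in> N" "N \<subseteq> ?W" "\<And>q. q \<in> N \<Longrightarrow> g q = G b (\<phi> q)"
          by (rule local_extension[OF smooth_fun_on_chart_compose(2)[OF c(1) open_ball G(1)] pW
            smooth_fun_on_chart_compose(1)[OF c(1) open_ball G(1)], of b]) (rule that)
        then have "Q b (g, N)" by (simp add: Q_def)
        then show ?thesis by blast
      qed
      then obtain gN where gN: "\<And>b. Q b (gN b)"
        using choice[of Q] by blast
      define g where "g b = fst (gN b)" for b
      define Ng where "Ng b = snd (gN b)" for b
      have g: "g b \<in> Cinf A" and Ng: "open (Ng b)" "p \<in> Ng b" "q \<in> Ng b \<Longrightarrow> g b q = G b (\<phi> q)" for b q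
        using gN[of b] by (auto simp: Q_def g_def Ng_def)
      define R where "R b N \<longleftrightarrow> open N \<and> p \<in> N \<and> (\<forall>q\<in>N. x b q = (\<phi> q - \<phi> p) \<bullet> b)" for b N
      have "\<exists>N. R b N" for b using xN[of b] unfolding R_def by blast
      then obtain Nx where NxR: "\<And>b. R b (Nx b)" using choice[of R] by blast
      have Nx: "open (Nx b)" "p \<in> Nx b" "q \<in> Nx b \<Longrightarrow> x b q = (\<phi> q - \<phi> p) \<bullet> b" for b q
        using NxR[of b] by (auto simp: R_def)
      let ?N = "?W \<inter> (\<Inter>b\<in>Basis. Ng b \<inter> Nx b)"
      have oN: "open ?N"
        by (intro open_Int open_INT smooth_fun_on_chart_compose(2)[OF c(1) open_ball G(1)[of 0]])
           (use Ng Nx in auto)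
      have gp: "g b p = frechet_derivative (?F f) (at (\<phi> p)) b" for b
        using Ng(3)[OF Ng(2)] G(2) by simp
      let ?h = "(\<lambda>q. f p) + (\<Sum>b\<in>Basis. x b * g b)"
      have hC: "?h \<in> Cinf A" using x g by (intro Cinf_add Cinf_sum Cinf_mult Cinf_const)
      have "v f = v ?h"
      proof (rule tangent_local[OF v f hC oN])
        show "p \<in> ?N" using pW Ng(2) Nx(2) by blast
        fix q assume q: "q \<in> ?N"
        have "f q = f p + (\<Sum>b\<in>Basis. ((\<phi> q - \<phi> p) \<bullet> b) * G b (\<phi> q))"
          using G(3)[of "\<phi> q"] q inv c(2) by (simp add: dist_commute)
        also have "\<dots> = f p + (\<Sum>b\<in>Basis. x b q * g b q)"
          using q Ng(3) Nx(3) by simp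
        finally show "f q = ?h q" by (simp add: sum_fun_apply)
      qed
      also have "\<dots> = (\<Sum>b\<in>Basis. v (x b * g b))"
        using x g by (subst tangent_spaceD(2)[OF v])
          (auto simp: tangent_const[OF v] tangent_sum[OF v])
      also have "\<dots> = (\<Sum>b\<in>Basis. v (x b) * D b f)"
        using x g by (intro sum.cong refl) (simp add: tangent_spaceD(4)[OF v] xp gp D_def f)
      finally show ?thesis by (simp add: sum_fun_apply)
    qed
  qed
  \<comment> \<open>Injectivity and independence both come from the coordinate functions, on which
    the D b form the identity matrix.\<close>
  have inj: "inj_on D Basis"
  proof
    fix b b' :: 'e assume *: "b \<in> Basis" "b' \<in> Basis" "D b = D b'"
    then have "b \<bullet> b = b' \<bullet> b" by (metis Dx)
    then show "b = b'" using * by (simp add: inner_Basis split: if_splits)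
  qed
  have "span (D ` Basis) = tangent_space A p"
  proof
    show "span (D ` Basis) \<subseteq> tangent_space A p"
      by (rule span_minimal) (use DT tangent_space_subspace in auto)
    show "tangent_space A p \<subseteq> span (D ` Basis)"
    proof
      fix v assume "v \<in> tangent_space A p"
      then have "v = (\<Sum>b\<in>Basis. v (x b) *\<^sub>R D b)" by (rule rep)
      also have "\<dots> \<in> span (D ` Basis)" by (intro span_sum span_scale span_base imageI)
      finally show "v \<in> span (D ` Basis)" .
    qed
  qed
  moreover have "independent (D ` Basis)"
  proof (rule ccontr)
    assume "\<not> independent (D ` Basis)"
    then obtain k v where z: "(\<Sum>v\<in>D ` Basis. k v *\<^sub>R v) = 0" and "v \<in> D ` Basis" and kv: "k v \<noteq> 0"
      unfolding dependent_finite[OF finite_imageI[OF finite_Basis]] by blast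
    then obtain b where b: "b \<in> Basis" "v = D b" by blast
    have "(\<Sum>b'\<in>Basis. k (D b') *\<^sub>R D b') = 0"
      using z by (simp add: sum.reindex[OF inj] o_def)
    then have "(\<Sum>b'\<in>Basis. k (D b') *\<^sub>R D b') (x b) = 0" by simp
    then have 1: "(\<Sum>b'\<in>Basis. k (D b') * (b' \<bullet> b)) = 0" by (simp add: sum_fun_apply Dx)
    have 2: "(\<Sum>b'\<in>Basis. k (D b') * (b' \<bullet> b)) = (\<Sum>b'\<in>Basis. if b' = b then k (D b') else 0)"
      using b(1) by (intro sum.cong refl) (simp add: inner_Basis)
    have 3: "(\<Sum>b'\<in>Basis. if b' = b then k (D b') else 0) = k (D b)"
      using b(1) by (simp add: sum.delta)
    show False using 1 kv unfolding 2 3 b(2) by blast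
  qed
  moreover have "finite (D ` Basis)" "card (D ` Basis) = DIM('e)"
    by (simp_all only: card_image[OF inj] finite_imageI finite_Basis)
  ultimately show ?thesis by blast
qed

end

section \<open>Dual frames and metric traces\<close>

lemma bilin_onD:
  assumes "bilin_on V \<beta>" "x \<in> V" "y \<in> V" "z \<in> V"
  shows "\<beta> (x + y) z = \<beta> x z + \<beta> y z" "\<beta> z (x + y) = \<beta> z x + \<beta> z y"
    "\<beta> (c *\<^sub>R x) z = c *\<^sub>R \<beta> x z" "\<beta> z (c *\<^sub>R x) = c *\<^sub>R \<beta> z x"
  using assms unfolding bilin_on_def lin_on_def by blast+

lemma lin_on_sum:
  assumes "lin_on V f" "subspace V" "\<And>i. i \<in> I \<Longrightarrow> x i \<in> V"
  shows "f (\<Sum>i\<in>I. a i *\<^sub>R x i) = (\<Sum>i\<in>I. a i *\<^sub>R f (x i))"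
proof -
  have 0: "f 0 = 0"
    using assms(1) subspace_0[OF assms(2)] unfolding lin_on_def by (metis scaleR_zero_left)
  show ?thesis
    using assms(3)
  proof (induction I rule: infinite_finite_induct)
    case (insert j I)
    have "(\<Sum>i\<in>I. a i *\<^sub>R x i) \<in> V" "a j *\<^sub>R x j \<in> V"
      using insert.prems assms(2) by (auto intro!: subspace_sum subspace_scale)
    then have "f (a j *\<^sub>R x j + (\<Sum>i\<in>I. a i *\<^sub>R x i)) = a j *\<^sub>R f (x j) + f (\<Sum>i\<in>I. a i *\<^sub>R x i)"
      using assms(1) insert.prems[of j] unfolding lin_on_def by simp
    then show ?case using insert by simp
  qed (simp_all add: 0)
qed

lemma bilin_on_sum:
  assumes "bilin_on V \<beta>" "subspace V" "\<And>i. i \<in> I \<Longrightarrow> x i \<in> V" "z \<in> V"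
  shows "\<beta> (\<Sum>i\<in>I. a i *\<^sub>R x i) z = (\<Sum>i\<in>I. a i *\<^sub>R \<beta> (x i) z)"
    "\<beta> z (\<Sum>i\<in>I. a i *\<^sub>R x i) = (\<Sum>i\<in>I. a i *\<^sub>R \<beta> z (x i))"
  using lin_on_sum[of V "\<lambda>x. \<beta> x z" I x a] lin_on_sum[of V "\<beta> z" I x a] assms
  unfolding bilin_on_def by simp_all

lemma is_basis_familyD:
  assumes "is_basis_family V n b"
  shows "subspace V" "i < n \<Longrightarrow> b i \<in> V" "dim V = n"
    "v \<in> V \<Longrightarrow> \<exists>a. v = (\<Sum>i<n. a i *\<^sub>R b i)"
    "(\<Sum>i<n. a i *\<^sub>R b i) = 0 \<Longrightarrow> i < n \<Longrightarrow> a i = 0"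
proof -
  have inj: "inj_on b {..<n}" and ind: "independent (b ` {..<n})" and sp: "span (b ` {..<n}) = V"
    using assms by (auto simp: is_basis_family_def)
  show "subspace V" using sp subspace_span by blast
  show "b i \<in> V" if "i < n" for i using that sp span_base[of "b i" "b ` {..<n}"] by blast
  show "dim V = n"
    using dim_span_eq_card_independent[OF ind] card_image[OF inj] sp by simp
  show "\<exists>a. v = (\<Sum>i<n. a i *\<^sub>R b i)" if "v \<in> V"
  proof -
    have "v \<in> range (\<lambda>u. \<Sum>w\<in>b ` {..<n}. u w *\<^sub>R w)"
      using that span_finite[OF finite_imageI[OF finite_lessThan], of b n] sp by simp
    then obtain u where "v = (\<Sum>w\<in>b ` {..<n}. u w *\<^sub>R w)" by (rule rangeE)
    then have "v = (\<Sum>i<n. u (b i) *\<^sub>R b i)"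
      by (simp add: sum.reindex[OF inj])
    then show ?thesis by (rule exI[of _ "\<lambda>i. u (b i)"])
  qed
  show "a i = 0" if "(\<Sum>i<n. a i *\<^sub>R b i) = 0" "i < n"
  proof (rule ccontr)
    assume "a i \<noteq> 0"
    define u where "u w = a (inv_into {..<n} b w)" for w
    have "u (b i) = a i" if "i < n" for i
      using that inv_into_f_f[OF inj] by (simp add: u_def)
    then have "(\<Sum>w\<in>b ` {..<n}. u w *\<^sub>R w) = 0" "u (b i) \<noteq> 0"
      using \<open>a i \<noteq> 0\<close> that by (simp_all add: sum.reindex[OF inj])
    then have "\<not> independent (b ` {..<n})"
      using that(2) by (subst dependent_finite) blast+
    then show False using ind by blast
  qed
qed

definition gram :: "nat \<Rightarrow> ('v \<Rightarrow> 'v \<Rightarrow> real) \<Rightarrow> (nat \<Rightarrow> 'v) \<Rightarrow> real mat" where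
  "gram n \<beta> e = Matrix.mat n n (\<lambda>(i, j). \<beta> (e i) (e j))"

text \<open>The inverse Gram matrix by Cramer's rule. Its entries are rational expressions in the
  Gram entries and therefore vary smoothly with the point.\<close>

definition inv_gram :: "nat \<Rightarrow> ('v \<Rightarrow> 'v \<Rightarrow> real) \<Rightarrow> (nat \<Rightarrow> 'v) \<Rightarrow> nat \<Rightarrow> nat \<Rightarrow> real" where
  "inv_gram n \<beta> e i j = inverse (Determinant.det (gram n \<beta> e)) * (adj_mat (gram n \<beta> e) $$ (i, j))"

text \<open>A kernel vector of the transposed Gram matrix would be the coefficient vector of an
  element orthogonal to the whole basis, which nondegeneracy excludes. Duality is then the adjugate
  identity.\<close>

lemma inv_gram_dual:
  fixes e :: "nat \<Rightarrow> 'v::real_vector"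
  assumes b: "is_basis_family V n e" and \<beta>: "bilin_on V \<beta>" "nondeg_on V \<beta>"
  shows "Determinant.det (gram n \<beta> e) \<noteq> 0"
    and "i < n \<Longrightarrow> j < n \<Longrightarrow> \<beta> (\<Sum>k<n. inv_gram n \<beta> e i k *\<^sub>R e k) (e j) = (if i = j then 1 else 0)"
proof -
  note bD = is_basis_familyD[OF b]
  let ?M = "gram n \<beta> e"
  have M: "?M \<in> carrier_mat n n" by (simp add: gram_def)
  have T: "transpose_mat ?M \<in> carrier_mat n n" using M by simp
  show d: "Determinant.det ?M \<noteq> 0"
  proof
    assume "Determinant.det ?M = 0"
    then have "Determinant.det (transpose_mat ?M) = 0" using Determinant.det_transpose[OF M] by simp
    then obtain v where v: "v \<in> carrier_vec n" "v \<noteq> 0\<^sub>v n" "transpose_mat ?M *\<^sub>v v = 0\<^sub>v n"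
      using det_0_iff_vec_prod_zero_field[OF T] by blast
    let ?w = "\<Sum>i<n. vec_index v i *\<^sub>R e i"
    have wV: "?w \<in> V"
      using bD(1,2) by (auto intro!: subspace_sum subspace_scale)
    have "\<beta> ?w (e j) = 0" if "j < n" for j
    proof -
      have "\<beta> ?w (e j) = (\<Sum>i<n. vec_index v i * \<beta> (e i) (e j))"
        using bilin_on_sum(1)[OF \<beta>(1) bD(1), of "{..<n}" e "e j"] bD(2) that by simp
      also have "\<dots> = vec_index (transpose_mat ?M *\<^sub>v v) j"
        using that v(1) by (simp add: gram_def scalar_prod_def mult_ac atLeast0LessThan)
      also have "\<dots> = 0" using v(3) that by simp
      finally show ?thesis .
    qed
    then have "\<beta> ?w y = 0" if y: "y \<in> V" for y
    proof -
      obtain a where a: "y = (\<Sum>i<n. a i *\<^sub>R e i)" using bD(4)[OF y] by blast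
      show ?thesis unfolding a
        using bilin_on_sum(2)[OF \<beta>(1) bD(1), of "{..<n}" e ?w a] bD(2) wV
          \<open>\<And>j. j < n \<Longrightarrow> \<beta> ?w (e j) = 0\<close> by simp
    qed
    then have "?w = 0" using \<beta>(2) wV unfolding nondeg_on_def by blast
    then have "vec_index v i = 0" if "i < n" for i using bD(5) that by blast
    then have "v = 0\<^sub>v n" using v(1) by (intro eq_vecI) auto
    then show False using v(2) by blast
  qed
  assume ij: "i < n" "j < n"
  have A: "adj_mat ?M \<in> carrier_mat n n" by (rule adj_mat(1)[OF M])
  have "(\<Sum>k<n. adj_mat ?M $$ (i, k) * \<beta> (e k) (e j)) = (adj_mat ?M * ?M) $$ (i, j)"
    using ij A M by (simp add: scalar_prod_def atLeast0LessThan) (simp add: gram_def)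
  also have "\<dots> = (if i = j then Determinant.det ?M else 0)"
    unfolding adj_mat(3)[OF M] using ij by simp
  finally have 1: "(\<Sum>k<n. adj_mat ?M $$ (i, k) * \<beta> (e k) (e j)) = (if i = j then Determinant.det ?M else 0)" .
  have "\<beta> (\<Sum>k<n. inv_gram n \<beta> e i k *\<^sub>R e k) (e j) = (\<Sum>k<n. inv_gram n \<beta> e i k * \<beta> (e k) (e j))"
    using bilin_on_sum(1)[OF \<beta>(1) bD(1), of "{..<n}" e "e j"] bD(2) ij by simp
  also have "\<dots> = inverse (Determinant.det ?M) * (\<Sum>k<n. adj_mat ?M $$ (i, k) * \<beta> (e k) (e j))"
    by (simp add: inv_gram_def sum_distrib_left mult.assoc)
  also have "\<dots> = (if i = j then 1 else 0)" unfolding 1 using d by simp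
  finally show "\<beta> (\<Sum>k<n. inv_gram n \<beta> e i k *\<^sub>R e k) (e j) = (if i = j then 1 else 0)" .
qed

text \<open>The first expansion reads coefficients off by duality. In the second, both sides have
  the same products with the basis, so nondegeneracy identifies them without knowing beforehand that
  the e' i span.\<close>

lemma dual_basis_resolution:
  assumes b: "is_basis_family V n e" and \<beta>: "bilin_on V \<beta>" "sym_on V \<beta>" "nondeg_on V \<beta>"
    and e': "\<And>i. i < n \<Longrightarrow> e' i \<in> V"
    and d: "\<And>i j. i < n \<Longrightarrow> j < n \<Longrightarrow> \<beta> (e' i) (e j) = (if i = j then 1 else 0)"
    and v: "v \<in> V"
  shows "v = (\<Sum>i<n. \<beta> v (e' i) *\<^sub>R e i)" "v = (\<Sum>i<n. \<beta> v (e i) *\<^sub>R e' i)"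
proof -
  note bD = is_basis_familyD[OF b]
  have sym: "\<beta> x y = \<beta> y x" if "x \<in> V" "y \<in> V" for x y
    using \<beta>(2) that unfolding sym_on_def by blast
  obtain a where a: "v = (\<Sum>i<n. a i *\<^sub>R e i)" using bD(4)[OF v] by blast
  have "\<beta> v (e' i) = a i" if "i < n" for i
  proof -
    have "\<beta> v (e' i) = \<beta> (e' i) v" using sym v e' that by blast
    also have "\<dots> = (\<Sum>j<n. a j * \<beta> (e' i) (e j))"
      unfolding a using bilin_on_sum(2)[OF \<beta>(1) bD(1), of "{..<n}" e "e' i" a] bD(2) e' that by simp
    also have "\<dots> = (\<Sum>j<n. if j = i then a j else 0)"
      using d that by (intro sum.cong) auto
    also have "\<dots> = a i" using that by simp
    finally show ?thesis .
  qed
  then show "v = (\<Sum>i<n. \<beta> v (e' i) *\<^sub>R e i)" using a by simp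
  define w where "w = (\<Sum>i<n. \<beta> v (e i) *\<^sub>R e' i)"
  have wV: "w \<in> V" unfolding w_def
    using bD(1) e' by (auto intro!: subspace_sum subspace_scale)
  have we: "\<beta> w (e j) = \<beta> v (e j)" if "j < n" for j
  proof -
    have "\<beta> w (e j) = (\<Sum>i<n. \<beta> v (e i) * \<beta> (e' i) (e j))"
      unfolding w_def using bilin_on_sum(1)[OF \<beta>(1) bD(1), of "{..<n}" e' "e j"] bD(2) e' that by simp
    also have "\<dots> = (\<Sum>i<n. if i = j then \<beta> v (e i) else 0)"
      using d that by (intro sum.cong) auto
    also have "\<dots> = \<beta> v (e j)" using that by simp
    finally show ?thesis .
  qed
  have lin: "\<beta> z y = (\<Sum>i<n. c i * \<beta> z (e i))" if "y = (\<Sum>i<n. c i *\<^sub>R e i)" "z \<in> V" for y z c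
    using bilin_on_sum(2)[OF \<beta>(1) bD(1), of "{..<n}" e z c] bD(2) that by simp
  have "\<beta> (v + (-1) *\<^sub>R w) y = 0" if y: "y \<in> V" for y
  proof -
    obtain c where c: "y = (\<Sum>i<n. c i *\<^sub>R e i)" using bD(4)[OF y] by blast
    have "\<beta> v y = \<beta> w y" using lin[OF c v] lin[OF c wV] we by simp
    moreover have "\<beta> (v + (-1) *\<^sub>R w) y = \<beta> v y + (-1) *\<^sub>R \<beta> w y"
      by (simp only: bilin_onD(1)[OF \<beta>(1) v subspace_scale[OF bD(1) wV] y] bilin_onD(3)[OF \<beta>(1) wV wV y])
    ultimately show ?thesis by simp
  qed
  moreover have "v + (-1) *\<^sub>R w \<in> V" by (intro subspace_add subspace_scale bD(1) v wV)
  ultimately have "v + (-1) *\<^sub>R w = 0" using \<beta>(3) unfolding nondeg_on_def by blast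
  then show "v = (\<Sum>i<n. \<beta> v (e i) *\<^sub>R e' i)" by (simp add: w_def)
qed

lemma dual_frames_exist:
  assumes b: "is_basis_family (F p) n b" and \<beta>: "bilin_on (F p) (\<beta> p)" "nondeg_on (F p) (\<beta> p)"
    and ev: "\<And>v. v \<in> F p \<Longrightarrow> \<exists>u\<in>S. u p = v"
  shows "\<exists>e e'. dual_frames F S \<beta> p e e'"
proof -
  note bD = is_basis_familyD[OF b]
  let ?b' = "\<lambda>i. \<Sum>k<n. inv_gram n (\<beta> p) b i k *\<^sub>R b k"
  have b'V: "?b' i \<in> F p" for i
    using bD(1,2) by (auto intro!: subspace_sum subspace_scale)
  have "\<exists>u. u \<in> S \<and> (i < n \<longrightarrow> u p = b i)" for i
    using ev[OF bD(2), of i] ev[OF b'V] by (cases "i < n") blast+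
  then obtain e where e: "\<And>i. e i \<in> S" "\<And>i. i < n \<Longrightarrow> e i p = b i" by metis
  have "\<exists>u. u \<in> S \<and> u p = ?b' i" for i
    using ev[OF b'V] by blast
  then obtain e' where e': "\<And>i. e' i \<in> S" "\<And>i. e' i p = ?b' i" by metis
  have "is_basis_family (F p) n (\<lambda>i. e i p)"
    using b e(2) unfolding is_basis_family_def
    by (metis (no_types, lifting) image_cong inj_on_cong lessThan_iff)
  then have "dual_frames F S \<beta> p e e'"
    unfolding dual_frames_def bD(3) using e e' inv_gram_dual(2)[OF b \<beta>] by simp
  then show ?thesis by blast
qed

text \<open>Frees the trace from the frames picked by \<open>SOME\<close>: any resolution of the
  identity at p computes it. The y i are expanded in the chosen dual frame, and after exchanging the
  sums the e j are reassembled from the x i. As x need not be a basis and I is arbitrary, frames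
  adapted to E_+ and E_- can be used without first comparing the rank of E with 2 d.\<close>

lemma metric_trace_eq:
  fixes S :: "('m \<Rightarrow> 'v::real_vector) set"
  assumes b: "is_basis_family (F p) n b"
    and \<beta>: "bilin_on (F p) (\<beta> p)" "sym_on (F p) (\<beta> p)" "nondeg_on (F p) (\<beta> p)"
    and S: "subspace S" "\<And>u. u \<in> S \<Longrightarrow> u p \<in> F p" "\<And>v. v \<in> F p \<Longrightarrow> \<exists>u\<in>S. u p = v"
    and T: "bilin_on S T" "\<And>u v. u \<in> S \<Longrightarrow> v \<in> S \<Longrightarrow> u p = 0 \<Longrightarrow> T u v = 0"
      "\<And>u v. u \<in> S \<Longrightarrow> v \<in> S \<Longrightarrow> v p = 0 \<Longrightarrow> T u v = 0"
    and I: "\<And>i. i \<in> I \<Longrightarrow> x i \<in> S" "\<And>i. i \<in> I \<Longrightarrow> y i \<in> S"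
      "\<And>v. v \<in> F p \<Longrightarrow> v = (\<Sum>i\<in>I. \<beta> p v (y i p) *\<^sub>R x i p)"
  shows "metric_trace F S \<beta> p T = (\<Sum>i\<in>I. T (x i) (y i))"
proof -
  have n: "dim (F p) = n" by (rule is_basis_familyD(3)[OF b])
  have sub: "subspace (F p)" by (rule is_basis_familyD(1)[OF b])
  obtain e e' where ee: "(SOME (e, e'). dual_frames F S \<beta> p e e') = (e, e')"
    by (metis surj_pair)
  have "\<exists>ee. (\<lambda>(e, e'). dual_frames F S \<beta> p e e') ee"
    using dual_frames_exist[where F=F and \<beta>=\<beta> and p=p and S=S, OF b \<beta>(1,3) S(3)] by auto
  then have "(\<lambda>(e, e'). dual_frames F S \<beta> p e e') (SOME (e, e'). dual_frames F S \<beta> p e e')"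
    by (rule someI_ex)
  then have df: "dual_frames F S \<beta> p e e'" unfolding ee by simp
  have eS: "e i \<in> S" "e' i \<in> S" if "i < n" for i
    using df that unfolding dual_frames_def n by auto
  have be: "is_basis_family (F p) n (\<lambda>i. e i p)"
    using df unfolding dual_frames_def n by blast
  have d: "\<beta> p (e' i p) (e j p) = (if i = j then 1 else 0)" if "i < n" "j < n" for i j
    using df that unfolding dual_frames_def n by blast
  note res = dual_basis_resolution[OF be \<beta>, of "\<lambda>i. e' i p"]
  have sym: "\<beta> p a c = \<beta> p c a" if "a \<in> F p" "c \<in> F p" for a c
    using \<beta>(2) that unfolding sym_on_def by blast
  have eqT1: "T u w = T u' w" if "u \<in> S" "u' \<in> S" "w \<in> S" "u p = u' p" for u u' w
  proof -
    have "T (u + (-1) *\<^sub>R u') w = T u w + (-1) *\<^sub>R T u' w"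
      by (simp only: bilin_onD(1)[OF T(1) that(1) subspace_scale[OF S(1) that(2)] that(3)]
        bilin_onD(3)[OF T(1) that(2,2,3)])
    moreover have "T (u + (-1) *\<^sub>R u') w = 0"
      using that by (intro T(2) subspace_add subspace_scale S(1)) simp_all
    ultimately show ?thesis by simp
  qed
  have eqT2: "T w u = T w u'" if "u \<in> S" "u' \<in> S" "w \<in> S" "u p = u' p" for u u' w
  proof -
    have "T w (u + (-1) *\<^sub>R u') = T w u + (-1) *\<^sub>R T w u'"
      by (simp only: bilin_onD(2)[OF T(1) that(1) subspace_scale[OF S(1) that(2)] that(3)]
        bilin_onD(4)[OF T(1) that(2,2,3)])
    moreover have "T w (u + (-1) *\<^sub>R u') = 0"
      using that by (intro T(3) subspace_add subspace_scale S(1)) simp_all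
    ultimately show ?thesis by simp
  qed
  have "(\<Sum>i\<in>I. T (x i) (y i)) = (\<Sum>i\<in>I. \<Sum>j<n. \<beta> p (e j p) (y i p) * T (x i) (e' j))"
  proof (rule sum.cong[OF refl])
    fix i assume i: "i \<in> I"
    let ?u = "\<Sum>j<n. \<beta> p (y i p) (e j p) *\<^sub>R e' j"
    have "?u \<in> S" using eS S(1) by (auto intro!: subspace_sum subspace_scale)
    moreover have "y i p = ?u p"
      using res(2)[OF S(2)[OF eS(2)] d S(2)[OF I(2)[OF i]]] by (simp add: sum_fun_apply)
    ultimately have "T (x i) (y i) = T (x i) ?u"
      using i I by (intro eqT2) auto
    also have "\<dots> = (\<Sum>j<n. \<beta> p (y i p) (e j p) * T (x i) (e' j))"
      using bilin_on_sum(2)[OF T(1) S(1), of "{..<n}" e' "x i"] eS I i by simp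
    also have "\<dots> = (\<Sum>j<n. \<beta> p (e j p) (y i p) * T (x i) (e' j))"
      using eS S(2) I(2)[OF i] sym by (intro sum.cong refl) (metis lessThan_iff)
    finally show "T (x i) (y i) = (\<Sum>j<n. \<beta> p (e j p) (y i p) * T (x i) (e' j))" .
  qed
  also have "\<dots> = (\<Sum>j<n. \<Sum>i\<in>I. \<beta> p (e j p) (y i p) * T (x i) (e' j))"
    by (rule sum.swap)
  also have "\<dots> = (\<Sum>j<n. T (e j) (e' j))"
  proof (rule sum.cong[OF refl])
    fix j assume "j \<in> {..<n}"
    then have j: "j < n" by simp
    let ?u = "\<Sum>i\<in>I. \<beta> p (e j p) (y i p) *\<^sub>R x i"
    have "?u \<in> S" using I S(1) by (auto intro!: subspace_sum subspace_scale)
    moreover have "e j p = ?u p"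
      using I(3)[OF S(2)[OF eS(1)[OF j]]] by (simp add: sum_fun_apply)
    ultimately have "T (e j) (e' j) = T ?u (e' j)"
      using eS j by (intro eqT1) auto
    also have "\<dots> = (\<Sum>i\<in>I. \<beta> p (e j p) (y i p) * T (x i) (e' j))"
      using bilin_on_sum(1)[OF T(1) S(1), of I x "e' j"] eS I j by simp
    finally show "(\<Sum>i\<in>I. \<beta> p (e j p) (y i p) * T (x i) (e' j)) = T (e j) (e' j)" ..
  qed
  finally show ?thesis
    unfolding metric_trace_def ee n by simp
qed

section \<open>Sections of a Courant algebroid\<close>

locale exact_courant =
  fixes C :: "('m::{t2_space,second_countable_topology}, 'e::euclidean_space, 'v::real_vector) courant"
  assumes exact: "exact_courant_algebroid C"

sublocale exact_courant \<subseteq> manifold "atlas C"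
  by unfold_locales (use exact in \<open>simp add: exact_courant_algebroid_def courant_algebroid_def\<close>)

context exact_courant
begin

abbreviation "\<Gamma> \<equiv> sections C"
abbreviation "VF \<equiv> vfields (atlas C)"
abbreviation "CM \<equiv> Cinf (atlas C)"
abbreviation "TM \<equiv> tangent_space (atlas C)"

lemma courant: "courant_algebroid C"
  using exact by (simp add: exact_courant_algebroid_def)

lemma vector_bundle: "smooth_vector_bundle C"
  using courant by (simp add: courant_algebroid_def)

lemma anchor_lin: "lin_on (fibre C p) (anchor C p)"
  using courant by (simp add: courant_algebroid_def)

lemma anchor_image: "anchor C p ` fibre C p = TM p"
  using exact unfolding exact_courant_algebroid_def by blast

lemma anchor_kernel: "{v \<in> fibre C p. anchor C p v = 0} = cotangent_in_E C p"
  using exact unfolding exact_courant_algebroid_def by blast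

lemma anch_VF: "u \<in> \<Gamma> \<Longrightarrow> anch C u \<in> VF"
  using courant unfolding courant_algebroid_def by blast

lemma pairing_props: "bilin_on (fibre C p) (pairing C p)" "sym_on (fibre C p) (pairing C p)"
    "nondeg_on (fibre C p) (pairing C p)"
  using courant unfolding courant_algebroid_def by blast+

lemma pair_CM: "u \<in> \<Gamma> \<Longrightarrow> v \<in> \<Gamma> \<Longrightarrow> pair C u v \<in> CM"
  using courant unfolding courant_algebroid_def by blast

lemma dorfman_section: "u \<in> \<Gamma> \<Longrightarrow> v \<in> \<Gamma> \<Longrightarrow> dorfman C u v \<in> \<Gamma>"
  using courant unfolding courant_algebroid_def by blast

lemma frame_at:
  obtains U e where "(U, e) \<in> frames C" "p \<in> U"
proof -
  have "p \<in> (\<Union>(U, e)\<in>frames C. U)"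
    using vector_bundle unfolding smooth_vector_bundle_def by simp
  then show ?thesis using that by blast
qed

lemma frame_props:
  assumes "(U, e) \<in> frames C"
  shows "open U" "p \<in> U \<Longrightarrow> is_basis_family (fibre C p) (rnk C) (\<lambda>i. e i p)"
  using vector_bundle assms unfolding smooth_vector_bundle_def by blast+

lemma fibre_basis: "\<exists>b. is_basis_family (fibre C p) (rnk C) b"
  using frame_at[of p] frame_props(2) by metis

lemma fibre_subspace: "subspace (fibre C p)"
  using fibre_basis is_basis_familyD(1) by blast

lemma section_fibre: "u \<in> \<Gamma> \<Longrightarrow> u p \<in> fibre C p"
  by (simp add: sections_def)

lemma section_coeffs:
  assumes "u \<in> \<Gamma>" "(U, e) \<in> frames C"
  obtains a where "\<And>i. i < rnk C \<Longrightarrow> smooth_fun_on (atlas C) U (a i)"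
    "\<And>p. p \<in> U \<Longrightarrow> u p = (\<Sum>i<rnk C. a i p *\<^sub>R e i p)"
proof -
  have "\<exists>a. (\<forall>i<rnk C. smooth_fun_on (atlas C) U (a i)) \<and>
        (\<forall>p\<in>U. u p = (\<Sum>i<rnk C. a i p *\<^sub>R e i p))"
    using assms unfolding sections_def by blast
  then show ?thesis using that by blast
qed

lemma sectionI:
  assumes "\<And>p. u p \<in> fibre C p"
    "\<And>U e. (U, e) \<in> frames C \<Longrightarrow> \<exists>a. (\<forall>i<rnk C. smooth_fun_on (atlas C) U (a i)) \<and>
        (\<forall>p\<in>U. u p = (\<Sum>i<rnk C. a i p *\<^sub>R e i p))"
  shows "u \<in> \<Gamma>"
  using assms unfolding sections_def by blast

lemma section_add [simp, intro]:
  assumes "u \<in> \<Gamma>" "v \<in> \<Gamma>"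
  shows "u + v \<in> \<Gamma>"
proof (rule sectionI)
  show "(u + v) p \<in> fibre C p" for p
    using assms by (simp add: section_fibre subspace_add[OF fibre_subspace])
  fix U e assume f: "(U, e) \<in> frames C"
  obtain a where a: "\<And>i. i < rnk C \<Longrightarrow> smooth_fun_on (atlas C) U (a i)"
    "\<And>p. p \<in> U \<Longrightarrow> u p = (\<Sum>i<rnk C. a i p *\<^sub>R e i p)"
    by (rule section_coeffs[OF assms(1) f]) (rule that)
  obtain b where b: "\<And>i. i < rnk C \<Longrightarrow> smooth_fun_on (atlas C) U (b i)"
    "\<And>p. p \<in> U \<Longrightarrow> v p = (\<Sum>i<rnk C. b i p *\<^sub>R e i p)"
    by (rule section_coeffs[OF assms(2) f]) (rule that)
  show "\<exists>c. (\<forall>i<rnk C. smooth_fun_on (atlas C) U (c i)) \<and>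
      (\<forall>p\<in>U. (u + v) p = (\<Sum>i<rnk C. c i p *\<^sub>R e i p))"
    using a b smooth_fun_on_add[OF frame_props(1)[OF f]]
    by (intro exI[of _ "\<lambda>i p. a i p + b i p"]) (simp add: scaleR_add_left sum.distrib)
qed

lemma section_fmul [simp, intro]:
  assumes "h \<in> CM" "u \<in> \<Gamma>"
  shows "fmul h u \<in> \<Gamma>"
proof (rule sectionI)
  show "fmul h u p \<in> fibre C p" for p
    using assms by (simp add: fmul_def section_fibre subspace_scale[OF fibre_subspace])
  fix U e assume f: "(U, e) \<in> frames C"
  obtain a where a: "\<And>i. i < rnk C \<Longrightarrow> smooth_fun_on (atlas C) U (a i)"
    "\<And>p. p \<in> U \<Longrightarrow> u p = (\<Sum>i<rnk C. a i p *\<^sub>R e i p)"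
    by (rule section_coeffs[OF assms(2) f]) (rule that)
  have "smooth_fun_on (atlas C) U h"
    using assms(1) smooth_fun_on_subset[of UNIV h U] by (simp add: Cinf_iff)
  then show "\<exists>c. (\<forall>i<rnk C. smooth_fun_on (atlas C) U (c i)) \<and>
      (\<forall>p\<in>U. fmul h u p = (\<Sum>i<rnk C. c i p *\<^sub>R e i p))"
    using a smooth_fun_on_mult[OF frame_props(1)[OF f]]
    by (intro exI[of _ "\<lambda>i p. h p * a i p"]) (simp add: fmul_def scaleR_sum_right)
qed

lemma section_zero [simp, intro]: "0 \<in> \<Gamma>"
  by (rule sectionI)
    (auto simp: subspace_0[OF fibre_subspace] frame_props(1) intro!: exI[of _ "\<lambda>i p. 0"] smooth_fun_on_const)

lemma section_scaleR [simp, intro]: "u \<in> \<Gamma> \<Longrightarrow> c *\<^sub>R u \<in> \<Gamma>"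
  using section_fmul[OF Cinf_const, of u c] by (simp add: fmul_def scaleR_fun_def)

lemma section_minus [simp, intro]: "u \<in> \<Gamma> \<Longrightarrow> - u \<in> \<Gamma>"
  using section_scaleR[of u "-1"] by simp

lemma section_diff [simp, intro]: "u \<in> \<Gamma> \<Longrightarrow> v \<in> \<Gamma> \<Longrightarrow> u - v \<in> \<Gamma>"
  using section_add[OF _ section_minus, of u v] by simp

lemma sections_subspace: "subspace \<Gamma>"
  unfolding subspace_def by auto

lemma section_sum [intro]: "(\<And>i. i \<in> I \<Longrightarrow> u i \<in> \<Gamma>) \<Longrightarrow> (\<Sum>i\<in>I. u i) \<in> \<Gamma>"
  by (rule subspace_sum[OF sections_subspace])

text \<open>\<open>e i\<close> carries information on U only. In another frame the coefficients are
  h times transition functions on the overlap and 0 on Z, and these two open sets cover the domain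
  of that frame.\<close>

lemma cutoff_frame_section:
  assumes f: "(U, e) \<in> frames C" and i: "i < rnk C" and h: "h \<in> CM"
    and Z: "open Z" "U \<union> Z = UNIV" "\<And>q. q \<in> Z \<Longrightarrow> h q = 0"
  shows "fmul h (e i) \<in> \<Gamma>"
proof (rule sectionI)
  have h0: "h q = 0" if "q \<notin> U" for q using that Z(2,3) by blast
  show "fmul h (e i) p \<in> fibre C p" for p
    using is_basis_familyD(2)[OF frame_props(2)[OF f] i, of p] h0[of p]
    by (cases "p \<in> U") (auto simp: fmul_def subspace_scale[OF fibre_subspace] subspace_0[OF fibre_subspace])
  fix V e' assume f': "(V, e') \<in> frames C"
  have oV: "open V" by (rule frame_props(1)[OF f'])
  have "\<exists>a. (\<forall>i<rnk C. \<forall>j<rnk C. smooth_fun_on (atlas C) (V \<inter> U) (a i j)) \<and>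
            (\<forall>j<rnk C. \<forall>p\<in>V \<inter> U. e j p = (\<Sum>i<rnk C. a i j p *\<^sub>R e' i p))"
    using vector_bundle[unfolded smooth_vector_bundle_def, THEN conjunct2, THEN conjunct2, THEN bspec, OF f',
        unfolded prod.case, THEN bspec, OF f, unfolded prod.case] .
  then obtain a where a: "\<And>k. k < rnk C \<Longrightarrow> smooth_fun_on (atlas C) (V \<inter> U) (a k i)"
    "\<And>p. p \<in> V \<inter> U \<Longrightarrow> e i p = (\<Sum>k<rnk C. a k i p *\<^sub>R e' k p)"
    using i by blast
  define c where "c k p = (if p \<in> U then h p * a k i p else 0)" for k p
  have VU: "open (V \<inter> U)" by (rule open_Int[OF oV frame_props(1)[OF f]])
  have "smooth_fun_on (atlas C) V (c k)" if k: "k < rnk C" for k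
  proof (rule smooth_fun_on_local)
    fix p assume p: "p \<in> V"
    have "smooth_fun_on (atlas C) (V \<inter> U) h"
      using h smooth_fun_on_subset[of UNIV h "V \<inter> U"] by (simp add: Cinf_iff)
    from smooth_fun_on_mult[OF VU this a(1)[OF k]]
    have 1: "smooth_fun_on (atlas C) (V \<inter> U) (c k)"
      by (rule smooth_fun_on_cong[OF VU, rotated]) (simp add: c_def)
    from smooth_fun_on_const[OF Z(1), of 0]
    have 2: "smooth_fun_on (atlas C) Z (c k)"
      by (rule smooth_fun_on_cong[OF Z(1), rotated]) (simp add: c_def Z(3))
    show "\<exists>N. open N \<and> p \<in> N \<and> smooth_fun_on (atlas C) N (c k)"
      using 1 2 VU Z(1,2) p by (cases "p \<in> U") blast+
  qed
  moreover have "fmul h (e i) p = (\<Sum>k<rnk C. c k p *\<^sub>R e' k p)" if "p \<in> V" for p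
    using that a(2)[of p] h0[of p] by (cases "p \<in> U") (simp_all add: c_def fmul_def scaleR_sum_right)
  ultimately show "\<exists>c. (\<forall>i<rnk C. smooth_fun_on (atlas C) V (c i)) \<and>
      (\<forall>p\<in>V. fmul h (e i) p = (\<Sum>i<rnk C. c i p *\<^sub>R e' i p))" by blast
qed

lemma local_frame_sections:
  assumes f: "(U, e) \<in> frames C" and p: "p \<in> U"
  obtains \<psi> N Z where "\<psi> \<in> CM" "open N" "p \<in> N" "N \<subseteq> U" "\<And>q. q \<in> N \<Longrightarrow> \<psi> q = 1"
    "open Z" "U \<union> Z = UNIV" "\<And>q. q \<in> Z \<Longrightarrow> \<psi> q = 0"
    "\<And>i. i < rnk C \<Longrightarrow> fmul \<psi> (e i) \<in> \<Gamma>" "\<And>i q. q \<in> N \<Longrightarrow> fmul \<psi> (e i) q = e i q"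
proof -
  obtain \<psi> N Z where b: "\<psi> \<in> CM" "open N" "p \<in> N" "N \<subseteq> U" "\<And>q. q \<in> N \<Longrightarrow> \<psi> q = 1"
    "open Z" "U \<union> Z = UNIV" "\<And>q. q \<in> Z \<Longrightarrow> \<psi> q = 0"
    by (rule bump[OF frame_props(1)[OF f] p]) (rule that)
  show ?thesis
    by (rule that[OF b]) (use cutoff_frame_section[OF f _ b(1,6,7,8)] b(5) in \<open>simp_all add: fmul_def\<close>)
qed

lemma section_through:
  assumes v: "v \<in> fibre C p"
  shows "\<exists>u\<in>\<Gamma>. u p = v"
proof -
  obtain U e where f: "(U, e) \<in> frames C" "p \<in> U" by (rule frame_at)
  obtain \<psi> N Z where b: "\<psi> \<in> CM" "open N" "p \<in> N" "N \<subseteq> U" "\<And>q. q \<in> N \<Longrightarrow> \<psi> q = 1"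
    "open Z" "U \<union> Z = UNIV" "\<And>q. q \<in> Z \<Longrightarrow> \<psi> q = 0"
    "\<And>i. i < rnk C \<Longrightarrow> fmul \<psi> (e i) \<in> \<Gamma>" "\<And>i q. q \<in> N \<Longrightarrow> fmul \<psi> (e i) q = e i q"
    by (rule local_frame_sections[OF f]) (rule that)
  obtain a where a: "v = (\<Sum>i<rnk C. a i *\<^sub>R e i p)"
    using is_basis_familyD(4)[OF frame_props(2)[OF f] v] by blast
  show ?thesis
  proof (rule bexI[of _ "\<Sum>i<rnk C. a i *\<^sub>R fmul \<psi> (e i)"])
    show "(\<Sum>i<rnk C. a i *\<^sub>R fmul \<psi> (e i)) p = v"
      by (simp add: sum_fun_apply a b(10)[OF b(3)])
    show "(\<Sum>i<rnk C. a i *\<^sub>R fmul \<psi> (e i)) \<in> \<Gamma>"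
      using b(9) by (intro section_sum section_scaleR) simp
  qed
qed

text \<open>A \<open>C\<^sup>\<infinity>\<close>-linear map on sections is tensorial: a section vanishing at \<open>p\<close> is, up to a
  function vanishing at \<open>p\<close>, a combination of cut-off frame sections with coefficients vanishing
  at \<open>p\<close>.\<close>

lemma tensorial:
  fixes T :: "('m \<Rightarrow> 'v) \<Rightarrow> 'b::real_vector"
  assumes add: "\<And>u v. u \<in> \<Gamma> \<Longrightarrow> v \<in> \<Gamma> \<Longrightarrow> T (u + v) = T u + T v"
    and mul: "\<And>h u. h \<in> CM \<Longrightarrow> u \<in> \<Gamma> \<Longrightarrow> T (fmul h u) = h p *\<^sub>R T u"
    and u: "u \<in> \<Gamma>" "u p = 0"
  shows "T u = 0"
proof -
  obtain U e where f: "(U, e) \<in> frames C" "p \<in> U" by (rule frame_at)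
  obtain \<psi> N Z where b: "\<psi> \<in> CM" "open N" "p \<in> N" "N \<subseteq> U" "\<And>q. q \<in> N \<Longrightarrow> \<psi> q = 1"
    "open Z" "U \<union> Z = UNIV" "\<And>q. q \<in> Z \<Longrightarrow> \<psi> q = 0"
    "\<And>i. i < rnk C \<Longrightarrow> fmul \<psi> (e i) \<in> \<Gamma>" "\<And>i q. q \<in> N \<Longrightarrow> fmul \<psi> (e i) q = e i q"
    by (rule local_frame_sections[OF f]) (rule that)
  obtain a where a: "\<And>i. i < rnk C \<Longrightarrow> smooth_fun_on (atlas C) U (a i)"
    "\<And>p. p \<in> U \<Longrightarrow> u p = (\<Sum>i<rnk C. a i p *\<^sub>R e i p)"
    by (rule section_coeffs[OF u(1) f(1)]) (rule that)
  have a0: "a i p = 0" if "i < rnk C" for i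
    using is_basis_familyD(5)[OF frame_props(2)[OF f], of "\<lambda>i. a i p"] a(2)[OF f(2)] u(2) that by simp
  have ac: "\<psi> * a i \<in> CM" if "i < rnk C" for i
    by (rule cutoff_Cinf[OF b(1) frame_props(1)[OF f(1)] b(6,7,8) a(1)[OF that]])
  let ?t = "\<lambda>i. fmul (\<psi> * a i) (fmul \<psi> (e i))"
  have t: "?t i \<in> \<Gamma>" if "i < rnk C" for i
    by (rule section_fmul[OF ac[OF that] b(9)[OF that]])
  have T0: "T 0 = 0"
    using add[of 0 0] by simp
  have Ts: "T (\<Sum>i\<in>I. w i) = (\<Sum>i\<in>I. T (w i))" if "\<And>i. i \<in> I \<Longrightarrow> w i \<in> \<Gamma>" for w :: "nat \<Rightarrow> 'm \<Rightarrow> 'v" and I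
    using that
  proof (induction I rule: infinite_finite_induct)
    case (insert i I)
    have "T (w i + sum w I) = T (w i) + T (sum w I)"
      by (rule add) (use insert.prems in auto)
    moreover have "T (sum w I) = (\<Sum>i\<in>I. T (w i))"
      by (rule insert.IH) (use insert.prems in auto)
    ultimately show ?case by (simp only: sum.insert[OF insert.hyps])
  qed (simp_all add: T0)
  have m: "1 - \<psi> * \<psi> \<in> CM" using b(1) by auto
  \<comment> \<open>The cut-off enters squared: one factor makes the coefficients a i globally
    smooth, the other the frame sections.\<close>
  have "u = (\<Sum>i<rnk C. ?t i) + fmul (1 - \<psi> * \<psi>) u"
  proof
    fix q
    show "u q = ((\<Sum>i<rnk C. ?t i) + fmul (1 - \<psi> * \<psi>) u) q"
    proof (cases "q \<in> U")
      case True
      have "(\<Sum>i<rnk C. ?t i) q = (\<psi> q * \<psi> q) *\<^sub>R (\<Sum>i<rnk C. a i q *\<^sub>R e i q)"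
        by (simp add: sum_fun_apply fmul_def scaleR_sum_right mult_ac)
      then show ?thesis
        by (simp add: fmul_def a(2)[OF True, symmetric] flip: scaleR_add_left)
    next
      case False
      then have "\<psi> q = 0" using b(7,8) by blast
      then show ?thesis by (simp add: sum_fun_apply fmul_def)
    qed
  qed
  then have "T u = T ((\<Sum>i<rnk C. ?t i) + fmul (1 - \<psi> * \<psi>) u)" by simp
  also have "\<dots> = T (\<Sum>i<rnk C. ?t i) + T (fmul (1 - \<psi> * \<psi>) u)"
    by (rule add[OF section_sum section_fmul[OF m u(1)]]) (use t in simp)
  also have "T (fmul (1 - \<psi> * \<psi>) u) = 0"
    using mul[OF m u(1)] b(3,5) by simp
  also have "T (\<Sum>i<rnk C. ?t i) = (\<Sum>i<rnk C. T (?t i))"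
    by (rule Ts) (use t in simp)
  also have "\<dots> = 0"
    using mul[OF ac b(9)] a0 by (intro sum.neutral ballI) simp
  finally show ?thesis by simp
qed

section \<open>Smoothness of dual frames and of represented functionals\<close>

lemma smooth_on_frame:
  assumes f: "(U, e) \<in> frames C"
    and l: "\<And>u v. u \<in> \<Gamma> \<Longrightarrow> v \<in> \<Gamma> \<Longrightarrow> (\<lambda>p. L p (u p) (v p)) \<in> CM" and ij: "i < rnk C" "j < rnk C"
  shows "smooth_fun_on (atlas C) U (\<lambda>p. L p (e i p) (e j p))"
proof (rule smooth_fun_on_local)
  fix p assume p: "p \<in> U"
  obtain \<psi> N Z where b: "\<psi> \<in> CM" "open N" "p \<in> N" "N \<subseteq> U" "\<And>q. q \<in> N \<Longrightarrow> \<psi> q = 1"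
    "open Z" "U \<union> Z = UNIV" "\<And>q. q \<in> Z \<Longrightarrow> \<psi> q = 0"
    "\<And>i. i < rnk C \<Longrightarrow> fmul \<psi> (e i) \<in> \<Gamma>" "\<And>i q. q \<in> N \<Longrightarrow> fmul \<psi> (e i) q = e i q"
    by (rule local_frame_sections[OF f p]) (rule that)
  have "smooth_fun_on (atlas C) N (\<lambda>p. L p (fmul \<psi> (e i) p) (fmul \<psi> (e j) p))"
    using l[OF b(9)[OF ij(1)] b(9)[OF ij(2)]] smooth_fun_on_subset[of UNIV _ N] by (simp add: Cinf_iff)
  then have "smooth_fun_on (atlas C) N (\<lambda>p. L p (e i p) (e j p))"
    by (rule smooth_fun_on_cong[OF b(2), rotated]) (simp add: b(10))
  then show "\<exists>N. open N \<and> p \<in> N \<and> smooth_fun_on (atlas C) N (\<lambda>p. L p (e i p) (e j p))"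
    using b(2,3) by blast
qed

lemma smooth_fun_on_det:
  assumes "open U" "\<And>i j. i < n \<Longrightarrow> j < n \<Longrightarrow> smooth_fun_on (atlas C) U (\<lambda>p. a p i j)"
  shows "smooth_fun_on (atlas C) U (\<lambda>p. Determinant.det (Matrix.mat n n (\<lambda>(i, j). a p i j)))"
proof -
  have "smooth_fun_on (atlas C) U (\<lambda>p. \<Sum>\<pi>\<in>{\<pi>. \<pi> permutes {0..<n}}. signof \<pi> * (\<Prod>i = 0..<n. a p i (\<pi> i)))"
  proof (intro smooth_fun_on_sum smooth_fun_on_mult smooth_fun_on_prod smooth_fun_on_const assms(1))
    fix \<pi> i assume "\<pi> \<in> {\<pi>. \<pi> permutes {0..<n}}" "i \<in> {0..<n}"
    then have "i < n" "\<pi> i < n"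
      using permutes_in_image[of \<pi> "{0..<n}" i] by auto
    then show "smooth_fun_on (atlas C) U (\<lambda>p. a p i (\<pi> i))" by (rule assms(2))
  qed
  moreover have "Determinant.det (Matrix.mat n n (\<lambda>(i, j). a p i j)) =
      (\<Sum>\<pi>\<in>{\<pi>. \<pi> permutes {0..<n}}. signof \<pi> * (\<Prod>i = 0..<n. a p i (\<pi> i)))" for p
    unfolding Determinant.det_def'[OF mat_carrier]
  proof (intro sum.cong refl arg_cong2[where f="(*)"] prod.cong)
    fix \<pi> i assume "\<pi> \<in> {\<pi>. \<pi> permutes {0..<n}}" "i \<in> {0..<n}"
    then have "i < n" "\<pi> i < n"
      using permutes_in_image[of \<pi> "{0..<n}" i] by auto
    then show "Matrix.mat n n (\<lambda>(i, j). a p i j) $$ (i, \<pi> i) = a p i (\<pi> i)" by simp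
  qed
  ultimately show ?thesis by simp
qed

lemma smooth_fun_on_inv_gram:
  assumes f: "(U, e) \<in> frames C" and ij: "i < rnk C" "j < rnk C"
  shows "smooth_fun_on (atlas C) U (\<lambda>p. inv_gram (rnk C) (pairing C p) (\<lambda>i. e i p) i j)"
proof -
  let ?n = "rnk C"
  let ?M = "\<lambda>p. gram ?n (pairing C p) (\<lambda>i. e i p)"
  have oU: "open U" by (rule frame_props(1)[OF f])
  have entries: "smooth_fun_on (atlas C) U (\<lambda>p. pairing C p (e k p) (e l p))" if "k < ?n" "l < ?n" for k l
    by (rule smooth_on_frame[OF f _ that]) (use pair_CM in \<open>simp add: ev2_def\<close>)
  have "smooth_fun_on (atlas C) U (\<lambda>p. Determinant.det (?M p))"
    unfolding gram_def by (rule smooth_fun_on_det[OF oU entries])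
  then have 1: "smooth_fun_on (atlas C) U (\<lambda>p. inverse (Determinant.det (?M p)))"
    by (rule smooth_fun_on_inverse[OF oU])
      (rule inv_gram_dual(1)[OF frame_props(2)[OF f] pairing_props(1,3)])
  \<comment> \<open>\<open>?s\<close> is the shift of indices that skips the deleted row or
    column.\<close>
  let ?s = "\<lambda>k l. if k < l then k else Suc k"
  have del: "mat_delete (?M p) j i = Matrix.mat (?n - 1) (?n - 1)
      (\<lambda>(k, l). pairing C p (e (?s k j) p) (e (?s l i) p))" for p
    unfolding mat_delete_def gram_def by (rule eq_matI) auto
  have "smooth_fun_on (atlas C) U (\<lambda>p. Determinant.det (mat_delete (?M p) j i))"
    unfolding del by (rule smooth_fun_on_det[OF oU]) (intro entries; use ij in auto)
  then have "smooth_fun_on (atlas C) U (\<lambda>p. (- 1) ^ (j + i) * Determinant.det (mat_delete (?M p) j i))"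
    by (intro smooth_fun_on_mult smooth_fun_on_const oU)
  moreover have "adj_mat (?M p) $$ (i, j) = (- 1) ^ (j + i) * Determinant.det (mat_delete (?M p) j i)" for p
    using ij by (simp add: adj_mat_def cofactor_def gram_def)
  ultimately have "smooth_fun_on (atlas C) U (\<lambda>p. adj_mat (?M p) $$ (i, j))" by simp
  then show ?thesis
    unfolding inv_gram_def by (rule smooth_fun_on_mult[OF oU 1])
qed

lemma pairing_eqI:
  assumes "x \<in> fibre C p" "y \<in> fibre C p" "\<And>w. w \<in> fibre C p \<Longrightarrow> pairing C p x w = pairing C p y w"
  shows "x = y"
proof -
  have "pairing C p (x + (-1) *\<^sub>R y) w = 0" if w: "w \<in> fibre C p" for w
    unfolding bilin_onD(1)[OF pairing_props(1) assms(1) subspace_scale[OF fibre_subspace assms(2)] w]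
      bilin_onD(3)[OF pairing_props(1) assms(2,2) w] using assms(3)[OF w] by simp
  moreover have "x + (-1) *\<^sub>R y \<in> fibre C p"
    by (intro subspace_add subspace_scale fibre_subspace assms)
  ultimately have "x + (-1) *\<^sub>R y = 0"
    using pairing_props(3) unfolding nondeg_on_def by blast
  then show ?thesis by simp
qed

text \<open>A smooth Riesz representation. Locally the representing section is \<Sum> L(e_i) e'_i
  with the dual frame from \<open>inv_gram\<close>; since the representing vector is unique, the
  local formulas agree. Smoothness of the projections to E_+ and E_-, of the lifts and of raised
  indices all comes from here.\<close>

lemma section_of_functional:
  assumes lin: "\<And>p. lin_on (fibre C p) (L p)"
    and smooth: "\<And>w. w \<in> \<Gamma> \<Longrightarrow> (\<lambda>p. L p (w p)) \<in> CM"
  obtains x where "x \<in> \<Gamma>" "\<And>p w. w \<in> fibre C p \<Longrightarrow> pairing C p (x p) w = L p w"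
proof -
  let ?n = "rnk C"
  let ?c = "\<lambda>e p i j. inv_gram ?n (pairing C p) (\<lambda>i. e i p) i j"
  let ?x = "\<lambda>e p. \<Sum>i<?n. L p (e i p) *\<^sub>R (\<Sum>j<?n. ?c e p i j *\<^sub>R e j p)"
  have loc: "?x e p \<in> fibre C p \<and> (\<forall>w\<in>fibre C p. pairing C p (?x e p) w = L p w)"
    if f: "(U, e) \<in> frames C" and p: "p \<in> U" for U e p
  proof -
    let ?e' = "\<lambda>i. \<Sum>j<?n. ?c e p i j *\<^sub>R e j p"
    note b = frame_props(2)[OF f p]
    note bD = is_basis_familyD[OF b]
    note d = inv_gram_dual(2)[OF b pairing_props(1,3)]
    have e'V: "?e' i \<in> fibre C p" for i
      using bD(2) by (intro subspace_sum subspace_scale fibre_subspace) simp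
    have xV: "?x e p \<in> fibre C p"
      by (rule subspace_sum[OF fibre_subspace]) (rule subspace_scale[OF fibre_subspace e'V])
    have "pairing C p (?x e p) w = L p w" if w: "w \<in> fibre C p" for w
    proof -
      have "pairing C p (?x e p) w = (\<Sum>i<?n. L p (e i p) * pairing C p (?e' i) w)"
        using bilin_on_sum(1)[OF pairing_props(1) fibre_subspace, of "{..<?n}" ?e' p w] e'V w by simp
      also have "\<dots> = (\<Sum>i<?n. pairing C p w (?e' i) * L p (e i p))"
        using pairing_props(2) e'V w unfolding sym_on_def by (intro sum.cong refl) (simp add: mult.commute)
      also have "\<dots> = L p (\<Sum>i<?n. pairing C p w (?e' i) *\<^sub>R e i p)"
        using lin_on_sum[OF lin fibre_subspace, of "{..<?n}" "\<lambda>i. e i p" p] bD(2) by simp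
      also have "\<dots> = L p w"
        using dual_basis_resolution(1)[OF b pairing_props e'V d w] by simp
      finally show ?thesis .
    qed
    then show ?thesis using xV by blast
  qed
  define Q where "Q p x \<longleftrightarrow> x \<in> fibre C p \<and> (\<forall>w\<in>fibre C p. pairing C p x w = L p w)" for p x
  have "\<exists>x. Q p x" for p
  proof -
    obtain U e where f: "(U, e) \<in> frames C" "p \<in> U" by (rule frame_at)
    show ?thesis unfolding Q_def by (rule exI[of _ "?x e p"]) (rule loc[OF f])
  qed
  then obtain x where Qx: "\<And>p. Q p (x p)" using choice[of Q] by blast
  have x: "x p \<in> fibre C p" "w \<in> fibre C p \<Longrightarrow> pairing C p (x p) w = L p w" for p w
    using Qx[of p] by (simp_all add: Q_def)
  have "x \<in> \<Gamma>"
  proof (rule sectionI[OF x(1)])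
    fix U e assume f: "(U, e) \<in> frames C"
    have oU: "open U" by (rule frame_props(1)[OF f])
    have Ls: "smooth_fun_on (atlas C) U (\<lambda>p. L p (e i p))" if "i < ?n" for i
      using smooth_on_frame[OF f _ that that, of "\<lambda>p x y. L p x"] smooth by simp
    show "\<exists>a. (\<forall>i<?n. smooth_fun_on (atlas C) U (a i)) \<and> (\<forall>p\<in>U. x p = (\<Sum>i<?n. a i p *\<^sub>R e i p))"
    proof (intro exI[of _ "\<lambda>j p. \<Sum>i<?n. L p (e i p) * ?c e p i j"] conjI allI impI ballI)
      fix j assume j: "j < ?n"
      show "smooth_fun_on (atlas C) U (\<lambda>p. \<Sum>i<?n. L p (e i p) * ?c e p i j)"
        by (intro smooth_fun_on_sum smooth_fun_on_mult oU Ls smooth_fun_on_inv_gram[OF f]) (use j in auto)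
    next
      fix p assume p: "p \<in> U"
      have "x p = ?x e p"
        by (rule pairing_eqI[OF x(1)]) (use loc[OF f p] x in auto)
      also have "\<dots> = (\<Sum>j<?n. (\<Sum>i<?n. L p (e i p) * ?c e p i j) *\<^sub>R e j p)"
        unfolding scaleR_sum_left scaleR_sum_right by (subst sum.swap) simp
      finally show "x p = (\<Sum>j<?n. (\<Sum>i<?n. L p (e i p) * ?c e p i j) *\<^sub>R e j p)" .
    qed
  qed
  from that[OF this x(2)] show ?thesis .
qed

end

section \<open>Generalised metrics\<close>

locale gen_metric = exact_courant C
  for C :: "('m::{t2_space,second_countable_topology}, 'e::euclidean_space, 'v::real_vector) courant" +
  fixes G :: "'m \<Rightarrow> 'v \<Rightarrow> 'v \<Rightarrow> real"
    and g :: "'m \<Rightarrow> 'm tvec \<Rightarrow> 'm tvec \<Rightarrow> real"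
  assumes gen_metric: "generalised_metric C G"
    and induced: "induced_metric C G g"
begin

abbreviation "GE \<equiv> G_End C G"
abbreviation "EF \<equiv> eigen_fibre C G"

lemma G_props: "bilin_on (fibre C p) (G p)" "sym_on (fibre C p) (G p)" "nondeg_on (fibre C p) (G p)"
  using gen_metric unfolding generalised_metric_def by blast+

lemma G_CM: "u \<in> \<Gamma> \<Longrightarrow> v \<in> \<Gamma> \<Longrightarrow> ev2 G u v \<in> CM"
  using gen_metric unfolding generalised_metric_def by blast

lemma g_props: "bilin_on (TM p) (g p)" "sym_on (TM p) (g p)" "nondeg_on (TM p) (g p)"
  using induced unfolding induced_metric_def semi_riemannian_def by blast+

lemma g_CM: "X \<in> VF \<Longrightarrow> Y \<in> VF \<Longrightarrow> ev2 g X Y \<in> CM"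
  using induced unfolding induced_metric_def semi_riemannian_def by blast

lemma pairing_bilin:
  assumes "x \<in> fibre C p" "y \<in> fibre C p" "z \<in> fibre C p"
  shows "pairing C p (x + y) z = pairing C p x z + pairing C p y z"
    "pairing C p z (x + y) = pairing C p z x + pairing C p z y"
    "pairing C p (c *\<^sub>R x) z = c * pairing C p x z" "pairing C p z (c *\<^sub>R x) = c * pairing C p z x"
  using bilin_onD[OF pairing_props(1) assms] by simp_all

lemma pairing_sym: "x \<in> fibre C p \<Longrightarrow> y \<in> fibre C p \<Longrightarrow> pairing C p x y = pairing C p y x"
  using pairing_props(2) unfolding sym_on_def by blast

lemma G_bilin:
  assumes "x \<in> fibre C p" "y \<in> fibre C p" "z \<in> fibre C p"
  shows "G p (x + y) z = G p x z + G p y z" "G p z (x + y) = G p z x + G p z y"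
    "G p (c *\<^sub>R x) z = c * G p x z" "G p z (c *\<^sub>R x) = c * G p z x"
  using bilin_onD[OF G_props(1) assms] by simp_all

lemma G_sym: "x \<in> fibre C p \<Longrightarrow> y \<in> fibre C p \<Longrightarrow> G p x y = G p y x"
  using G_props(2) unfolding sym_on_def by blast

lemma g_bilin:
  assumes "x \<in> TM p" "y \<in> TM p" "z \<in> TM p"
  shows "g p (x + y) z = g p x z + g p y z" "g p z (x + y) = g p z x + g p z y"
    "g p (c *\<^sub>R x) z = c * g p x z" "g p z (c *\<^sub>R x) = c * g p z x"
  using bilin_onD[OF g_props(1) assms] by simp_all

lemma g_sym: "x \<in> TM p \<Longrightarrow> y \<in> TM p \<Longrightarrow> g p x y = g p y x"
  using g_props(2) unfolding sym_on_def by blast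

lemma anchor_bilin:
  assumes "x \<in> fibre C p" "y \<in> fibre C p"
  shows "anchor C p (x + y) = anchor C p x + anchor C p y" "anchor C p (c *\<^sub>R x) = c *\<^sub>R anchor C p x"
  using anchor_lin assms unfolding lin_on_def by blast+

lemma anchor_scaleR: "x \<in> fibre C p \<Longrightarrow> anchor C p (c *\<^sub>R x) = c *\<^sub>R anchor C p x"
  using anchor_bilin(2)[of x p x] by simp

lemma g_zero: "x \<in> TM p \<Longrightarrow> g p x 0 = 0" "x \<in> TM p \<Longrightarrow> g p 0 x = 0"
  using g_bilin(3,4)[of x p x x 0] by simp_all

lemma anchor_TM: "x \<in> fibre C p \<Longrightarrow> anchor C p x \<in> TM p"
  using anchor_image by blast

lemma fibre_add: "x \<in> fibre C p \<Longrightarrow> y \<in> fibre C p \<Longrightarrow> x + y \<in> fibre C p"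
  by (rule subspace_add[OF fibre_subspace])

lemma fibre_scaleR: "x \<in> fibre C p \<Longrightarrow> c *\<^sub>R x \<in> fibre C p"
  by (rule subspace_scale[OF fibre_subspace])

text \<open>The section representing G(u, .) meets the description defining \<open>G_End\<close> at
  every point, which gives the defining identity and smoothness together.\<close>

lemma GE_section:
  assumes u: "u \<in> \<Gamma>"
  shows "(\<lambda>p. GE p (u p)) \<in> \<Gamma>" "v \<in> fibre C p \<Longrightarrow> pairing C p (GE p (u p)) v = G p (u p) v"
proof -
  have "lin_on (fibre C p) (G p (u p))" for p
    using G_props(1) section_fibre[OF u] unfolding bilin_on_def by blast
  moreover have "(\<lambda>p. G p (u p) (w p)) \<in> CM" if "w \<in> \<Gamma>" for w
    using G_CM[OF u that] by (simp add: ev2_def)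
  ultimately obtain x where x: "x \<in> \<Gamma>" "\<And>p w. w \<in> fibre C p \<Longrightarrow> pairing C p (x p) w = G p (u p) w"
    using section_of_functional[of "\<lambda>p. G p (u p)"] by blast
  have eq: "GE p (u p) = x p" for p
    unfolding G_End_def
  proof (rule the_equality)
    show "x p \<in> fibre C p \<and> (\<forall>v\<in>fibre C p. pairing C p (x p) v = G p (u p) v)"
      using x section_fibre by blast
    show "w = x p" if "w \<in> fibre C p \<and> (\<forall>v\<in>fibre C p. pairing C p w v = G p (u p) v)" for w
      by (rule pairing_eqI[of _ p]) (use that x section_fibre in auto)
  qed
  show "(\<lambda>p. GE p (u p)) \<in> \<Gamma>" using x(1) by (simp add: eq)
  show "pairing C p (GE p (u p)) v = G p (u p) v" if "v \<in> fibre C p" for v p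
    using x(2)[OF that] by (simp add: eq)
qed

lemma GE_fibre: "x \<in> fibre C p \<Longrightarrow> GE p x \<in> fibre C p"
  using section_through[of x p] GE_section(1) section_fibre by metis

lemma pairing_GE: "x \<in> fibre C p \<Longrightarrow> y \<in> fibre C p \<Longrightarrow> pairing C p (GE p x) y = G p x y"
  using section_through[of x p] GE_section(2) by metis

lemma GE_involution: "x \<in> fibre C p \<Longrightarrow> GE p (GE p x) = x"
  using gen_metric unfolding generalised_metric_def by blast

lemma GE_add: "x \<in> fibre C p \<Longrightarrow> y \<in> fibre C p \<Longrightarrow> GE p (x + y) = GE p x + GE p y"
  by (rule pairing_eqI[of _ p])
    (simp_all add: GE_fibre fibre_add pairing_GE pairing_bilin G_bilin)

lemma GE_scaleR: "x \<in> fibre C p \<Longrightarrow> GE p (c *\<^sub>R x) = c *\<^sub>R GE p x"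
  by (rule pairing_eqI[of _ p])
    (simp_all add: GE_fibre fibre_scaleR pairing_GE pairing_bilin G_bilin)

lemma sign_square: "s \<in> {1, -1} \<Longrightarrow> s * s = (1::real)"
  by auto

lemma EF_fibre: "x \<in> EF s p \<Longrightarrow> x \<in> fibre C p"
  by (simp add: eigen_fibre_def)

lemma EF_GE: "x \<in> EF s p \<Longrightarrow> GE p x = s *\<^sub>R x"
  by (simp add: eigen_fibre_def)

lemma EF_subspace: "subspace (EF s p)"
  unfolding subspace_def
proof (intro conjI ballI allI)
  show "0 \<in> EF s p"
    using GE_scaleR[OF subspace_0[OF fibre_subspace], of p 0] subspace_0[OF fibre_subspace]
    by (simp add: eigen_fibre_def)
  show "x + y \<in> EF s p" if "x \<in> EF s p" "y \<in> EF s p" for x y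
    using that by (simp add: eigen_fibre_def GE_add fibre_add scaleR_add_right)
  show "c *\<^sub>R x \<in> EF s p" if "x \<in> EF s p" for c x
    using that by (simp add: eigen_fibre_def GE_scaleR fibre_scaleR)
qed

lemma EF_G: "x \<in> EF s p \<Longrightarrow> y \<in> fibre C p \<Longrightarrow> G p x y = s * pairing C p x y"
  using pairing_GE[of x p y] by (simp add: EF_fibre EF_GE pairing_bilin)

text \<open>G is s times the scalar product seen from x and -s times it seen from y, and both forms
  are symmetric.\<close>

lemma EF_orthogonal:
  assumes s: "s \<in> {1, -1}" and x: "x \<in> EF s p" "y \<in> EF (- s) p"
  shows "pairing C p x y = 0"
proof -
  have "s * pairing C p x y = - s * pairing C p x y"
    using EF_G[OF x(1) EF_fibre[OF x(2)]] EF_G[OF x(2) EF_fibre[OF x(1)]]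
      G_sym[OF EF_fibre[OF x(1)] EF_fibre[OF x(2)]] pairing_sym[OF EF_fibre[OF x(1)] EF_fibre[OF x(2)]] by simp
  then show ?thesis using s by auto
qed

definition pf :: "real \<Rightarrow> 'm \<Rightarrow> 'v \<Rightarrow> 'v" where
  "pf s p x = (1 / 2) *\<^sub>R (x + s *\<^sub>R GE p x)"

lemma proj_pf: "proj C G s u p = pf s p (u p)"
  by (simp add: proj_def pf_def)

lemma pf_EF:
  assumes "s \<in> {1, -1}" "x \<in> fibre C p"
  shows "pf s p x \<in> EF s p"
proof -
  have "GE p (pf s p x) = (1 / 2) *\<^sub>R (GE p x + s *\<^sub>R x)"
    using assms(2) by (simp add: pf_def GE_add GE_scaleR GE_fibre fibre_add fibre_scaleR GE_involution)
  also have "\<dots> = s *\<^sub>R pf s p x"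
    using sign_square[OF assms(1)] by (simp add: pf_def scaleR_add_right add.commute)
  finally show ?thesis
    using assms(2) by (simp add: eigen_fibre_def pf_def GE_fibre fibre_add fibre_scaleR)
qed

lemma pf_sum: "pf 1 p x + pf (-1) p x = x"
  by (simp add: pf_def scaleR_add_right scaleR_diff_right flip: scaleR_add_left)

lemma pf_sum_sign: "s \<in> {1, -1} \<Longrightarrow> pf s p x + pf (- s) p x = x"
  using pf_sum[of p x] by (cases "s = 1") (simp_all add: add.commute)

lemma pf_same: "s \<in> {1, -1} \<Longrightarrow> x \<in> EF s p \<Longrightarrow> pf s p x = x"
  using sign_square[of s] by (simp add: pf_def EF_GE flip: scaleR_2) 

lemma pf_opposite: "s \<in> {1, -1} \<Longrightarrow> x \<in> EF s p \<Longrightarrow> pf (- s) p x = 0"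
  using sign_square[of s] by (simp add: pf_def EF_GE) 

lemma pf_add: "x \<in> fibre C p \<Longrightarrow> y \<in> fibre C p \<Longrightarrow> pf s p (x + y) = pf s p x + pf s p y"
  by (simp add: pf_def GE_add scaleR_add_right)

lemma pf_scaleR: "x \<in> fibre C p \<Longrightarrow> pf s p (c *\<^sub>R x) = c *\<^sub>R pf s p x"
  by (simp add: pf_def GE_scaleR scaleR_add_right mult.commute)

lemma pf_fibre: "x \<in> fibre C p \<Longrightarrow> pf s p x \<in> fibre C p"
  by (simp add: pf_def GE_fibre fibre_add fibre_scaleR)

lemma proj_section: "u \<in> \<Gamma> \<Longrightarrow> proj C G s u \<in> \<Gamma>"
proof -
  assume u: "u \<in> \<Gamma>"
  have "proj C G s u = (1 / 2) *\<^sub>R (u + s *\<^sub>R (\<lambda>p. GE p (u p)))"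
    by (simp add: proj_def fun_eq_iff)
  then show ?thesis using u GE_section(1)[OF u] by simp
qed

lemma g_EF:
  assumes "s \<in> {1, -1}" "x \<in> EF s p" "y \<in> EF s p"
  shows "g p (anchor C p x) (anchor C p y) = s * pairing C p x y"
proof -
  have "g p (anchor C p x) (anchor C p y) = G p x y"
    using induced assms unfolding induced_metric_def by blast
  then show ?thesis using EF_G[OF assms(2) EF_fibre[OF assms(3)]] by simp
qed

text \<open>Pairing x with E_s is s g of the anchors, hence 0, and pairing with the other eigenspace
  vanishes by orthogonality; so x is orthogonal to the whole fibre.\<close>

lemma anchor_EF_inj:
  assumes s: "s \<in> {1, -1}" and x: "x \<in> EF s p" and 0: "anchor C p x = 0"
  shows "x = 0"
proof (rule pairing_eqI[of _ p])
  show "x \<in> fibre C p" "0 \<in> fibre C p"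
    using EF_fibre[OF x] subspace_0[OF fibre_subspace] by auto
  fix w assume w: "w \<in> fibre C p"
  have ms: "- s \<in> {1, -1}" using s by auto
  have "w = pf s p w + pf (- s) p w" using pf_sum_sign[OF s] ..
  then have "pairing C p x w = pairing C p x (pf s p w) + pairing C p x (pf (- s) p w)"
    using pairing_bilin(2)[OF pf_fibre[OF w] pf_fibre[OF w] EF_fibre[OF x]] by metis
  also have "pairing C p x (pf (- s) p w) = 0"
    by (rule EF_orthogonal[OF s x pf_EF[OF ms w]])
  also have "pairing C p x (pf s p w) = s * g p (anchor C p x) (anchor C p (pf s p w))"
    using g_EF[OF s x pf_EF[OF s w]] sign_square[OF s] by (simp flip: mult.assoc)
  also have "g p (anchor C p x) (anchor C p (pf s p w)) = 0"
    using g_bilin(3)[OF anchor_TM anchor_TM anchor_TM, of x p x "pf s p w" 0] EF_fibre[OF x] pf_fibre[OF w] 0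
    by simp
  finally have "pairing C p x w = 0" by simp
  moreover have "pairing C p 0 w = 0"
    using pairing_bilin(3)[OF w w w, of 0] by simp
  ultimately show "pairing C p x w = pairing C p 0 w" by simp
qed

lemma EF_eqI:
  assumes s: "s \<in> {1, -1}" and x: "x \<in> EF s p" "y \<in> EF s p" and eq: "anchor C p x = anchor C p y"
  shows "x = y"
proof -
  have "x + (-1) *\<^sub>R y \<in> EF s p" by (intro subspace_add subspace_scale EF_subspace x)
  moreover have "anchor C p (x + (-1) *\<^sub>R y) = 0"
    by (simp only: anchor_bilin(1)[OF EF_fibre[OF x(1)] fibre_scaleR[OF EF_fibre[OF x(2)]]]
        anchor_bilin(2)[OF EF_fibre[OF x(2)] EF_fibre[OF x(2)]] eq) simp
  ultimately have "x + (-1) *\<^sub>R y = 0" by (rule anchor_EF_inj[OF s])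
  then show ?thesis by simp
qed

lemma g_eqI:
  assumes "x \<in> TM p" "y \<in> TM p" "\<And>z. z \<in> TM p \<Longrightarrow> g p x z = g p y z"
  shows "x = y"
proof -
  have "g p (x + (-1) *\<^sub>R y) z = 0" if z: "z \<in> TM p" for z
    unfolding g_bilin(1)[OF assms(1) subspace_scale[OF tangent_space_subspace assms(2)] z]
      g_bilin(3)[OF assms(2,2) z] using assms(3)[OF z] by simp
  moreover have "x + (-1) *\<^sub>R y \<in> TM p"
    by (intro subspace_add subspace_scale tangent_space_subspace assms)
  ultimately have "x + (-1) *\<^sub>R y = 0"
    using g_props(3) unfolding nondeg_on_def by blast
  then show ?thesis by simp
qed

text \<open>If \<open>v\<close> is the cotangent vector \<open>g(x, \<cdot>)\<close>, then \<open>\<pi> v = 0\<close> forces \<open>\<pi> v\<^sub>s = x / (2 s)\<close>.\<close>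

lemma cotangent_half:
  assumes s: "s \<in> {1, -1}" and x: "x \<in> TM p" and v: "v \<in> fibre C p"
    and vx: "\<And>w. w \<in> fibre C p \<Longrightarrow> pairing C p v w = g p x (anchor C p w) / 2"
  shows "anchor C p ((2 * s) *\<^sub>R pf s p v) = x"
proof -
  have ms: "- s \<in> {1, -1}" using s by auto
  have "lin_on (TM p) (g p x)"
    using g_props(1) x unfolding bilin_on_def by blast
  then have "v \<in> cotangent_in_E C p"
    unfolding cotangent_in_E_def using v vx by blast
  then have "anchor C p v = 0" using anchor_kernel by blast
  then have "anchor C p (pf s p v + pf (- s) p v) = 0"
    using pf_sum_sign[OF s] by simp
  then have an: "anchor C p (pf (- s) p v) = (-1) *\<^sub>R anchor C p (pf s p v)"
    unfolding anchor_bilin(1)[OF pf_fibre[OF v] pf_fibre[OF v]]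
    by (simp add: eq_neg_iff_add_eq_0 add.commute)
  note T = anchor_TM[OF pf_fibre[OF v]]
  \<comment> \<open>Only the component of v in E_t pairs with y in E_t, and there the scalar product
    is t g.\<close>
  have key: "g p x (anchor C p y) = 2 * t * g p (anchor C p (pf t p v)) (anchor C p y)"
    if t: "t \<in> {1, -1}" and y: "y \<in> EF t p" for t y
  proof -
    have mt: "- t \<in> {1, -1}" using t by auto
    have tt: "- (- t) = t" by simp
    have "g p x (anchor C p y) / 2 = pairing C p (pf t p v + pf (- t) p v) y"
      using vx[OF EF_fibre[OF y]] pf_sum_sign[OF t, of p v] by simp
    also have "\<dots> = pairing C p (pf t p v) y"
      unfolding pairing_bilin(1)[OF pf_fibre[OF v] pf_fibre[OF v] EF_fibre[OF y]]
      using EF_orthogonal[OF mt pf_EF[OF mt v]] y by simp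
    also have "\<dots> = t * g p (anchor C p (pf t p v)) (anchor C p y)"
      using g_EF[OF t pf_EF[OF t v] y] sign_square[OF t] by (simp flip: mult.assoc)
    finally show ?thesis by simp
  qed
  have eq: "anchor C p ((2 * s) *\<^sub>R pf s p v) = (2 * s) *\<^sub>R anchor C p (pf s p v)"
    by (rule anchor_bilin(2)[OF pf_fibre[OF v] pf_fibre[OF v]])
  show ?thesis
    unfolding eq
  proof (rule g_eqI[of _ p])
    show "(2 * s) *\<^sub>R anchor C p (pf s p v) \<in> TM p"
      by (rule subspace_scale[OF tangent_space_subspace T])
    show "x \<in> TM p" by (rule x)
    fix z assume "z \<in> TM p"
    then obtain w where w: "w \<in> fibre C p" "z = anchor C p w" using anchor_image by blast
    have z: "z = anchor C p (pf s p w) + anchor C p (pf (- s) p w)"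
      using anchor_bilin(1)[OF pf_fibre[OF w(1)] pf_fibre[OF w(1)], of s "- s"] pf_sum_sign[OF s, of p w] w(2)
      by simp
    note W = anchor_TM[OF pf_fibre[OF w(1)]]
    have 1: "g p x (anchor C p (pf s p w)) = 2 * s * g p (anchor C p (pf s p v)) (anchor C p (pf s p w))"
      by (rule key[OF s pf_EF[OF s w(1)]])
    \<comment> \<open>Two signs cancel: the one from -s in place of s, and the one in \<pi> v_-s = -
      \<pi> v_s. Hence both halves of z carry the same factor 2 s.\<close>
    have 2: "g p x (anchor C p (pf (- s) p w)) = 2 * s * g p (anchor C p (pf s p v)) (anchor C p (pf (- s) p w))"
      unfolding key[OF ms pf_EF[OF ms w(1)]] an g_bilin(3)[OF T T W] by simp
    have "g p ((2 * s) *\<^sub>R anchor C p (pf s p v)) z = 2 * s * g p (anchor C p (pf s p v)) z"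
      by (rule g_bilin(3)[OF T T \<open>z \<in> TM p\<close>])
    also have "\<dots> = g p x z"
      unfolding z g_bilin(2)[OF W W T] g_bilin(2)[OF W W x] 1 2 by (rule distrib_left)
    finally show "g p ((2 * s) *\<^sub>R anchor C p (pf s p v)) z = g p x z" .
  qed
qed

subsection \<open>Vector fields\<close>

lemma VF_TM: "X \<in> VF \<Longrightarrow> X p \<in> TM p"
  by (simp add: vfields_def)

lemma VF_apply: "X \<in> VF \<Longrightarrow> f \<in> CM \<Longrightarrow> vf_apply X f \<in> CM"
  by (simp add: vfields_def)

lemma VF_add [simp, intro]: "X \<in> VF \<Longrightarrow> Y \<in> VF \<Longrightarrow> X + Y \<in> VF"
proof -
  assume XY: "X \<in> VF" "Y \<in> VF"
  have "vf_apply (X + Y) f = vf_apply X f + vf_apply Y f" for f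
    by (simp add: vf_apply_def fun_eq_iff)
  then show ?thesis
    using XY by (simp add: vfields_def subspace_add[OF tangent_space_subspace])
qed

lemma VF_fmul [simp, intro]: "h \<in> CM \<Longrightarrow> X \<in> VF \<Longrightarrow> fmul h X \<in> VF"
proof -
  assume hX: "h \<in> CM" "X \<in> VF"
  have "vf_apply (fmul h X) f = h * vf_apply X f" for f
    by (simp add: vf_apply_def fmul_def fun_eq_iff)
  then show ?thesis
    using hX by (simp add: vfields_def fmul_def subspace_scale[OF tangent_space_subspace])
qed

lemma VF_zero [simp, intro]: "0 \<in> VF"
  by (auto simp: vfields_def subspace_0[OF tangent_space_subspace] vf_apply_def)

lemma VF_scaleR [simp, intro]: "X \<in> VF \<Longrightarrow> c *\<^sub>R X \<in> VF"
  using VF_fmul[OF Cinf_const, of X c] by (simp add: fmul_def scaleR_fun_def)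

lemma VF_minus [simp, intro]: "X \<in> VF \<Longrightarrow> - X \<in> VF"
  using VF_scaleR[of X "-1"] by simp

lemma VF_diff [simp, intro]: "X \<in> VF \<Longrightarrow> Y \<in> VF \<Longrightarrow> X - Y \<in> VF"
  using VF_add[OF _ VF_minus, of X Y] by simp

lemma VF_subspace: "subspace VF"
  unfolding subspace_def by auto

lemma VF_sum [intro]: "(\<And>i. i \<in> I \<Longrightarrow> X i \<in> VF) \<Longrightarrow> (\<Sum>i\<in>I. X i) \<in> VF"
  by (rule subspace_sum[OF VF_subspace])

lemma vf_apply_simps:
  assumes "X \<in> VF"
  shows "f \<in> CM \<Longrightarrow> h \<in> CM \<Longrightarrow> vf_apply X (f + h) = vf_apply X f + vf_apply X h"
    "f \<in> CM \<Longrightarrow> h \<in> CM \<Longrightarrow> vf_apply X (f - h) = vf_apply X f - vf_apply X h"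
    "f \<in> CM \<Longrightarrow> vf_apply X (- f) = - vf_apply X f"
    "f \<in> CM \<Longrightarrow> vf_apply X (c *\<^sub>R f) = c *\<^sub>R vf_apply X f"
    "f \<in> CM \<Longrightarrow> h \<in> CM \<Longrightarrow> vf_apply X (f * h) = vf_apply X f * h + f * vf_apply X h"
    "vf_apply X 0 = 0"
proof -
  note T = VF_TM[OF assms]
  show add: "f \<in> CM \<Longrightarrow> h \<in> CM \<Longrightarrow> vf_apply X (f + h) = vf_apply X f + vf_apply X h"
    using tangent_spaceD(2)[OF T] by (simp add: vf_apply_def fun_eq_iff)
  show "f \<in> CM \<Longrightarrow> h \<in> CM \<Longrightarrow> vf_apply X (f - h) = vf_apply X f - vf_apply X h"
    using tangent_diff[OF T] by (simp add: vf_apply_def fun_eq_iff)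
  show sc: "f \<in> CM \<Longrightarrow> vf_apply X (c *\<^sub>R f) = c *\<^sub>R vf_apply X f" for c
    using tangent_spaceD(3)[OF T, of f] by (simp add: vf_apply_def fun_eq_iff)
  show "f \<in> CM \<Longrightarrow> vf_apply X (- f) = - vf_apply X f"
    using sc[of "-1"] by simp
  show "f \<in> CM \<Longrightarrow> h \<in> CM \<Longrightarrow> vf_apply X (f * h) = vf_apply X f * h + f * vf_apply X h"
    using tangent_spaceD(4)[OF T] by (simp add: vf_apply_def fun_eq_iff algebra_simps)
  show "vf_apply X 0 = 0"
    using tangent_const[OF T, where c=0] by (simp add: vf_apply_def fun_eq_iff zero_fun_def)
qed

lemma vf_apply_left:
  "vf_apply (X + Y) f = vf_apply X f + vf_apply Y f" "vf_apply (X - Y) f = vf_apply X f - vf_apply Y f"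
  "vf_apply (c *\<^sub>R X) f = c *\<^sub>R vf_apply X f" "vf_apply (fmul h X) f = h * vf_apply X f"
  by (simp_all add: vf_apply_def fmul_def fun_eq_iff)

lemma VF_through:
  assumes "x \<in> TM p"
  shows "\<exists>X\<in>VF. X p = x"
proof -
  have "x \<in> anchor C p ` fibre C p" unfolding anchor_image by (rule assms)
  then obtain w where w: "w \<in> fibre C p" "anchor C p w = x" by (elim imageE) simp
  obtain u where u: "u \<in> \<Gamma>" "u p = w" using section_through[OF w(1)] by blast
  show ?thesis by (rule bexI[OF _ anch_VF[OF u(1)]]) (simp add: anch_def u w)
qed

subsection \<open>Lifts\<close>

text \<open>The functional g(X, \<pi> .) / 2 is represented by the cotangent field g(X, .), and by
  \<open>cotangent_half\<close> 2 s times its E_s part has anchor X. Surjectivity of \<pi>_s and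
  smoothness of its inverse are obtained together.\<close>

lemma lift_exists:
  assumes s: "s \<in> {1, -1}" and X: "X \<in> VF"
  shows "\<exists>u\<in>\<Gamma>. \<forall>p. u p \<in> EF s p \<and> anchor C p (u p) = X p"
proof -
  let ?L = "\<lambda>p w. g p (X p) (anchor C p w) / 2"
  have "lin_on (fibre C p) (?L p)" for p
    unfolding lin_on_def
    by (simp add: anchor_bilin g_bilin(2,4)[OF anchor_TM anchor_TM VF_TM[OF X]] add_divide_distrib)
  moreover have "(\<lambda>p. ?L p (w p)) \<in> CM" if "w \<in> \<Gamma>" for w
    using Cinf_scaleR[OF g_CM[OF X anch_VF[OF that]], of "1/2"]
    by (simp add: ev2_def anch_def scaleR_fun_def)
  ultimately obtain v where v: "v \<in> \<Gamma>" "\<And>p w. w \<in> fibre C p \<Longrightarrow> pairing C p (v p) w = ?L p w"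
    using section_of_functional[of ?L] by blast
  show ?thesis
  proof (intro bexI[of _ "(2 * s) *\<^sub>R proj C G s v"] allI conjI)
    show "(2 * s) *\<^sub>R proj C G s v \<in> \<Gamma>" using proj_section[OF v(1)] by simp
    show "((2 * s) *\<^sub>R proj C G s v) p \<in> EF s p" for p
      using pf_EF[OF s section_fibre[OF v(1)]] by (simp add: proj_pf subspace_scale[OF EF_subspace])
    show "anchor C p (((2 * s) *\<^sub>R proj C G s v) p) = X p" for p
      using cotangent_half[OF s VF_TM[OF X] section_fibre[OF v(1)] v(2)] by (simp add: proj_pf)
  qed
qed

lemma lift_eqI:
  assumes s: "s \<in> {1, -1}" and u: "\<And>p. u p \<in> EF s p" "\<And>p. anchor C p (u p) = X p"
  shows "lift C G s X = u"
proof
  fix p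
  show "lift C G s X p = u p"
    unfolding lift_def by (rule the_equality) (use u EF_eqI[OF s] in auto)
qed

lemma lift_props:
  assumes s: "s \<in> {1, -1}" and X: "X \<in> VF"
  shows "lift C G s X \<in> \<Gamma>" "lift C G s X p \<in> EF s p" "anch C (lift C G s X) = X"
proof -
  obtain u where u: "u \<in> \<Gamma>" "\<And>p. u p \<in> EF s p" "\<And>p. anchor C p (u p) = X p"
    using lift_exists[OF assms] by blast
  have "lift C G s X = u" by (rule lift_eqI[OF s u(2,3)])
  then show "lift C G s X \<in> \<Gamma>" "lift C G s X p \<in> EF s p" "anch C (lift C G s X) = X"
    using u by (simp_all add: anch_def)
qed

text \<open>The E_s component of u moved to TM by \<pi>_s. A section is determined by
  \<open>pj 1 u\<close> and \<open>pj (-1) u\<close>, and later computations take place in these two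
  vector fields.\<close>

definition pj :: "real \<Rightarrow> ('m \<Rightarrow> 'v) \<Rightarrow> 'm vfield" where
  "pj s u = anch C (proj C G s u)"

lemma pj_VF [simp, intro]: "u \<in> \<Gamma> \<Longrightarrow> pj s u \<in> VF"
  by (simp add: pj_def anch_VF proj_section)

lemma pj_apply: "pj s u p = anchor C p (pf s p (u p))"
  by (simp add: pj_def anch_def proj_pf)

lemma lift_pj: "s \<in> {1, -1} \<Longrightarrow> u \<in> \<Gamma> \<Longrightarrow> lift C G s (pj s u) = proj C G s u"
  by (rule lift_eqI) (simp_all add: proj_pf pf_EF section_fibre pj_apply)

lemma pj_lift:
  assumes "s \<in> {1, -1}" "X \<in> VF"
  shows "pj s (lift C G s X) = X" "pj (- s) (lift C G s X) = 0"
proof -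
  show "pj s (lift C G s X) = X"
    using pf_same[OF assms(1) lift_props(2)[OF assms]] lift_props(3)[OF assms]
    by (simp add: fun_eq_iff pj_apply anch_def)
  have "anchor C p 0 = 0" for p
    using anchor_bilin(2)[OF subspace_0[OF fibre_subspace] subspace_0[OF fibre_subspace], of p 0] by simp
  then show "pj (- s) (lift C G s X) = 0"
    using pf_opposite[OF assms(1) lift_props(2)[OF assms]] by (simp add: fun_eq_iff pj_apply)
qed

lemma pj_lift_1 [simp]: "X \<in> VF \<Longrightarrow> pj 1 (lift C G 1 X) = X" "X \<in> VF \<Longrightarrow> pj (-1) (lift C G 1 X) = 0"
    "X \<in> VF \<Longrightarrow> pj (-1) (lift C G (-1) X) = X" "X \<in> VF \<Longrightarrow> pj 1 (lift C G (-1) X) = 0"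
  using pj_lift[of 1 X] pj_lift[of "-1" X] by simp_all

lemma pj_add: "u \<in> \<Gamma> \<Longrightarrow> v \<in> \<Gamma> \<Longrightarrow> pj s (u + v) = pj s u + pj s v"
  by (simp add: fun_eq_iff pj_apply pf_add section_fibre anchor_bilin pf_fibre)

lemma pj_fmul: "u \<in> \<Gamma> \<Longrightarrow> pj s (fmul h u) = fmul h (pj s u)"
  by (rule ext) (simp add: pj_apply fmul_def pf_scaleR section_fibre anchor_scaleR pf_fibre)

lemma pj_scaleR: "u \<in> \<Gamma> \<Longrightarrow> pj s (c *\<^sub>R u) = c *\<^sub>R pj s u"
  by (rule ext) (simp add: pj_apply pf_scaleR section_fibre anchor_scaleR pf_fibre)

lemma pj_diff: "u \<in> \<Gamma> \<Longrightarrow> v \<in> \<Gamma> \<Longrightarrow> pj s (u - v) = pj s u - pj s v"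
  using pj_add[of u "(-1) *\<^sub>R v" s] pj_scaleR[of v s "-1"] by simp

lemma section_decompose: "u \<in> \<Gamma> \<Longrightarrow> u = lift C G 1 (pj 1 u) + lift C G (-1) (pj (-1) u)"
  by (simp add: lift_pj fun_eq_iff proj_pf pf_sum)

lemma section_eqI: "u \<in> \<Gamma> \<Longrightarrow> v \<in> \<Gamma> \<Longrightarrow> pj 1 u = pj 1 v \<Longrightarrow> pj (-1) u = pj (-1) v \<Longrightarrow> u = v"
  using section_decompose by metis

lemma anch_pj: "u \<in> \<Gamma> \<Longrightarrow> anch C u = pj 1 u + pj (-1) u"
  using anchor_bilin(1)[OF pf_fibre[OF section_fibre] pf_fibre[OF section_fibre]] pf_sum
  by (simp add: fun_eq_iff anch_def pj_apply) metis

lemma pair_pj: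
  assumes "u \<in> \<Gamma>" "w \<in> \<Gamma>"
  shows "pair C u w p = ev2 g (pj 1 u) (pj 1 w) p - ev2 g (pj (-1) u) (pj (-1) w) p"
proof -
  note F = section_fibre[OF assms(1), of p] section_fibre[OF assms(2), of p]
  have "pairing C p (u p) (w p) = pairing C p (pf 1 p (u p) + pf (-1) p (u p)) (pf 1 p (w p) + pf (-1) p (w p))"
    by (simp add: pf_sum)
  also have "\<dots> = pairing C p (pf 1 p (u p)) (pf 1 p (w p)) + pairing C p (pf (-1) p (u p)) (pf (-1) p (w p))"
    using EF_orthogonal[of 1 "pf 1 p (u p)" p "pf (-1) p (w p)"]
      EF_orthogonal[of "-1" "pf (-1) p (u p)" p "pf 1 p (w p)"] pf_EF[of 1] pf_EF[of "-1"] F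
    by (simp add: pairing_bilin pf_fibre fibre_add)
  finally show ?thesis
    using g_EF[of 1 "pf 1 p (u p)" p "pf 1 p (w p)"] g_EF[of "-1" "pf (-1) p (u p)" p "pf (-1) p (w p)"]
      pf_EF[of 1] pf_EF[of "-1"] F
    by (simp add: ev2_def pj_apply)
qed

lemma anchor_lift: "s \<in> {1, -1} \<Longrightarrow> X \<in> VF \<Longrightarrow> anchor C p (lift C G s X p) = X p"
  using lift_props(3)[of s X] by (metis anch_def)

lemma lift_add:
  assumes s: "s \<in> {1, -1}" and X: "X \<in> VF" "Y \<in> VF"
  shows "lift C G s (X + Y) = lift C G s X + lift C G s Y"
proof (rule lift_eqI[OF s])
  note l = lift_props(2)[OF s X(1)] lift_props(2)[OF s X(2)]
  show "(lift C G s X + lift C G s Y) p \<in> EF s p" for p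
    using subspace_add[OF EF_subspace l] by simp
  show "anchor C p ((lift C G s X + lift C G s Y) p) = (X + Y) p" for p
    using anchor_bilin(1)[OF EF_fibre EF_fibre, OF l] anchor_lift[OF s X(1)] anchor_lift[OF s X(2)] by simp
qed

lemma eigen_section_lift:
  assumes "s \<in> {1, -1}" "u \<in> eigen_sections C G s"
  shows "u = lift C G s (anch C u)" "u \<in> \<Gamma>" "anch C u \<in> VF"
proof -
  have u: "u \<in> \<Gamma>" "\<And>p. u p \<in> EF s p" using assms(2) by (auto simp: eigen_sections_def)
  show "u = lift C G s (anch C u)"
    by (rule lift_eqI[OF assms(1), symmetric]) (use u in \<open>auto simp: anch_def\<close>)
  show "u \<in> \<Gamma>" "anch C u \<in> VF" using u anch_VF by auto
qed

text \<open>Transported from sections of E: precompose T with \<open>pj 1\<close> and test it on the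
  lift of X to E_+, which vanishes at p together with X.\<close>

lemma VF_tensorial:
  fixes T :: "'m vfield \<Rightarrow> 'b::real_vector"
  assumes add: "\<And>X Y. X \<in> VF \<Longrightarrow> Y \<in> VF \<Longrightarrow> T (X + Y) = T X + T Y"
    and mul: "\<And>h X. h \<in> CM \<Longrightarrow> X \<in> VF \<Longrightarrow> T (fmul h X) = h p *\<^sub>R T X"
    and X: "X \<in> VF" "X p = 0"
  shows "T X = 0"
proof -
  have "lift C G 1 X p = 0"
    by (rule anchor_EF_inj[of 1 _ p]) (use lift_props(2,3)[of 1 X] X in \<open>auto simp: anch_def fun_eq_iff\<close>)
  then have "T (pj 1 (lift C G 1 X)) = 0"
    by (rule tensorial[where T="\<lambda>u. T (pj 1 u)", rotated 3])
      (use lift_props(1)[of 1 X] X(1) in \<open>auto simp: pj_add pj_fmul add mul\<close>)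
  then show ?thesis using X(1) by simp
qed

text \<open>Raising an index with g, reduced to the case of E: represent L after the anchor and keep
  the E_+ component. Pairing with the lift of Y to E_+ ignores the other component and returns
  L(Y).\<close>

lemma VF_of_functional:
  assumes lin: "\<And>p. lin_on (TM p) (L p)"
    and smooth: "\<And>Y. Y \<in> VF \<Longrightarrow> (\<lambda>p. L p (Y p)) \<in> CM"
  shows "\<exists>X\<in>VF. \<forall>Y\<in>VF. \<forall>p. ev2 g X Y p = L p (Y p)"
proof -
  have "lin_on (fibre C p) (\<lambda>w. L p (anchor C p w))" for p
    using lin[of p] anchor_TM[of _ p] anchor_bilin[of _ p] unfolding lin_on_def by simp
  moreover have "(\<lambda>p. L p (anchor C p (w p))) \<in> CM" if "w \<in> \<Gamma>" for w
    using smooth[OF anch_VF[OF that]] by (simp add: anch_def)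
  ultimately obtain x where x: "x \<in> \<Gamma>"
    "\<And>p w. w \<in> fibre C p \<Longrightarrow> pairing C p (x p) w = L p (anchor C p w)"
    using section_of_functional[of "\<lambda>p w. L p (anchor C p w)"] by blast
  have "ev2 g (pj 1 x) Y p = L p (Y p)" if Y: "Y \<in> VF" for Y p
  proof -
    note l = lift_props[of 1 Y]
    have "pair C x (lift C G 1 Y) p = ev2 g (pj 1 x) Y p - ev2 g (pj (-1) x) 0 p"
      using pair_pj[OF x(1) l(1), of p] Y by simp
    moreover have "ev2 g (pj (-1) x) 0 p = 0"
      using g_zero(1)[OF VF_TM[OF pj_VF[OF x(1)]]] by (simp add: ev2_def)
    moreover have "pair C x (lift C G 1 Y) p = L p (Y p)"
      using x(2)[OF section_fibre[OF l(1)]] anchor_lift[of 1 Y p] Y by (simp add: ev2_def)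
    ultimately show ?thesis by simp
  qed
  then show ?thesis by (intro bexI[OF _ pj_VF[OF x(1)]] ballI allI)
qed

end

context gen_metric
begin

subsection \<open>Traces in adapted frames\<close>

lemma TM_basis: "\<exists>b. is_basis_family (TM p) DIM('e) b"
proof -
  obtain B where B: "finite B" "independent B" "span B = TM p" "card B = DIM('e)"
    using tangent_basis[of p] by blast
  obtain b where b: "bij_betw b {0..<DIM('e)} B"
    using ex_bij_betw_nat_finite[OF B(1)] B(4) by auto
  then have "b ` {..<DIM('e)} = B" "inj_on b {..<DIM('e)}"
    by (simp_all add: bij_betw_def lessThan_atLeast0)
  then show ?thesis
    using B(2,3) unfolding is_basis_family_def by blast
qed

text \<open>The dual fields are constant linear combinations \<open>y\<^sub>i = \<Sum> c\<^sub>i\<^sub>j x\<^sub>j\<close> with \<open>c\<close> symmetric, so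
  that the two slots of a sum \<open>\<Sum> T x\<^sub>i y\<^sub>i\<close> can be exchanged for every \<open>\<real>\<close>-bilinear \<open>T\<close>.\<close>

definition dual_vf :: "'m \<Rightarrow> (nat \<Rightarrow> 'm vfield) \<Rightarrow> (nat \<Rightarrow> 'm vfield) \<Rightarrow> bool" where
  "dual_vf p x y \<longleftrightarrow> (\<forall>i. x i \<in> VF \<and> y i \<in> VF) \<and>
     (\<forall>v\<in>TM p. v = (\<Sum>i<DIM('e). g p v (y i p) *\<^sub>R x i p)) \<and>
     (\<forall>v\<in>TM p. v = (\<Sum>i<DIM('e). g p v (x i p) *\<^sub>R y i p)) \<and>
     (\<forall>i<DIM('e). \<forall>j<DIM('e). g p (y i p) (x j p) = (if i = j then 1 else 0)) \<and>
     (\<exists>c. (\<forall>i<DIM('e). \<forall>j<DIM('e). c i j = c j i) \<and> (\<forall>i<DIM('e). y i = (\<Sum>j<DIM('e). c i j *\<^sub>R x j)))"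

lemma dual_vf_exists: "\<exists>x y. dual_vf p x y"
proof -
  let ?n = "DIM('e)"
  obtain b where b: "is_basis_family (TM p) ?n b" using TM_basis by blast
  note bD = is_basis_familyD[OF b]
  let ?c = "inv_gram ?n (g p) b"
  let ?b' = "\<lambda>i. \<Sum>k<?n. ?c i k *\<^sub>R b k"
  note d = inv_gram_dual(2)[OF b g_props(1,3)]
  have b'T: "?b' i \<in> TM p" for i
    by (rule subspace_sum[OF bD(1)]) (simp add: subspace_scale[OF bD(1)] bD(2))
  \<comment> \<open>The inverse Gram matrix is the Gram matrix of the dual basis, hence symmetric;
    this yields the symmetric constants demanded by \<open>dual_vf\<close>.\<close>
  have gb: "g p (?b' i) (?b' j) = ?c j i" if ij: "i < ?n" "j < ?n" for i j
  proof -
    have "g p (?b' i) (?b' j) = (\<Sum>k<?n. ?c j k * g p (?b' i) (b k))"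
      using bilin_on_sum(2)[OF g_props(1) bD(1), of "{..<?n}" b "?b' i" "?c j"] bD(2) b'T by simp
    also have "\<dots> = (\<Sum>k<?n. if k = i then ?c j k else 0)"
      using d ij by (intro sum.cong refl) simp
    also have "\<dots> = ?c j i" using ij by simp
    finally show ?thesis .
  qed
  have csym: "?c i j = ?c j i" if "i < ?n" "j < ?n" for i j
    using gb[OF that] gb[OF that(2,1)] g_sym[OF b'T b'T, of i j] by simp
  define Q where "Q i X \<longleftrightarrow> X \<in> VF \<and> (i < ?n \<longrightarrow> X p = b i)" for i X
  have "\<exists>X. Q i X" for i
    using VF_through[OF bD(2), of i] VF_zero unfolding Q_def by (cases "i < ?n") blast+
  then obtain x where xQ: "\<And>i. Q i (x i)" using choice[of Q] by blast
  have x: "x i \<in> VF" "i < ?n \<Longrightarrow> x i p = b i" for i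
    using xQ[of i] by (simp_all add: Q_def)
  define y where "y i = (\<Sum>j<?n. ?c i j *\<^sub>R x j)" for i
  have y: "y i \<in> VF" "y i p = ?b' i" for i
    unfolding y_def using x by (auto simp: sum_fun_apply intro!: VF_sum)
  have res: "v = (\<Sum>i<?n. g p v (?b' i) *\<^sub>R b i)" "v = (\<Sum>i<?n. g p v (b i) *\<^sub>R ?b' i)" if "v \<in> TM p" for v
    by (rule dual_basis_resolution[OF b g_props[of p] _ _ that]; (rule b'T | rule d; assumption))+
  have "dual_vf p x y"
    unfolding dual_vf_def
  proof (intro conjI allI ballI impI)
    show "x i \<in> VF" "y i \<in> VF" for i using x y by auto
    show "v = (\<Sum>i<?n. g p v (y i p) *\<^sub>R x i p)" if "v \<in> TM p" for v
      using res(1)[OF that] x y by simp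
    show "v = (\<Sum>i<?n. g p v (x i p) *\<^sub>R y i p)" if "v \<in> TM p" for v
      using res(2)[OF that] x y by simp
    show "g p (y i p) (x j p) = (if i = j then 1 else 0)" if "i < ?n" "j < ?n" for i j
      using d[OF that] x that y by simp
    show "\<exists>c. (\<forall>i<?n. \<forall>j<?n. c i j = c j i) \<and> (\<forall>i<?n. y i = (\<Sum>j<?n. c i j *\<^sub>R x j))"
      using csym by (intro exI[of _ ?c]) (simp add: y_def)
  qed
  then show ?thesis by blast
qed

lemma dual_vfD:
  assumes "dual_vf p x y"
  shows "x i \<in> VF" "y i \<in> VF" "v \<in> TM p \<Longrightarrow> v = (\<Sum>i<DIM('e). g p v (y i p) *\<^sub>R x i p)"
    "v \<in> TM p \<Longrightarrow> v = (\<Sum>i<DIM('e). g p v (x i p) *\<^sub>R y i p)"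
    "i < DIM('e) \<Longrightarrow> j < DIM('e) \<Longrightarrow> g p (y i p) (x j p) = (if i = j then 1 else 0)"
  using assms unfolding dual_vf_def by blast+

text \<open>The condition under which T is the value at p of a tensor, so that its trace can be
  computed in any frame.\<close>

definition tens_TM :: "'m \<Rightarrow> ('m vfield \<Rightarrow> 'm vfield \<Rightarrow> real) \<Rightarrow> bool" where
  "tens_TM p T \<longleftrightarrow>
     (\<forall>X\<in>VF. \<forall>Y\<in>VF. \<forall>Z\<in>VF. T (X + Y) Z = T X Z + T Y Z \<and> T Z (X + Y) = T Z X + T Z Y) \<and>
     (\<forall>h\<in>CM. \<forall>X\<in>VF. \<forall>Y\<in>VF. T (fmul h X) Y = h p * T X Y \<and> T X (fmul h Y) = h p * T X Y)"

definition tens_E :: "'m \<Rightarrow> (('m \<Rightarrow> 'v) \<Rightarrow> ('m \<Rightarrow> 'v) \<Rightarrow> real) \<Rightarrow> bool" where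
  "tens_E p T \<longleftrightarrow>
     (\<forall>X\<in>\<Gamma>. \<forall>Y\<in>\<Gamma>. \<forall>Z\<in>\<Gamma>. T (X + Y) Z = T X Z + T Y Z \<and> T Z (X + Y) = T Z X + T Z Y) \<and>
     (\<forall>h\<in>CM. \<forall>X\<in>\<Gamma>. \<forall>Y\<in>\<Gamma>. T (fmul h X) Y = h p * T X Y \<and> T X (fmul h Y) = h p * T X Y)"

lemma fmul_const: "fmul (\<lambda>p. c) u = c *\<^sub>R u"
  by (simp add: fmul_def scaleR_fun_def)

lemma trace_TM_eq:
  assumes T: "tens_TM p T" and xy: "dual_vf p x y"
  shows "trace_TM (atlas C) g p T = (\<Sum>i<DIM('e). T (x i) (y i))"
proof -
  obtain b where b: "is_basis_family (TM p) DIM('e) b" using TM_basis by blast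
  have add: "T (X + Y) Z = T X Z + T Y Z" "T Z (X + Y) = T Z X + T Z Y"
    if "X \<in> VF" "Y \<in> VF" "Z \<in> VF" for X Y Z using T that unfolding tens_TM_def by blast+
  have mul: "T (fmul h X) Y = h p * T X Y" "T X (fmul h Y) = h p * T X Y"
    if "h \<in> CM" "X \<in> VF" "Y \<in> VF" for h X Y using T that unfolding tens_TM_def by blast+
  have sc: "T (c *\<^sub>R X) Y = c * T X Y" "T X (c *\<^sub>R Y) = c * T X Y" if "X \<in> VF" "Y \<in> VF" for c X Y
    using mul[OF Cinf_const that, of c] by (simp_all add: fmul_const)
  show ?thesis
  proof (rule metric_trace_eq[where F="TM" and \<beta>=g and p=p and S=VF and n="DIM('e)" and b=b])
    show "is_basis_family (TM p) DIM('e) b" "bilin_on (TM p) (g p)" "sym_on (TM p) (g p)"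
      "nondeg_on (TM p) (g p)" "subspace VF"
      by (fact b g_props VF_subspace)+
    show "X p \<in> TM p" if "X \<in> VF" for X by (rule VF_TM[OF that])
    show "\<exists>X\<in>VF. X p = v" if "v \<in> TM p" for v by (rule VF_through[OF that])
    show "bilin_on VF T"
      unfolding bilin_on_def lin_on_def using add sc by simp
    show "T X Y = 0" if "X \<in> VF" "Y \<in> VF" "X p = 0" for X Y
      by (rule VF_tensorial[where T="\<lambda>X. T X Y", OF _ _ that(1,3)]) (use that add mul in auto)
    show "T X Y = 0" if "X \<in> VF" "Y \<in> VF" "Y p = 0" for X Y
      by (rule VF_tensorial[where T="T X", OF _ _ that(2,3)]) (use that add mul in auto)
    show "x i \<in> VF" "y i \<in> VF" for i by (fact dual_vfD[OF xy])+
    show "v = (\<Sum>i<DIM('e). g p v (y i p) *\<^sub>R x i p)" if "v \<in> TM p" for v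
      by (rule dual_vfD(3)[OF xy that])
  qed
qed

lemma trace_E_resolution:
  assumes T: "tens_E p T" and x: "\<And>i. i \<in> I \<Longrightarrow> x i \<in> \<Gamma>" and y: "\<And>i. i \<in> I \<Longrightarrow> y i \<in> \<Gamma>"
    and res: "\<And>v. v \<in> fibre C p \<Longrightarrow> v = (\<Sum>i\<in>I. pairing C p v (y i p) *\<^sub>R x i p)"
  shows "trace_E C p T = (\<Sum>i\<in>I. T (x i) (y i))"
proof -
  obtain b where b: "is_basis_family (fibre C p) (rnk C) b" using fibre_basis by blast
  have add: "T (X + Y) Z = T X Z + T Y Z" "T Z (X + Y) = T Z X + T Z Y"
    if "X \<in> \<Gamma>" "Y \<in> \<Gamma>" "Z \<in> \<Gamma>" for X Y Z using T that unfolding tens_E_def by blast+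
  have mul: "T (fmul h X) Y = h p * T X Y" "T X (fmul h Y) = h p * T X Y"
    if "h \<in> CM" "X \<in> \<Gamma>" "Y \<in> \<Gamma>" for h X Y using T that unfolding tens_E_def by blast+
  have sc: "T (c *\<^sub>R X) Y = c * T X Y" "T X (c *\<^sub>R Y) = c * T X Y" if "X \<in> \<Gamma>" "Y \<in> \<Gamma>" for c X Y
    using mul[OF Cinf_const that, of c] by (simp_all add: fmul_const)
  show ?thesis
  proof (rule metric_trace_eq[where F="fibre C" and \<beta>="pairing C" and p=p and S=\<Gamma> and n="rnk C" and b=b])
    show "is_basis_family (fibre C p) (rnk C) b" "bilin_on (fibre C p) (pairing C p)"
      "sym_on (fibre C p) (pairing C p)" "nondeg_on (fibre C p) (pairing C p)" "subspace \<Gamma>"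
      by (fact b pairing_props sections_subspace)+
    show "X p \<in> fibre C p" if "X \<in> \<Gamma>" for X by (rule section_fibre[OF that])
    show "\<exists>X\<in>\<Gamma>. X p = v" if "v \<in> fibre C p" for v by (rule section_through[OF that])
    show "bilin_on \<Gamma> T"
      unfolding bilin_on_def lin_on_def using add sc by simp
    show "T X Y = 0" if "X \<in> \<Gamma>" "Y \<in> \<Gamma>" "X p = 0" for X Y
      by (rule tensorial[where T="\<lambda>X. T X Y", OF _ _ that(1,3)]) (use that add mul in auto)
    show "T X Y = 0" if "X \<in> \<Gamma>" "Y \<in> \<Gamma>" "Y p = 0" for X Y
      by (rule tensorial[where T="T X", OF _ _ that(2,3)]) (use that add mul in auto)
    show "x i \<in> \<Gamma>" "y i \<in> \<Gamma>" if "i \<in> I" for i by (fact x[OF that] y[OF that])+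
    show "v = (\<Sum>i\<in>I. pairing C p v (y i p) *\<^sub>R x i p)" if "v \<in> fibre C p" for v
      by (rule res[OF that])
  qed
qed

text \<open>The scalar product is -g on E_-, so the vector dual to the lift of x i to E_- is minus
  the lift of y i. This is the origin of the difference.\<close>

lemma trace_E_eq:
  assumes T: "tens_E p T" and xy: "dual_vf p x y"
  shows "trace_E C p T = (\<Sum>i<DIM('e). T (lift C G 1 (x i)) (lift C G 1 (y i)))
    - (\<Sum>i<DIM('e). T (lift C G (-1) (x i)) (lift C G (-1) (y i)))"
proof -
  note D = dual_vfD[OF xy]
  let ?n = "DIM('e)"
  let ?I = "{..<?n} \<times> {1, -1::real}"
  let ?x = "\<lambda>(i, s). lift C G s (x i)"
  let ?y = "\<lambda>(i, s). s *\<^sub>R lift C G s (y i)"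
  have L: "lift C G s (x i) \<in> \<Gamma>" "lift C G s (y i) \<in> \<Gamma>" if "s \<in> {1, -1}" for s i
    using lift_props(1)[OF that] D(1,2) by auto
  have sumI: "(\<Sum>z\<in>?I. f z) = (\<Sum>i<?n. f (i, 1)) + (\<Sum>i<?n. f (i, -1))" for f :: "nat \<times> real \<Rightarrow> 'b::ab_group_add"
  proof -
    have "(\<Sum>z\<in>?I. f z) = (\<Sum>i<?n. \<Sum>s\<in>{1, -1}. f (i, s))"
      unfolding sum.cartesian_product by simp
    then show ?thesis by (simp add: sum.distrib)
  qed
  have sc: "T X (c *\<^sub>R Y) = c * T X Y" if "X \<in> \<Gamma>" "Y \<in> \<Gamma>" for c X Y
    using T that Cinf_const unfolding tens_E_def by (metis fmul_const)
  have pfrep: "pf s p v = (\<Sum>i<?n. (s * pairing C p v (lift C G s (y i) p)) *\<^sub>R lift C G s (x i) p)"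
    if s: "s \<in> {1, -1}" and v: "v \<in> fibre C p" for s v
  proof (rule EF_eqI[OF s pf_EF[OF s v]])
    note lE = lift_props(2)[OF s D(1)] lift_props(2)[OF s D(2)]
    have ms: "- s \<in> {1, -1}" using s by auto
    show "(\<Sum>i<?n. (s * pairing C p v (lift C G s (y i) p)) *\<^sub>R lift C G s (x i) p) \<in> EF s p"
      using lE by (intro subspace_sum[OF EF_subspace] subspace_scale[OF EF_subspace])
    have c: "s * pairing C p v (lift C G s (y i) p) = g p (anchor C p (pf s p v)) (y i p)" for i
    proof -
      have "pairing C p v (lift C G s (y i) p) = pairing C p (pf s p v + pf (- s) p v) (lift C G s (y i) p)"
        by (simp only: pf_sum_sign[OF s])
      also have "\<dots> = pairing C p (pf s p v) (lift C G s (y i) p) + pairing C p (pf (- s) p v) (lift C G s (y i) p)"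
        by (rule pairing_bilin(1)[OF pf_fibre[OF v] pf_fibre[OF v] EF_fibre[OF lE(2)]])
      also have "pairing C p (pf (- s) p v) (lift C G s (y i) p) = 0"
        using EF_orthogonal[OF ms pf_EF[OF ms v]] lE(2)[of i p] by simp
      finally have "s * pairing C p v (lift C G s (y i) p) = s * pairing C p (pf s p v) (lift C G s (y i) p)"
        by simp
      also have "\<dots> = g p (anchor C p (pf s p v)) (anchor C p (lift C G s (y i) p))"
        by (rule g_EF[OF s pf_EF[OF s v] lE(2), symmetric])
      finally show ?thesis by (simp only: anchor_lift[OF s D(2)])
    qed
    have "anchor C p (\<Sum>i<?n. (s * pairing C p v (lift C G s (y i) p)) *\<^sub>R lift C G s (x i) p)
        = (\<Sum>i<?n. (s * pairing C p v (lift C G s (y i) p)) *\<^sub>R anchor C p (lift C G s (x i) p))"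
      by (rule lin_on_sum[OF anchor_lin fibre_subspace]) (rule EF_fibre[OF lE(1)])
    also have "\<dots> = (\<Sum>i<?n. g p (anchor C p (pf s p v)) (y i p) *\<^sub>R x i p)"
      by (simp only: c anchor_lift[OF s D(1)])
    also have "\<dots> = anchor C p (pf s p v)"
      by (rule D(3)[symmetric, OF anchor_TM[OF pf_fibre[OF v]]])
    finally show "anchor C p (pf s p v) =
        anchor C p (\<Sum>i<?n. (s * pairing C p v (lift C G s (y i) p)) *\<^sub>R lift C G s (x i) p)" ..
  qed
  have "trace_E C p T = (\<Sum>z\<in>?I. T (?x z) (?y z))"
  proof (rule trace_E_resolution[OF T])
    show "?x z \<in> \<Gamma>" "?y z \<in> \<Gamma>" if "z \<in> ?I" for z
      using that L by auto
    fix v assume v: "v \<in> fibre C p"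
    have "(\<Sum>z\<in>?I. pairing C p v (?y z p) *\<^sub>R ?x z p)
      = (\<Sum>i<?n. (1 * pairing C p v (lift C G 1 (y i) p)) *\<^sub>R lift C G 1 (x i) p)
      + (\<Sum>i<?n. ((-1) * pairing C p v (lift C G (-1) (y i) p)) *\<^sub>R lift C G (-1) (x i) p)"
    proof -
      have X: "pairing C p v (?y (i, s) p) = s * pairing C p v (lift C G s (y i) p)" if "s \<in> {1, -1}" for i s
        using pairing_bilin(4)[OF section_fibre[OF L(2)[OF that]] section_fibre[OF L(2)[OF that]] v] by simp
      show ?thesis unfolding sumI using X[of 1] X[of "-1"] by simp
    qed
    also have "\<dots> = pf 1 p v + pf (-1) p v"
      using pfrep[OF _ v, of 1] pfrep[OF _ v, of "-1"] by simp
    finally show "v = (\<Sum>z\<in>?I. pairing C p v (?y z p) *\<^sub>R ?x z p)"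
      by (simp only: pf_sum)
  qed
  also have "\<dots> = (\<Sum>i<?n. T (lift C G 1 (x i)) (1 *\<^sub>R lift C G 1 (y i)))
    + (\<Sum>i<?n. T (lift C G (-1) (x i)) ((-1) *\<^sub>R lift C G (-1) (y i)))"
    unfolding sumI by simp
  also have "\<dots> = (\<Sum>i<?n. T (lift C G 1 (x i)) (lift C G 1 (y i)))
    - (\<Sum>i<?n. T (lift C G (-1) (x i)) (lift C G (-1) (y i)))"
  proof -
    have "T (lift C G (-1) (x i)) ((-1) *\<^sub>R lift C G (-1) (y i)) = - T (lift C G (-1) (x i)) (lift C G (-1) (y i))" for i
      using sc[OF L(1)[of "-1" i] L(2)[of "-1" i], of "-1"] by simp
    then show ?thesis by (simp only: scaleR_one sum_negf diff_conv_add_uminus)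
  qed
  finally show ?thesis .
qed

lemma dual_vf_swap:
  assumes xy: "dual_vf p x y" and T: "\<And>X Y Z. X \<in> VF \<Longrightarrow> Y \<in> VF \<Longrightarrow> Z \<in> VF \<Longrightarrow> T (X + Y) Z = T X Z + T Y Z"
    "\<And>X Y Z. X \<in> VF \<Longrightarrow> Y \<in> VF \<Longrightarrow> Z \<in> VF \<Longrightarrow> T Z (X + Y) = T Z X + T Z Y"
    "\<And>c X Y. X \<in> VF \<Longrightarrow> Y \<in> VF \<Longrightarrow> T (c *\<^sub>R X) Y = c * T X Y"
    "\<And>c X Y. X \<in> VF \<Longrightarrow> Y \<in> VF \<Longrightarrow> T X (c *\<^sub>R Y) = c * (T X Y :: real)"
  shows "(\<Sum>i<DIM('e). T (y i) (x i)) = (\<Sum>i<DIM('e). T (x i) (y i))"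
proof -
  let ?n = "DIM('e)"
  obtain c where c: "\<And>i j. i < ?n \<Longrightarrow> j < ?n \<Longrightarrow> c i j = c j i" "\<And>i. i < ?n \<Longrightarrow> y i = (\<Sum>j<?n. c i j *\<^sub>R x j)"
    using xy unfolding dual_vf_def by blast
  note D = dual_vfD[OF xy]
  have b: "bilin_on VF T" unfolding bilin_on_def lin_on_def using T by simp
  have "(\<Sum>i<?n. T (y i) (x i)) = (\<Sum>i<?n. \<Sum>j<?n. c i j * T (x j) (x i))"
    using bilin_on_sum(1)[OF b VF_subspace, of "{..<?n}" x] D(1) c(2) by simp
  also have "\<dots> = (\<Sum>j<?n. \<Sum>i<?n. c i j * T (x j) (x i))" by (rule sum.swap)
  also have "\<dots> = (\<Sum>j<?n. \<Sum>i<?n. c j i * T (x j) (x i))"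
    by (intro sum.cong refl) (metis c(1) lessThan_iff)
  also have "\<dots> = (\<Sum>j<?n. T (x j) (y j))"
    using bilin_on_sum(2)[OF b VF_subspace, of "{..<?n}" x] D(1) c(2) by simp
  finally show ?thesis .
qed

end

section \<open>Levi-Civita calculus and the Dorfman bracket\<close>

locale courant_geometry = gen_metric C G g
  for C :: "('m::{t2_space,second_countable_topology}, 'e::euclidean_space, 'v::real_vector) courant"
    and G g +
  fixes nabla :: "'m vfield \<Rightarrow> 'm vfield \<Rightarrow> 'm vfield"
    and H :: "'m \<Rightarrow> 'm tvec \<Rightarrow> 'm tvec \<Rightarrow> 'm tvec \<Rightarrow> real"
  assumes levi: "levi_civita (atlas C) g nabla"
    and three: "induced_three_form C G g H"
begin

abbreviation "gg \<equiv> ev2 g"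
abbreviation "hh \<equiv> ev3 H"

lemma gg_add: 
  assumes "X \<in> VF" "Y \<in> VF" "Z \<in> VF"
  shows "gg (X + Y) Z p = gg X Z p + gg Y Z p" "gg Z (X + Y) p = gg Z X p + gg Z Y p"
  using g_bilin[OF VF_TM[OF assms(1)] VF_TM[OF assms(2)] VF_TM[OF assms(3)], of p] by (simp_all add: ev2_def)

lemma gg_scaleR:
  assumes "X \<in> VF" "Z \<in> VF"
  shows "gg (c *\<^sub>R X) Z p = c * gg X Z p" "gg Z (c *\<^sub>R X) p = c * gg Z X p"
  using g_bilin[OF VF_TM[OF assms(1)] VF_TM[OF assms(1)] VF_TM[OF assms(2)], of p] by (simp_all add: ev2_def)

lemma gg_minus:
  assumes "X \<in> VF" "Z \<in> VF"
  shows "gg (- X) Z p = - gg X Z p" "gg Z (- X) p = - gg Z X p"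
  using gg_scaleR[OF assms, of "-1" p] by simp_all

lemma gg_diff:
  assumes "X \<in> VF" "Y \<in> VF" "Z \<in> VF"
  shows "gg (X - Y) Z p = gg X Z p - gg Y Z p" "gg Z (X - Y) p = gg Z X p - gg Z Y p"
  using gg_add[OF assms(1) VF_minus[OF assms(2)] assms(3), of p] gg_minus[OF assms(2,3), of p] by simp_all

lemma gg_fmul:
  assumes "X \<in> VF" "Z \<in> VF"
  shows "gg (fmul h X) Z p = h p * gg X Z p" "gg Z (fmul h X) p = h p * gg Z X p"
  using g_bilin(3,4)[OF VF_TM[OF assms(1)] VF_TM[OF assms(1)] VF_TM[OF assms(2)], of p "h p"]
  by (simp_all add: ev2_def fmul_def)

lemma gg_zero: "X \<in> VF \<Longrightarrow> gg 0 X p = 0" "X \<in> VF \<Longrightarrow> gg X 0 p = 0"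
  using g_zero[OF VF_TM] by (simp_all add: ev2_def)

lemmas gg_simps = gg_add gg_scaleR gg_minus gg_diff gg_fmul gg_zero

lemma gg_sym: "X \<in> VF \<Longrightarrow> Y \<in> VF \<Longrightarrow> gg X Y p = gg Y X p"
  using g_sym[OF VF_TM VF_TM] by (simp add: ev2_def)

lemma VF_eqI:
  assumes "X \<in> VF" "Y \<in> VF" "\<And>Z p. Z \<in> VF \<Longrightarrow> gg X Z p = gg Y Z p"
  shows "X = Y"
proof
  fix p
  show "X p = Y p"
  proof (rule g_eqI[OF VF_TM[OF assms(1)] VF_TM[OF assms(2)]])
    fix z assume "z \<in> TM p"
    then obtain Z where Z: "Z \<in> VF" "Z p = z" using VF_through by blast
    show "g p (X p) z = g p (Y p) z" using assms(3)[OF Z(1), of p] Z(2) by (simp add: ev2_def)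
  qed
qed

lemma nab_VF [simp, intro]: "X \<in> VF \<Longrightarrow> Y \<in> VF \<Longrightarrow> nabla X Y \<in> VF"
  using levi unfolding levi_civita_def by blast

lemma nab_add:
  assumes "X \<in> VF" "Y \<in> VF" "Z \<in> VF"
  shows "nabla (X + Y) Z = nabla X Z + nabla Y Z" "nabla X (Y + Z) = nabla X Y + nabla X Z"
  using levi assms unfolding levi_civita_def by blast+

lemma nab_fmul:
  assumes "X \<in> VF" "Y \<in> VF" "f \<in> CM"
  shows "nabla (fmul f X) Y = fmul f (nabla X Y)"
    "nabla X (fmul f Y) = fmul (vf_apply X f) Y + fmul f (nabla X Y)"
  using levi assms unfolding levi_civita_def by blast+

lemma nab_scaleR:
  assumes "X \<in> VF" "Y \<in> VF"
  shows "nabla (c *\<^sub>R X) Y = c *\<^sub>R nabla X Y" "nabla X (c *\<^sub>R Y) = c *\<^sub>R nabla X Y"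
proof -
  show "nabla (c *\<^sub>R X) Y = c *\<^sub>R nabla X Y"
    using nab_fmul(1)[OF assms Cinf_const, of c] by (simp add: fmul_const)
  have "vf_apply X (\<lambda>p. c) = 0"
    using tangent_const[OF VF_TM[OF assms(1)]] by (simp add: vf_apply_def fun_eq_iff)
  then show "nabla X (c *\<^sub>R Y) = c *\<^sub>R nabla X Y"
    using nab_fmul(2)[OF assms Cinf_const, of c] by (simp add: fmul_const) (simp add: fmul_def zero_fun_def plus_fun_def)
qed

lemma nab_minus:
  assumes "X \<in> VF" "Y \<in> VF"
  shows "nabla (- X) Y = - nabla X Y" "nabla X (- Y) = - nabla X Y"
  using nab_scaleR[OF assms, of "-1"] by simp_all

lemma nab_diff:
  assumes "X \<in> VF" "Y \<in> VF" "Z \<in> VF"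
  shows "nabla (X - Y) Z = nabla X Z - nabla Y Z" "nabla X (Y - Z) = nabla X Y - nabla X Z"
  using nab_add[OF assms(1) VF_minus[OF assms(2)] assms(3)] nab_add(2)[OF assms(1,2) VF_minus[OF assms(3)]]
    nab_minus assms by simp_all

lemmas nab_simps = nab_add nab_scaleR nab_minus nab_diff

lemma lie_nab: "X \<in> VF \<Longrightarrow> Y \<in> VF \<Longrightarrow> lie_bracket X Y = nabla X Y - nabla Y X"
  using levi unfolding levi_civita_def by metis

lemma lie_VF [simp, intro]: "X \<in> VF \<Longrightarrow> Y \<in> VF \<Longrightarrow> lie_bracket X Y \<in> VF"
  by (simp add: lie_nab)

lemma nab_metric:
  assumes "X \<in> VF" "Y \<in> VF" "Z \<in> VF"
  shows "vf_apply X (gg Y Z) p = gg (nabla X Y) Z p + gg Y (nabla X Z) p"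
proof -
  have "vf_apply X (gg Y Z) = gg (nabla X Y) Z + gg Y (nabla X Z)"
    using levi assms unfolding levi_civita_def by blast
  then show ?thesis by simp
qed

subsection \<open>The three-form\<close>

lemma three_form: "three_form (atlas C) H"
  using three unfolding induced_three_form_def closed_three_form_def by blast

lemma hh_CM: "X \<in> VF \<Longrightarrow> Y \<in> VF \<Longrightarrow> Z \<in> VF \<Longrightarrow> hh X Y Z \<in> CM"
  using three_form unfolding three_form_def by blast

lemma H_bilin: "x \<in> TM p \<Longrightarrow> bilin_on (TM p) (H p x)"
  using three_form unfolding three_form_def by blast

lemma H_skew: "x \<in> TM p \<Longrightarrow> y \<in> TM p \<Longrightarrow> z \<in> TM p \<Longrightarrow> H p x y z = - H p y x z"
  "x \<in> TM p \<Longrightarrow> y \<in> TM p \<Longrightarrow> z \<in> TM p \<Longrightarrow> H p x y z = - H p x z y"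
  using three_form unfolding three_form_def by blast+

lemma hh_skew:
  assumes "X \<in> VF" "Y \<in> VF" "Z \<in> VF"
  shows "hh X Y Z p = - hh Y X Z p" "hh X Y Z p = - hh X Z Y p" "hh X Y Z p = hh Y Z X p"
  using H_skew[OF VF_TM[OF assms(1)] VF_TM[OF assms(2)] VF_TM[OF assms(3)], of p]
    H_skew[OF VF_TM[OF assms(2)] VF_TM[OF assms(1)] VF_TM[OF assms(3)], of p] by (simp_all add: ev3_def)

lemma hh_linear3:
  assumes "X \<in> VF" "Y \<in> VF" "Z \<in> VF" "W \<in> VF"
  shows "hh X Y (Z + W) p = hh X Y Z p + hh X Y W p" "hh X Y (c *\<^sub>R Z) p = c * hh X Y Z p"
    "hh X Y (fmul f Z) p = f p * hh X Y Z p"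
  using bilin_onD[OF H_bilin[OF VF_TM[OF assms(1)]] VF_TM[OF assms(3)] VF_TM[OF assms(4)] VF_TM[OF assms(2)], of p]
  by (simp_all add: ev3_def fmul_def)

lemma hh_linear:
  assumes "X \<in> VF" "Y \<in> VF" "Z \<in> VF" "W \<in> VF"
  shows "hh X (Z + W) Y p = hh X Z Y p + hh X W Y p" "hh X (c *\<^sub>R Z) Y p = c * hh X Z Y p"
    "hh X (fmul f Z) Y p = f p * hh X Z Y p"
    "hh (Z + W) X Y p = hh Z X Y p + hh W X Y p" "hh (c *\<^sub>R Z) X Y p = c * hh Z X Y p"
    "hh (fmul f Z) X Y p = f p * hh Z X Y p"
proof -
  have rot1: "hh X Z Y p = hh Y X Z p" if "Z \<in> VF" for Z
    using hh_skew(3)[OF assms(2,1) that, of p] by simp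
  have rot2: "hh Z X Y p = hh X Y Z p" if "Z \<in> VF" for Z
    using hh_skew(3)[OF that assms(1,2), of p] by simp
  have c: "hh X Y (fmul f Z) p = f p * hh X Y Z p" "hh Y X (fmul f Z) p = f p * hh Y X Z p"
    if "Z \<in> VF" for f Z
    using hh_linear3(3)[OF assms(1,2) that that] hh_linear3(3)[OF assms(2,1) that that]
    by simp_all
  have m: "fmul f Z p \<in> TM p" if "Z \<in> VF" for f Z
    using subspace_scale[OF tangent_space_subspace VF_TM[OF that]] by (simp add: fmul_def)
  show "hh X (Z + W) Y p = hh X Z Y p + hh X W Y p" "hh X (c *\<^sub>R Z) Y p = c * hh X Z Y p"
    using assms hh_linear3[OF assms(2,1) assms(3,4)] by (simp_all add: rot1)
  show "hh (Z + W) X Y p = hh Z X Y p + hh W X Y p" "hh (c *\<^sub>R Z) X Y p = c * hh Z X Y p"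
    using assms hh_linear3[OF assms(1,2) assms(3,4)] by (simp_all add: rot2)
  have "hh X (fmul f Z) Y p = - hh X Y (fmul f Z) p"
    unfolding ev3_def by (rule H_skew(2)[OF VF_TM[OF assms(1)] m[OF assms(3)] VF_TM[OF assms(2)]])
  then show 1: "hh X (fmul f Z) Y p = f p * hh X Z Y p"
    unfolding c(1)[OF assms(3)] hh_skew(2)[OF assms(1,3,2)] by linarith
  have "hh (fmul f Z) X Y p = - hh X (fmul f Z) Y p"
    unfolding ev3_def by (rule H_skew(1)[OF m[OF assms(3)] VF_TM[OF assms(1)] VF_TM[OF assms(2)]])
  then show "hh (fmul f Z) X Y p = f p * hh Z X Y p"
    unfolding 1 hh_skew(1)[OF assms(3,1,2)] by linarith
qed

definition Hs :: "'m vfield \<Rightarrow> 'm vfield \<Rightarrow> 'm vfield" where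
  "Hs X Y = (SOME W. W \<in> VF \<and> (\<forall>Z\<in>VF. \<forall>p. gg W Z p = hh X Y Z p))"

lemma Hs_props:
  assumes "X \<in> VF" "Y \<in> VF"
  shows Hs_VF: "Hs X Y \<in> VF" and gg_Hs: "\<And>Z p. Z \<in> VF \<Longrightarrow> gg (Hs X Y) Z p = hh X Y Z p"
    and gg_Hs': "\<And>Z p. Z \<in> VF \<Longrightarrow> gg Z (Hs X Y) p = hh X Y Z p"
proof -
  have "\<exists>W\<in>VF. \<forall>Z\<in>VF. \<forall>p. gg W Z p = H p (X p) (Y p) (Z p)"
  proof (rule VF_of_functional)
    show "lin_on (TM p) (H p (X p) (Y p))" for p
      using H_bilin[OF VF_TM[OF assms(1)]] VF_TM[OF assms(2)] unfolding bilin_on_def by blast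
    show "(\<lambda>p. H p (X p) (Y p) (Z p)) \<in> CM" if "Z \<in> VF" for Z
      using hh_CM[OF assms that] by (simp add: ev3_def)
  qed
  then have "\<exists>W. W \<in> VF \<and> (\<forall>Z\<in>VF. \<forall>p. gg W Z p = hh X Y Z p)"
    by (auto simp: ev3_def)
  then have *: "Hs X Y \<in> VF \<and> (\<forall>Z\<in>VF. \<forall>p. gg (Hs X Y) Z p = hh X Y Z p)"
    unfolding Hs_def by (rule someI_ex)
  then show "Hs X Y \<in> VF" by blast
  show 1: "gg (Hs X Y) Z p = hh X Y Z p" if "Z \<in> VF" for Z p
    using * that by blast
  show "gg Z (Hs X Y) p = hh X Y Z p" if "Z \<in> VF" for Z p
    using 1[OF that] gg_sym[of Z "Hs X Y" p] * that by simp
qed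

declare Hs_VF [simp, intro]

subsection \<open>The Dorfman bracket in terms of the Levi-Civita connection\<close>

lemma proj_props:
  assumes "s \<in> {1, -1}" "u \<in> \<Gamma>"
  shows "pj s (proj C G s u) = pj s u" "pj (- s) (proj C G s u) = 0" "pj s (proj C G (- s) u) = 0"
proof -
  have ms: "- s \<in> {1, -1}" using assms(1) by auto
  show "pj s (proj C G s u) = pj s u" "pj (- s) (proj C G s u) = 0"
    unfolding lift_pj[OF assms, symmetric] by (rule pj_lift[OF assms(1) pj_VF[OF assms(2)]])+
  show "pj s (proj C G (- s) u) = 0"
    using pj_lift(2)[OF ms pj_VF[OF assms(2)], of "- s"] lift_pj[OF ms assms(2)] by simp
qed

text \<open>The one-form part of the twisted bracket of X + g(X', .) and Y + g(Y', .), evaluated on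
  Z, after the torsion-free nabla has replaced all Lie brackets. X' = u_+ - u_- is the vector field
  whose metric dual is the form part of \<phi>(u).\<close>

definition dorf_form :: "('m \<Rightarrow> 'v) \<Rightarrow> ('m \<Rightarrow> 'v) \<Rightarrow> 'm vfield \<Rightarrow> 'm \<Rightarrow> real" where
  "dorf_form u v Z p = (let X = anch C u; Y = anch C v; X' = pj 1 u - pj (-1) u; Y' = pj 1 v - pj (-1) v in
     gg (nabla X Y') Z p + gg Y' (nabla Z X) p - gg (nabla Y X') Z p + gg (nabla Z X') Y p + hh X Y Z p)"

text \<open>The vector part of \<phi>(w) is w_+ + w_- and its form part is dual to w_+ - w_-, so the
  components of the bracket are half the sum and half the difference of the two parts.\<close>

lemma dorfman_pj:
  assumes u: "u \<in> \<Gamma>" and v: "v \<in> \<Gamma>" and Z: "Z \<in> VF" and s: "s \<in> {1, -1}"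
  shows "gg (pj s (dorfman C u v)) Z p =
    (1 / 2) * (gg (lie_bracket (anch C u) (anch C v)) Z p + s * dorf_form u v Z p)"
proof -
  let ?d = "dorfman C u v"
  let ?X = "anch C u" and ?Y = "anch C v" and ?X' = "pj 1 u - pj (-1) u" and ?Y' = "pj 1 v - pj (-1) v"
  have d: "?d \<in> \<Gamma>" by (rule dorfman_section[OF u v])
  note VFs = anch_VF[OF u] anch_VF[OF v] VF_diff[OF pj_VF[OF u, of 1] pj_VF[OF u, of "-1"]]
    VF_diff[OF pj_VF[OF v, of 1] pj_VF[OF v, of "-1"]]
    pj_VF[OF u] pj_VF[OF v] pj_VF[OF d] Z
  have ph: "fst (phi C G g ?d) = fst (H_bracket H (phi C G g u) (phi C G g v))"
    "snd (phi C G g ?d) Z = snd (H_bracket H (phi C G g u) (phi C G g v)) Z"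
    using three u v Z unfolding induced_three_form_def by blast+
  have form: "(\<lambda>Z. gg (pj 1 w) Z - gg (pj (-1) w) Z) W = gg (pj 1 w - pj (-1) w) W" if "w \<in> \<Gamma>" "W \<in> VF" for w W
    using that by (simp add: fun_eq_iff gg_diff)
  have phi: "phi C G g w = (anch C w, \<lambda>Z. gg (pj 1 w) Z - gg (pj (-1) w) Z)" for w
    by (simp add: phi_def pj_def)
  have 1: "pj 1 ?d + pj (-1) ?d = lie_bracket ?X ?Y"
    using ph(1) anch_pj[OF d] by (simp add: phi H_bracket_def)
  have 2: "gg (pj 1 ?d) Z p - gg (pj (-1) ?d) Z p = dorf_form u v Z p"
  proof -
    have "gg (pj 1 ?d) Z - gg (pj (-1) ?d) Z =
      (vf_apply ?X (gg ?Y' Z) - gg ?Y' (lie_bracket ?X Z))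
      - (vf_apply ?Y (gg ?X' Z) - vf_apply Z (gg ?X' ?Y) - gg ?X' (lie_bracket ?Y Z)) + hh ?X ?Y Z"
      using ph(2) form[OF v lie_VF[OF VFs(1) Z]] form[OF v Z] form[OF u Z] form[OF u VFs(2)]
        form[OF u lie_VF[OF VFs(2) Z]]
      by (simp add: phi H_bracket_def lie_form_def d_form_def)
    then have "gg (pj 1 ?d) Z p - gg (pj (-1) ?d) Z p =
      (vf_apply ?X (gg ?Y' Z) - gg ?Y' (lie_bracket ?X Z)
      - (vf_apply ?Y (gg ?X' Z) - vf_apply Z (gg ?X' ?Y) - gg ?X' (lie_bracket ?Y Z)) + hh ?X ?Y Z) p"
      by (metis minus_apply)
    also have "\<dots> = dorf_form u v Z p"
      using VFs(1-4) Z gg_sym[OF VFs(3) nab_VF[OF Z VFs(2)], of p]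
      by (simp add: nab_metric[OF VFs(1) VFs(4) Z] nab_metric[OF VFs(2) VFs(3) Z] nab_metric[OF Z VFs(3) VFs(2)]
          dorf_form_def Let_def lie_nab gg_diff(2)[OF nab_VF nab_VF])
    finally show ?thesis .
  qed
  have 3: "gg (pj 1 ?d) Z p + gg (pj (-1) ?d) Z p = gg (lie_bracket ?X ?Y) Z p"
    using gg_add(1)[OF pj_VF[OF d, of 1] pj_VF[OF d, of "-1"] Z, of p] 1 by simp
  show ?thesis
    using s 2 3 by auto
qed

subsection \<open>The connections of the canonical construction\<close>

text \<open>\<open>D_tilde\<close> on M. Along E_s it is nabla by definition; along E_-s the mixed
  bracket turns out to be nabla plus (s/2) H, so nabla is taken along the full anchor and H sees
  \<open>pj (- s) u\<close> only.\<close>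

definition Dt :: "real \<Rightarrow> ('m \<Rightarrow> 'v) \<Rightarrow> ('m \<Rightarrow> 'v) \<Rightarrow> 'm vfield" where
  "Dt s u v = nabla (anch C u) (pj s v) + (s / 2) *\<^sub>R Hs (pj (- s) u) (pj s v)"

text \<open>The torsion of \<open>D_tilde\<close> is -(1/2) H on pure triples. Subtracting a third
  of it adds H/6 to the scalar product with w, and dividing by the sign of the scalar product on E_s
  gives s/6.\<close>

definition D0 :: "real \<Rightarrow> ('m \<Rightarrow> 'v) \<Rightarrow> ('m \<Rightarrow> 'v) \<Rightarrow> 'm vfield" where
  "D0 s u v = Dt s u v + (s / 6) *\<^sub>R Hs (pj s u) (pj s v)"

lemma Dt_VF [simp, intro]: "u \<in> \<Gamma> \<Longrightarrow> v \<in> \<Gamma> \<Longrightarrow> Dt s u v \<in> VF"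
  by (simp add: Dt_def anch_VF)

lemma D0_VF [simp, intro]: "u \<in> \<Gamma> \<Longrightarrow> v \<in> \<Gamma> \<Longrightarrow> D0 s u v \<in> VF"
  by (simp add: D0_def)

text \<open>For arguments of opposite type the form parts are -s X and s Y. The terms with nabla
  along Z then cancel, and the remaining form part s (nabla_X Y + nabla_Y X) + H combines with
  [X, Y] to twice the right-hand side.\<close>

lemma dorfman_mixed:
  assumes u: "u \<in> \<Gamma>" and v: "v \<in> \<Gamma>" and s: "s \<in> {1, -1}"
  shows "pj s (dorfman C (proj C G (- s) u) (proj C G s v)) =
    nabla (pj (- s) u) (pj s v) + (s / 2) *\<^sub>R Hs (pj (- s) u) (pj s v)"
proof (rule VF_eqI)
  have ms: "- s \<in> {1, -1}" using s by auto
  let ?u = "proj C G (- s) u" and ?v = "proj C G s v"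
  note pu = proj_section[OF u, of "- s"] and pv = proj_section[OF v, of s]
  note P = proj_props[OF ms u] proj_props[OF s v]
  let ?X = "pj (- s) u" and ?Y = "pj s v"
  have an: "anch C ?u = ?X" "anch C ?v = ?Y"
    using anch_pj[OF pu] anch_pj[OF pv] P s by auto
  have di: "pj 1 ?u - pj (-1) ?u = (- s) *\<^sub>R ?X" "pj 1 ?v - pj (-1) ?v = s *\<^sub>R ?Y"
    using P s by auto
  show "pj s (dorfman C ?u ?v) \<in> VF" using dorfman_section[OF pu pv] by simp
  show "nabla ?X ?Y + (s / 2) *\<^sub>R Hs ?X ?Y \<in> VF" using u v by simp
  fix Z p assume Z: "Z \<in> VF"
  have ss: "s * (s * x) = x" for x using sign_square[OF s] by (simp flip: mult.assoc)
  show "gg (pj s (dorfman C ?u ?v)) Z p = gg (nabla ?X ?Y + (s / 2) *\<^sub>R Hs ?X ?Y) Z p"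
    unfolding dorfman_pj[OF pu pv Z s] dorf_form_def Let_def an di
    using u v Z gg_sym[OF nab_VF[OF Z pj_VF[OF u]] pj_VF[OF v], of "- s" s p]
    by (simp add: nab_simps gg_simps lie_nab gg_Hs) (simp add: algebra_simps ss)
qed

lemma D_tilde_eq:
  assumes u: "u \<in> \<Gamma>" and v: "v \<in> \<Gamma>"
  shows "D_tilde C G nabla u v = lift C G 1 (Dt 1 u v) + lift C G (-1) (Dt (-1) u v)"
proof -
  have pl: "proj C G s w = lift C G s (pj s w)" if "s \<in> {1, -1}" "w \<in> \<Gamma>" for s w
    using lift_pj[OF that] ..
  have ds: "dorfman C (proj C G t u) (proj C G s v) \<in> \<Gamma>" for s t
    by (rule dorfman_section[OF proj_section[OF u] proj_section[OF v]])
  have Dts: "Dt s u v = nabla (pj s u) (pj s v) + pj s (dorfman C (proj C G (- s) u) (proj C G s v))"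
    if "s \<in> {1, -1}" for s
    using dorfman_mixed[OF u v that] u v anch_pj[OF u] that by (auto simp: Dt_def nab_add add_ac)
  have L: "lift C G s (Dt s u v) = lift C G s (nabla (pj s u) (pj s v)) + proj C G s (dorfman C (proj C G (- s) u) (proj C G s v))"
    if "s \<in> {1, -1}" for s
    unfolding Dts[OF that] pl[OF that ds]
    by (rule lift_add[OF that nab_VF[OF pj_VF[OF u] pj_VF[OF v]] pj_VF[OF ds]])
  have "D_tilde C G nabla u v = (lift C G 1 (nabla (pj 1 u) (pj 1 v)) + proj C G (-1) (dorfman C (proj C G 1 u) (proj C G (-1) v)))
    + (lift C G (-1) (nabla (pj (-1) u) (pj (-1) v)) + proj C G 1 (dorfman C (proj C G (-1) u) (proj C G 1 v)))"
    by (simp add: D_tilde_def pj_def)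
  then show ?thesis using L[of 1] L[of "-1"] by (simp add: add_ac)
qed

text \<open>The nabla terms cancel throughout. On mixed triples the H of \<open>Dt\<close> cancels
  the H of the bracket; on pure triples \<open>Dt\<close> contains no H and the bracket leaves
  -(1/2) H.\<close>

lemma torsion_D_tilde:
  assumes u: "u \<in> \<Gamma>" and v: "v \<in> \<Gamma>" and w: "w \<in> \<Gamma>"
  shows "torsion C (D_tilde C G nabla) u v w p =
    - (1 / 2) * (hh (pj 1 u) (pj 1 v) (pj 1 w) p + hh (pj (-1) u) (pj (-1) v) (pj (-1) w) p)"
proof -
  have T: "D_tilde C G nabla a b \<in> \<Gamma>" "pj 1 (D_tilde C G nabla a b) = Dt 1 a b"
    "pj (-1) (D_tilde C G nabla a b) = Dt (-1) a b" if "a \<in> \<Gamma>" "b \<in> \<Gamma>" for a b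
    unfolding D_tilde_eq[OF that] using that lift_props(1)[of 1] lift_props(1)[of "-1"]
    by (simp_all add: pj_add)
  note d = dorfman_section[OF u v]
  note an = anch_pj[OF u] anch_pj[OF v] anch_pj[OF w]
  note VFs = pj_VF[OF u] pj_VF[OF v] pj_VF[OF w]
  have gs: "gg (pj r v) (nabla (pj a w) (pj b u)) p = gg (nabla (pj a w) (pj b u)) (pj r v) p" for r a b
    by (rule gg_sym[OF VFs(2) nab_VF[OF VFs(3,1)]])
  have h1: "hh (pj a v) (pj b u) (pj c w) p = - hh (pj b u) (pj a v) (pj c w) p" for a b c
    by (rule hh_skew(1)[OF VFs(2,1,3)])
  have h2: "hh (pj a w) (pj b u) (pj c v) p = hh (pj b u) (pj c v) (pj a w) p" for a b c
    by (rule hh_skew(3)[OF VFs(3,1,2)])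
  have "torsion C (D_tilde C G nabla) u v w p =
    gg (Dt 1 u v - Dt 1 v u - pj 1 (dorfman C u v)) (pj 1 w) p
    - gg (Dt (-1) u v - Dt (-1) v u - pj (-1) (dorfman C u v)) (pj (-1) w) p
    + gg (Dt 1 w u) (pj 1 v) p - gg (Dt (-1) w u) (pj (-1) v) p"
    using T d u v w by (simp add: torsion_def pair_pj pj_diff section_diff)
  also have "\<dots> = - (1 / 2) * (hh (pj 1 u) (pj 1 v) (pj 1 w) p + hh (pj (-1) u) (pj (-1) v) (pj (-1) w) p)"
    using VFs d
    by (simp add: gg_simps dorfman_pj[OF u v] dorf_form_def Let_def an Dt_def nab_simps lie_nab gg_Hs
        hh_linear hh_linear3 gs h1 h2) (simp add: field_simps)
  finally show ?thesis .
qed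

lemma pair_lift_sum:
  assumes "P \<in> VF" "Q \<in> VF" "w \<in> \<Gamma>"
  shows "pair C (lift C G 1 P + lift C G (-1) Q) w p = gg P (pj 1 w) p - gg Q (pj (-1) w) p"
proof -
  have L: "lift C G 1 P \<in> \<Gamma>" "lift C G (-1) Q \<in> \<Gamma>"
    using lift_props(1)[of 1 P] lift_props(1)[of "-1" Q] assms by auto
  show ?thesis using assms L by (simp add: pair_pj pj_add)
qed

lemma pair_eqI:
  assumes "x \<in> \<Gamma>" "y \<in> \<Gamma>" "\<And>w p. w \<in> \<Gamma> \<Longrightarrow> pair C x w p = pair C y w p"
  shows "x = y"
proof
  fix p
  show "x p = y p"
  proof (rule pairing_eqI[OF section_fibre[OF assms(1)] section_fibre[OF assms(2)]])
    fix w assume "w \<in> fibre C p"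
    then obtain W where W: "W \<in> \<Gamma>" "W p = w" using section_through by blast
    show "pairing C p (x p) w = pairing C p (y p) w"
      using assms(3)[OF W(1), of p] W(2) by (simp add: ev2_def)
  qed
qed

lemma D_zero_eq:
  assumes u: "u \<in> \<Gamma>" and v: "v \<in> \<Gamma>"
  shows "D_zero C G nabla u v = lift C G 1 (D0 1 u v) + lift C G (-1) (D0 (-1) u v)"
proof -
  let ?x = "lift C G 1 (D0 1 u v) + lift C G (-1) (D0 (-1) u v)"
  let ?P = "\<lambda>x. x \<in> \<Gamma> \<and> (\<forall>w\<in>\<Gamma>. pair C x w =
        pair C (D_tilde C G nabla u v) w - (1 / 3) *\<^sub>R torsion C (D_tilde C G nabla) u v w)"
  have x: "?x \<in> \<Gamma>"
    using lift_props(1)[of 1] lift_props(1)[of "-1"] u v by simp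
  have "pair C ?x w p = pair C (D_tilde C G nabla u v) w p - (1 / 3) * torsion C (D_tilde C G nabla) u v w p"
    if w: "w \<in> \<Gamma>" for w p
  proof -
    note VFs = pj_VF[OF u] pj_VF[OF v] pj_VF[OF w]
    show ?thesis
      unfolding D_tilde_eq[OF u v] pair_lift_sum[OF D0_VF[OF u v] D0_VF[OF u v] w]
        pair_lift_sum[OF Dt_VF[OF u v] Dt_VF[OF u v] w] torsion_D_tilde[OF u v w]
      using u v VFs by (simp add: D0_def gg_simps gg_Hs) (simp add: field_simps)?
  qed
  then have P: "?P ?x" using x by (auto simp: fun_eq_iff)
  show ?thesis
    unfolding D_zero_def
  proof (rule the_equality[of ?P, OF P])
    fix y assume y: "?P y"
    show "y = ?x"
    proof (rule pair_eqI)
      show "y \<in> \<Gamma>" "?x \<in> \<Gamma>" using x y by blast+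
      show "pair C y w p = pair C ?x w p" if "w \<in> \<Gamma>" for w p
        using y P that by metis
    qed
  qed
qed

lemma D_zero_section [simp, intro]: "u \<in> \<Gamma> \<Longrightarrow> v \<in> \<Gamma> \<Longrightarrow> D_zero C G nabla u v \<in> \<Gamma>"
  using lift_props(1)[of 1] lift_props(1)[of "-1"] by (simp add: D_zero_eq)

lemma pj_D_zero:
  assumes "s \<in> {1, -1}" "u \<in> \<Gamma>" "v \<in> \<Gamma>"
  shows "pj s (D_zero C G nabla u v) = D0 s u v"
  using assms lift_props(1)[of 1] lift_props(1)[of "-1"]
  by (auto simp: D_zero_eq pj_add)

lemma pair_D_zero:
  assumes u: "u \<in> \<Gamma>" and v: "v \<in> \<Gamma>" and w: "w \<in> \<Gamma>"
  shows "pair C (D_zero C G nabla u v) w p = gg (D0 1 u v) (pj 1 w) p - gg (D0 (-1) u v) (pj (-1) w) p"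
  unfolding D_zero_eq[OF u v] by (rule pair_lift_sum) (use assms in auto)

lemma gg_D0:
  assumes u: "u \<in> \<Gamma>" and v: "v \<in> \<Gamma>" and Z: "Z \<in> VF"
  shows "gg (D0 s u v) Z p = gg (nabla (anch C u) (pj s v)) Z p
    + (s / 2) * hh (pj (- s) u) (pj s v) Z p + (s / 6) * hh (pj s u) (pj s v) Z p"
  using assms anch_VF[OF u] by (simp add: D0_def Dt_def gg_add gg_scaleR gg_Hs)

lemma D_zero_metric:
  assumes u: "u \<in> \<Gamma>" and v: "v \<in> \<Gamma>" and w: "w \<in> \<Gamma>"
  shows "vf_apply (anch C u) (pair C v w) p =
    pair C (D_zero C G nabla u v) w p + pair C v (D_zero C G nabla u w) p"
proof -
  note VFs = pj_VF[OF u] pj_VF[OF v] pj_VF[OF w] anch_VF[OF u]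
  have "pair C v w = gg (pj 1 v) (pj 1 w) - gg (pj (-1) v) (pj (-1) w)"
    by (simp add: fun_eq_iff pair_pj[OF v w])
  then have 1: "vf_apply (anch C u) (pair C v w) p =
      (gg (nabla (anch C u) (pj 1 v)) (pj 1 w) p + gg (pj 1 v) (nabla (anch C u) (pj 1 w)) p)
      - (gg (nabla (anch C u) (pj (-1) v)) (pj (-1) w) p + gg (pj (-1) v) (nabla (anch C u) (pj (-1) w)) p)"
    using VFs by (simp add: vf_apply_simps(2) g_CM nab_metric)
  have 2: "pair C v (D_zero C G nabla u w) p = gg (D0 1 u w) (pj 1 v) p - gg (D0 (-1) u w) (pj (-1) v) p"
    using pair_pj[OF v D_zero_section[OF u w], of p] pj_D_zero[OF _ u w] u v w
    by (simp add: gg_sym[of _ "pj t v" for t])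
  have 3: "hh X (pj s v) (pj s w) p = - hh X (pj s w) (pj s v) p" if "X \<in> VF" for X s
    by (rule hh_skew(2)[OF that VFs(2,3)])
  show ?thesis
    unfolding 1 2 pair_D_zero[OF u v w]
    using u v w VFs gg_sym[of "pj 1 v" "nabla (anch C u) (pj 1 w)" p]
      gg_sym[of "pj (-1) v" "nabla (anch C u) (pj (-1) w)" p]
      3[of "pj 1 u" 1] 3[of "pj (-1) u" 1] 3[of "pj 1 u" "-1"] 3[of "pj (-1) u" "-1"]
    by (simp add: gg_D0)
qed

text \<open>A totally skew summand of the connection enters the torsion three times, so the
  correction H/6 contributes H/2 and cancels the torsion of \<open>D_tilde\<close>.\<close>

lemma D_zero_torsion_free:
  assumes u: "u \<in> \<Gamma>" and v: "v \<in> \<Gamma>" and w: "w \<in> \<Gamma>"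
  shows "torsion C (D_zero C G nabla) u v w p = 0"
proof -
  let ?D = "D_zero C G nabla" and ?T = "D_tilde C G nabla"
  note VFs = pj_VF[OF u] pj_VF[OF v] pj_VF[OF w]
  have T: "?T a b \<in> \<Gamma>" if "a \<in> \<Gamma>" "b \<in> \<Gamma>" for a b
    unfolding D_tilde_eq[OF that] using that lift_props(1)[of 1] lift_props(1)[of "-1"] by simp
  have D: "pair C (?D a b) c p = pair C (?T a b) c p
      + (1 / 6) * (hh (pj 1 a) (pj 1 b) (pj 1 c) p + hh (pj (-1) a) (pj (-1) b) (pj (-1) c) p)"
    if "a \<in> \<Gamma>" "b \<in> \<Gamma>" "c \<in> \<Gamma>" for a b c
    unfolding pair_D_zero[OF that] D_tilde_eq[OF that(1,2)]
      pair_lift_sum[OF Dt_VF[OF that(1,2)] Dt_VF[OF that(1,2)] that(3)]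
    using that by (simp add: D0_def gg_simps gg_Hs) (simp add: field_simps)?
  have pd: "pair C (a - b) c p = pair C a c p - pair C b c p" if "a \<in> \<Gamma>" "b \<in> \<Gamma>" "c \<in> \<Gamma>" for a b c
    using that by (simp add: pair_pj pj_diff gg_diff)
  have "torsion C ?D u v w p = torsion C ?T u v w p
    + (1 / 6) * (hh (pj 1 u) (pj 1 v) (pj 1 w) p + hh (pj (-1) u) (pj (-1) v) (pj (-1) w) p)
    - (1 / 6) * (hh (pj 1 v) (pj 1 u) (pj 1 w) p + hh (pj (-1) v) (pj (-1) u) (pj (-1) w) p)
    + (1 / 6) * (hh (pj 1 w) (pj 1 u) (pj 1 v) p + hh (pj (-1) w) (pj (-1) u) (pj (-1) v) p)"
    using u v w T dorfman_section[OF u v] by (simp add: torsion_def pd D)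
  then show ?thesis
    unfolding torsion_D_tilde[OF u v w]
    using hh_skew(1)[OF VFs(2,1,3), of 1 1 1 p] hh_skew(1)[OF VFs(2,1,3), of "-1" "-1" "-1" p]
      hh_skew(3)[OF VFs(3,1,2), of 1 1 1 p] hh_skew(3)[OF VFs(3,1,2), of "-1" "-1" "-1" p]
    by (simp add: field_simps)
qed

end

section \<open>Contractions over frames of E\<close>

context gen_metric
begin

lemma pairing_scaleR:
  assumes "x \<in> fibre C p" "z \<in> fibre C p"
  shows "pairing C p (c *\<^sub>R x) z = c * pairing C p x z" "pairing C p z (c *\<^sub>R x) = c * pairing C p z x"
  using pairing_bilin(3,4)[OF assms(1,1,2)] by simp_all

definition tens1 :: "'m \<Rightarrow> (('m \<Rightarrow> 'v) \<Rightarrow> real) \<Rightarrow> bool" where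
  "tens1 p T \<longleftrightarrow> (\<forall>u\<in>\<Gamma>. \<forall>v\<in>\<Gamma>. T (u + v) = T u + T v) \<and> (\<forall>h\<in>CM. \<forall>u\<in>\<Gamma>. T (fmul h u) = h p * T u)"

lemma fmul_apply: "fmul f u p = f p *\<^sub>R u p"
  by (simp add: fmul_def)

lemma tens_E_cong:
  assumes "tens_E p T'" "\<And>u v. u \<in> \<Gamma> \<Longrightarrow> v \<in> \<Gamma> \<Longrightarrow> T u v = T' u v"
  shows "tens_E p T"
  using assms unfolding tens_E_def by simp

text \<open>Only the resolution of the identity at p is recorded, which is what contractions
  use.\<close>

definition E_frame :: "'m \<Rightarrow> (nat \<Rightarrow> 'm \<Rightarrow> 'v) \<Rightarrow> (nat \<Rightarrow> 'm \<Rightarrow> 'v) \<Rightarrow> bool" where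
  "E_frame p x y \<longleftrightarrow> (\<forall>i<rnk C. x i \<in> \<Gamma> \<and> y i \<in> \<Gamma>) \<and>
     (\<forall>v\<in>fibre C p. v = (\<Sum>i<rnk C. pairing C p v (y i p) *\<^sub>R x i p))"

lemma E_frame_exists: "\<exists>x y. E_frame p x y"
proof -
  obtain b where b: "is_basis_family (fibre C p) (rnk C) b" using fibre_basis by blast
  have n: "dim (fibre C p) = rnk C" by (rule is_basis_familyD(3)[OF b])
  have "\<exists>x y. dual_frames (fibre C) \<Gamma> (pairing C) p x y"
    by (rule dual_frames_exist[where F="fibre C" and \<beta>="pairing C" and p=p, OF b pairing_props(1,3)])
      (rule section_through)
  then obtain x y where xy: "dual_frames (fibre C) \<Gamma> (pairing C) p x y" by blast
  have 1: "x i \<in> \<Gamma>" "y i \<in> \<Gamma>" if "i < rnk C" for i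
    using xy that unfolding dual_frames_def n by auto
  have 2: "is_basis_family (fibre C p) (rnk C) (\<lambda>i. x i p)"
    using xy unfolding dual_frames_def n by blast
  have 3: "pairing C p (y i p) (x j p) = (if i = j then 1 else 0)" if "i < rnk C" "j < rnk C" for i j
    using xy that unfolding dual_frames_def n by blast
  have "v = (\<Sum>i<rnk C. pairing C p v (y i p) *\<^sub>R x i p)" if "v \<in> fibre C p" for v
    by (rule dual_basis_resolution(1)[OF 2 pairing_props _ 3 that]) (use section_fibre 1 in auto)
  then have "E_frame p x y" unfolding E_frame_def using 1 by blast
  then show ?thesis by blast
qed

lemma E_frameD:
  assumes "E_frame p x y"
  shows "i < rnk C \<Longrightarrow> x i \<in> \<Gamma>" "i < rnk C \<Longrightarrow> y i \<in> \<Gamma>"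
    "v \<in> fibre C p \<Longrightarrow> v = (\<Sum>i<rnk C. pairing C p v (y i p) *\<^sub>R x i p)"
  using assms unfolding E_frame_def by blast+

lemma trace_E_frame:
  assumes "tens_E p T" "E_frame p x y"
  shows "trace_E C p T = (\<Sum>i<rnk C. T (x i) (y i))"
  by (rule trace_E_resolution[OF assms(1)]) (use E_frameD[OF assms(2)] in auto)

text \<open>w and its expansion with coefficients frozen at p agree at p, and T depends on the value
  at p only.\<close>

lemma tens1_contract:
  assumes T: "tens1 p T" and xy: "E_frame p x y" and w: "w \<in> \<Gamma>"
  shows "(\<Sum>i<rnk C. pair C w (y i) p * T (x i)) = T w"
proof -
  let ?w = "\<Sum>i<rnk C. pair C w (y i) p *\<^sub>R x i"
  have add: "T (u + v) = T u + T v" if "u \<in> \<Gamma>" "v \<in> \<Gamma>" for u v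
    using T that unfolding tens1_def by blast
  have mul: "T (fmul h u) = h p * T u" if "h \<in> CM" "u \<in> \<Gamma>" for h u
    using T that unfolding tens1_def by blast
  have sc: "T (c *\<^sub>R u) = c * T u" if "u \<in> \<Gamma>" for c u
    using mul[OF Cinf_const that, of c] by (simp add: fmul_const)
  have lin: "lin_on \<Gamma> T" unfolding lin_on_def using add sc by simp
  have wS: "?w \<in> \<Gamma>" using E_frameD(1)[OF xy] by (intro section_sum section_scaleR) simp
  have "w p = ?w p"
    using E_frameD(3)[OF xy section_fibre[OF w]] by (simp add: sum_fun_apply ev2_def)
  then have z: "(w - ?w) p = 0" by simp
  have "T (w - ?w) = 0"
    by (rule tensorial[where T=T and p=p, OF _ _ section_diff[OF w wS] z]) (use add mul in auto)
  then have "T w = T ?w" using add[of "w - ?w" ?w] w wS by simp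
  also have "\<dots> = (\<Sum>i<rnk C. pair C w (y i) p * T (x i))"
    using lin_on_sum[OF lin sections_subspace, of "{..<rnk C}" x] E_frameD(1)[OF xy] by simp
  finally show ?thesis by simp
qed

lemma pair_sym: "u \<in> \<Gamma> \<Longrightarrow> v \<in> \<Gamma> \<Longrightarrow> pair C u v p = pair C v u p"
  using pairing_sym[OF section_fibre section_fibre] by (simp add: ev2_def)

lemma pair_add:
  assumes "u \<in> \<Gamma>" "v \<in> \<Gamma>" "w \<in> \<Gamma>"
  shows "pair C (u + v) w p = pair C u w p + pair C v w p" "pair C w (u + v) p = pair C w u p + pair C w v p"
  using pairing_bilin[OF section_fibre[OF assms(1)] section_fibre[OF assms(2)] section_fibre[OF assms(3)], of p]
  by (simp_all add: ev2_def)

lemma pair_fmul: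
  assumes "u \<in> \<Gamma>" "w \<in> \<Gamma>"
  shows "pair C (fmul h u) w p = h p * pair C u w p" "pair C w (fmul h u) p = h p * pair C w u p"
  using pairing_bilin(3,4)[OF section_fibre[OF assms(1)] section_fibre[OF assms(1)] section_fibre[OF assms(2)], of p "h p"]
  by (simp_all add: ev2_def fmul_def)

lemma pair_scaleR:
  assumes "u \<in> \<Gamma>" "w \<in> \<Gamma>"
  shows "pair C (c *\<^sub>R u) w p = c * pair C u w p" "pair C w (c *\<^sub>R u) p = c * pair C w u p"
  using pair_fmul[OF assms, of "\<lambda>p. c" p] by (simp_all add: fmul_const)

lemma pair_diff:
  assumes "u \<in> \<Gamma>" "v \<in> \<Gamma>" "w \<in> \<Gamma>"
  shows "pair C (u - v) w p = pair C u w p - pair C v w p" "pair C w (u - v) p = pair C w u p - pair C w v p"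
  using pair_add[OF assms(1) section_minus[OF assms(2)] assms(3), of p] pair_scaleR[OF assms(2,3), of "-1" p]
  by simp_all

lemma pf_self_adjoint:
  assumes s: "s \<in> {1, -1}" and u: "u \<in> fibre C p" and v: "v \<in> fibre C p"
  shows "pairing C p (pf s p u) v = pairing C p (pf s p v) u"
  using u v pairing_GE[OF u v] pairing_GE[OF v u] G_sym[OF u v] pairing_sym[OF u v]
  by (simp add: pf_def pairing_bilin GE_fibre fibre_scaleR fibre_add)

lemma pair_pf:
  assumes s: "s \<in> {1, -1}" and t: "t \<in> EF s p" and v: "v \<in> fibre C p"
  shows "pairing C p t (pf s p v) = pairing C p t v"
  using pf_self_adjoint[OF s v EF_fibre[OF t]] pf_same[OF s t] pairing_sym[OF EF_fibre[OF t] pf_fibre[OF v]]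
  by simp

text \<open>The rank of E_s as the trace of its projection: in the adapted frame every E_s vector
  contributes s, counted with sign s.\<close>

lemma trace_pf:
  assumes s: "s \<in> {1, -1}" and xy: "E_frame p x y"
  shows "(\<Sum>i<rnk C. pairing C p (pf s p (x i p)) (y i p)) = DIM('e)"
proof -
  let ?T = "\<lambda>u v. pairing C p (pf s p (u p)) (v p)"
  have T: "tens_E p ?T"
    unfolding tens_E_def
    by (auto simp: pf_add pf_scaleR pairing_bilin pairing_scaleR section_fibre pf_fibre fmul_def)
  obtain a b where ab: "dual_vf p a b" using dual_vf_exists by blast
  note D = dual_vfD[OF ab]
  have ms: "- s \<in> {1, -1}" using s by auto
  have 1: "?T (lift C G s (a i)) (lift C G s (b i)) = s" if "i < DIM('e)" for i
  proof -
    note lE = lift_props(2)[OF s D(1)[of i], of p] lift_props(2)[OF s D(2)[of i], of p]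
    have "?T (lift C G s (a i)) (lift C G s (b i)) = s * g p (a i p) (b i p)"
      using g_EF[OF s lE] sign_square[OF s] pf_same[OF s lE(1)]
      by (simp add: anchor_lift[OF s D(1)] anchor_lift[OF s D(2)] flip: mult.assoc)
    also have "g p (a i p) (b i p) = 1"
      using D(5)[OF that that] g_sym[OF VF_TM[OF D(1)] VF_TM[OF D(2)]] by simp
    finally show ?thesis by simp
  qed
  have 2: "?T (lift C G (- s) (a i)) (lift C G (- s) (b i)) = 0" for i
    using pf_opposite[OF ms lift_props(2)[OF ms D(1)[of i], of p]]
      pairing_scaleR(1)[OF EF_fibre EF_fibre, OF lift_props(2)[OF ms D(2)[of i], of p]
        lift_props(2)[OF ms D(2)[of i], of p], of 0] by simp
  have "(\<Sum>i<rnk C. ?T (x i) (y i)) = trace_E C p ?T"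
    by (rule trace_E_frame[OF T xy, symmetric])
  also have "\<dots> = DIM('e)"
    unfolding trace_E_eq[OF T ab] using s 1 2 by auto
  finally show ?thesis .
qed

subsection \<open>Test tensors in the kernel of the trace\<close>

text \<open>The projection of \<open>x \<otimes> (y \<and> z)\<close> to \<open>so(E)\<^sub>G\<^sup>\<langle>1\<rangle>\<close>, corrected by a multiple of \<open>\<chi>\<^sup>t\<close> so
  as to be trace-free. Pairing a difference of generalised Levi-Civita connections with these
  tensors recovers its components.\<close>

definition test_tensor :: "'m \<Rightarrow> real \<Rightarrow> 'v \<Rightarrow> 'v \<Rightarrow> 'v \<Rightarrow> 'v \<Rightarrow> 'v \<Rightarrow> 'v" where
  "test_tensor p s x y z u v = (let b = pairing C p; t = b x z *\<^sub>R y + (- b x y) *\<^sub>R z; k = 1 / (real DIM('e) - 1) in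
     ((2 / 3) * b x u * b y v + (1 / 3) * b x v * b y u) *\<^sub>R z
     + (- (2 / 3) * b x u * b z v - (1 / 3) * b x v * b z u) *\<^sub>R y
     + ((1 / 3) * (b z u * b y v - b y u * b z v)) *\<^sub>R x
     + (k * b (pf s p u) v) *\<^sub>R t + (- k * b t v) *\<^sub>R pf s p u)"

lemma pairing_sum5:
  assumes "a1 \<in> fibre C p" "a2 \<in> fibre C p" "a3 \<in> fibre C p" "a4 \<in> fibre C p" "a5 \<in> fibre C p" "w \<in> fibre C p"
  shows "pairing C p (c1 *\<^sub>R a1 + c2 *\<^sub>R a2 + c3 *\<^sub>R a3 + c4 *\<^sub>R a4 + c5 *\<^sub>R a5) w =
    c1 * pairing C p a1 w + c2 * pairing C p a2 w + c3 * pairing C p a3 w + c4 * pairing C p a4 w + c5 * pairing C p a5 w"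
  using assms by (simp add: pairing_bilin fibre_add fibre_scaleR)

lemma test_tensor_pairing:
  assumes s: "s \<in> {1, -1}" and xyz: "x \<in> EF s p" "y \<in> EF s p" "z \<in> EF s p"
    and uvw: "u \<in> fibre C p" "v \<in> fibre C p" "w \<in> fibre C p"
  defines "b \<equiv> pairing C p" and "t \<equiv> pairing C p x z *\<^sub>R y + (- pairing C p x y) *\<^sub>R z"
  shows "b (test_tensor p s x y z u v) w =
     ((2 / 3) * b x u * b y v + (1 / 3) * b x v * b y u) * b z w
     + (- (2 / 3) * b x u * b z v - (1 / 3) * b x v * b z u) * b y w
     + ((1 / 3) * (b z u * b y v - b y u * b z v)) * b x w
     + (1 / (real DIM('e) - 1) * b (pf s p u) v) * b t w + (- (1 / (real DIM('e) - 1)) * b t v) * b (pf s p u) w"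
    and "test_tensor p s x y z u v \<in> fibre C p" and "t \<in> EF s p"
    and "b t w = b x z * b y w - b x y * b z w"
proof -
  note F = EF_fibre[OF xyz(1)] EF_fibre[OF xyz(2)] EF_fibre[OF xyz(3)]
  show t: "t \<in> EF s p" unfolding t_def
    by (intro subspace_add subspace_scale EF_subspace xyz)
  show "b (test_tensor p s x y z u v) w =
     ((2 / 3) * b x u * b y v + (1 / 3) * b x v * b y u) * b z w
     + (- (2 / 3) * b x u * b z v - (1 / 3) * b x v * b z u) * b y w
     + ((1 / 3) * (b z u * b y v - b y u * b z v)) * b x w
     + (1 / (real DIM('e) - 1) * b (pf s p u) v) * b t w + (- (1 / (real DIM('e) - 1)) * b t v) * b (pf s p u) w"
    unfolding b_def t_def test_tensor_def Let_def
    by (rule pairing_sum5[OF F(3,2,1) EF_fibre[OF t, unfolded t_def] pf_fibre[OF uvw(1)] uvw(3)])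
  show "test_tensor p s x y z u v \<in> fibre C p"
    unfolding test_tensor_def Let_def
    by (intro fibre_add fibre_scaleR F pf_fibre uvw)
  show "b t w = b x z * b y w - b x y * b z w"
    unfolding b_def t_def using F uvw by (simp add: pairing_bilin fibre_scaleR del: scaleR_minus_left)
qed

text \<open>The first three summands of the tensor have trace v -> <t, v>, and the correction built
  from t has trace k (1 - d) <t, v>; this fixes k = 1 / (d - 1). The factor d comes from
  \<open>trace_pf\<close>.\<close>

lemma test_tensor_kernel:
  assumes s: "s \<in> {1, -1}" and xyz: "x \<in> EF s p" "y \<in> EF s p" "z \<in> EF s p" and dim: "DIM('e) \<ge> 2"
  shows "test_tensor p s x y z \<in> prolongation_kernel C G p"
proof -
  let ?K = "test_tensor p s x y z"
  define b where "b = pairing C p"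
  define t where "t = pairing C p x z *\<^sub>R y + (- pairing C p x y) *\<^sub>R z"
  define k where "k = 1 / (real DIM('e) - 1)"
  note F = EF_fibre[OF xyz(1)] EF_fibre[OF xyz(2)] EF_fibre[OF xyz(3)]
  have ms: "- s \<in> {1, -1}" using s by auto
  note P = test_tensor_pairing[OF s xyz, folded b_def t_def k_def]
  have tE: "t \<in> EF s p" using P(3)[OF F(1,1,1)] .
  have sym: "b u v = b v u" if "u \<in> fibre C p" "v \<in> fibre C p" for u v
    using pairing_sym that by (simp add: b_def)
  have A: "b (pf s p u) v = b (pf s p v) u" if "u \<in> fibre C p" "v \<in> fibre C p" for u v
    using pf_self_adjoint[OF s that] by (simp add: b_def)
  have B: "b (u + u') v = b u v + b u' v" "b v (u + u') = b v u + b v u'" "b (c *\<^sub>R u) v = c * b u v" "b v (c *\<^sub>R u) = c * b v u"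
    if "u \<in> fibre C p" "u' \<in> fibre C p" "v \<in> fibre C p" for u u' v c
    using pairing_bilin[OF that] by (simp_all add: b_def)
  have eqI: "u = v" if "u \<in> fibre C p" "v \<in> fibre C p" "\<And>w. w \<in> fibre C p \<Longrightarrow> b u w = b v w" for u v
    using pairing_eqI[OF that(1,2)] that(3) by (simp add: b_def)
  have bilin: "bilin_on (fibre C p) ?K"
    unfolding bilin_on_def lin_on_def
  proof (intro conjI ballI allI)
    fix u v w c assume F3: "u \<in> fibre C p" "v \<in> fibre C p" "w \<in> fibre C p"
    note mem = F F3 pf_fibre[OF F3(1)] pf_fibre[OF F3(2)] pf_fibre[OF F3(3)] EF_fibre[OF tE]
    show "?K u (v + w) = ?K u v + ?K u w"
      by (rule eqI) (use mem in \<open>simp_all add: P(1,2) B fibre_add field_simps\<close>)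
    show "?K (v + w) u = ?K v u + ?K w u"
      by (rule eqI) (use mem in \<open>simp_all add: P(1,2) B fibre_add pf_add field_simps\<close>)
  next
    fix u v :: 'v and c :: real assume F3: "u \<in> fibre C p" "v \<in> fibre C p"
    note mem = F F3 pf_fibre[OF F3(1)] pf_fibre[OF F3(2)] EF_fibre[OF tE]
    show "?K u (c *\<^sub>R v) = c *\<^sub>R ?K u v"
      by (rule eqI) (use mem in \<open>simp_all add: P(1,2) B fibre_scaleR field_simps\<close>)
    show "?K (c *\<^sub>R v) u = c *\<^sub>R ?K v u"
      by (rule eqI) (use mem in \<open>simp_all add: P(1,2) B fibre_scaleR pf_scaleR field_simps\<close>)
  qed
  have skew: "b (?K u v) w = - b v (?K u w)" if "u \<in> fibre C p" "v \<in> fibre C p" "w \<in> fibre C p" for u v w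
    using that by (simp add: P sym[of v "?K u w"]) (simp add: field_simps)
  have cyc: "b (?K u v) w + b (?K v w) u + b (?K w u) v = 0"
    if "u \<in> fibre C p" "v \<in> fibre C p" "w \<in> fibre C p" for u v w
    using that A[of v u] A[of w u] A[of w v] by (simp add: P) (simp add: field_simps)
  have pres: "?K u v \<in> EF r p" if r: "r \<in> {1, -1}" and u: "u \<in> fibre C p" and v: "v \<in> EF r p" for r u v
  proof (cases "r = s")
    case True
    show ?thesis unfolding True test_tensor_def Let_def
      by (intro subspace_add subspace_scale EF_subspace xyz pf_EF s u)
  next
    case False
    then have r: "r = - s" using r s by auto
    \<comment> \<open>On E_-s the tensor vanishes, because each of its coefficients contains the
      pairing of v with some vector of E_s.\<close>
    have z: "b w v = 0" if "w \<in> EF s p" for w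
      using EF_orthogonal[OF s that, of v] v r by (simp add: b_def)
    have b0: "b 0 w = 0" if "w \<in> fibre C p" for w
      using B(3)[OF that that that, of 0] by simp
    have "?K u v = 0"
    proof (rule eqI)
      show "?K u v \<in> fibre C p" "0 \<in> fibre C p"
        using P(2)[OF u EF_fibre[OF v] u] subspace_0[OF fibre_subspace] by auto
      show "b (?K u v) w = b 0 w" if w: "w \<in> fibre C p" for w
        using z[OF xyz(1)] z[OF xyz(2)] z[OF xyz(3)] z[OF pf_EF[OF s u]] z[OF tE] b0[OF w]
        by (simp add: P(1)[OF u EF_fibre[OF v] w])
    qed
    then show ?thesis using subspace_0[OF EF_subspace] by simp
  qed
  have tr: "trace_E C p (\<lambda>u u'. pairing C p (?K (u p) v) (u' p)) = 0" if v: "v \<in> fibre C p" for v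
  proof -
    let ?T = "\<lambda>u u'. b (?K (u p) v) (u' p)"
    have T: "tens_E p ?T"
      unfolding tens_E_def
      using v section_fibre P(2) bilin_onD(1,3)[OF bilin] by (auto simp: B fmul_def)
    obtain a c where ac: "E_frame p a c" using E_frame_exists by blast
    note D = E_frameD[OF ac]
    have Kfib: "?K (a i p) v \<in> fibre C p" if "i < rnk C" for i
      using P(2) section_fibre[OF D(1)[OF that]] v by blast
    have contr: "(\<Sum>i<rnk C. b w (c i p) * f (a i p)) = f w" if w: "w \<in> fibre C p" and f: "lin_on (fibre C p) f" for w and f :: "'v \<Rightarrow> real"
    proof -
      have "f w = f (\<Sum>i<rnk C. b w (c i p) *\<^sub>R a i p)"
        using D(3)[OF w] by (simp add: b_def)
      also have "\<dots> = (\<Sum>i<rnk C. b w (c i p) *\<^sub>R f (a i p))"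
        by (rule lin_on_sum[OF f fibre_subspace]) (use D(1) section_fibre in auto)
      finally show ?thesis by simp
    qed
    have lb: "lin_on (fibre C p) (b w)" if "w \<in> fibre C p" for w
      using that B(2,4) unfolding lin_on_def by simp
    have lpf: "lin_on (fibre C p) (\<lambda>u. b (pf s p u) v)"
      unfolding lin_on_def using v by (simp add: B pf_add pf_scaleR pf_fibre)
    have c2: "(\<Sum>i<rnk C. b w' (a i p) * b w (c i p)) = b w' w" if "w \<in> fibre C p" "w' \<in> fibre C p" for w w'
      using contr[OF that(1) lb[OF that(2)]] by (simp add: mult.commute)
    have c3: "(\<Sum>i<rnk C. b (pf s p (a i p)) v * b t (c i p)) = b t v"
      using contr[OF EF_fibre[OF tE] lpf] pf_same[OF s tE] by (simp add: mult.commute)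
    have c4: "(\<Sum>i<rnk C. b (pf s p (a i p)) (c i p)) = real DIM('e)"
      using trace_pf[OF s ac] by (simp add: b_def)
    have "trace_E C p ?T = (\<Sum>i<rnk C. ?T (a i) (c i))"
      by (rule trace_E_frame[OF T ac])
    also have "\<dots> = (\<Sum>i<rnk C. (2 / 3) * b y v * (b x (a i p) * b z (c i p)) + (1 / 3) * b x v * (b y (a i p) * b z (c i p))
      - (2 / 3) * b z v * (b x (a i p) * b y (c i p)) - (1 / 3) * b x v * (b z (a i p) * b y (c i p))
      + (1 / 3) * b y v * (b z (a i p) * b x (c i p)) - (1 / 3) * b z v * (b y (a i p) * b x (c i p))
      + k * (b (pf s p (a i p)) v * b t (c i p)) - k * b t v * b (pf s p (a i p)) (c i p))"
    proof (rule sum.cong[OF refl])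
      fix i assume "i \<in> {..<rnk C}"
      then have i: "a i p \<in> fibre C p" "c i p \<in> fibre C p" using D(1,2) section_fibre by auto
      show "?T (a i) (c i) = (2 / 3) * b y v * (b x (a i p) * b z (c i p)) + (1 / 3) * b x v * (b y (a i p) * b z (c i p))
      - (2 / 3) * b z v * (b x (a i p) * b y (c i p)) - (1 / 3) * b x v * (b z (a i p) * b y (c i p))
      + (1 / 3) * b y v * (b z (a i p) * b x (c i p)) - (1 / 3) * b z v * (b y (a i p) * b x (c i p))
      + k * (b (pf s p (a i p)) v * b t (c i p)) - k * b t v * b (pf s p (a i p)) (c i p)"
        unfolding P(1)[OF i(1) v i(2)] by (simp add: algebra_simps)
    qed
    also have "\<dots> = (2 / 3) * b y v * b x z + (1 / 3) * b x v * b y z - (2 / 3) * b z v * b x y - (1 / 3) * b x v * b z y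
      + (1 / 3) * b y v * b z x - (1 / 3) * b z v * b y x + k * b t v - k * b t v * real DIM('e)"
      unfolding sum.distrib sum_subtractf sum_distrib_left[symmetric] c2[OF F(3,1)] c2[OF F(3,2)] c2[OF F(2,1)]
        c2[OF F(2,3)] c2[OF F(1,3)] c2[OF F(1,2)] c3 c4 ..
    also have "\<dots> = b y v * b x z - b z v * b x y - k * (real DIM('e) - 1) * b t v"
      using sym[OF F(2,3)] sym[OF F(1,3)] sym[OF F(1,2)] by (simp add: algebra_simps)
    also have "k * (real DIM('e) - 1) = 1" using dim by (simp add: k_def)
    finally show ?thesis using P(4)[OF v v v] by (simp add: b_def mult.commute)
  qed
  show ?thesis
    unfolding prolongation_kernel_def so_prolongation_def
    using bilin P(2) skew cyc pres tr by (auto simp: b_def)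
qed

end

section \<open>The canonical generalised Levi-Civita connection\<close>

context courant_geometry
begin

lemma anch_add: "u \<in> \<Gamma> \<Longrightarrow> v \<in> \<Gamma> \<Longrightarrow> anch C (u + v) = anch C u + anch C v"
  by (simp add: anch_pj pj_add add_ac)

lemma anch_fmul: "u \<in> \<Gamma> \<Longrightarrow> anch C (fmul h u) = fmul h (anch C u)"
  by (rule ext) (simp add: anch_def fmul_def anchor_scaleR section_fibre)

lemma hh_zero: "X \<in> VF \<Longrightarrow> Y \<in> VF \<Longrightarrow> hh 0 X Y p = 0" "X \<in> VF \<Longrightarrow> Y \<in> VF \<Longrightarrow> hh X 0 Y p = 0"
  "X \<in> VF \<Longrightarrow> Y \<in> VF \<Longrightarrow> hh X Y 0 p = 0"
  using hh_linear(5)[of X Y 0 0 0 p] hh_linear(2)[of X Y 0 0 0 p] hh_linear3(2)[of X Y 0 0 0 p] by simp_all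

lemma D_zero_linear:
  assumes u: "u \<in> \<Gamma>" "u' \<in> \<Gamma>" and v: "v \<in> \<Gamma>" and f: "f \<in> CM"
  shows "D_zero C G nabla (u + u') v = D_zero C G nabla u v + D_zero C G nabla u' v"
    "D_zero C G nabla v (u + u') = D_zero C G nabla v u + D_zero C G nabla v u'"
    "D_zero C G nabla (fmul f u) v = fmul f (D_zero C G nabla u v)"
    "D_zero C G nabla v (fmul f u) = fmul (vf_apply (anch C v) f) u + fmul f (D_zero C G nabla v u)"
proof -
  note VFs = anch_VF[OF u(1)] anch_VF[OF u(2)] anch_VF[OF v]
  have Xf: "vf_apply (anch C v) f \<in> CM" by (rule VF_apply[OF VFs(3) f])
  show "D_zero C G nabla (u + u') v = D_zero C G nabla u v + D_zero C G nabla u' v"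
    by (rule pair_eqI) (use u v VFs in
      \<open>auto simp: pair_add pair_D_zero gg_D0 anch_add pj_add nab_add gg_add hh_linear distrib_left\<close>)
  show "D_zero C G nabla v (u + u') = D_zero C G nabla v u + D_zero C G nabla v u'"
    by (rule pair_eqI) (use u v VFs in
      \<open>auto simp: pair_add pair_D_zero gg_D0 anch_add pj_add nab_add gg_add hh_linear distrib_left\<close>)
  show "D_zero C G nabla (fmul f u) v = fmul f (D_zero C G nabla u v)"
    by (rule pair_eqI) (use u v f VFs in
      \<open>auto simp: pair_fmul pair_D_zero gg_D0 anch_fmul pj_fmul nab_fmul gg_fmul hh_linear algebra_simps\<close>)
  show "D_zero C G nabla v (fmul f u) = fmul (vf_apply (anch C v) f) u + fmul f (D_zero C G nabla v u)"
  proof (rule pair_eqI)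
    show "D_zero C G nabla v (fmul f u) \<in> \<Gamma>" using u v f by simp
    show "fmul (vf_apply (anch C v) f) u + fmul f (D_zero C G nabla v u) \<in> \<Gamma>" using u v f Xf by simp
    show "pair C (D_zero C G nabla v (fmul f u)) w p =
        pair C (fmul (vf_apply (anch C v) f) u + fmul f (D_zero C G nabla v u)) w p" if w: "w \<in> \<Gamma>" for w p
      using u v f w VFs Xf by (simp add: pair_add pair_fmul pair_D_zero gg_D0 pj_fmul nab_fmul gg_add gg_fmul hh_linear
          pair_pj[OF u(1) w]) (simp add: algebra_simps)
  qed
qed

lemmas D_zero_add = D_zero_linear(1,2)[OF _ _ _ Cinf_zero]

lemma G_pj:
  assumes "u \<in> \<Gamma>" "w \<in> \<Gamma>"
  shows "ev2 G u w p = gg (pj 1 u) (pj 1 w) p + gg (pj (-1) u) (pj (-1) w) p"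
proof -
  let ?u = "(\<lambda>p. GE p (u p))"
  have gu: "?u \<in> \<Gamma>" by (rule GE_section(1)[OF assms(1)])
  have pf: "pf s p (GE p x) = s *\<^sub>R pf s p x" if "s \<in> {1, -1}" "x \<in> fibre C p" for s p x
    using that by (auto simp: pf_def GE_involution scaleR_add_right scaleR_diff_right)
  have "pj s ?u = s *\<^sub>R pj s u" if "s \<in> {1, -1}" for s
    by (rule ext) (simp add: pj_apply pf[OF that section_fibre[OF assms(1)]]
        anchor_scaleR[OF pf_fibre[OF section_fibre[OF assms(1)]]])
  from this[of 1] this[of "-1"] have "pj 1 ?u = pj 1 u" "pj (-1) ?u = - pj (-1) u" by simp_all
  moreover have "ev2 G u w p = pair C ?u w p"
    using GE_section(2)[OF assms(1) section_fibre[OF assms(2)], of p] by (simp add: ev2_def)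
  ultimately show ?thesis
    using assms by (simp add: pair_pj[OF gu assms(2)] gg_minus)
qed

lemma pure_EF:
  assumes s: "s \<in> {1, -1}" and a: "a \<in> \<Gamma>" "pj (- s) a = 0"
  shows "a p \<in> EF s p"
proof -
  have ms: "- s \<in> {1, -1}" using s by auto
  have "anchor C p (pf (- s) p (a p)) = 0"
    using a(2) pj_apply[of "- s" a p] by simp
  then have "pf (- s) p (a p) = 0"
    by (rule anchor_EF_inj[OF ms pf_EF[OF ms section_fibre[OF a(1)]]])
  then have "a p = pf s p (a p)" using pf_sum_sign[OF s, of p "a p"] by simp
  then show ?thesis using pf_EF[OF s section_fibre[OF a(1)], of p] by simp
qed

lemma pure_pair:
  assumes s: "s \<in> {1, -1}" and "u \<in> \<Gamma>" "w \<in> \<Gamma>" "pj (- s) u = 0"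
  shows "pair C u w p = s * gg (pj s u) (pj s w) p" "pair C w u p = s * gg (pj s w) (pj s u) p"
  using assms by (auto simp: pair_pj gg_zero)

text \<open>The H terms are skew in the traced slots and drop out. The sign of the scalar product on
  E_s cancels the sign of the trace there, so E_+ and E_- both contribute the trace of nabla with
  the same sign.\<close>

lemma div_D_zero:
  assumes v: "v \<in> \<Gamma>" and xy: "E_frame p x y"
  shows "(\<Sum>i<rnk C. pair C (D_zero C G nabla (x i) v) (y i) p) = div_G C g nabla v p"
proof -
  let ?T = "\<lambda>u u'. pair C (D_zero C G nabla u v) u' p"
  have T: "tens_E p ?T"
    unfolding tens_E_def using v by (auto simp: D_zero_add D_zero_linear(3) pair_add pair_fmul)
  obtain a b where ab: "dual_vf p a b" using dual_vf_exists by blast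
  note D = dual_vfD[OF ab]
  have L: "lift C G s X \<in> \<Gamma>" if "s \<in> {1, -1}" "X \<in> VF" for s X
    using lift_props(1)[OF that] .
  have 1: "?T (lift C G s X) (lift C G s Y) = s * gg (nabla X (pj s v)) Y p + (1 / 6) * hh X (pj s v) Y p"
    if s: "s \<in> {1, -1}" and X: "X \<in> VF" "Y \<in> VF" for s X Y
  proof -
    have pd: "pair C (D_zero C G nabla (lift C G s X) v) (lift C G s Y) p
        = s * gg (pj s (D_zero C G nabla (lift C G s X) v)) (pj s (lift C G s Y)) p"
      by (rule pure_pair(2)[OF s L[OF s X(2)] _ pj_lift(2)[OF s X(2)]]) (use L[OF s X(1)] v in simp)
    show ?thesis
      unfolding pd pj_D_zero[OF s L[OF s X(1)] v] pj_lift(1)[OF s X(2)] gg_D0[OF L[OF s X(1)] v X(2)] pj_lift[OF s X(1)] lift_props(3)[OF s X(1)]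
      using s X v by (auto simp: hh_zero)
  qed
  have z: "(\<Sum>i<DIM('e). hh (a i) Y (b i) p) = 0" if Y: "Y \<in> VF" for Y
  proof -
    have "(\<Sum>i<DIM('e). hh (b i) Y (a i) p) = (\<Sum>i<DIM('e). hh (a i) Y (b i) p)"
      by (rule dual_vf_swap[OF ab, of "\<lambda>X Z. hh X Y Z p"]) (use Y in \<open>auto simp: hh_linear hh_linear3\<close>)
    moreover have "hh (b i) Y (a i) p = - hh (a i) Y (b i) p" for i
      using hh_skew[OF D(2) Y D(1), of i i p] hh_skew[OF Y D(1) D(2), of i i p] by simp
    ultimately show ?thesis by (simp add: sum_negf)
  qed
  have T2: "tens_TM p (\<lambda>Y Y'. gg (nabla Y (anch C v)) Y' p)"
    unfolding tens_TM_def using anch_VF[OF v] by (auto simp: nab_add nab_fmul gg_add gg_fmul)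
  have "(\<Sum>i<rnk C. ?T (x i) (y i)) = trace_E C p ?T"
    by (rule trace_E_frame[OF T xy, symmetric])
  also have "\<dots> = (\<Sum>i<DIM('e). gg (nabla (a i) (pj 1 v)) (b i) p) + (\<Sum>i<DIM('e). gg (nabla (a i) (pj (-1) v)) (b i) p)"
    unfolding trace_E_eq[OF T ab] using D v z[of "pj 1 v"] z[of "pj (-1) v"]
    by (simp add: 1 sum.distrib sum_subtractf sum_negf sum_divide_distrib[symmetric])
  also have "\<dots> = (\<Sum>i<DIM('e). gg (nabla (a i) (anch C v)) (b i) p)"
    using D v by (simp add: anch_pj nab_add gg_add sum.distrib)
  also have "\<dots> = div_G C g nabla v p"
    by (simp add: div_G_def div_g_def trace_TM_eq[OF T2 ab])
  finally show ?thesis .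
qed

end

locale canonical_lc = courant_geometry C G g nabla H
  for C :: "('m::{t2_space,second_countable_topology}, 'e::euclidean_space, 'v::real_vector) courant"
    and G g nabla H +
  fixes dv :: "('m \<Rightarrow> 'v) \<Rightarrow> 'm \<Rightarrow> real" and e :: "'m \<Rightarrow> 'v" and D :: "('m, 'v) gconn"
  assumes dim: "DIM('e) \<ge> 2" and e: "e \<in> \<Gamma>"
    and dv: "\<forall>v\<in>\<Gamma>. dv v = div_G C g nabla v - pair C e v"
    and canon: "canonical_connection C G nabla dv D"
begin

lemma glc: "generalised_levi_civita C G D"
  using canon by (simp add: canonical_connection_def)

lemma conn: "generalised_connection C D"
  using glc by (simp add: generalised_levi_civita_def)

lemma D_section [simp, intro]: "u \<in> \<Gamma> \<Longrightarrow> v \<in> \<Gamma> \<Longrightarrow> D u v \<in> \<Gamma>"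
  using conn unfolding generalised_connection_def by blast

lemma D_add:
  assumes "u \<in> \<Gamma>" "u' \<in> \<Gamma>" "v \<in> \<Gamma>"
  shows "D (u + u') v = D u v + D u' v" "D v (u + u') = D v u + D v u'"
proof -
  have "bilin_on \<Gamma> D" using conn unfolding generalised_connection_def by blast
  from bilin_onD(1,2)[OF this assms]
  show "D (u + u') v = D u v + D u' v" "D v (u + u') = D v u + D v u'" .
qed

lemma D_fmul:
  assumes "u \<in> \<Gamma>" "v \<in> \<Gamma>" "f \<in> CM"
  shows "D (fmul f u) v = fmul f (D u v)" "D u (fmul f v) = fmul (vf_apply (anch C u) f) v + fmul f (D u v)"
  using conn assms unfolding generalised_connection_def by blast+

lemma D_metric:
  assumes "u \<in> \<Gamma>" "v \<in> \<Gamma>" "w \<in> \<Gamma>"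
  shows "vf_apply (anch C u) (pair C v w) p = pair C (D u v) w p + pair C v (D u w) p"
    "vf_apply (anch C u) (ev2 G v w) p = ev2 G (D u v) w p + ev2 G v (D u w) p"
proof -
  have "vf_apply (anch C u) (pair C v w) = pair C (D u v) w + pair C v (D u w)"
    using conn assms unfolding generalised_connection_def by blast
  then show "vf_apply (anch C u) (pair C v w) p = pair C (D u v) w p + pair C v (D u w) p" by simp
  have "vf_apply (anch C u) (ev2 G v w) = ev2 G (D u v) w + ev2 G v (D u w)"
    using glc assms unfolding generalised_levi_civita_def by blast
  then show "vf_apply (anch C u) (ev2 G v w) p = ev2 G (D u v) w p + ev2 G v (D u w) p" by simp
qed

lemma D_torsion: "u \<in> \<Gamma> \<Longrightarrow> v \<in> \<Gamma> \<Longrightarrow> w \<in> \<Gamma> \<Longrightarrow> torsion C D u v w = 0"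
  using glc unfolding generalised_levi_civita_def by blast

text \<open>Test against w in E_-s. It is orthogonal to v for the scalar product and for G, so
  differentiating gives two equations for the E_-s part of D_u v and the E_s part of D_u w. Their
  relative signs differ, hence both unknowns vanish.\<close>

lemma D_pure:
  assumes s: "s \<in> {1, -1}" and u: "u \<in> \<Gamma>" and v: "v \<in> \<Gamma>" "pj (- s) v = 0"
  shows "pj (- s) (D u v) = 0"
proof (rule VF_eqI)
  have ms: "- s \<in> {1, -1}" using s by auto
  show "pj (- s) (D u v) \<in> VF" "0 \<in> VF" using u v by auto
  fix Z p assume Z: "Z \<in> VF"
  let ?w = "lift C G (- s) Z"
  have w: "?w \<in> \<Gamma>" "pj (- s) ?w = Z" "pj s ?w = 0"
    using lift_props(1)[OF ms Z] pj_lift[OF ms Z] by auto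
  have "pair C v ?w q = 0" "ev2 G v ?w q = 0" for q
    using s v w Z by (auto simp: pair_pj G_pj gg_zero)
  then have "pair C v ?w = 0" "ev2 G v ?w = 0"
    by (simp_all add: fun_eq_iff)
  then have "pair C (D u v) ?w p + pair C v (D u ?w) p = 0" "ev2 G (D u v) ?w p + ev2 G v (D u ?w) p = 0"
    using D_metric[OF u v(1) w(1), of p] vf_apply_simps(6)[OF anch_VF[OF u]] by simp_all
  then have "gg (pj (- s) (D u v)) Z p = 0"
    using s v w Z u by (auto simp: pair_pj G_pj gg_zero)
  then show "gg (pj (- s) (D u v)) Z p = gg 0 Z p" using Z by (simp add: gg_zero)
qed

definition S :: "('m \<Rightarrow> 'v) \<Rightarrow> ('m \<Rightarrow> 'v) \<Rightarrow> 'm \<Rightarrow> 'v" where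
  "S u v = D u v - D_zero C G nabla u v"

lemma S_section [simp, intro]: "u \<in> \<Gamma> \<Longrightarrow> v \<in> \<Gamma> \<Longrightarrow> S u v \<in> \<Gamma>"
  by (simp add: S_def section_diff)

lemma S_linear:
  assumes u: "u \<in> \<Gamma>" "u' \<in> \<Gamma>" and v: "v \<in> \<Gamma>" and f: "f \<in> CM"
  shows "S (u + u') v = S u v + S u' v" "S v (u + u') = S v u + S v u'"
    "S (fmul f u) v = fmul f (S u v)" "S v (fmul f u) = fmul f (S v u)"
  unfolding S_def D_zero_linear[OF assms] D_add[OF u v] D_fmul(1)[OF u(1) v f] D_fmul(2)[OF v u(1) f]
  by (auto simp: fmul_def fun_eq_iff scaleR_diff_right)

lemma S_pair: "u \<in> \<Gamma> \<Longrightarrow> v \<in> \<Gamma> \<Longrightarrow> w \<in> \<Gamma> \<Longrightarrow>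
    pair C (S u v) w p = pair C (D u v) w p - pair C (D_zero C G nabla u v) w p"
  by (simp add: S_def pair_diff)

lemma S_skew:
  assumes "u \<in> \<Gamma>" "v \<in> \<Gamma>" "w \<in> \<Gamma>"
  shows "pair C (S u v) w p = - pair C (S u w) v p"
  using D_metric(1)[OF assms, of p] D_zero_metric[OF assms, of p] assms
    pair_sym[of v "D u w" p] pair_sym[of v "D_zero C G nabla u w" p]
  by (simp add: S_pair)

text \<open>The bracket cancels in the difference of the two vanishing torsions; skewness of S
  brings what remains into cyclic form.\<close>

lemma S_cyclic:
  assumes u: "u \<in> \<Gamma>" and v: "v \<in> \<Gamma>" and w: "w \<in> \<Gamma>"
  shows "pair C (S u v) w p + pair C (S v w) u p + pair C (S w u) v p = 0"
proof -
  have "torsion C D u v w p = torsion C (D_zero C G nabla) u v w p"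
    using D_torsion[OF assms] D_zero_torsion_free[OF assms] by simp
  then have "pair C (S u v) w p - pair C (S v u) w p + pair C (S w u) v p = 0"
    using assms dorfman_section[OF u v] by (simp add: torsion_def pair_diff section_diff S_pair)
  then show ?thesis using S_skew[OF v u w, of p] by simp
qed

lemma S_pure:
  assumes s: "s \<in> {1, -1}" and u: "u \<in> \<Gamma>" and v: "v \<in> \<Gamma>" "pj (- s) v = 0"
  shows "pj (- s) (S u v) = 0"
proof -
  have ms: "- s \<in> {1, -1}" using s by auto
  have "nabla (anch C u) 0 = 0"
    using nab_scaleR(2)[OF anch_VF[OF u] VF_zero, of 0] by simp
  moreover have "Hs X 0 = 0" if "X \<in> VF" for X
    by (rule VF_eqI) (use that in \<open>auto simp: gg_Hs hh_zero gg_zero\<close>)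
  ultimately have "D0 (- s) u v = 0"
    using u v(2) by (simp add: D0_def Dt_def)
  then show ?thesis
    using D_pure[OF assms] pj_D_zero[OF ms u v(1)] u v by (simp add: S_def pj_diff)
qed

text \<open>The trace of S is the difference of the two divergences, and \<open>D_zero\<close> has
  the metric divergence by \<open>div_D_zero\<close>.\<close>

lemma S_trace:
  assumes v: "v \<in> \<Gamma>" and xy: "E_frame p x y"
  shows "(\<Sum>i<rnk C. pair C (S (x i) v) (y i) p) = - pair C e v p"
proof -
  let ?T = "\<lambda>u u'. pair C (D u v) u' p"
  have T: "tens_E p ?T"
    unfolding tens_E_def using v by (auto simp: D_add D_fmul(1) pair_add pair_fmul)
  have "div_conn C D v = dv v"
    using canon v unfolding canonical_connection_def by blast
  then have "trace_E C p ?T = div_G C g nabla v p - pair C e v p"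
    using dv v by (simp add: div_conn_def fun_eq_iff)
  then have "(\<Sum>i<rnk C. pair C (D (x i) v) (y i) p) = div_G C g nabla v p - pair C e v p"
    by (simp add: trace_E_frame[OF T xy])
  then show ?thesis
    using div_D_zero[OF v xy] E_frameD(1,2)[OF xy] v by (simp add: S_pair sum_subtractf)
qed

lemmas S_add = S_linear(1,2)[OF _ _ _ Cinf_zero]

lemma S_tens1:
  assumes "u \<in> \<Gamma>" "v \<in> \<Gamma>"
  shows "tens1 p (\<lambda>w. pair C (S u w) v p)" "tens1 p (\<lambda>w. pair C (S w u) v p)"
    "tens1 p (\<lambda>w. pair C (S u v) w p)" "tens1 p (\<lambda>w. pair C v w p)"
  unfolding tens1_def using assms
  by (auto simp: S_add S_linear(3,4) pair_add pair_fmul)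

lemma proj_self_adjoint:
  assumes s: "s \<in> {1, -1}" and a: "a \<in> \<Gamma>" "pj (- s) a = 0" and v: "v \<in> \<Gamma>"
  shows "pair C a (proj C G s v) p = pair C a v p"
  using pair_pf[OF s pure_EF[OF s a] section_fibre[OF v]] by (simp add: ev2_def proj_pf)

text \<open>The components of \<open>S\<close> are read off from the orthogonality to the test tensors; the cyclic
  identity turns the three contributions into \<open>2 S\<close>, and the correction term yields the trace.\<close>

lemma S_formula:
  assumes s: "s \<in> {1, -1}" and a: "a \<in> \<Gamma>" "pj (- s) a = 0" and b: "b \<in> \<Gamma>" "pj (- s) b = 0"
    and c: "c \<in> \<Gamma>" "pj (- s) c = 0"
  shows "pair C (S a b) c p = 1 / (real DIM('e) - 1) * (pair C a b p * pair C e c p - pair C a c p * pair C e b p)"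
proof -
  define k where "k = 1 / (real DIM('e) - 1)"
  define t where "t = pair C a c p *\<^sub>R b + (- pair C a b p) *\<^sub>R c"
  have t: "t \<in> \<Gamma>" "pj (- s) t = 0"
    using b c by (simp_all add: t_def pj_add pj_scaleR del: scaleR_minus_left)
  let ?K = "test_tensor p s (a p) (b p) (c p)"
  note E = pure_EF[OF s a, of p] pure_EF[OF s b, of p] pure_EF[OF s c, of p]
  note P = test_tensor_pairing[OF s E]
  have ker: "?K \<in> prolongation_kernel C G p" by (rule test_tensor_kernel[OF s E dim])
  then have Kb: "bilin_on (fibre C p) ?K"
    unfolding prolongation_kernel_def so_prolongation_def by blast
  obtain x y where xy: "E_frame p x y" using E_frame_exists by blast
  note xyD = E_frameD[OF xy]
  let ?in = "\<lambda>u u' v v'. pairing C p (S u v p) (?K (u' p) (v' p))"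
  have Kf: "?K (u p) (v p) \<in> fibre C p" if "u \<in> \<Gamma>" "v \<in> \<Gamma>" for u v
    using P(2)[OF section_fibre[OF that(1)] section_fibre[OF that(2)] section_fibre[OF that(1)]] .
  have tens_in: "tens_E p (?in u u')" if "u \<in> \<Gamma>" "u' \<in> \<Gamma>" for u u'
  proof -
    have "?K x (h *\<^sub>R y) = h *\<^sub>R ?K x y" if "x \<in> fibre C p" "y \<in> fibre C p" for x y h
      by (rule bilin_onD(4)[OF Kb that(2,2,1)])
    then show ?thesis
      unfolding tens_E_def using that Kf section_fibre bilin_onD(2)[OF Kb]
      by (auto simp: S_add S_linear(4) pairing_bilin pairing_scaleR fmul_apply)
  qed
  have inner: "trace_E C p (?in u u') = (4 / 3) * (pair C a u' p * pair C (S u b) c p)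
      + (2 / 3) * (pair C b u' p * pair C (S u a) c p) - (2 / 3) * (pair C c u' p * pair C (S u a) b p)
      - 2 * k * pair C (S u t) u' p" if u: "u \<in> \<Gamma>" "u' \<in> \<Gamma>" for u u'
  proof -
    \<comment> \<open>The correction in the test tensor involves the E_s part of u'. Since S_u t
      lies in E_s, replacing that part by u' itself changes nothing in the end.\<close>
    let ?pu = "proj C G s u'"
    have pu: "?pu \<in> \<Gamma>" by (rule proj_section[OF u(2)])
    have "?in u u' (x j) (y j) =
        (2 / 3) * pair C a u' p * (pair C b (y j) p * pair C (S u (x j)) c p)
      + (1 / 3) * pair C b u' p * (pair C a (y j) p * pair C (S u (x j)) c p)
      - (2 / 3) * pair C a u' p * (pair C c (y j) p * pair C (S u (x j)) b p)
      - (1 / 3) * pair C c u' p * (pair C a (y j) p * pair C (S u (x j)) b p)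
      + (1 / 3) * pair C c u' p * (pair C b (y j) p * pair C (S u (x j)) a p)
      - (1 / 3) * pair C b u' p * (pair C c (y j) p * pair C (S u (x j)) a p)
      + k * (pair C ?pu (y j) p * pair C (S u (x j)) t p)
      - k * (pair C t (y j) p * pair C (S u (x j)) ?pu p)" if j: "j < rnk C" for j
    proof -
      note xj = xyD(1)[OF j] and yj = xyD(2)[OF j]
      have sx: "S u (x j) \<in> \<Gamma>" using u xj by simp
      have 1: "?in u u' (x j) (y j) = pairing C p (?K (u' p) (y j p)) (S u (x j) p)"
        by (rule pairing_sym[OF section_fibre[OF sx] Kf[OF u(2) yj]])
      have tp: "t p = pairing C p (a p) (c p) *\<^sub>R b p + (- pairing C p (a p) (b p)) *\<^sub>R c p"
        by (simp add: t_def ev2_def)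
      note P1 = P(1)[OF section_fibre[OF u(2)] section_fibre[OF yj] section_fibre[OF sx], folded tp k_def]
      have sw: "pairing C p (w p) (S u (x j) p) = pairing C p (S u (x j) p) (w p)" if "w \<in> \<Gamma>" for w
        by (rule pairing_sym[OF section_fibre[OF that] section_fibre[OF sx]])
      show ?thesis
        unfolding 1 P1 using sw[OF a(1)] sw[OF b(1)] sw[OF c(1)] sw[OF t(1)] sw[OF pu]
        by (simp add: ev2_def proj_pf field_simps)
    qed
    then have "trace_E C p (?in u u') = (\<Sum>j<rnk C.
        (2 / 3) * pair C a u' p * (pair C b (y j) p * pair C (S u (x j)) c p)
      + (1 / 3) * pair C b u' p * (pair C a (y j) p * pair C (S u (x j)) c p)
      - (2 / 3) * pair C a u' p * (pair C c (y j) p * pair C (S u (x j)) b p)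
      - (1 / 3) * pair C c u' p * (pair C a (y j) p * pair C (S u (x j)) b p)
      + (1 / 3) * pair C c u' p * (pair C b (y j) p * pair C (S u (x j)) a p)
      - (1 / 3) * pair C b u' p * (pair C c (y j) p * pair C (S u (x j)) a p)
      + k * (pair C ?pu (y j) p * pair C (S u (x j)) t p)
      - k * (pair C t (y j) p * pair C (S u (x j)) ?pu p))"
      unfolding trace_E_frame[OF tens_in[OF u] xy] by (intro sum.cong refl) simp
    also have "\<dots> = (2 / 3) * pair C a u' p * pair C (S u b) c p + (1 / 3) * pair C b u' p * pair C (S u a) c p
      - (2 / 3) * pair C a u' p * pair C (S u c) b p - (1 / 3) * pair C c u' p * pair C (S u a) b p
      + (1 / 3) * pair C c u' p * pair C (S u b) a p - (1 / 3) * pair C b u' p * pair C (S u c) a p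
      + k * pair C (S u ?pu) t p - k * pair C (S u t) ?pu p"
      unfolding sum.distrib sum_subtractf sum_distrib_left[symmetric]
      by (simp only: tens1_contract[OF S_tens1(1)[OF u(1) a(1)] xy] tens1_contract[OF S_tens1(1)[OF u(1) b(1)] xy]
          tens1_contract[OF S_tens1(1)[OF u(1) c(1)] xy] tens1_contract[OF S_tens1(1)[OF u(1) t(1)] xy]
          tens1_contract[OF S_tens1(1)[OF u(1) pu] xy] a(1) b(1) c(1) t(1) pu)
    also have "\<dots> = (4 / 3) * (pair C a u' p * pair C (S u b) c p)
      + (2 / 3) * (pair C b u' p * pair C (S u a) c p) - (2 / 3) * (pair C c u' p * pair C (S u a) b p)
      - 2 * k * pair C (S u t) u' p"
      using S_skew[OF u(1) c(1) b(1), of p] S_skew[OF u(1) b(1) a(1), of p] S_skew[OF u(1) c(1) a(1), of p]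
        S_skew[OF u(1) pu t(1), of p] proj_self_adjoint[OF s S_section[OF u(1) t(1)] S_pure[OF s u(1) t] u(2), of p]
      by (simp add: field_simps)
    finally show ?thesis .
  qed
  have tens_out: "tens_E p (\<lambda>u u'. trace_E C p (?in u u'))"
  proof (rule tens_E_cong[OF _ inner])
    show "tens_E p (\<lambda>u u'. (4 / 3) * (pair C a u' p * pair C (S u b) c p)
      + (2 / 3) * (pair C b u' p * pair C (S u a) c p) - (2 / 3) * (pair C c u' p * pair C (S u a) b p)
      - 2 * k * pair C (S u t) u' p)"
      unfolding tens_E_def using a b c t
      by (auto simp: S_add S_linear(3) pair_add pair_fmul field_simps)
  qed
  have D0S: "trace_E C p (\<lambda>u u'. trace_E C p (\<lambda>v v'.
          pairing C p ((D u v - D_zero C G nabla u v) p) (?K (u' p) (v' p)))) = 0"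
    using canon ker unfolding canonical_connection_def by blast
  have "0 = trace_E C p (\<lambda>u u'. trace_E C p (?in u u'))"
    using D0S by (simp add: S_def)
  also have "\<dots> = (\<Sum>i<rnk C. (4 / 3) * (pair C a (y i) p * pair C (S (x i) b) c p)
      + (2 / 3) * (pair C b (y i) p * pair C (S (x i) a) c p) - (2 / 3) * (pair C c (y i) p * pair C (S (x i) a) b p)
      - 2 * k * pair C (S (x i) t) (y i) p)"
    unfolding trace_E_frame[OF tens_out xy] by (intro sum.cong refl) (simp add: inner xyD(1,2))
  also have "\<dots> = (4 / 3) * pair C (S a b) c p + (2 / 3) * pair C (S b a) c p - (2 / 3) * pair C (S c a) b p
      + 2 * k * pair C e t p"
    unfolding sum.distrib sum_subtractf sum_distrib_left[symmetric] S_trace[OF t(1) xy]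
      tens1_contract[OF S_tens1(2)[OF b(1) c(1)] xy a(1)] tens1_contract[OF S_tens1(2)[OF a(1) c(1)] xy b(1)]
      tens1_contract[OF S_tens1(2)[OF a(1) b(1)] xy c(1)] by simp
  also have "\<dots> = 2 * pair C (S a b) c p + 2 * k * pair C e t p"
    using S_skew[OF b(1) a(1) c(1), of p] S_cyclic[OF a(1) b(1) c(1), of p] by (simp add: field_simps)
  finally have "pair C (S a b) c p = - k * pair C e t p" by simp
  moreover have "pair C e t p = pair C a c p * pair C e b p - pair C a b p * pair C e c p"
    using e b c by (simp add: t_def pair_add pair_scaleR del: scaleR_minus_left)
  ultimately show ?thesis unfolding k_def[symmetric] by (simp add: algebra_simps)
qed

text \<open>S preserves types in its second argument, so two terms of the cyclic identity pair E_+
  with E_- and vanish; the third must vanish as well.\<close>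

lemma S_mixed:
  assumes s: "s \<in> {1, -1}" and u: "u \<in> \<Gamma>" "pj s u = 0" and v: "v \<in> \<Gamma>" "pj (- s) v = 0"
  shows "S u v = 0"
proof (rule section_eqI)
  have ms: "- s \<in> {1, -1}" using s by auto
  show "S u v \<in> \<Gamma>" "0 \<in> \<Gamma>" using u v by auto
  have z: "pj r 0 = 0" for r using pj_scaleR[OF section_zero, of r 0] by simp
  have 1: "pj (- s) (S u v) = 0" by (rule S_pure[OF s u(1) v])
  have 2: "pj s (S u v) = 0"
  proof (rule VF_eqI)
    show "pj s (S u v) \<in> VF" "0 \<in> VF" using u v by auto
    fix Z p assume Z: "Z \<in> VF"
    let ?w = "lift C G s Z"
    have w: "?w \<in> \<Gamma>" "pj s ?w = Z" "pj (- s) ?w = 0"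
      using lift_props(1)[OF s Z] pj_lift[OF s Z] by auto
    have "pair C (S v ?w) u p = 0"
      using pure_pair(1)[OF s S_section[OF v(1) w(1)] u(1) S_pure[OF s v(1) w(1,3)], of p] u v w
      by (simp add: gg_zero)
    moreover have "pair C (S ?w u) v p = 0"
      using pure_pair(2)[OF s v(1) S_section[OF w(1) u(1)] v(2), of p] S_pure[OF ms w(1) u(1)] u v w
      by (simp add: gg_zero)
    ultimately have "pair C (S u v) ?w p = 0"
      using S_cyclic[OF u(1) v(1) w(1), of p] by simp
    then have "gg (pj s (S u v)) Z p = 0"
      using pure_pair(2)[OF s w(1) S_section[OF u(1) v(1)] w(3), of p] w(2) s by auto
    then show "gg (pj s (S u v)) Z p = gg 0 Z p" using Z by (simp add: gg_zero)
  qed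
  show "pj 1 (S u v) = pj 1 0" "pj (-1) (S u v) = pj (-1) 0"
    using s 1 2 z by auto
qed

subsection \<open>The connection on lifts\<close>

definition P :: "real \<Rightarrow> 'm vfield \<Rightarrow> 'm vfield \<Rightarrow> 'm vfield" where
  "P s X Y = (s / 6) *\<^sub>R Hs X Y + (s * (1 / (real DIM('e) - 1))) *\<^sub>R (fmul (gg X Y) (pj s e) - fmul (gg (pj s e) Y) X)"

lemma P_VF [simp, intro]: "X \<in> VF \<Longrightarrow> Y \<in> VF \<Longrightarrow> P s X Y \<in> VF"
  unfolding P_def using e by (intro VF_add VF_scaleR VF_diff VF_fmul Hs_VF g_CM pj_VF)

lemma D_lift:
  assumes s: "s \<in> {1, -1}" and X: "X \<in> VF" and Y: "Y \<in> VF"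
  shows "D (lift C G s X) (lift C G s Y) = lift C G s (nabla X Y + P s X Y)"
    "D (lift C G (- s) X) (lift C G s Y) = lift C G s (nabla X Y + (s / 2) *\<^sub>R Hs X Y)"
proof -
  have ms: "- s \<in> {1, -1}" using s by auto
  \<comment> \<open>D preserves the type of v, so the E_-s components of both sides vanish and only
    the E_s component has to be compared.\<close>
  have lft: "D u v = lift C G s W"
    if u: "u \<in> \<Gamma>" and v: "v \<in> \<Gamma>" "pj (- s) v = 0" and W: "W \<in> VF"
      and eq: "\<And>Z p. Z \<in> VF \<Longrightarrow> gg (pj s (D u v)) Z p = gg W Z p" for u v W
  proof (rule section_eqI)
    show "D u v \<in> \<Gamma>" "lift C G s W \<in> \<Gamma>" using u v lift_props(1)[OF s W] by auto
    have "pj s (D u v) = W" by (rule VF_eqI) (use u v W eq in auto)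
    then show "pj 1 (D u v) = pj 1 (lift C G s W)" "pj (-1) (D u v) = pj (-1) (lift C G s W)"
      using s W D_pure[OF s u v] by auto
  qed
  have pjD: "gg (pj s (D u v)) Z p = gg (D0 s u v) Z p + gg (pj s (S u v)) Z p"
    if "u \<in> \<Gamma>" "v \<in> \<Gamma>" "Z \<in> VF" for u v Z p
    using that by (simp add: S_def pj_diff gg_diff pj_D_zero[OF s])
  note L = lift_props(1)[OF s X] lift_props(1)[OF s Y] pj_lift[OF s X] pj_lift[OF s Y]
  note LX = lift_props(3)[OF s X] lift_props(3)[OF ms X] lift_props(1)[OF ms X] pj_lift[OF ms X, simplified]
  show "D (lift C G s X) (lift C G s Y) = lift C G s (nabla X Y + P s X Y)"
  proof (rule lft)
    show "lift C G s X \<in> \<Gamma>" "lift C G s Y \<in> \<Gamma>" "pj (- s) (lift C G s Y) = 0" "nabla X Y + P s X Y \<in> VF"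
      using L X Y by auto
    fix Z p assume Z: "Z \<in> VF"
    note LZ = lift_props(1)[OF s Z] pj_lift[OF s Z]
    have pp: "pair C (lift C G s A) (lift C G s B) p = s * gg A B p" if "A \<in> VF" "B \<in> VF" for A B
      using pure_pair(1)[OF s lift_props(1)[OF s that(1)] lift_props(1)[OF s that(2)] pj_lift(2)[OF s that(1)], of p]
        pj_lift[OF s that(1)] pj_lift[OF s that(2)] by simp
    have pe: "pair C e (lift C G s B) p = s * gg (pj s e) B p" if "B \<in> VF" for B
      using pure_pair(2)[OF s lift_props(1)[OF s that] e pj_lift(2)[OF s that], of p] pj_lift[OF s that] by simp
    \<comment> \<open>Each scalar product on E_s is s g. The two factors s on the right cancel and
      the one on the left remains, which is the sign in front of 1 / (d - 1) in
      \<open>P\<close>.\<close>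
    have "s * gg (pj s (S (lift C G s X) (lift C G s Y))) Z p = pair C (S (lift C G s X) (lift C G s Y)) (lift C G s Z) p"
      using pure_pair(2)[OF s LZ(1) S_section[OF L(1,2)] LZ(3), of p] LZ by simp
    also have "\<dots> = (1 / (real DIM('e) - 1)) * (s * gg X Y p * (s * gg (pj s e) Z p) - s * gg X Z p * (s * gg (pj s e) Y p))"
      using S_formula[OF s L(1) L(4) L(2) L(6) LZ(1) LZ(3), of p] X Y Z by (simp only: pp pe)
    finally have "gg (pj s (S (lift C G s X) (lift C G s Y))) Z p =
        s * (1 / (real DIM('e) - 1)) * (gg X Y p * gg (pj s e) Z p - gg X Z p * gg (pj s e) Y p)"
      using s by (auto simp: diff_divide_distrib)
    then show "gg (pj s (D (lift C G s X) (lift C G s Y))) Z p = gg (nabla X Y + P s X Y) Z p"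
      unfolding pjD[OF L(1,2) Z] gg_D0[OF L(1,2) Z] L(3-6) LX(1)
      using X Y Z e by (simp add: P_def gg_simps gg_Hs hh_zero g_CM) (simp add: field_simps)?
  qed
  show "D (lift C G (- s) X) (lift C G s Y) = lift C G s (nabla X Y + (s / 2) *\<^sub>R Hs X Y)"
  proof (rule lft)
    show "lift C G (- s) X \<in> \<Gamma>" "lift C G s Y \<in> \<Gamma>" "pj (- s) (lift C G s Y) = 0"
      "nabla X Y + (s / 2) *\<^sub>R Hs X Y \<in> VF"
      using L LX X Y by auto
    fix Z p assume Z: "Z \<in> VF"
    have "S (lift C G (- s) X) (lift C G s Y) = 0"
      by (rule S_mixed[OF s LX(3) _ L(2) L(6)]) (use LX in simp)
    then have "pj s (S (lift C G (- s) X) (lift C G s Y)) = 0"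
      using pj_scaleR[OF section_zero, of s 0] by simp
    then show "gg (pj s (D (lift C G (- s) X) (lift C G s Y))) Z p = gg (nabla X Y + (s / 2) *\<^sub>R Hs X Y) Z p"
      unfolding pjD[OF LX(3) L(2) Z] gg_D0[OF LX(3) L(2) Z] L(5,6) LX
      using X Y Z by (simp add: gg_simps gg_Hs hh_zero)
  qed
qed

end

section \<open>Curvature\<close>

context courant_geometry
begin

section \<open>Symmetries of the Riemann tensor\<close>

lemma lie_apply: "lie_bracket X Y p f = X p (vf_apply Y f) - Y p (vf_apply X f)"
  by (simp add: lie_bracket_def)

lemma vf_apply_lie: "vf_apply (lie_bracket X Y) f = vf_apply X (vf_apply Y f) - vf_apply Y (vf_apply X f)"
  by (rule ext) (simp add: vf_apply_def lie_bracket_def)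

lemma jacobi:
  assumes "X \<in> VF" "Y \<in> VF" "Z \<in> VF"
  shows "lie_bracket (lie_bracket X Y) Z + lie_bracket (lie_bracket Y Z) X + lie_bracket (lie_bracket Z X) Y = 0"
proof (rule ext, rule ext)
  fix p f
  let ?J = "lie_bracket (lie_bracket X Y) Z + lie_bracket (lie_bracket Y Z) X + lie_bracket (lie_bracket Z X) Y"
  have J: "?J \<in> VF" using assms by simp
  show "?J p f = (0 :: 'm vfield) p f"
  \<comment> \<open>Tangent vectors vanish off the smooth functions by convention and are linear
    only on them.\<close>
  proof (cases "f \<in> CM")
    case False
    then show ?thesis using tangent_spaceD(1)[OF VF_TM[OF J]] by simp
  next
    case True
    have c: "vf_apply W f \<in> CM" if "W \<in> VF" for W by (rule VF_apply[OF that True])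
    have c2: "vf_apply W (vf_apply W' f) \<in> CM" if "W \<in> VF" "W' \<in> VF" for W W'
      by (rule VF_apply[OF that(1) c[OF that(2)]])
    have t: "W p (vf_apply W1 (vf_apply W2 f) - vf_apply W2 (vf_apply W1 f)) =
        W p (vf_apply W1 (vf_apply W2 f)) - W p (vf_apply W2 (vf_apply W1 f))"
      if "W \<in> VF" "W1 \<in> VF" "W2 \<in> VF" for W W1 W2
      by (rule tangent_diff[OF VF_TM[OF that(1)]]) (use that c2 in auto)
    show ?thesis
      using assms by (simp add: lie_apply vf_apply_lie t)
  qed
qed

lemma riemann_VF [simp, intro]: "X \<in> VF \<Longrightarrow> Y \<in> VF \<Longrightarrow> Z \<in> VF \<Longrightarrow> riemann nabla X Y Z \<in> VF"
  by (simp add: riemann_def)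

lemma riemann_skew12:
  assumes "X \<in> VF" "Y \<in> VF" "Z \<in> VF"
  shows "riemann nabla X Y Z = - riemann nabla Y X Z"
proof -
  have "lie_bracket X Y = - lie_bracket Y X" using assms by (simp add: lie_nab)
  then show ?thesis using assms by (simp add: riemann_def nab_minus)
qed

text \<open>Torsion-freeness turns the cyclic sum into minus the Jacobi expression.\<close>

lemma riemann_bianchi:
  assumes "X \<in> VF" "Y \<in> VF" "Z \<in> VF"
  shows "riemann nabla X Y Z + riemann nabla Y Z X + riemann nabla Z X Y = 0"
proof -
  have l: "nabla (lie_bracket X Y) Z = nabla Z (lie_bracket X Y) + lie_bracket (lie_bracket X Y) Z"
    if "X \<in> VF" "Y \<in> VF" "Z \<in> VF" for X Y Z
    using that lie_nab[of "lie_bracket X Y" Z] by simp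
  have n: "nabla Z (lie_bracket X Y) = nabla Z (nabla X Y) - nabla Z (nabla Y X)"
    if "X \<in> VF" "Y \<in> VF" "Z \<in> VF" for X Y Z
    using that by (simp add: lie_nab nab_diff)
  have "riemann nabla X Y Z + riemann nabla Y Z X + riemann nabla Z X Y =
    - (lie_bracket (lie_bracket X Y) Z + lie_bracket (lie_bracket Y Z) X + lie_bracket (lie_bracket Z X) Y)"
    unfolding riemann_def l[OF assms] l[OF assms(2,3,1)] l[OF assms(3,1,2)] n[OF assms] n[OF assms(2,3,1)]
      n[OF assms(3,1,2)] by (simp add: algebra_simps)
  then show ?thesis using jacobi[OF assms] by simp
qed

text \<open>The commutator of two derivatives of the function g(Z, W) is its derivative along the
  Lie bracket; after expanding with \<open>nab_metric\<close> the products of first derivatives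
  cancel.\<close>

lemma riemann_skew34:
  assumes X: "X \<in> VF" and Y: "Y \<in> VF" and Z: "Z \<in> VF" and W: "W \<in> VF"
  shows "gg (riemann nabla X Y Z) W p = - gg (riemann nabla X Y W) Z p"
proof -
  have m: "vf_apply A (gg Z W) = gg (nabla A Z) W + gg Z (nabla A W)" if "A \<in> VF" for A
    by (rule ext) (simp add: nab_metric[OF that Z W])
  have m2: "vf_apply A (vf_apply B (gg Z W)) p =
      gg (nabla A (nabla B Z)) W p + gg (nabla B Z) (nabla A W) p + gg (nabla A Z) (nabla B W) p + gg Z (nabla A (nabla B W)) p"
    if "A \<in> VF" "B \<in> VF" for A B
    using that Z W by (simp add: m[OF that(2)] vf_apply_simps(1) g_CM nab_metric)
  have "vf_apply X (vf_apply Y (gg Z W)) p - vf_apply Y (vf_apply X (gg Z W)) p = vf_apply (lie_bracket X Y) (gg Z W) p"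
    by (simp add: vf_apply_lie)
  then have "gg (nabla X (nabla Y Z)) W p + gg Z (nabla X (nabla Y W)) p - gg (nabla Y (nabla X Z)) W p
      - gg Z (nabla Y (nabla X W)) p = gg (nabla (lie_bracket X Y) Z) W p + gg Z (nabla (lie_bracket X Y) W) p"
    unfolding m2[OF X Y] m2[OF Y X] using m[of "lie_bracket X Y"] X Y by simp
  then show ?thesis
    using assms gg_sym[of Z "nabla X (nabla Y W)" p] gg_sym[of Z "nabla Y (nabla X W)" p]
      gg_sym[of Z "nabla (lie_bracket X Y) W" p]
    by (simp add: riemann_def gg_diff)
qed

text \<open>The classical octahedron argument: four Bianchi identities and the two skew-symmetries
  imply the claim by linear arithmetic.\<close>

lemma riemann_pair_symmetry:
  assumes X: "X \<in> VF" and Y: "Y \<in> VF" and Z: "Z \<in> VF" and W: "W \<in> VF"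
  shows "gg (riemann nabla X Y Z) W p = gg (riemann nabla Z W X) Y p"
proof -
  let ?r = "\<lambda>X Y Z W. gg (riemann nabla X Y Z) W p"
  have b: "?r X Y Z W + ?r Y Z X W + ?r Z X Y W = 0" if "X \<in> VF" "Y \<in> VF" "Z \<in> VF" "W \<in> VF" for X Y Z W
  proof -
    have "gg (riemann nabla X Y Z + riemann nabla Y Z X + riemann nabla Z X Y) W p = 0"
      unfolding riemann_bianchi[OF that(1-3)] using that by (simp add: gg_zero)
    then show ?thesis using that by (simp add: gg_add)
  qed
  have s1: "?r X Y Z W = - ?r Y X Z W" if "X \<in> VF" "Y \<in> VF" "Z \<in> VF" "W \<in> VF" for X Y Z W
    using riemann_skew12[OF that(1-3)] that by (simp add: gg_minus)
  note s2 = riemann_skew34[of _ _ _ _ p]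
  show ?thesis
    using b[OF X Y Z W] b[OF Y Z W X] b[OF Z W X Y] b[OF W X Y Z]
      s1[OF X Y Z W] s1[OF Y Z X W] s1[OF Z X Y W] s1[OF Y Z W X] s1[OF Z W Y X] s1[OF W Y Z X]
      s1[OF Z W X Y] s1[OF W X Z Y] s1[OF X Z W Y] s1[OF W X Y Z] s1[OF X Y W Z] s1[OF Y W X Z]
      s2[OF X Y Z W] s2[OF Y Z X W] s2[OF Z X Y W] s2[OF Z W X Y] s2[OF W X Y Z] s2[OF W Y Z X]
      s2[OF X Z Y W] s2[OF Y W X Z] s2[OF X W Y Z] s2[OF Z Y X W]
    by linarith
qed

lemma riemann_linear:
  assumes "X \<in> VF" "X' \<in> VF" "Y \<in> VF" "Z \<in> VF" "f \<in> CM"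
  shows "riemann nabla (X + X') Y Z = riemann nabla X Y Z + riemann nabla X' Y Z"
    "riemann nabla (fmul f X) Y Z = fmul f (riemann nabla X Y Z)"
proof -
  show "riemann nabla (X + X') Y Z = riemann nabla X Y Z + riemann nabla X' Y Z"
    using assms by (simp add: riemann_def lie_nab nab_simps)
  have Yf: "vf_apply Y f \<in> CM" by (rule VF_apply[OF assms(3,5)])
  show "riemann nabla (fmul f X) Y Z = fmul f (riemann nabla X Y Z)"
    using assms Yf by (simp add: riemann_def lie_nab nab_simps nab_fmul)
      (simp add: fmul_def fun_eq_iff algebra_simps)
qed

lemma ricci_frame:
  assumes A: "A \<in> VF" and B: "B \<in> VF" and xy: "dual_vf p x y"
  shows "ricci (atlas C) g nabla A B p = (\<Sum>i<DIM('e). gg (riemann nabla (x i) A B) (y i) p)"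
    "ricci (atlas C) g nabla A B p = (\<Sum>i<DIM('e). gg (riemann nabla (y i) A B) (x i) p)"
proof -
  let ?T = "\<lambda>Z Z'. gg (riemann nabla Z A B) Z' p"
  have T: "tens_TM p ?T"
    unfolding tens_TM_def using A B riemann_linear(1)[OF _ _ _ _ Cinf_zero]
    by (auto simp: riemann_linear(2) gg_add gg_fmul)
  show 1: "ricci (atlas C) g nabla A B p = (\<Sum>i<DIM('e). ?T (x i) (y i))"
    unfolding ricci_def by (rule trace_TM_eq[OF T xy])
  have sc: "?T (c *\<^sub>R X) Y = c * ?T X Y" "?T X (c *\<^sub>R Y) = c * ?T X Y" if "X \<in> VF" "Y \<in> VF" for c X Y
    using T that Cinf_const unfolding tens_TM_def by (metis fmul_const)+
  have "(\<Sum>i<DIM('e). ?T (y i) (x i)) = (\<Sum>i<DIM('e). ?T (x i) (y i))"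
    by (rule dual_vf_swap[OF xy, of ?T]) (use T sc in \<open>auto simp: tens_TM_def\<close>)
  then show "ricci (atlas C) g nabla A B p = (\<Sum>i<DIM('e). ?T (y i) (x i))"
    unfolding 1 ..
qed

lemma ricci_sym:
  assumes A: "A \<in> VF" and B: "B \<in> VF"
  shows "ricci (atlas C) g nabla A B p = ricci (atlas C) g nabla B A p"
proof -
  obtain x y where xy: "dual_vf p x y" using dual_vf_exists by blast
  note D = dual_vfD(1,2)[OF xy]
  have "gg (riemann nabla (x i) A B) (y i) p = gg (riemann nabla (y i) B A) (x i) p" for i
    using riemann_pair_symmetry[OF D(1) A B D(2), of i i p] riemann_skew34[OF B D(2) D(1) A, of i i p]
      riemann_skew12[OF B D(2) A, of i] gg_minus(1)[OF riemann_VF[OF D(2) B A] D(1), of i i p] by simp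
  then show ?thesis
    unfolding ricci_frame(1)[OF A B xy] ricci_frame(2)[OF B A xy] by simp
qed

end

section \<open>Tensoriality of the generalised Riemann curvature\<close>

context canonical_lc
begin

text \<open>The term with D along D_v w absorbs the derivative of a coefficient in the second
  direction slot.\<close>

lemma D_second_linear:
  assumes v: "v \<in> \<Gamma>" "v' \<in> \<Gamma>" and w: "w \<in> \<Gamma>" and a: "a \<in> \<Gamma>" and f: "f \<in> CM"
  shows "D_second D (v + v') w a = D_second D v w a + D_second D v' w a"
    "D_second D w (v + v') a = D_second D w v a + D_second D w v' a"
    "D_second D (fmul f v) w a = fmul f (D_second D v w a)"
    "D_second D w (fmul f v) a = fmul f (D_second D w v a)"
proof -
  have wf: "vf_apply (anch C w) f \<in> CM" by (rule VF_apply[OF anch_VF[OF w] f])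
  show "D_second D (v + v') w a = D_second D v w a + D_second D v' w a"
    "D_second D w (v + v') a = D_second D w v a + D_second D w v' a"
    using assms by (simp_all add: D_second_def D_add)
  show "D_second D (fmul f v) w a = fmul f (D_second D v w a)"
    using assms by (simp add: D_second_def D_fmul) (simp add: fmul_def fun_eq_iff scaleR_diff_right)
  show "D_second D w (fmul f v) a = fmul f (D_second D w v a)"
    using assms wf by (simp add: D_second_def D_fmul D_add) (simp add: fmul_def fun_eq_iff scaleR_diff_right)
qed

lemma D_second_section [simp, intro]: "v \<in> \<Gamma> \<Longrightarrow> w \<in> \<Gamma> \<Longrightarrow> a \<in> \<Gamma> \<Longrightarrow> D_second D v w a \<in> \<Gamma>"
  by (simp add: D_second_def section_diff)

text \<open>The failure of the second summand to be \<open>C\<^sup>\<infinity>\<close>-linear in \<open>v\<close> is governed by the anchor of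
  \<open>D\<^sub>a u - D\<^sub>u a - [a, u]\<close>, which vanishing torsion expresses through \<open>\<langle>D a, u\<rangle>\<close>; this cancels against
  the trace term.\<close>

lemma torsion_anchor:
  assumes a: "a \<in> \<Gamma>" and u: "u \<in> \<Gamma>" and f: "f \<in> CM" and xy: "E_frame p x y"
  shows "vf_apply (anch C a) (vf_apply (anch C u) f) p - vf_apply (anch C u) (vf_apply (anch C a) f) p
      - vf_apply (anch C (D a u - D u a)) f p
    = (\<Sum>i<rnk C. vf_apply (anch C (x i)) f p * pair C (D (y i) a) u p)"
proof -
  let ?t = "D a u - D u a - dorfman C a u"
  note d = dorfman_section[OF a u]
  have t: "?t \<in> \<Gamma>" using a u d by (simp add: section_diff)
  have an: "anch C (dorfman C a u) = lie_bracket (anch C a) (anch C u)"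
    using courant a u unfolding courant_algebroid_def by blast
  have "anch C (D a u - D u a) = anch C ?t + anch C (dorfman C a u)"
    using anch_add[OF t d] by simp
  then have 1: "vf_apply (anch C (D a u - D u a)) f p = vf_apply (anch C ?t) f p
      + (vf_apply (anch C a) (vf_apply (anch C u) f) p - vf_apply (anch C u) (vf_apply (anch C a) f) p)"
    by (simp add: an vf_apply_left vf_apply_lie)
  have "tens1 p (\<lambda>w. vf_apply (anch C w) f p)"
    unfolding tens1_def by (simp add: anch_add anch_fmul vf_apply_left)
  from tens1_contract[OF this xy t]
  have 2: "vf_apply (anch C ?t) f p = (\<Sum>i<rnk C. pair C ?t (y i) p * vf_apply (anch C (x i)) f p)" by simp
  have "pair C ?t (y i) p = - pair C (D (y i) a) u p" if "i < rnk C" for i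
  proof -
    have "torsion C D a u (y i) p = 0" using D_torsion[OF a u E_frameD(2)[OF xy that]] by simp
    then show ?thesis by (simp add: torsion_def)
  qed
  then have "vf_apply (anch C ?t) f p = - (\<Sum>i<rnk C. vf_apply (anch C (x i)) f p * pair C (D (y i) a) u p)"
    unfolding 2 sum_negf[symmetric] by (intro sum.cong refl) simp
  then show ?thesis using 1 by simp
qed

lemma gen_riemann_frame:
  assumes "u \<in> \<Gamma>" "a \<in> \<Gamma>" "v \<in> \<Gamma>" "b \<in> \<Gamma>" and xy: "E_frame p x y"
  shows "gen_riemann C D u a v b p = (1 / 2) * (pair C (D_second D v b a - D_second D b v a) u p
      + pair C (D_second D a u v - D_second D u a v) b p
      - (\<Sum>i<rnk C. pair C (D (x i) v) b p * pair C (D (y i) a) u p))"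
proof -
  have T: "tens_E p (\<lambda>w w'. pair C (D w v) b p * pair C (D w' a) u p)"
    unfolding tens_E_def using assms by (auto simp: D_add D_fmul(1) pair_add pair_fmul algebra_simps)
  show ?thesis unfolding gen_riemann_def trace_E_frame[OF T xy] ..
qed

text \<open>This permits evaluating the Ricci trace in an adapted frame. Additivity and the slot u
  are checked term by term; in the slot v the Leibniz defect of the second derivatives has to be
  cancelled by the trace term through \<open>torsion_anchor\<close>.\<close>

lemma gen_riemann_tensorial:
  assumes a: "a \<in> \<Gamma>" and b: "b \<in> \<Gamma>"
  shows "tens_E p (\<lambda>u v. gen_riemann C D u a v b p)"
proof -
  obtain x y where xy: "E_frame p x y" using E_frame_exists by blast
  note xyD = E_frameD(1,2)[OF xy]
  note dl = D_second_linear(1,2)[OF _ _ _ _ Cinf_zero] D_second_linear(3,4)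
  let ?F = "\<lambda>u v. (1 / 2) * (pair C (D_second D v b a - D_second D b v a) u p
      + pair C (D_second D a u v - D_second D u a v) b p
      - (\<Sum>i<rnk C. pair C (D (x i) v) b p * pair C (D (y i) a) u p))"
  have add3: "D_second D v w (a + c) = D_second D v w a + D_second D v w c"
    if "v \<in> \<Gamma>" "w \<in> \<Gamma>" "a \<in> \<Gamma>" "c \<in> \<Gamma>" for v w a c
    using that by (simp add: D_second_def D_add)
  \<comment> \<open>The first-order terms are symmetric in v and w and disappear on
    antisymmetrising; the defect is the commutator of the anchors acting on f, corrected by the
    anchor of D_v w - D_w v.\<close>
  have mul3: "pair C (D_second D v w (fmul f c) - D_second D w v (fmul f c)) b p =
      f p * pair C (D_second D v w c - D_second D w v c) b p
      + (vf_apply (anch C v) (vf_apply (anch C w) f) p - vf_apply (anch C w) (vf_apply (anch C v) f) p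
         - vf_apply (anch C (D v w - D w v)) f p) * pair C c b p"
    if v: "v \<in> \<Gamma>" and w: "w \<in> \<Gamma>" and c: "c \<in> \<Gamma>" and f: "f \<in> CM" for v w c f
  proof -
    have cm: "vf_apply (anch C z) f \<in> CM" if "z \<in> \<Gamma>" for z by (rule VF_apply[OF anch_VF[OF that] f])
    have "anch C (D v w - D w v) = anch C (D v w) - anch C (D w v)"
      using anch_add[of "D v w - D w v" "D w v"] v w by (simp add: section_diff)
    moreover have "pair C (D_second D r q (fmul f c)) b p = f p * pair C (D_second D r q c) b p
      + (vf_apply (anch C r) (vf_apply (anch C q) f) p - vf_apply (anch C (D r q)) f p) * pair C c b p
      + vf_apply (anch C q) f p * pair C (D r c) b p + vf_apply (anch C r) f p * pair C (D q c) b p"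
      if "r \<in> \<Gamma>" "q \<in> \<Gamma>" for r q
      using that c f b cm VF_apply[OF anch_VF cm]
      by (simp add: D_second_def D_fmul D_add pair_add pair_diff pair_fmul) (simp add: algebra_simps)
    ultimately show ?thesis
      using v w c f b pair_diff(1)[of "D_second D v w (fmul f c)" "D_second D w v (fmul f c)" b p]
        pair_diff(1)[of "D_second D v w c" "D_second D w v c" b p]
      by (simp add: vf_apply_left) (simp add: algebra_simps)
  qed
  show ?thesis
  proof (rule tens_E_cong)
    show "gen_riemann C D u a v b p = ?F u v" if "u \<in> \<Gamma>" "v \<in> \<Gamma>" for u v
      by (rule gen_riemann_frame[OF that(1) a that(2) b xy])
    show "tens_E p ?F"
      unfolding tens_E_def
    proof (intro conjI ballI)
      fix X Y Z assume m: "X \<in> \<Gamma>" "Y \<in> \<Gamma>" "Z \<in> \<Gamma>"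
      show "?F (X + Y) Z = ?F X Z + ?F Y Z"
        using m a b xyD by (simp add: dl pair_add pair_diff distrib_left sum.distrib) (simp add: field_simps)?
      show "?F Z (X + Y) = ?F Z X + ?F Z Y"
        using m a b xyD by (simp add: dl add3 D_add pair_add pair_diff distrib_right sum.distrib) (simp add: field_simps)?
    next
      fix f X Y assume m: "f \<in> CM" "X \<in> \<Gamma>" "Y \<in> \<Gamma>"
      show "?F (fmul f X) Y = f p * ?F X Y"
        using m a b xyD by (simp add: dl pair_fmul pair_diff sum_distrib_left algebra_simps)
      have "(\<Sum>i<rnk C. pair C (D (x i) (fmul f Y)) b p * pair C (D (y i) a) X p) =
          (\<Sum>i<rnk C. vf_apply (anch C (x i)) f p * pair C (D (y i) a) X p) * pair C Y b p
          + f p * (\<Sum>i<rnk C. pair C (D (x i) Y) b p * pair C (D (y i) a) X p)"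
        unfolding sum_distrib_left sum_distrib_right sum.distrib[symmetric]
        using m b xyD VF_apply[OF anch_VF m(1)]
        by (intro sum.cong refl) (simp add: D_fmul pair_add pair_fmul algebra_simps)
      then show "?F X (fmul f Y) = f p * ?F X Y"
        unfolding mul3[OF a m(2,3,1)] torsion_anchor[OF a m(2,1) xy]
        using m a b by (simp add: dl pair_diff pair_fmul) (simp add: field_simps)?
    qed
  qed
qed

end

section \<open>The pure-type Ricci curvature\<close>

context canonical_lc
begin

lemma pair_lift:
  assumes s: "s \<in> {1, -1}" and "X \<in> VF" "Y \<in> VF"
  shows "pair C (lift C G s X) (lift C G s Y) p = s * gg X Y p"
  using pure_pair(1)[OF s lift_props(1)[OF s assms(2)] lift_props(1)[OF s assms(3)] pj_lift(2)[OF s assms(2)]]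
    pj_lift(1)[OF s] assms by simp

lemma D_second_pure:
  assumes "s \<in> {1, -1}" "u \<in> \<Gamma>" "v \<in> \<Gamma>" "a \<in> \<Gamma>" "pj (- s) a = 0"
  shows "pj (- s) (D_second D u v a - D_second D v u a) = 0"
  using assms by (simp add: D_second_def pj_diff section_diff D_pure)

text \<open>D preserves types, so each of the three terms contains the pairing of a section of E_+
  with one of E_-. In the Ricci trace on E_s this removes the frame vectors of E_-s.\<close>

lemma gen_riemann_mixed:
  assumes s: "s \<in> {1, -1}" and u: "u \<in> \<Gamma>" "pj s u = 0" and a: "a \<in> \<Gamma>" "pj (- s) a = 0"
    and v: "v \<in> \<Gamma>" "pj s v = 0" and b: "b \<in> \<Gamma>" "pj (- s) b = 0"
  shows "gen_riemann C D u a v b p = 0"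
proof -
  have ms: "- s \<in> {1, -1}" using s by auto
  obtain x y where xy: "E_frame p x y" using E_frame_exists by blast
  have z: "pair C w u p = 0" if "w \<in> \<Gamma>" "pj (- s) w = 0" for w
    using pure_pair(1)[OF s that(1) u(1) that(2)] u that by (simp add: gg_zero)
  have z': "pair C w b p = 0" if "w \<in> \<Gamma>" "pj s w = 0" for w
    using pure_pair(2)[OF s b(1) that(1) b(2)] b that by (simp add: gg_zero)
  have "pair C (D (x i) v) b p = 0" if "i < rnk C" for i
    using z'[of "D (x i) v"] D_pure[OF ms E_frameD(1)[OF xy that] v(1)] E_frameD(1)[OF xy that] v by simp
  moreover have "pair C (D_second D v b a - D_second D b v a) u p = 0"
    by (rule z[OF _ D_second_pure[OF s v(1) b(1) a]]) (use v b a in \<open>simp add: section_diff\<close>)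
  moreover have "pair C (D_second D a u v - D_second D u a v) b p = 0"
    by (rule z') (use D_second_pure[OF ms a(1) u(1) v(1)] u v a in \<open>simp_all add: section_diff\<close>)
  ultimately show ?thesis
    unfolding gen_riemann_frame[OF u(1) a(1) v(1) b(1) xy] by simp
qed

end

section \<open>Reduction to tensors on M at a fixed point with a fixed frame\<close>

locale canonical_frame = canonical_lc C G g nabla H dv e D
  for C :: "('m::{t2_space,second_countable_topology}, 'e::euclidean_space, 'v::real_vector) courant"
    and G g nabla H dv e D +
  fixes s k :: real and p :: 'm and x y :: "nat \<Rightarrow> 'm vfield"
  assumes s: "s \<in> {1, -1}" and xy: "dual_vf p x y" and k: "k = s * (1 / (real DIM('e) - 1))"
begin

lemma frame_VF [simp, intro]: "x i \<in> VF" "y i \<in> VF"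
  by (fact dual_vfD(1,2)[OF xy])+

abbreviation "E \<equiv> pj s e"
text \<open>\<open>N\<close> and \<open>M\<close> are the derivatives of E_s sections along E_s and
  along E_-s, read on M; \<open>Dl\<close> is the torsion of \<open>N\<close>.\<close>

abbreviation "N X Y \<equiv> nabla X Y + P s X Y"
abbreviation "M X Y \<equiv> nabla X Y + (s / 2) *\<^sub>R Hs X Y"
abbreviation "Dl X Y \<equiv> P s X Y - P s Y X"

text \<open>The vector field dual to the one-form Z -> g(P_Z V, B), see \<open>gg_om\<close>. It
  arises when the trace over E_s contracts the directions of two factors P.\<close>

definition om :: "'m vfield \<Rightarrow> 'm vfield \<Rightarrow> 'm vfield" where
  "om V B = (s / 6) *\<^sub>R Hs V B + k *\<^sub>R (fmul (gg E B) V - fmul (gg E V) B)"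

lemma ss: "s * s = 1" "s * (s * c) = c"
  using s by auto

lemma E_VF [simp, intro]: "E \<in> VF"
  using e by simp

lemma om_VF [simp, intro]: "V \<in> VF \<Longrightarrow> B \<in> VF \<Longrightarrow> om V B \<in> VF"
  unfolding om_def by (intro VF_add VF_scaleR VF_diff VF_fmul Hs_VF g_CM E_VF)

lemma gg_P:
  assumes "X \<in> VF" "Y \<in> VF" "Z \<in> VF"
  shows "gg (P s X Y) Z q = s / 6 * hh X Y Z q + k * (gg X Y q * gg E Z q - gg E Y q * gg X Z q)"
    "gg Z (P s X Y) q = s / 6 * hh X Y Z q + k * (gg X Y q * gg E Z q - gg E Y q * gg X Z q)"
proof -
  show 1: "gg (P s X Y) Z q = s / 6 * hh X Y Z q + k * (gg X Y q * gg E Z q - gg E Y q * gg X Z q)"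
    using assms by (simp add: P_def k gg_simps gg_Hs g_CM)
  show "gg Z (P s X Y) q = s / 6 * hh X Y Z q + k * (gg X Y q * gg E Z q - gg E Y q * gg X Z q)"
    unfolding 1[symmetric] by (rule gg_sym) (use assms in auto)
qed

lemma gg_om:
  assumes "X \<in> VF" "Y \<in> VF" "Z \<in> VF"
  shows "gg (om X Y) Z q = gg (P s Z X) Y q"
  using assms hh_skew(3)[OF assms(3,1,2), of q] gg_sym[of X Z q] gg_sym[of Y Z q]
  by (simp add: gg_P) (simp add: om_def gg_simps gg_Hs g_CM algebra_simps)

lemma gg_Dl:
  assumes "X \<in> VF" "Y \<in> VF" "Z \<in> VF"
  shows "gg (Dl X Y) Z q = s / 3 * hh X Y Z q + k * (gg E X q * gg Y Z q - gg E Y q * gg X Z q)"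
  using assms hh_skew(1)[OF assms, of q] gg_sym[of X Y q]
  by (simp add: gg_P gg_diff algebra_simps)

lemma P_add:
  assumes "X \<in> VF" "X' \<in> VF" "Y \<in> VF"
  shows "P s (X + X') Y = P s X Y + P s X' Y" "P s Y (X + X') = P s Y X + P s Y X'"
  by (rule VF_eqI; use assms in \<open>simp add: gg_P gg_add hh_linear algebra_simps\<close>)+

lemma P_diff:
  assumes "X \<in> VF" "X' \<in> VF" "Y \<in> VF"
  shows "P s (X - X') Y = P s X Y - P s X' Y"
  using P_add(1)[OF VF_diff[OF assms(1,2)] assms(2,3)] by (simp add: eq_diff_eq)

text \<open>Vanishing torsion of D on three sections of E_s, read on M. By \<open>gg_om\<close> the
  right-hand side is dual to the difference of the \<open>M\<close> and \<open>N\<close> corrections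
  in the direction Z, the very coefficient with which nabla terms leave the trace over E.\<close>

lemma Dl_om:
  assumes "X \<in> VF" "Y \<in> VF"
  shows "Dl X Y = (s / 2) *\<^sub>R Hs X Y - om X Y"
proof (rule VF_eqI)
  fix Z q assume Z: "Z \<in> VF"
  show "gg (Dl X Y) Z q = gg ((s / 2) *\<^sub>R Hs X Y - om X Y) Z q"
    using assms Z hh_skew(3)[OF Z assms, of q] gg_sym[of X Z q] gg_sym[of Y Z q]
    by (simp add: gg_Dl) (simp add: gg_simps gg_Hs gg_om gg_P field_simps)
qed (use assms in auto)

section \<open>Contractions with the frame of TM at p\<close>

definition tens_vf :: "('m vfield \<Rightarrow> real) \<Rightarrow> bool" where
  "tens_vf T \<longleftrightarrow> (\<forall>X\<in>VF. \<forall>Y\<in>VF. T (X + Y) = T X + T Y) \<and> (\<forall>h\<in>CM. \<forall>X\<in>VF. T (fmul h X) = h p * T X)"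

lemma contract:
  assumes T: "tens_vf T" and W: "W \<in> VF"
  shows "(\<Sum>i<DIM('e). gg W (y i) p * T (x i)) = T W" "(\<Sum>i<DIM('e). gg W (x i) p * T (y i)) = T W"
proof -
  have add: "T (X + Y) = T X + T Y" if "X \<in> VF" "Y \<in> VF" for X Y
    using T that unfolding tens_vf_def by blast
  have mul: "T (fmul h X) = h p * T X" if "h \<in> CM" "X \<in> VF" for h X
    using T that unfolding tens_vf_def by blast
  have sc: "T (c *\<^sub>R X) = c * T X" if "X \<in> VF" for c X
    using mul[OF Cinf_const that, of c] by (simp add: fmul_const)
  have lin: "lin_on VF T" unfolding lin_on_def using add sc by simp
  have *: "(\<Sum>i<DIM('e). c i * T (z i)) = T W"
    if z: "\<And>i. z i \<in> VF" and r: "W p = (\<Sum>i<DIM('e). c i *\<^sub>R z i p)" for c z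
  proof -
    let ?w = "\<Sum>i<DIM('e). c i *\<^sub>R z i"
    have wV: "?w \<in> VF" by (intro VF_sum VF_scaleR z)
    have z0: "(W - ?w) p = 0" using r by (simp add: sum_fun_apply)
    have "T (W - ?w) = 0"
      by (rule VF_tensorial[where T=T and p=p, OF _ _ VF_diff[OF W wV] z0]) (use add mul in auto)
    then have "T W = T ?w" using add[of "W - ?w" ?w] W wV by simp
    also have "\<dots> = (\<Sum>i<DIM('e). c i * T (z i))"
      using lin_on_sum[OF lin VF_subspace, of "{..<DIM('e)}" z] z by simp
    finally show ?thesis by simp
  qed
  show "(\<Sum>i<DIM('e). gg W (y i) p * T (x i)) = T W"
    by (rule *) (use dual_vfD(3)[OF xy VF_TM[OF W]] in \<open>simp_all add: ev2_def\<close>)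
  show "(\<Sum>i<DIM('e). gg W (x i) p * T (y i)) = T W"
    by (rule *) (use dual_vfD(4)[OF xy VF_TM[OF W]] in \<open>simp_all add: ev2_def\<close>)
qed

lemma trace_gg: "(\<Sum>i<DIM('e). gg (y i) (x i) p) = real DIM('e)" "(\<Sum>i<DIM('e). gg (x i) (y i) p) = real DIM('e)"
proof -
  have 1: "gg (y i) (x i) p = 1" if "i < DIM('e)" for i
    using dual_vfD(5)[OF xy that that] by (simp add: ev2_def)
  have 2: "gg (x i) (y i) p = 1" if "i < DIM('e)" for i
    unfolding gg_sym[OF frame_VF(1) frame_VF(2)] by (rule 1[OF that])
  show "(\<Sum>i<DIM('e). gg (y i) (x i) p) = real DIM('e)" "(\<Sum>i<DIM('e). gg (x i) (y i) p) = real DIM('e)"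
    by (simp_all add: 1 2)
qed

text \<open>Exchanging the two slots by \<open>dual_vf_swap\<close> preserves the sum, while
  skewness reverses its sign.\<close>

lemma trace_skew:
  assumes T: "\<And>X Y Z. X \<in> VF \<Longrightarrow> Y \<in> VF \<Longrightarrow> Z \<in> VF \<Longrightarrow> T (X + Y) Z = T X Z + T Y Z"
    "\<And>c X Y. X \<in> VF \<Longrightarrow> Y \<in> VF \<Longrightarrow> T (c *\<^sub>R X) Y = c * (T X Y :: real)"
    "\<And>X Y. X \<in> VF \<Longrightarrow> Y \<in> VF \<Longrightarrow> T X Y = - T Y X"
  shows "(\<Sum>i<DIM('e). T (x i) (y i)) = 0" "(\<Sum>i<DIM('e). T (y i) (x i)) = 0"
proof -
  have r: "T Z (X + Y) = T Z X + T Z Y" if "X \<in> VF" "Y \<in> VF" "Z \<in> VF" for X Y Z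
    using T(1)[OF that] T(3)[of Z "X + Y"] T(3)[of Z X] T(3)[of Z Y] that by simp
  have rc: "T X (c *\<^sub>R Y) = c * T X Y" if "X \<in> VF" "Y \<in> VF" for c X Y
    using T(2)[OF that(2,1), of c] T(3)[of X "c *\<^sub>R Y"] T(3)[of X Y] that by simp
  have 1: "(\<Sum>i<DIM('e). T (y i) (x i)) = (\<Sum>i<DIM('e). T (x i) (y i))"
    by (rule dual_vf_swap[OF xy, of T]) (use T(1,2) r rc in auto)
  have "(\<Sum>i<DIM('e). T (y i) (x i)) = (\<Sum>i<DIM('e). - T (x i) (y i))"
    by (intro sum.cong refl T(3)) auto
  then show "(\<Sum>i<DIM('e). T (x i) (y i)) = 0" "(\<Sum>i<DIM('e). T (y i) (x i)) = 0"
    using 1 by (simp_all add: sum_negf)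
qed

lemma tens_vf_gg: "Z \<in> VF \<Longrightarrow> tens_vf (\<lambda>X. gg X Z p)"
  by (auto simp: tens_vf_def gg_simps)

lemma tens_vf_hh:
  "Y \<in> VF \<Longrightarrow> Z \<in> VF \<Longrightarrow> tens_vf (\<lambda>X. hh X Y Z p)" "Y \<in> VF \<Longrightarrow> Z \<in> VF \<Longrightarrow> tens_vf (\<lambda>X. hh Y X Z p)"
  by (auto simp: tens_vf_def hh_linear)

lemma tens_vf_P:
  "Y \<in> VF \<Longrightarrow> Z \<in> VF \<Longrightarrow> tens_vf (\<lambda>X. gg (P s X Y) Z p)" "Y \<in> VF \<Longrightarrow> Z \<in> VF \<Longrightarrow> tens_vf (\<lambda>X. gg (P s Y X) Z p)"
  unfolding tens_vf_def by (auto simp: gg_P hh_linear gg_add gg_fmul algebra_simps)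

lemma tens_vf_Dl:
  "Y \<in> VF \<Longrightarrow> Z \<in> VF \<Longrightarrow> tens_vf (\<lambda>X. gg (Dl X Y) Z p)" "Y \<in> VF \<Longrightarrow> Z \<in> VF \<Longrightarrow> tens_vf (\<lambda>X. gg (Dl Y X) Z p)"
  unfolding tens_vf_def by (auto simp: gg_Dl hh_linear gg_add gg_fmul algebra_simps)

lemma tens_vf_nab: "A \<in> VF \<Longrightarrow> U \<in> VF \<Longrightarrow> tens_vf (\<lambda>X. gg (nabla X A) U p)"
  by (auto simp: tens_vf_def nab_add nab_fmul gg_add gg_fmul)

section \<open>Expansion of the generalised curvature on lifts\<close>

lemma gen_ricci_lift:
  assumes A: "A \<in> VF" and B: "B \<in> VF"
  shows "gen_ricci C D (lift C G s A) (lift C G s B) p =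
    s * (\<Sum>i<DIM('e). gen_riemann C D (lift C G s (x i)) (lift C G s A) (lift C G s (y i)) (lift C G s B) p)"
proof -
  have ms: "- s \<in> {1, -1}" using s by auto
  note L = lift_props(1)[OF s] and Lm = lift_props(1)[OF ms]
  have z: "gen_riemann C D (lift C G (-s) (x i)) (lift C G s A) (lift C G (-s) (y i)) (lift C G s B) p = 0" for i
    by (rule gen_riemann_mixed[OF s]) (use L Lm A B pj_lift[OF s] pj_lift[OF ms] in auto)
  show ?thesis
    unfolding gen_ricci_def trace_E_eq[OF gen_riemann_tensorial[OF L[OF A] L[OF B]] xy]
    using s z by auto
qed

text \<open>The antisymmetrised second derivative on M. It equals the curvature of \<open>N\<close>
  minus the derivative \<open>N\<close> along its torsion \<open>Dl V B\<close>.\<close>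

definition curv :: "'m vfield \<Rightarrow> 'm vfield \<Rightarrow> 'm vfield \<Rightarrow> 'm vfield" where
  "curv V B A = N V (N B A) - N (N V B) A - N B (N V A) + N (N B V) A"

lemma gen_riemann_lift:
  assumes U: "U \<in> VF" and A: "A \<in> VF" and V: "V \<in> VF" and B: "B \<in> VF"
  shows "gen_riemann C D (lift C G s U) (lift C G s A) (lift C G s V) (lift C G s B) p =
    s / 2 * (gg (curv V B A) U p + gg (curv A U V) B p
      - (\<Sum>i<DIM('e). gg (N (x i) V) B p * gg (N (y i) A) U p - gg (M (x i) V) B p * gg (M (y i) A) U p))"
proof -
  have ms: "- s \<in> {1, -1}" using s by auto
  note L = lift_props(1)[OF s] and Lm = lift_props(1)[OF ms]
  have NV: "N X Y \<in> VF" "M X Y \<in> VF" if "X \<in> VF" "Y \<in> VF" for X Y using that by auto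
  have D2: "pair C (D_second D (lift C G s V) (lift C G s B) (lift C G s A)
      - D_second D (lift C G s B) (lift C G s V) (lift C G s A)) (lift C G s U) p = s * gg (curv V B A) U p"
    if "U \<in> VF" "A \<in> VF" "V \<in> VF" "B \<in> VF" for U A V B
  proof -
    have "pair C ((lift C G s W1 - lift C G s W2) - (lift C G s W3 - lift C G s W4)) (lift C G s U) p
        = s * gg (W1 - W2 - W3 + W4) U p"
      if "W1 \<in> VF" "W2 \<in> VF" "W3 \<in> VF" "W4 \<in> VF" for W1 W2 W3 W4
      using that \<open>U \<in> VF\<close> by (simp add: pair_diff section_diff L pair_lift[OF s] gg_add gg_diff) (simp add: algebra_simps)
    from this[OF NV(1)[OF that(3) NV(1)[OF that(4,2)]] NV(1)[OF NV(1)[OF that(3,4)] that(2)]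
        NV(1)[OF that(4) NV(1)[OF that(3,2)]] NV(1)[OF NV(1)[OF that(4,3)] that(2)]]
    show ?thesis
      using that by (simp only: D_second_def D_lift(1)[OF s] NV curv_def)
  qed
  let ?T = "\<lambda>w w'. pair C (D w (lift C G s V)) (lift C G s B) p * pair C (D w' (lift C G s A)) (lift C G s U) p"
  have T: "tens_E p ?T"
    unfolding tens_E_def using assms L by (auto simp: D_add D_fmul(1) pair_add pair_fmul algebra_simps)
  have Ts: "?T (lift C G s X) (lift C G s Y) = gg (N X V) B p * gg (N Y A) U p"
    and Tm: "?T (lift C G (- s) X) (lift C G (- s) Y) = gg (M X V) B p * gg (M Y A) U p"
    if "X \<in> VF" "Y \<in> VF" for X Y
    using that assms by (simp_all add: D_lift[OF s] pair_lift[OF s] NV ss mult.left_commute)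
  have tr: "trace_E C p ?T = s * (\<Sum>i<DIM('e). gg (N (x i) V) B p * gg (N (y i) A) U p - gg (M (x i) V) B p * gg (M (y i) A) U p)"
    unfolding trace_E_eq[OF T xy] using s Ts[OF frame_VF] Tm[OF frame_VF]
    by (auto simp: sum_subtractf)
  show ?thesis
    unfolding gen_riemann_def tr D2[OF assms] D2[OF B V A U]
    by (simp add: algebra_simps)
qed

text \<open>The covariant derivative of the tensor P, that is (nabla_V P)_B A.\<close>

definition nd :: "'m vfield \<Rightarrow> 'm vfield \<Rightarrow> 'm vfield \<Rightarrow> 'm vfield" where
  "nd V B A = nabla V (P s B A) - P s (nabla V B) A - P s B (nabla V A)"

text \<open>The part of \<open>curv\<close> that is quadratic in P; the last summand comes from the
  torsion of \<open>N\<close>.\<close>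

definition qd :: "'m vfield \<Rightarrow> 'm vfield \<Rightarrow> 'm vfield \<Rightarrow> 'm vfield" where
  "qd V B A = P s V (P s B A) - P s B (P s V A) - P s (Dl V B) A"

lemma nd_VF [simp, intro]: "V \<in> VF \<Longrightarrow> B \<in> VF \<Longrightarrow> A \<in> VF \<Longrightarrow> nd V B A \<in> VF"
  and qd_VF [simp, intro]: "V \<in> VF \<Longrightarrow> B \<in> VF \<Longrightarrow> A \<in> VF \<Longrightarrow> qd V B A \<in> VF"
  by (simp_all add: nd_def qd_def)

lemma curv_expand:
  assumes V: "V \<in> VF" and B: "B \<in> VF" and A: "A \<in> VF"
  shows "curv V B A = riemann nabla V B A + nd V B A - nd B V A + qd V B A - nabla (Dl V B) A"
proof -
  note VFs = assms nab_VF[OF V B] nab_VF[OF B V] nab_VF[OF V A] nab_VF[OF B A]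
    P_VF[OF V B] P_VF[OF B V] P_VF[OF V A] P_VF[OF B A]
  show ?thesis
    using VFs by (simp add: curv_def nd_def qd_def riemann_def lie_nab nab_add nab_diff P_add P_diff algebra_simps)
qed

lemma gg_curv:
  assumes "V \<in> VF" "B \<in> VF" "A \<in> VF" "U \<in> VF"
  shows "gg (curv V B A) U p = gg (riemann nabla V B A) U p + gg (nd V B A) U p - gg (nd B V A) U p
    + gg (qd V B A) U p - gg (nabla (Dl V B) A) U p"
  using assms by (simp add: curv_expand gg_add gg_diff)

text \<open>The two derivative terms on the right also occur, with the same sign, in the expansion of the
  two curvature terms, and cancel there.\<close>

lemma trace_cross:
  assumes U: "U \<in> VF" and A: "A \<in> VF" and V: "V \<in> VF" and B: "B \<in> VF"
  shows "(\<Sum>i<DIM('e). gg (N (x i) V) B p * gg (N (y i) A) U p - gg (M (x i) V) B p * gg (M (y i) A) U p)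
    = gg (P s (om V B) A) U p - 1 / 4 * hh (Hs V B) A U p
      - gg (nabla (Dl V B) A) U p - gg (nabla (Dl A U) V) B p"
proof -
  have D: "gg (Dl V B) X p = s / 2 * hh X V B p - gg (P s X V) B p"
    if "X \<in> VF" "V \<in> VF" "B \<in> VF" for X V B
    using that hh_skew(3)[OF that, of p] by (simp add: Dl_om gg_diff gg_scaleR gg_Hs gg_om)
  have t: "gg (N X V) B p * gg (N Y A) U p - gg (M X V) B p * gg (M Y A) U p =
      gg (om V B) X p * gg (P s Y A) U p - 1 / 4 * (gg (Hs V B) X p * hh Y A U p)
      - gg (Dl V B) X p * gg (nabla Y A) U p - gg (Dl A U) Y p * gg (nabla X V) B p"
    if "X \<in> VF" "Y \<in> VF" for X Y
  proof -
    have e: "gg (N X V) B p = gg (nabla X V) B p + gg (P s X V) B p" "gg (N Y A) U p = gg (nabla Y A) U p + gg (P s Y A) U p"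
      "gg (M X V) B p = gg (nabla X V) B p + s / 2 * hh X V B p" "gg (M Y A) U p = gg (nabla Y A) U p + s / 2 * hh Y A U p"
      "gg (Hs V B) X p = hh X V B p"
      using assms that hh_skew(3)[OF that(1) V B, of p] by (simp_all add: gg_add gg_scaleR gg_Hs)
    have "s / 2 * hh X V B p * (s / 2 * hh Y A U p) = (s * s) * (1 / 4 * (hh X V B p * hh Y A U p))"
      by simp
    then have "s / 2 * hh X V B p * (s / 2 * hh Y A U p) = 1 / 4 * (hh X V B p * hh Y A U p)"
      by (simp only: ss(1) mult_1)
    then show ?thesis
      unfolding e D[OF that(1) V B] D[OF that(2) A U] gg_om[OF V B that(1)]
      by (simp add: algebra_simps)
  qed
  note c = contract(2)[OF tens_vf_P(1)[OF A U] om_VF[OF V B]] contract(2)[OF tens_vf_hh(1)[OF A U] Hs_VF[OF V B]]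
    contract(2)[OF tens_vf_nab[OF A U] VF_diff[OF P_VF[OF V B] P_VF[OF B V]]]
    contract(1)[OF tens_vf_nab[OF V B] VF_diff[OF P_VF[OF A U] P_VF[OF U A]]]
  show ?thesis
    unfolding t[OF frame_VF] sum_subtractf sum_distrib_left[symmetric] c by simp
qed

lemma gen_riemann_tensor:
  assumes U: "U \<in> VF" and A: "A \<in> VF" and V: "V \<in> VF" and B: "B \<in> VF"
  shows "gen_riemann C D (lift C G s U) (lift C G s A) (lift C G s V) (lift C G s B) p =
    s / 2 * (gg (riemann nabla V B A) U p + gg (riemann nabla A U V) B p
      + (gg (nd V B A) U p - gg (nd B V A) U p + gg (nd A U V) B p - gg (nd U A V) B p)
      + (gg (qd V B A) U p + gg (qd A U V) B p - gg (P s (om V B) A) U p + 1 / 4 * hh (Hs V B) A U p))"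
  unfolding gen_riemann_lift[OF assms] trace_cross[OF assms] gg_curv[OF V B A U] gg_curv[OF A U V B]
  by (simp add: algebra_simps)

text \<open>(nabla_V H)(B, A, U). The derivative of the third argument is accounted for by
  differentiating \<open>Hs B A\<close> as a vector field.\<close>

definition dh :: "'m vfield \<Rightarrow> 'm vfield \<Rightarrow> 'm vfield \<Rightarrow> 'm vfield \<Rightarrow> real" where
  "dh V B A U = gg (nabla V (Hs B A)) U p - hh (nabla V B) A U p - hh B (nabla V A) U p"

text \<open>g is parallel, so in the derivative of P only H and E are differentiated.\<close>

lemma gg_nd:
  assumes V: "V \<in> VF" and B: "B \<in> VF" and A: "A \<in> VF" and U: "U \<in> VF"
  shows "gg (nd V B A) U p = s / 6 * dh V B A U
    + k * (gg B A p * gg (nabla V E) U p - gg B U p * gg (nabla V E) A p)"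
proof -
  note VFs = assms E_VF
  have "P s B A = (s / 6) *\<^sub>R Hs B A + k *\<^sub>R (fmul (gg B A) E - fmul (gg E A) B)"
    by (simp add: P_def k)
  then have "nabla V (P s B A) = (s / 6) *\<^sub>R nabla V (Hs B A)
      + k *\<^sub>R (fmul (vf_apply V (gg B A)) E + fmul (gg B A) (nabla V E)
        - (fmul (vf_apply V (gg E A)) B + fmul (gg E A) (nabla V B)))"
    using VFs g_CM[OF B A] g_CM[OF E_VF A] by (simp add: nab_add nab_scaleR nab_diff nab_fmul)
  moreover have "vf_apply V (gg B A) \<in> CM" "vf_apply V (gg E A) \<in> CM"
    using VF_apply[OF V g_CM[OF B A]] VF_apply[OF V g_CM[OF E_VF A]] by auto
  ultimately have "gg (nabla V (P s B A)) U p = s / 6 * gg (nabla V (Hs B A)) U p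
      + k * (vf_apply V (gg B A) p * gg E U p + gg B A p * gg (nabla V E) U p
        - vf_apply V (gg E A) p * gg B U p - gg E A p * gg (nabla V B) U p)"
    using VFs g_CM[OF B A] g_CM[OF E_VF A] by (simp add: gg_simps) 
  then show ?thesis
    using VFs gg_sym[of "nabla V B" A p] gg_sym[of "nabla V A" B p]
    by (simp add: nd_def gg_diff gg_P dh_def nab_metric[OF V]) (simp add: field_simps)
qed

lemma dh_linear:
  assumes "V \<in> VF" "V' \<in> VF" "B \<in> VF" "A \<in> VF" "U \<in> VF"
  shows "dh (V + V') B A U = dh V B A U + dh V' B A U" "dh (c *\<^sub>R V) B A U = c * dh V B A U"
    "dh B A U (V + V') = dh B A U V + dh B A U V'" "dh B A U (c *\<^sub>R V) = c * dh B A U V"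
  using assms by (simp_all add: dh_def nab_add nab_scaleR gg_add gg_scaleR hh_linear hh_linear3 algebra_simps)

text \<open>nabla_V H is again totally skew; the cyclic rule follows by differentiating the equality
  H(B, A, U) = H(A, U, B) of functions along V.\<close>

lemma dh_skew:
  assumes V: "V \<in> VF" and B: "B \<in> VF" and A: "A \<in> VF" and U: "U \<in> VF"
  shows "dh V B A U = - dh V A B U" "dh V B A U = dh V A U B"
proof -
  have "Hs B A = - Hs A B"
    by (rule VF_eqI) (use A B hh_skew(1)[OF B A] in \<open>auto simp: gg_minus gg_Hs\<close>)
  then show "dh V B A U = - dh V A B U"
    using assms hh_skew(1)[of "nabla V B" A U p] hh_skew(1)[of B "nabla V A" U p]
    by (simp add: dh_def nab_minus gg_minus)
  have "gg (Hs B A) U = gg (Hs A U) B"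
    by (rule ext) (use assms hh_skew(3)[OF B A U] in \<open>simp add: gg_Hs\<close>)
  then have "vf_apply V (gg (Hs B A) U) p = vf_apply V (gg (Hs A U) B) p" by simp
  then show "dh V B A U = dh V A U B"
    using assms hh_skew(3)[of "nabla V B" A U p] hh_skew(3)[of B "nabla V A" U p] hh_skew(3)[of B A "nabla V U" p]
    by (simp add: dh_def nab_metric gg_Hs)
qed

text \<open>Where the derivative is along A or B, the frame fills two skew slots of nabla H and the
  sum vanishes. The two remaining terms, both divergences of H on (B, A), cancel after exchanging x
  and y.\<close>

lemma trace_dh:
  assumes A: "A \<in> VF" and B: "B \<in> VF"
  shows "(\<Sum>i<DIM('e). dh (y i) B A (x i) - dh B (y i) A (x i) + dh A (x i) (y i) B - dh (x i) A (y i) B) = 0"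
proof -
  have r: "dh B V A U = dh B A U V" "dh A U V B = dh A B U V" "dh U A V B = dh U B A V"
    if "U \<in> VF" "V \<in> VF" for U V
    using dh_skew(2)[OF B that(2) A that(1)] dh_skew(2)[OF A that B] dh_skew(2)[OF A that(2) B that(1)]
      dh_skew(2)[OF that(1) A that(2) B] dh_skew(2)[OF that(1) that(2) B A] by (simp_all add: dh_skew(2)[OF A B that])
  have lin: "dh X B A (Y + Z) = dh X B A Y + dh X B A Z" "dh X B A (c *\<^sub>R Y) = c * dh X B A Y"
    "dh (Y + Z) B A X = dh Y B A X + dh Z B A X" "dh (c *\<^sub>R Y) B A X = c * dh Y B A X"
    if "X \<in> VF" "Y \<in> VF" "Z \<in> VF" for X Y Z c
    using dh_linear(3,4)[OF that(2,3,1) B A] dh_linear(1,2)[OF that(2,3) B A that(1)] by simp_all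
  have 1: "(\<Sum>i<DIM('e). dh (y i) B A (x i)) = (\<Sum>i<DIM('e). dh (x i) B A (y i))"
    by (rule dual_vf_swap[OF xy, of "\<lambda>X Y. dh X B A Y"]) (use lin in auto)
  have sk: "(\<Sum>i<DIM('e). dh W Z (x i) (y i)) = 0" if "W \<in> VF" "Z \<in> VF" for W Z
  proof (rule trace_skew(1)[where T="dh W Z"])
    fix X Y assume XY: "X \<in> VF" "Y \<in> VF"
    show "dh W Z X Y = - dh W Z Y X"
      using dh_skew[OF that XY] dh_skew[OF that XY(2,1)] dh_skew[OF that(1) XY that(2)] by simp
  next
    fix X Y V c assume XY: "X \<in> VF" "Y \<in> VF"
    have t: "dh W Z X Y = dh W Y Z X" if "X \<in> VF" for X
      using dh_skew(2)[OF \<open>W \<in> VF\<close> XY(2) \<open>Z \<in> VF\<close> that] by simp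
    show "dh W Z (c *\<^sub>R X) Y = c * dh W Z X Y"
      using t XY dh_linear(4)[OF XY(1) XY(1) that(1) XY(2) that(2), of c] by simp
    assume V: "V \<in> VF"
    show "dh W Z (X + Y) V = dh W Z X V + dh W Z Y V"
      using dh_skew(2)[OF that(1) V that(2)] XY dh_linear(3)[OF XY that(1) V that(2)] by simp
  qed
  have sk': "(\<Sum>i<DIM('e). dh B A (x i) (y i)) = 0" "(\<Sum>i<DIM('e). dh A B (x i) (y i)) = 0"
    using sk A B by auto
  show ?thesis
    unfolding sum.distrib sum_subtractf r[OF frame_VF(1) frame_VF(2)] 1 sk' by simp
qed

section \<open>Algebraic traces of H and P\<close>

lemma Hs_skew: "X \<in> VF \<Longrightarrow> Y \<in> VF \<Longrightarrow> Hs X Y = - Hs Y X"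
  by (rule VF_eqI) (auto simp: gg_minus gg_Hs intro: hh_skew(1))

lemma Hs_linear:
  assumes "X \<in> VF" "X' \<in> VF" "Y \<in> VF" "h \<in> CM"
  shows "Hs (X + X') Y = Hs X Y + Hs X' Y" "Hs (fmul h X) Y = fmul h (Hs X Y)" "Hs (c *\<^sub>R X) Y = c *\<^sub>R Hs X Y"
  by (rule VF_eqI; use assms in \<open>simp add: gg_Hs gg_add gg_fmul gg_scaleR hh_linear\<close>)+

lemmas Hs_add = Hs_linear(1)[OF _ _ _ Cinf_zero] and Hs_scaleR = Hs_linear(3)[OF _ VF_zero _ Cinf_zero]

lemma H_square_frame:
  assumes A: "A \<in> VF" and B: "B \<in> VF"
  shows "H_square (atlas C) g H A B p = (\<Sum>i<DIM('e). gg (Hs (x i) A) (Hs (y i) B) p)"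
proof -
  have inner: "trace_TM (atlas C) g p (\<lambda>W W'. hh X A W p * hh Y B W' p) = gg (Hs X A) (Hs Y B) p"
    if "X \<in> VF" "Y \<in> VF" for X Y
  proof -
    have "tens_TM p (\<lambda>W W'. hh X A W p * hh Y B W' p)"
      unfolding tens_TM_def using A B that by (auto simp: hh_linear3 algebra_simps)
    from trace_TM_eq[OF this xy]
    have "trace_TM (atlas C) g p (\<lambda>W W'. hh X A W p * hh Y B W' p)
        = (\<Sum>i<DIM('e). gg (Hs X A) (x i) p * hh Y B (y i) p)"
      using A that by (simp add: gg_Hs)
    also have "\<dots> = (\<Sum>i<DIM('e). gg (Hs X A) (x i) p * gg (y i) (Hs Y B) p)"
      using B that by (simp add: gg_Hs')
    also have "\<dots> = gg (Hs X A) (Hs Y B) p"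
      by (rule contract(2)[OF tens_vf_gg]) (use A B that in auto)
    finally show ?thesis .
  qed
  have T: "tens_TM p (\<lambda>X Y. trace_TM (atlas C) g p (\<lambda>W W'. hh X A W p * hh Y B W' p))"
    unfolding tens_TM_def using A B
    by (auto simp: inner Hs_add Hs_linear(2) gg_add gg_fmul)
  show ?thesis
    unfolding H_square_def trace_TM_eq[OF T xy] by (intro sum.cong refl inner) auto
qed

lemma P_skew:
  assumes "X \<in> VF" "Y \<in> VF" "Z \<in> VF"
  shows "gg (P s X Y) Z p = - gg Y (P s X Z) p"
  using assms hh_skew(2)[OF assms, of p] gg_sym[of X Z p] gg_sym[of Y E p] by (simp add: gg_P) (simp add: algebra_simps)

text \<open>The versions differ in which slot of H is raised, so that the argument to be substituted
  or contracted later stands alone in a factor g.\<close>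

lemma P_expand:
  assumes "X \<in> VF" "Y \<in> VF" "Z \<in> VF"
  shows "gg (P s X Y) Z p = s / 6 * gg (Hs X Y) Z p + k * (gg X Y p * gg E Z p) - k * (gg E Y p * gg X Z p)"
    "gg Z (P s X Y) p = s / 6 * gg Z (Hs X Y) p + k * (gg X Y p * gg Z E p) - k * (gg E Y p * gg Z X p)"
    "gg (P s X Y) Z p = s / 6 * gg X (Hs Y Z) p + k * (gg X Y p * gg E Z p) - k * (gg E Y p * gg X Z p)"
  using assms gg_sym[of Z X p] gg_sym[of Z E p] hh_skew(3)[OF assms, of p]
  by (simp_all add: gg_P gg_Hs gg_Hs' algebra_simps)

lemma Dl_expand:
  assumes "X \<in> VF" "Y \<in> VF" "Z \<in> VF"
  shows "gg (Dl X Y) Z p = s / 3 * gg (Hs X Y) Z p + k * (gg E X p * gg Y Z p) - k * (gg E Y p * gg X Z p)"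
  using assms by (simp add: gg_Dl gg_Hs) (simp add: algebra_simps)?

lemmas sum_expand = sum.distrib sum_subtractf sum_negf sum_distrib_left[symmetric]

lemma trace_hh:
  assumes W: "W \<in> VF"
  shows "(\<Sum>i<DIM('e). hh W (x i) (y i) p) = 0" "(\<Sum>i<DIM('e). hh W (y i) (x i) p) = 0"
    "(\<Sum>i<DIM('e). hh (x i) W (y i) p) = 0" "(\<Sum>i<DIM('e). hh (y i) W (x i) p) = 0"
    "(\<Sum>i<DIM('e). hh (x i) (y i) W p) = 0" "(\<Sum>i<DIM('e). hh (y i) (x i) W p) = 0"
proof -
  have 1: "(\<Sum>i<DIM('e). hh W (x i) (y i) p) = 0" "(\<Sum>i<DIM('e). hh W (y i) (x i) p) = 0"
    by (rule trace_skew[where T="\<lambda>X Y. hh W X Y p"]; (use W in \<open>simp add: hh_linear\<close> | (rule hh_skew(2)[OF W]; assumption)))+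
  then show "(\<Sum>i<DIM('e). hh W (x i) (y i) p) = 0" "(\<Sum>i<DIM('e). hh W (y i) (x i) p) = 0" .
  have 2: "hh (x i) W (y i) p = hh W (y i) (x i) p" "hh (y i) W (x i) p = hh W (x i) (y i) p"
    "hh (x i) (y i) W p = hh W (x i) (y i) p" "hh (y i) (x i) W p = hh W (y i) (x i) p" for i
    using hh_skew(3)[OF frame_VF(1) W frame_VF(2), of i i p] hh_skew(3)[OF frame_VF(2) W frame_VF(1), of i i p]
      hh_skew(3)[OF W frame_VF(1) frame_VF(2), of i i p] hh_skew(3)[OF W frame_VF(2) frame_VF(1), of i i p] by simp_all
  show "(\<Sum>i<DIM('e). hh (x i) W (y i) p) = 0" "(\<Sum>i<DIM('e). hh (y i) W (x i) p) = 0"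
    "(\<Sum>i<DIM('e). hh (x i) (y i) W p) = 0" "(\<Sum>i<DIM('e). hh (y i) (x i) W p) = 0"
    unfolding 2 by (fact 1)+
qed

lemma trace_P:
  assumes W: "W \<in> VF"
  shows "(\<Sum>i<DIM('e). gg (P s (y i) W) (x i) p) = k * (1 - real DIM('e)) * gg E W p"
    "(\<Sum>i<DIM('e). gg (P s W (y i)) (x i) p) = 0"
    "(\<Sum>i<DIM('e). gg (P s (x i) (y i)) W p) = k * (real DIM('e) - 1) * gg E W p"
    "(\<Sum>i<DIM('e). gg (Dl (y i) W) (x i) p) = k * (1 - real DIM('e)) * gg E W p"
    "(\<Sum>i<DIM('e). gg (Dl W (x i)) (y i) p) = k * (real DIM('e) - 1) * gg E W p"
proof -
  note c = contract[OF tens_vf_gg[OF W] E_VF] contract[OF tens_vf_gg[OF E_VF] W]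
  have w: "gg X W p = gg W X p" "gg X E p = gg E X p" if "X \<in> VF" for X
    using gg_sym[OF that W] gg_sym[OF that E_VF] by auto
  have t: "gg (P s Y W) X p = s / 6 * hh Y W X p + k * (gg W Y p * gg X E p) - (k * gg E W p) * gg Y X p"
    "gg (P s W Y) X p = s / 6 * hh W Y X p + k * (gg W Y p * gg X E p) - k * (gg E Y p * gg X W p)"
    "gg (P s X Y) W p = s / 6 * hh X Y W p + (k * gg E W p) * gg X Y p - k * (gg E Y p * gg X W p)"
    "gg (Dl Y W) X p = s / 3 * hh Y W X p + k * (gg E Y p * gg X W p) - (k * gg E W p) * gg Y X p"
    "gg (Dl W X) Y p = s / 3 * hh W X Y p + (k * gg E W p) * gg X Y p - k * (gg E X p * gg Y W p)"
    if "X \<in> VF" "Y \<in> VF" for X Y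
    using that W w[OF that(1)] w[OF that(2)] by (simp_all add: gg_P(1) gg_Dl algebra_simps)
  have EW: "gg W E p = gg E W p" by (rule gg_sym[OF W E_VF])
  show "(\<Sum>i<DIM('e). gg (P s (y i) W) (x i) p) = k * (1 - real DIM('e)) * gg E W p"
    "(\<Sum>i<DIM('e). gg (P s W (y i)) (x i) p) = 0"
    "(\<Sum>i<DIM('e). gg (P s (x i) (y i)) W p) = k * (real DIM('e) - 1) * gg E W p"
    "(\<Sum>i<DIM('e). gg (Dl (y i) W) (x i) p) = k * (1 - real DIM('e)) * gg E W p"
    "(\<Sum>i<DIM('e). gg (Dl W (x i)) (y i) p) = k * (real DIM('e) - 1) * gg E W p"
    unfolding t[OF frame_VF] sum_expand c trace_gg trace_hh[OF W] EW by (simp_all add: algebra_simps)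
qed

section \<open>Traces of the terms quadratic in P, for fixed A and B\<close>

context
  fixes A B :: "'m vfield"
  assumes A: "A \<in> VF" and B: "B \<in> VF"
begin

abbreviation "Q \<equiv> H_square (atlas C) g H A B p"
text \<open>Skew in A and B. It occurs in the partial traces below and cancels in the sum that
  enters the Ricci curvature.\<close>

abbreviation "h0 \<equiv> hh A B E p"
abbreviation "gAB \<equiv> gg A B p"
abbreviation "EE \<equiv> gg E A p * gg E B p"
abbreviation "e2 \<equiv> gg E E p"

lemma hh_ABE: "hh A E B p = - h0" "hh E A B p = h0" "hh B A E p = - h0" "hh B E A p = h0" "hh E B A p = - h0"
  using hh_skew[OF A B E_VF, of p] hh_skew[OF B A E_VF, of p] hh_skew[OF B E_VF A, of p] hh_skew[OF A E_VF B, of p]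
  by simp_all

lemma P_vals:
  "gg (P s B A) E p = k * (gAB * e2 - EE) - s / 6 * h0" "gg (P s E A) B p = s / 6 * h0"
  "gg (P s A E) B p = k * (EE - gAB * e2) - s / 6 * h0" "gg (P s A B) E p = k * (gAB * e2 - EE) + s / 6 * h0"
  "gg (Dl E B) A p = k * (gAB * e2 - EE) - s / 3 * h0" "gg (Dl A E) B p = k * (EE - gAB * e2) - s / 3 * h0"
  using A B gg_sym[OF A B, of p] gg_sym[OF A E_VF, of p] gg_sym[OF B E_VF, of p]
  by (simp_all add: gg_P(1) gg_Dl hh_ABE algebra_simps)

lemma trace_Q:
  "(\<Sum>i<DIM('e). gg (Hs (x i) A) (Hs (y i) B) p) = Q" "(\<Sum>i<DIM('e). gg (Hs (y i) A) (Hs (x i) B) p) = Q"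
  "(\<Sum>i<DIM('e). gg (Hs (y i) B) (Hs (x i) A) p) = Q"
proof -
  show 1: "(\<Sum>i<DIM('e). gg (Hs (x i) A) (Hs (y i) B) p) = Q"
    by (rule H_square_frame[OF A B, symmetric])
  show "(\<Sum>i<DIM('e). gg (Hs (y i) A) (Hs (x i) B) p) = Q"
    unfolding 1[symmetric] by (rule dual_vf_swap[OF xy, of "\<lambda>X Y. gg (Hs X A) (Hs Y B) p"])
      (use A B in \<open>auto simp: Hs_add Hs_scaleR gg_add gg_scaleR\<close>)
  show "(\<Sum>i<DIM('e). gg (Hs (y i) B) (Hs (x i) A) p) = Q"
    unfolding 1[symmetric] by (intro sum.cong refl gg_sym) (use A B in auto)
qed

lemma gg_Hs_skew:
  assumes "X \<in> VF" "Y \<in> VF" "Z \<in> VF"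
  shows "gg Z (Hs X Y) p = - gg Z (Hs Y X) p" "gg (Hs X Y) Z p = - gg (Hs Y X) Z p"
  using assms Hs_skew[OF assms(1,2)] by (simp_all add: gg_minus)

text \<open>P s B A and P s A B are fixed vector fields here, so these two sums are traces of a
  single P.\<close>

lemma trace_PP:
  "(\<Sum>i<DIM('e). gg (P s (y i) (P s B A)) (x i) p) = k * (1 - real DIM('e)) * (k * (gAB * e2 - EE) - s / 6 * h0)"
  "(\<Sum>i<DIM('e). gg (P s A (P s (x i) (y i))) B p) = - (k * (real DIM('e) - 1) * (k * (gAB * e2 - EE) + s / 6 * h0))"
proof -
  show "(\<Sum>i<DIM('e). gg (P s (y i) (P s B A)) (x i) p) = k * (1 - real DIM('e)) * (k * (gAB * e2 - EE) - s / 6 * h0)"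
    unfolding trace_P(1)[OF P_VF[OF B A]] gg_sym[OF E_VF P_VF[OF B A]] P_vals ..
  show "(\<Sum>i<DIM('e). gg (P s A (P s (x i) (y i))) B p) = - (k * (real DIM('e) - 1) * (k * (gAB * e2 - EE) + s / 6 * h0))"
    unfolding P_skew[OF A P_VF[OF frame_VF] B] sum_negf trace_P(3)[OF P_VF[OF A B]] gg_sym[OF E_VF P_VF[OF A B]] P_vals ..
qed

text \<open>Each summand is expanded until x_i and y_i occur in separate factors, or together in a
  skew H, or as the product that sums to Q. Then every part is a contraction, zero, or (s/6)^2
  Q.\<close>

lemma trace_PP_mid:
  "(\<Sum>i<DIM('e). gg (P s B (P s (y i) A)) (x i) p) = 1 / 36 * Q + s * k / 2 * h0 - k * k * (gAB * e2 - EE)"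
  "(\<Sum>i<DIM('e). gg (P s (x i) (P s A (y i))) B p) = 1 / 36 * Q - s * k / 2 * h0 - k * k * (gAB * e2 - EE)"
proof -
  have t1: "gg (P s B (P s Y A)) X p = s / 6 * (s / 6) * gg (Hs Y A) (Hs X B) p
      - s / 6 * k * (gg A Y p * hh B X E p) + s / 6 * k * gg E A p * hh B X Y p
      - k * (gg B X p * gg (P s Y A) E p) + k * (gg E X p * gg (P s Y A) B p)"
    if X: "X \<in> VF" and Y: "Y \<in> VF" for X Y
  proof -
    have "gg (P s Y A) (Hs B X) p = s / 6 * gg (Hs Y A) (Hs B X) p + k * (gg Y A p * gg E (Hs B X) p)
        - k * (gg E A p * gg Y (Hs B X) p)"
      by (rule P_expand(1)[OF Y A Hs_VF[OF B X]])
    also have "\<dots> = - (s / 6 * gg (Hs Y A) (Hs X B) p) + k * (gg A Y p * hh B X E p) - k * (gg E A p * hh B X Y p)"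
      unfolding gg_Hs_skew(1)[OF B X Hs_VF[OF Y A]] gg_Hs'[OF B X E_VF] gg_Hs'[OF B X Y] gg_sym[OF Y A]
      by simp
    finally have 1: "gg (P s Y A) (Hs B X) p = - (s / 6 * gg (Hs Y A) (Hs X B) p) + k * (gg A Y p * hh B X E p)
        - k * (gg E A p * hh B X Y p)" .
    show ?thesis
      unfolding P_skew[OF B P_VF[OF Y A] X] P_expand(2)[OF B X P_VF[OF Y A]] 1 by (simp add: algebra_simps)
  qed
  have t2: "gg (P s X (P s A Y)) B p = s / 6 * (s / 6) * gg (Hs Y A) (Hs X B) p
      + s / 6 * k * (gg A Y p * hh B X E p) - s / 6 * k * (gg E Y p * hh B X A p)
      + k * gg E B p * gg (P s A Y) X p - k * (gg B X p * gg (P s A Y) E p)"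
    if X: "X \<in> VF" and Y: "Y \<in> VF" for X Y
  proof -
    have w: "P s A Y \<in> VF" using A Y by simp
    have h: "gg (Hs A Y) (Hs B X) p = gg (Hs Y A) (Hs X B) p"
      unfolding gg_Hs_skew(1)[OF B X Hs_VF[OF A Y]] gg_Hs_skew(2)[OF A Y Hs_VF[OF X B]] by simp
    have 1: "gg (P s A Y) (Hs B X) p = s / 6 * gg (Hs Y A) (Hs X B) p + k * (gg A Y p * hh B X E p)
        - k * (gg E Y p * hh B X A p)"
      unfolding P_expand(1)[OF A Y Hs_VF[OF B X]] h gg_Hs'[OF B X E_VF] gg_Hs'[OF B X A] ..
    have 2: "gg (Hs X (P s A Y)) B p = gg (P s A Y) (Hs B X) p"
      using hh_skew(3)[OF X w B, of p] hh_skew(3)[OF w B X, of p] X B w by (simp add: gg_Hs gg_Hs')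
    show ?thesis
      unfolding P_expand(1)[OF X w B] 2 1 gg_sym[OF X w] gg_sym[OF E_VF w] gg_sym[OF X B] by (simp add: algebra_simps)
  qed
  note c = contract(1)[OF tens_vf_hh(2)[OF B E_VF] A] contract(2)[OF tens_vf_P(1)[OF A E_VF] B]
    contract(2)[OF tens_vf_P(1)[OF A B] E_VF] contract(1)[OF tens_vf_hh(2)[OF B A] E_VF]
    contract(2)[OF tens_vf_P(2)[OF A E_VF] B]
  show "(\<Sum>i<DIM('e). gg (P s B (P s (y i) A)) (x i) p) = 1 / 36 * Q + s * k / 2 * h0 - k * k * (gAB * e2 - EE)"
    unfolding t1[OF frame_VF] sum_expand trace_Q trace_hh[OF B] c P_vals hh_ABE using ss by (simp add: field_simps)
  show "(\<Sum>i<DIM('e). gg (P s (x i) (P s A (y i))) B p) = 1 / 36 * Q - s * k / 2 * h0 - k * k * (gAB * e2 - EE)"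
    unfolding t2[OF frame_VF] sum_expand trace_Q trace_P[OF A] c P_vals hh_ABE using ss by (simp add: field_simps)
qed

text \<open>The H part of \<open>Dl\<close> has coefficient s/3, hence Q appears with s/6 times s/3,
  that is 1/18; the sign comes from reordering one \<open>Hs\<close>.\<close>

lemma trace_PDl:
  "(\<Sum>i<DIM('e). gg (P s (Dl (y i) B) A) (x i) p) =
    - (1 / 18 * Q) - s * k / 2 * h0 + k * k * (gAB * e2 - EE) + k * k * (real DIM('e) - 1) * EE"
  "(\<Sum>i<DIM('e). gg (P s (Dl A (x i)) (y i)) B p) =
    - (1 / 18 * Q) + s * k / 2 * h0 + k * k * (gAB * e2 - EE) + k * k * (real DIM('e) - 1) * EE"
proof -
  have d: "Dl X Y \<in> VF" if "X \<in> VF" "Y \<in> VF" for X Y using that by auto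
  have t1: "gg (P s (Dl Y B) A) X p = - (s / 6 * (s / 3)) * gg (Hs Y B) (Hs X A) p
      + s / 6 * k * (gg E Y p * hh A X B p) - s / 6 * k * gg E B p * hh A X Y p
      + k * (gg E X p * gg (Dl Y B) A p) - k * gg E A p * gg (Dl Y B) X p"
    if X: "X \<in> VF" and Y: "Y \<in> VF" for X Y
  proof -
    have 1: "gg (Dl Y B) (Hs A X) p = s / 3 * gg (Hs Y B) (Hs A X) p + k * (gg E Y p * hh A X B p) - k * (gg E B p * hh A X Y p)"
      unfolding Dl_expand[OF Y B Hs_VF[OF A X]] gg_Hs'[OF A X B] gg_Hs'[OF A X Y] ..
    show ?thesis
      unfolding P_expand(3)[OF d[OF Y B] A X] 1 gg_Hs_skew(1)[OF A X Hs_VF[OF Y B]] by (simp add: algebra_simps)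
  qed
  have t2: "gg (P s (Dl A X) Y) B p = - (s / 6 * (s / 3)) * gg (Hs X A) (Hs Y B) p
      + s / 6 * k * gg E A p * hh Y B X p - s / 6 * k * (gg E X p * hh Y B A p)
      + k * gg E B p * gg (Dl A X) Y p - k * (gg E Y p * gg (Dl A X) B p)"
    if X: "X \<in> VF" and Y: "Y \<in> VF" for X Y
  proof -
    have 1: "gg (Dl A X) (Hs Y B) p = s / 3 * gg (Hs A X) (Hs Y B) p + k * (gg E A p * hh Y B X p) - k * (gg E X p * hh Y B A p)"
      unfolding Dl_expand[OF A X Hs_VF[OF Y B]] gg_Hs'[OF Y B X] gg_Hs'[OF Y B A] ..
    show ?thesis
      unfolding P_expand(3)[OF d[OF A X] Y B] 1 gg_Hs_skew(2)[OF A X Hs_VF[OF Y B]] by (simp add: algebra_simps)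
  qed
  note c = contract(1)[OF tens_vf_hh(2)[OF A B] E_VF] contract(2)[OF tens_vf_Dl(1)[OF B A] E_VF]
    contract(2)[OF tens_vf_hh(1)[OF B A] E_VF] contract(1)[OF tens_vf_Dl(2)[OF A B] E_VF]
  show "(\<Sum>i<DIM('e). gg (P s (Dl (y i) B) A) (x i) p) =
    - (1 / 18 * Q) - s * k / 2 * h0 + k * k * (gAB * e2 - EE) + k * k * (real DIM('e) - 1) * EE"
    unfolding t1[OF frame_VF] sum_expand trace_Q trace_hh[OF A] c trace_P[OF B] P_vals hh_ABE
    using ss by (simp add: field_simps)
  show "(\<Sum>i<DIM('e). gg (P s (Dl A (x i)) (y i)) B p) =
    - (1 / 18 * Q) + s * k / 2 * h0 + k * k * (gAB * e2 - EE) + k * k * (real DIM('e) - 1) * EE"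
    unfolding t2[OF frame_VF] sum_expand trace_Q trace_hh[OF B] c trace_P[OF A] P_vals hh_ABE
    using ss by (simp add: field_simps)
qed

text \<open>The contributions of the trace over E: the first from directions in E_s, the second from
  directions in E_-s.\<close>

lemma trace_Pom:
  "(\<Sum>i<DIM('e). gg (P s (om (y i) B) A) (x i) p) =
    - (1 / 36 * Q) - k * k * (gAB * e2 - EE) - k * k * (real DIM('e) - 1) * EE"
  "(\<Sum>i<DIM('e). hh (Hs (y i) B) A (x i) p) = - Q"
proof -
  have t: "gg (P s (om Y B) A) X p = - (s / 6 * (s / 6)) * gg (Hs X A) (Hs Y B) p
      + s / 6 * k * gg E B p * hh A X Y p - s / 6 * k * (gg E Y p * hh A X B p)
      + k * (gg E X p * gg (P s A Y) B p) - k * gg E A p * gg (P s X Y) B p"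
    if X: "X \<in> VF" and Y: "Y \<in> VF" for X Y
  proof -
    note h = Hs_VF[OF A X]
    have 1: "gg (om Y B) (Hs A X) p = s / 6 * gg (Hs A X) (Hs Y B) p + k * (hh A X Y p * gg E B p) - k * (gg E Y p * hh A X B p)"
      unfolding gg_om[OF Y B h] P_expand(3)[OF h Y B] gg_Hs[OF A X Y] gg_Hs[OF A X B] ..
    show ?thesis
      unfolding P_expand(3)[OF om_VF[OF Y B] A X] 1 gg_om[OF Y B A] gg_om[OF Y B X]
        gg_Hs_skew(2)[OF A X Hs_VF[OF Y B]] by (simp add: algebra_simps)
  qed
  note c = contract(2)[OF tens_vf_hh(2)[OF A B] E_VF] contract(1)[OF tens_vf_hh(2)[OF A B] E_VF]
    contract(2)[OF tens_vf_P(2)[OF A B] E_VF]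
  show "(\<Sum>i<DIM('e). gg (P s (om (y i) B) A) (x i) p) =
    - (1 / 36 * Q) - k * k * (gAB * e2 - EE) - k * k * (real DIM('e) - 1) * EE"
    unfolding t[OF frame_VF] sum_expand trace_Q trace_hh[OF A] c trace_P[OF B] P_vals hh_ABE
    using ss by (simp add: field_simps)
  have "hh (Hs Y B) A X p = - gg (Hs Y B) (Hs X A) p" if X: "X \<in> VF" and Y: "Y \<in> VF" for X Y
    using gg_Hs_skew(1)[OF A X Hs_VF[OF Y B]] hh_skew(3)[OF Hs_VF[OF Y B] A X, of p] gg_Hs'[OF A X Hs_VF[OF Y B], of p] by simp
  from this[OF frame_VF] show "(\<Sum>i<DIM('e). hh (Hs (y i) B) A (x i) p) = - Q"
    by (simp add: sum_negf trace_Q)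
qed

end

lemma ricci_lift:
  assumes A: "A \<in> VF" and B: "B \<in> VF"
  shows "gen_ricci C D (lift C G s A) (lift C G s B) p =
      ricci (atlas C) g nabla A B p - 1 / 12 * H_square (atlas C) g H A B p
      + s * (div_g (atlas C) g nabla E p / (real DIM('e) - 1)) * gg A B p
      + s * ((real DIM('e) - 2) / (real DIM('e) - 1)) * sym_nabla g nabla E A B p
      + (3 - 2 * real DIM('e)) / (2 * (real DIM('e) - 1)\<^sup>2) * gg E E p * gg A B p
      + (real DIM('e) - 2) / (2 * (real DIM('e) - 1)\<^sup>2) * (gg E A p * gg E B p)"
proof -
  define d where "d = real DIM('e)"
  have d: "d - 1 \<noteq> 0" using dim by (simp add: d_def)
  let ?nE = "\<lambda>X Y. gg (nabla X E) Y p"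
  let ?div = "div_g (atlas C) g nabla E p"
  have R: "(\<Sum>i<DIM('e). gg (riemann nabla (y i) B A) (x i) p) = ricci (atlas C) g nabla A B p"
    "(\<Sum>i<DIM('e). gg (riemann nabla A (x i) (y i)) B p) = ricci (atlas C) g nabla A B p"
  proof -
    show "(\<Sum>i<DIM('e). gg (riemann nabla (y i) B A) (x i) p) = ricci (atlas C) g nabla A B p"
      unfolding ricci_sym[OF A B] by (rule ricci_frame(2)[OF B A xy, symmetric])
    have "gg (riemann nabla A (x i) (y i)) B p = gg (riemann nabla (y i) B A) (x i) p" for i
      by (rule riemann_pair_symmetry[OF A frame_VF B])
    then show "(\<Sum>i<DIM('e). gg (riemann nabla A (x i) (y i)) B p) = ricci (atlas C) g nabla A B p"
      unfolding ricci_sym[OF A B] using ricci_frame(2)[OF B A xy] by simp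
  qed
  have DV: "?div = (\<Sum>i<DIM('e). ?nE (x i) (y i))" "?div = (\<Sum>i<DIM('e). ?nE (y i) (x i))"
  proof -
    have "tens_TM p ?nE" by (auto simp: tens_TM_def nab_add nab_fmul gg_add gg_fmul)
    then show 1: "?div = (\<Sum>i<DIM('e). ?nE (x i) (y i))"
      unfolding div_g_def by (rule trace_TM_eq[OF _ xy])
    show "?div = (\<Sum>i<DIM('e). ?nE (y i) (x i))"
      unfolding 1 by (rule dual_vf_swap[OF xy, of ?nE, symmetric]) (auto simp: nab_add nab_scaleR gg_add gg_scaleR)
  qed
  \<comment> \<open>The two sums with factor g(A, B) give the divergence twice. For each order of A
    and B the trace of g gives d and two contractions subtract one each, whence d - 2.\<close>
  have ND: "(\<Sum>i<DIM('e). gg (nd (y i) B A) (x i) p - gg (nd B (y i) A) (x i) p + gg (nd A (x i) (y i)) B p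
      - gg (nd (x i) A (y i)) B p) = k * (2 * gg A B p * ?div + (d - 2) * (?nE A B + ?nE B A))"
  proof -
    have t: "gg (nd Y B A) X p - gg (nd B Y A) X p + gg (nd A X Y) B p - gg (nd X A Y) B p =
        s / 6 * (dh Y B A X - dh B Y A X + dh A X Y B - dh X A Y B)
        + k * gg A B p * ?nE Y X - k * (gg B X p * ?nE Y A)
        - k * (gg A Y p * ?nE B X) + k * ?nE B A * gg Y X p
        + k * ?nE A B * gg X Y p - k * (gg B X p * ?nE A Y)
        - k * (gg A Y p * ?nE X B) + k * gg A B p * ?nE X Y"
      if "X \<in> VF" "Y \<in> VF" for X Y
      using that A B gg_sym[OF B A, of p] gg_sym[OF that(2) A, of p] gg_sym[OF that(1) B, of p]
      by (simp add: gg_nd algebra_simps)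
    note c = contract(2)[OF tens_vf_nab[OF E_VF A] B] contract(1)[OF tens_vf_nab[OF E_VF B] A]
    have c': "(\<Sum>i<DIM('e). gg A (y i) p * ?nE B (x i)) = ?nE B A" "(\<Sum>i<DIM('e). gg B (x i) p * ?nE A (y i)) = ?nE A B"
    proof -
      have T: "tens_vf (\<lambda>X. ?nE W X)" if "W \<in> VF" for W
        using that by (auto simp: tens_vf_def gg_add gg_fmul)
      show "(\<Sum>i<DIM('e). gg A (y i) p * ?nE B (x i)) = ?nE B A" by (rule contract(1)[OF T[OF B] A])
      show "(\<Sum>i<DIM('e). gg B (x i) p * ?nE A (y i)) = ?nE A B" by (rule contract(2)[OF T[OF A] B])
    qed
    have dh0: "(\<Sum>i<DIM('e). s / 6 * (dh (y i) B A (x i) - dh B (y i) A (x i) + dh A (x i) (y i) B - dh (x i) A (y i) B)) = 0"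
      unfolding sum_distrib_left[symmetric] trace_dh[OF A B] by simp
    have "(\<Sum>i<DIM('e). gg (nd (y i) B A) (x i) p - gg (nd B (y i) A) (x i) p + gg (nd A (x i) (y i)) B p
        - gg (nd (x i) A (y i)) B p) =
      (\<Sum>i<DIM('e). s / 6 * (dh (y i) B A (x i) - dh B (y i) A (x i) + dh A (x i) (y i) B - dh (x i) A (y i) B))
      + (\<Sum>i<DIM('e). k * gg A B p * ?nE (y i) (x i) - k * (gg B (x i) p * ?nE (y i) A)
        - k * (gg A (y i) p * ?nE B (x i)) + k * ?nE B A * gg (y i) (x i) p
        + k * ?nE A B * gg (x i) (y i) p - k * (gg B (x i) p * ?nE A (y i))
        - k * (gg A (y i) p * ?nE (x i) B) + k * gg A B p * ?nE (x i) (y i))"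
      unfolding t[OF frame_VF] sum.distrib[symmetric] by (intro sum.cong refl) simp
    also have "\<dots> = k * (2 * gg A B p * ?div + (d - 2) * (?nE A B + ?nE B A))"
      unfolding dh0 unfolding sum_expand DV[symmetric] c c' trace_gg d_def[symmetric]
      by (simp add: algebra_simps)
    finally show ?thesis .
  qed
  let ?g = "gg A B p" and ?EE = "gg E A p * gg E B p" and ?e2 = "gg E E p" and ?Q = "H_square (atlas C) g H A B p"
  \<comment> \<open>The coefficient of Q is -2/36 + 2/18 + 1/36 - 1/4 = -1/6. With z = g(A, B) |E|^2
    - g(E, A) g(E, B), the coefficient of k^2 z is 2 (1 - d) + 2 - 2 + 1 = 3 - 2 d, and the separate
    terms in g(E, A) g(E, B) add -(d - 1) k^2; collecting that product gives d - 2.\<close>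
  have QD: "(\<Sum>i<DIM('e). gg (qd (y i) B A) (x i) p + gg (qd A (x i) (y i)) B p
      - gg (P s (om (y i) B) A) (x i) p + 1 / 4 * hh (Hs (y i) B) A (x i) p) =
      - (1 / 6) * ?Q + k * k * ((3 - 2 * d) * ?e2 * ?g + (d - 2) * ?EE)"
  proof -
    have t: "gg (qd V Z W) X p = gg (P s V (P s Z W)) X p - gg (P s Z (P s V W)) X p - gg (P s (Dl V Z) W) X p"
      if "V \<in> VF" "Z \<in> VF" "W \<in> VF" "X \<in> VF" for V Z W X
      using that by (simp add: qd_def gg_diff)
    show ?thesis
      unfolding t[OF frame_VF(2) B A frame_VF(1)] t[OF A frame_VF B] sum_expand
        trace_PP[OF A B] trace_PP_mid[OF A B] trace_PDl[OF A B] trace_Pom[OF A B] d_def[symmetric]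
      by (simp add: field_simps)
  qed
  have *: "gen_ricci C D (lift C G s A) (lift C G s B) p = s * (s / 2) * (
      (\<Sum>i<DIM('e). gg (riemann nabla (y i) B A) (x i) p) + (\<Sum>i<DIM('e). gg (riemann nabla A (x i) (y i)) B p)
      + (\<Sum>i<DIM('e). gg (nd (y i) B A) (x i) p - gg (nd B (y i) A) (x i) p + gg (nd A (x i) (y i)) B p
        - gg (nd (x i) A (y i)) B p)
      + (\<Sum>i<DIM('e). gg (qd (y i) B A) (x i) p + gg (qd A (x i) (y i)) B p
        - gg (P s (om (y i) B) A) (x i) p + 1 / 4 * hh (Hs (y i) B) A (x i) p))"
    unfolding gen_ricci_lift[OF A B] gen_riemann_tensor[OF frame_VF(1) A frame_VF(2) B] sum_distrib_left[symmetric]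
      sum.distrib[symmetric] by (simp only: mult.assoc)
  have "s * (s / 2) = 1 / 2" using ss(1) by simp
  note * = *[unfolded this R ND QD]
  have main: "gen_ricci C D (lift C G s A) (lift C G s B) p = 1 / 2 * (2 * ricci (atlas C) g nabla A B p
      + k * (2 * ?g * ?div + (d - 2) * (?nE A B + ?nE B A))
      - (1 / 6) * ?Q + k * k * ((3 - 2 * d) * ?e2 * ?g + (d - 2) * ?EE))"
    unfolding * by simp
  \<comment> \<open>Writing q for 1 / (d - 1) turns the final comparison into a polynomial identity
    in q, with k = s q and k^2 = q^2.\<close>
  define q where "q = 1 / (d - 1)"
  have q: "z / (d - 1) = z * q" "z / (2 * (d - 1)\<^sup>2) = z * (q * q) / 2" for z
    by (simp_all add: q_def power2_eq_square)
  have kq: "k = s * q" "k * k = q * q"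
    using ss by (simp_all add: k d_def q_def ac_simps)
  show ?thesis
    unfolding main sym_nabla_def d_def[symmetric] kq(2) q unfolding kq(1) by (simp add: field_simps)
qed

end

context canonical_lc
begin

text \<open>A section of E_s is the lift of its anchor, so \<open>ricci_lift\<close> applies; the
  auxiliary frame at p does not occur in its conclusion. The norm of e_s for G is g(E, E), because G
  is +g on both eigenbundles.\<close>

lemma gen_ricci_eigen:
  assumes s: "s \<in> {1, -1}" and a: "a \<in> eigen_sections C G s" and b: "b \<in> eigen_sections C G s"
  shows "let A = anch C a; B = anch C b; e\<^sub>s = proj C G s e; X = anch C e\<^sub>s; d = real DIM('e) in
      gen_ricci C D a b p =
        ricci (atlas C) g nabla A B p
        - 1 / 12 * H_square (atlas C) g H A B p
        + s * (div_g (atlas C) g nabla X p / (d - 1)) * ev2 g A B p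
        + s * ((d - 2) / (d - 1)) * sym_nabla g nabla X A B p
        + (3 - 2 * d) / (2 * (d - 1)\<^sup>2) * ev2 G e\<^sub>s e\<^sub>s p * ev2 g A B p
        + (d - 2) / (2 * (d - 1)\<^sup>2) * (ev2 g X A p * ev2 g X B p)"
proof -
  obtain x y where xy: "dual_vf p x y" using dual_vf_exists by blast
  interpret canonical_frame C G g nabla H dv e D s "s * (1 / (real DIM('e) - 1))" p x y
    by unfold_locales (use s xy in auto)
  note a' = eigen_section_lift[OF s a] and b' = eigen_section_lift[OF s b]
  have X: "anch C (proj C G s e) = pj s e" by (simp add: pj_def)
  have z: "gg (pj r (proj C G s e)) (pj r (proj C G s e)) p = (if r = s then gg (pj s e) (pj s e) p else 0)"
    if "r \<in> {1, -1}" for r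
    using that s proj_props[OF s e] by (auto simp: gg_zero)
  have "ev2 G (proj C G s e) (proj C G s e) p = gg (pj s e) (pj s e) p"
    unfolding G_pj[OF proj_section[OF e] proj_section[OF e]] using z[of 1] z[of "-1"] s by auto
  then show ?thesis
    using ricci_lift[OF a'(3) b'(3)] a'(1) b'(1) by (simp add: Let_def X)
qed

end

theorem corollary4p3:
  fixes C :: "('m::{t2_space,second_countable_topology}, 'e::euclidean_space, 'v::real_vector) courant"
    and G :: "'m \<Rightarrow> 'v \<Rightarrow> 'v \<Rightarrow> real"
    and g :: "'m \<Rightarrow> 'm tvec \<Rightarrow> 'm tvec \<Rightarrow> real"
    and nabla :: "'m vfield \<Rightarrow> 'm vfield \<Rightarrow> 'm vfield"
    and H :: "'m \<Rightarrow> 'm tvec \<Rightarrow> 'm tvec \<Rightarrow> 'm tvec \<Rightarrow> real"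
    and dv :: "('m \<Rightarrow> 'v) \<Rightarrow> 'm \<Rightarrow> real"
    and e :: "'m \<Rightarrow> 'v"
    and D :: "('m, 'v) gconn"
    and d :: real
  assumes "exact_courant_algebroid C"
    and "DIM('e) \<ge> 2"
    and "d = real DIM('e)"
    and "generalised_metric C G"
    and "induced_metric C G g"
    and "levi_civita (atlas C) g nabla"
    and "induced_three_form C G g H"
    and "divergence_operator C dv"
    and "e \<in> sections C"
    and "\<forall>v\<in>sections C. dv v = div_G C g nabla v - pair C e v"
    and "canonical_connection C G nabla dv D"
  shows "\<forall>s\<in>{1, -1}. \<forall>a\<in>eigen_sections C G s. \<forall>b\<in>eigen_sections C G s. \<forall>p.
    (let A = anch C a; B = anch C b; e\<^sub>s = proj C G s e; X = anch C e\<^sub>s in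
      gen_ricci C D a b p =
        ricci (atlas C) g nabla A B p
        - 1 / 12 * H_square (atlas C) g H A B p
        + s * (div_g (atlas C) g nabla X p / (d - 1)) * ev2 g A B p
        + s * ((d - 2) / (d - 1)) * sym_nabla g nabla X A B p
        + (3 - 2 * d) / (2 * (d - 1)\<^sup>2) * ev2 G e\<^sub>s e\<^sub>s p * ev2 g A B p
        + (d - 2) / (2 * (d - 1)\<^sup>2) * (ev2 g X A p * ev2 g X B p))"
proof -
  interpret canonical_lc C G g nabla H dv e D
    by unfold_locales (fact assms)+
  show ?thesis
    using gen_ricci_eigen unfolding assms(3) Let_def by blast
qed

end
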